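(* Let $\mathcal Q_{41}=(\{123,145,167,246,258,357,368,478\},\emptyset)$. For every quatroid $\mathcal Q$ not in the $\mathfrak S_8$-orbit of $\mathcal Q_{41}$, the realization space $\mathcal S_{\mathcal Q}$ is irreducible. If $\mathcal Q$ is in the $\mathfrak S_8$-orbit of $\mathcal Q_{41}$, then $\mathcal S_{\mathcal Q}$ is the union of two irreducible components.
   Context: Let $\mathcal P\subset(\mathbb P^2_{\mathbb C})^8$ be the space of ordered $8$-tuples $\mathbf p=(p_1,\dots,p_8)$ of pairwise distinct points. A conic is an irreducible plane quadric. A pair $\mathcal Q=(\mathcal I,\mathcal J)$ consists of a set $\mathcal I$ of $3$-subsets and a set $\mathcal J$ of $6$-subsets of $\{1,\dots,8\}$ ($123$ abbreviates $\{1,2,3\}$, etc.). Its realization space $\mathcal S_{\mathcal Q}\subset\mathcal P$ (a locally closed subset) is the set of $\mathbf p$ such that the triples of points of $\mathbf p$ lying on a line are exactly those indexed by $\mathcal I$ and the sextuples of points of $\mathbf p$ lying on a conic are exactly those indexed by $\mathcal J$. $\mathcal Q$ is a quatroid if $\mathcal S_{\mathcal Q}\ne\emptyset$. The group $\mathfrak S_8$ acts on pairs by permuting $\{1,\dots,8\}$. *)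

theory Defs
  imports
    "HOL-Analysis.Analysis"
    "HOL-Library.Poly_Mapping"
    "HOL-Computational_Algebra.Factorial_Ring"
begin

section \<open>Irreducible topological spaces\<close>

definition irreducible_space :: "'a topology \<Rightarrow> bool" where
  "irreducible_space X \<longleftrightarrow> topspace X \<noteq> {} \<and>
     (\<forall>C D. closedin X C \<and> closedin X D \<and> C \<union> D = topspace X \<longrightarrow>
        C = topspace X \<or> D = topspace X)"

definition irreducible_components :: "'a topology \<Rightarrow> 'a set set" where
  "irreducible_components X =
     {C. C \<subseteq> topspace X \<and> irreducible_space (subtopology X C) \<and>
         (\<forall>D. C \<subseteq> D \<and> D \<subseteq> topspace X \<and> irreducible_space (subtopology X D) \<longrightarrow> D = C)}"

section \<open>Polynomials with complex coefficients\<close>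

text \<open>The polynomial ring over the complex numbers in the variables \<^typ>\<open>'v\<close>: a finitely
  supported map from exponent vectors to coefficients, with the convolution product of
  \<^theory>\<open>HOL-Library.Poly_Mapping\<close>.\<close>

type_synonym 'v cpoly = "('v \<Rightarrow>\<^sub>0 nat) \<Rightarrow>\<^sub>0 complex"

definition peval :: "('v::finite \<Rightarrow> complex) \<Rightarrow> 'v cpoly \<Rightarrow> complex" where
  "peval x f = (\<Sum>m\<in>Poly_Mapping.keys f.
     Poly_Mapping.lookup f m * (\<Prod>v\<in>UNIV. x v ^ Poly_Mapping.lookup m v))"

definition homogeneous :: "nat \<Rightarrow> 'v::finite cpoly \<Rightarrow> bool" where
  "homogeneous d f \<longleftrightarrow>
     (\<forall>m\<in>Poly_Mapping.keys f. (\<Sum>v\<in>UNIV. Poly_Mapping.lookup m v) = d)"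

text \<open>The variable \<open>(i, j)\<close> is the \<open>j\<close>-th homogeneous coordinate of the \<open>i\<close>-th point.\<close>

definition multihomogeneous :: "('i::finite \<Rightarrow> nat) \<Rightarrow> ('i \<times> 'j::finite) cpoly \<Rightarrow> bool" where
  "multihomogeneous d f \<longleftrightarrow>
     (\<forall>m\<in>Poly_Mapping.keys f. \<forall>i. (\<Sum>j\<in>UNIV. Poly_Mapping.lookup m (i, j)) = d i)"

section \<open>The projective plane\<close>

definition proj_rel :: "complex^3 \<Rightarrow> complex^3 \<Rightarrow> bool" where
  "proj_rel x y \<longleftrightarrow> x \<noteq> 0 \<and> y \<noteq> 0 \<and> (\<exists>c. c \<noteq> 0 \<and> y = c *s x)"

quotient_type proj2 = "complex^3" / partial: proj_rel
proof (rule part_equivpI)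
  have "(axis 1 1 :: complex^3) \<noteq> 0"
    by (simp add: axis_eq_0_iff)
  then have "proj_rel (axis 1 1) (axis 1 1)"
    unfolding proj_rel_def by (metis vector_smult_lid zero_neq_one)
  then show "\<exists>x. proj_rel x x" ..
  show "symp proj_rel"
  proof (rule sympI)
    fix x y assume "proj_rel x y"
    then obtain c where c: "x \<noteq> 0" "y \<noteq> 0" "c \<noteq> 0" "y = c *s x"
      by (auto simp: proj_rel_def)
    then have "x = inverse c *s y" by (simp add: vector_smult_assoc)
    with c show "proj_rel y x"
      unfolding proj_rel_def by (metis inverse_nonzero_iff_nonzero)
  qed
  show "transp proj_rel"
  proof (rule transpI)
    fix x y z assume "proj_rel x y" "proj_rel y z"
    then show "proj_rel x z"
      unfolding proj_rel_def by (metis mult_eq_0_iff vector_smult_assoc)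
  qed
qed

definition homogeneous_coords :: "proj2 \<Rightarrow> complex^3 \<Rightarrow> bool" where
  "homogeneous_coords p x \<longleftrightarrow> x \<noteq> 0 \<and> abs_proj2 x = p"

definition plane_zeros :: "3 cpoly \<Rightarrow> proj2 set" where
  "plane_zeros f = {p. \<forall>x. homogeneous_coords p x \<longrightarrow> peval (\<lambda>j. x $ j) f = 0}"

definition plane_line :: "proj2 set \<Rightarrow> bool" where
  "plane_line L \<longleftrightarrow> (\<exists>f. f \<noteq> 0 \<and> homogeneous 1 f \<and> L = plane_zeros f)"

text \<open>Irreducibility is that of the defining quadratic form in the polynomial ring, so that
  double lines are excluded, although their underlying sets are irreducible.\<close>

definition plane_conic :: "proj2 set \<Rightarrow> bool" where
  "plane_conic C \<longleftrightarrow> (\<exists>f. irreducible f \<and> homogeneous 2 f \<and> C = plane_zeros f)"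

section \<open>The Zariski topology on the eightfold product of the projective plane\<close>

text \<open>The labels \<open>1, \<dots>, 8\<close> are the elements of the eight-element type \<^typ>\<open>8\<close>, in which
  the numeral \<open>8\<close> equals \<open>0\<close>.\<close>

definition tuple_zeros :: "(8 \<times> 3) cpoly set \<Rightarrow> (8 \<Rightarrow> proj2) set" where
  "tuple_zeros F = {p. \<forall>f\<in>F. \<forall>x. (\<forall>i. homogeneous_coords (p i) (x i)) \<longrightarrow>
     peval (\<lambda>(i, j). x i $ j) f = 0}"

definition zariski_closed :: "(8 \<Rightarrow> proj2) set \<Rightarrow> bool" where
  "zariski_closed Z \<longleftrightarrow>
     (\<exists>F. (\<forall>f\<in>F. \<exists>d. multihomogeneous d f) \<and> Z = tuple_zeros F)"

definition zariski :: "(8 \<Rightarrow> proj2) topology" where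
  "zariski = topology (\<lambda>U. zariski_closed (- U))"

subsection \<open>The Zariski closed sets are the closed sets of a topology\<close>

lemma peval_superset:
  assumes "finite A" "Poly_Mapping.keys f \<subseteq> A"
  shows "peval x f = (\<Sum>m\<in>A.
     Poly_Mapping.lookup f m * (\<Prod>v\<in>UNIV. x v ^ Poly_Mapping.lookup m v))"
  unfolding peval_def using assms
  by (intro sum.mono_neutral_left) (auto simp: in_keys_iff)

lemma peval_zero [simp]: "peval x 0 = 0"
  by (simp add: peval_def)

lemma peval_add: "peval x (f + g) = peval x f + peval x g"
proof -
  let ?A = "Poly_Mapping.keys f \<union> Poly_Mapping.keys g"
  have "Poly_Mapping.keys (f + g) \<subseteq> ?A" by (rule Poly_Mapping.keys_add)
  then show ?thesis
    by (simp add: peval_superset[of ?A] lookup_add sum.distrib distrib_right)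
qed

lemma peval_sum: "peval x (\<Sum>a\<in>A. h a) = (\<Sum>a\<in>A. peval x (h a))"
  by (induction A rule: infinite_finite_induct) (simp_all add: peval_add)

lemma peval_single:
  "peval x (Poly_Mapping.single m c) = c * (\<Prod>v\<in>UNIV. x v ^ Poly_Mapping.lookup m v)"
  by (simp add: peval_superset[of "{m}"])

lemma cpoly_sum_singles:
  "(f :: 'v cpoly) = (\<Sum>m\<in>Poly_Mapping.keys f. Poly_Mapping.single m (Poly_Mapping.lookup f m))"
  by (rule poly_mapping_eqI)
    (simp add: lookup_sum lookup_single when_def in_keys_iff)

lemma peval_mult: "peval x (f * g) = peval x f * peval x g"
proof -
  have "f * g = (\<Sum>m\<in>Poly_Mapping.keys f. Poly_Mapping.single m (Poly_Mapping.lookup f m))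
      * (\<Sum>n\<in>Poly_Mapping.keys g. Poly_Mapping.single n (Poly_Mapping.lookup g n))"
    by (rule arg_cong2[where f = "(*)", OF cpoly_sum_singles cpoly_sum_singles])
  also have "\<dots> = (\<Sum>m\<in>Poly_Mapping.keys f. \<Sum>n\<in>Poly_Mapping.keys g.
      Poly_Mapping.single (m + n) (Poly_Mapping.lookup f m * Poly_Mapping.lookup g n))"
    by (simp only: sum_product mult_single)
  finally have "peval x (f * g) = (\<Sum>m\<in>Poly_Mapping.keys f. \<Sum>n\<in>Poly_Mapping.keys g.
      Poly_Mapping.lookup f m * Poly_Mapping.lookup g n *
        (\<Prod>v\<in>UNIV. x v ^ Poly_Mapping.lookup (m + n) v))"
    by (simp only: peval_sum peval_single)
  then show ?thesis
    by (simp add: peval_def sum_product lookup_add power_add prod.distrib mult_ac)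
qed

lemma multihomogeneous_mult:
  assumes "multihomogeneous d f" "multihomogeneous e g"
  shows "multihomogeneous (\<lambda>i. d i + e i) (f * g)"
  unfolding multihomogeneous_def
proof (intro ballI allI)
  fix m i assume "m \<in> Poly_Mapping.keys (f * g)"
  then obtain a b where "m = a + b" "a \<in> Poly_Mapping.keys f" "b \<in> Poly_Mapping.keys g"
    using keys_mult by blast
  then show "(\<Sum>j\<in>UNIV. Poly_Mapping.lookup m (i, j)) = d i + e i"
    using assms by (simp add: multihomogeneous_def lookup_add sum.distrib)
qed

lemma homogeneous_coords_exist: "\<exists>x. homogeneous_coords p x"
proof -
  have "proj_rel (rep_proj2 p) (rep_proj2 p)" "abs_proj2 (rep_proj2 p) = p"
    using Quotient3_rep_reflp[OF Quotient3_proj2] Quotient3_abs_rep[OF Quotient3_proj2] by fast+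
  then show ?thesis by (auto simp: homogeneous_coords_def proj_rel_def)
qed

lemma homogeneous_coords_unique:
  assumes "homogeneous_coords p x" "homogeneous_coords p y"
  shows "\<exists>c. c \<noteq> 0 \<and> y = c *s x"
proof -
  have refl: "proj_rel z z" if "z \<noteq> 0" for z
    unfolding proj_rel_def using that by (metis vector_smult_lid zero_neq_one)
  have "proj_rel x y"
    using assms Quotient3_proj2 refl
    unfolding homogeneous_coords_def Quotient3_def by metis
  then show ?thesis by (auto simp: proj_rel_def)
qed

lemma prod_UNIV_pairs:
  "(\<Prod>v\<in>UNIV. h v) = (\<Prod>i\<in>UNIV. \<Prod>j\<in>UNIV. h (i::'a::finite, j::'b::finite))"
  by (simp only: prod.cartesian_product UNIV_Times_UNIV case_prod_eta)

lemma peval_rescale: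
  fixes x y :: "8 \<Rightarrow> complex^3"
  assumes "multihomogeneous d f" "\<And>i. y i = c i *s x i"
  shows "peval (\<lambda>(i, j). y i $ j) f = (\<Prod>i\<in>UNIV. c i ^ d i) * peval (\<lambda>(i, j). x i $ j) f"
proof -
  have *: "(\<Prod>v\<in>UNIV. (case v of (i, j) \<Rightarrow> y i $ j) ^ Poly_Mapping.lookup m v)
      = (\<Prod>i\<in>UNIV. c i ^ d i) * (\<Prod>v\<in>UNIV. (case v of (i, j) \<Rightarrow> x i $ j) ^ Poly_Mapping.lookup m v)"
    if "m \<in> Poly_Mapping.keys f" for m
  proof -
    have "(\<Prod>v\<in>UNIV. (case v of (i, j) \<Rightarrow> y i $ j) ^ Poly_Mapping.lookup m v)
       = (\<Prod>i\<in>UNIV. \<Prod>j\<in>UNIV. (c i * x i $ j) ^ Poly_Mapping.lookup m (i, j))"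
      by (simp only: prod_UNIV_pairs prod.case assms(2) vector_smult_component)
    also have "\<dots> = (\<Prod>i\<in>UNIV. c i ^ (\<Sum>j\<in>UNIV. Poly_Mapping.lookup m (i, j)))
       * (\<Prod>i\<in>UNIV. \<Prod>j\<in>UNIV. (x i $ j) ^ Poly_Mapping.lookup m (i, j))"
      by (simp add: power_mult_distrib prod.distrib power_sum)
    also have "(\<Prod>i\<in>UNIV. \<Prod>j\<in>UNIV. (x i $ j) ^ Poly_Mapping.lookup m (i, j))
       = (\<Prod>v\<in>UNIV. (case v of (i, j) \<Rightarrow> x i $ j) ^ Poly_Mapping.lookup m v)"
      by (simp only: prod_UNIV_pairs prod.case)
    finally show ?thesis using assms(1) that by (simp add: multihomogeneous_def)
  qed
  show ?thesis
    unfolding peval_def sum_distrib_left by (rule sum.cong) (simp_all only: * mult.left_commute)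
qed

lemma vanishing_independent_of_coords:
  fixes x y :: "8 \<Rightarrow> complex^3"
  assumes "multihomogeneous d f"
    and x: "\<And>i. homogeneous_coords (p i) (x i)" and y: "\<And>i. homogeneous_coords (p i) (y i)"
    and "peval (\<lambda>(i, j). x i $ j) f = 0"
  shows "peval (\<lambda>(i, j). y i $ j) f = 0"
proof -
  obtain c where "\<And>i. y i = c i *s x i"
    using homogeneous_coords_unique[OF x y] by metis
  then show ?thesis using peval_rescale[OF assms(1)] assms(4) by simp
qed

lemma zariski_closed_Un:
  assumes "zariski_closed Y" "zariski_closed Z"
  shows "zariski_closed (Y \<union> Z)"
proof -
  obtain F where F: "\<forall>f\<in>F. \<exists>d. multihomogeneous d f" "Y = tuple_zeros F"
    using assms(1) by (auto simp: zariski_closed_def)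
  obtain G where G: "\<forall>f\<in>G. \<exists>d. multihomogeneous d f" "Z = tuple_zeros G"
    using assms(2) by (auto simp: zariski_closed_def)
  let ?H = "{f * g | f g. f \<in> F \<and> g \<in> G}"
  have "p \<in> Y \<union> Z" if p: "p \<in> tuple_zeros ?H" for p
  proof (rule ccontr)
    assume "p \<notin> Y \<union> Z"
    then obtain f x g y where f: "f \<in> F" "\<And>i. homogeneous_coords (p i) (x i)"
        "peval (\<lambda>(i, j). x i $ j) f \<noteq> 0"
      and g: "g \<in> G" "\<And>i. homogeneous_coords (p i) (y i)" "peval (\<lambda>(i, j). y i $ j) g \<noteq> 0"
      by (auto simp: F(2) G(2) tuple_zeros_def)
    obtain e where "multihomogeneous e g" using G(1) g(1) by blast
    then have "peval (\<lambda>(i, j). x i $ j) g \<noteq> 0"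
      using vanishing_independent_of_coords[of e g p x y] f(2) g(2,3) by blast
    moreover have "peval (\<lambda>(i, j). x i $ j) (f * g) = 0"
      using p f(1,2) g(1) by (auto simp: tuple_zeros_def)
    ultimately show False using f(3) by (simp add: peval_mult)
  qed
  moreover have "Y \<union> Z \<subseteq> tuple_zeros ?H"
    by (auto simp: F(2) G(2) tuple_zeros_def peval_mult)
  ultimately have "Y \<union> Z = tuple_zeros ?H" by blast
  moreover have "\<forall>h\<in>?H. \<exists>d. multihomogeneous d h"
    using F(1) G(1) multihomogeneous_mult by blast
  ultimately show ?thesis unfolding zariski_closed_def by blast
qed

lemma zariski_closed_Inter:
  assumes "\<And>Z. Z \<in> \<Z> \<Longrightarrow> zariski_closed Z"
  shows "zariski_closed (\<Inter>\<Z>)"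
proof -
  obtain F where F: "\<And>Z. Z \<in> \<Z> \<Longrightarrow> (\<forall>f\<in>F Z. \<exists>d. multihomogeneous d f) \<and> Z = tuple_zeros (F Z)"
    using assms unfolding zariski_closed_def by metis
  have "\<Inter>\<Z> = (\<Inter>Z\<in>\<Z>. tuple_zeros (F Z))" using F by auto
  also have "\<dots> = tuple_zeros (\<Union>(F ` \<Z>))" by (auto simp: tuple_zeros_def)
  finally show ?thesis unfolding zariski_closed_def using F by blast
qed

lemma zariski_closed_empty: "zariski_closed {}"
proof -
  have "peval x (Poly_Mapping.single 0 1) = 1" for x :: "8 \<times> 3 \<Rightarrow> complex"
    by (simp add: peval_single del: single_one)
  moreover have "\<exists>x. \<forall>i. homogeneous_coords (p i) (x i)" for p :: "8 \<Rightarrow> proj2"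
    by (rule choice) (simp add: homogeneous_coords_exist)
  ultimately have "{} = tuple_zeros {Poly_Mapping.single 0 1}"
    by (auto simp: tuple_zeros_def)
  moreover have "multihomogeneous (\<lambda>_. 0) (Poly_Mapping.single 0 1 :: (8 \<times> 3) cpoly)"
    by (simp add: multihomogeneous_def)
  ultimately show ?thesis unfolding zariski_closed_def by blast
qed

lemma istopology_zariski: "istopology (\<lambda>U. zariski_closed (- U))"
  unfolding istopology_def
proof (intro conjI allI impI)
  fix S T assume "zariski_closed (- S)" "zariski_closed (- T)"
  then show "zariski_closed (- (S \<inter> T))" by (simp add: Compl_Int zariski_closed_Un)
next
  fix K assume "\<forall>U\<in>K. zariski_closed (- U)"
  then have "zariski_closed (\<Inter>(uminus ` K))" by (intro zariski_closed_Inter) auto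
  then show "zariski_closed (- \<Union>K)" by (simp add: uminus_Sup)
qed

lemma openin_zariski: "openin zariski U \<longleftrightarrow> zariski_closed (- U)"
  by (simp only: zariski_def topology_inverse'[OF istopology_zariski])

lemma topspace_zariski [simp]: "topspace zariski = UNIV"
proof -
  have "openin zariski UNIV" by (simp add: openin_zariski zariski_closed_empty)
  then show ?thesis using openin_subset by blast
qed

lemma closedin_zariski: "closedin zariski Z \<longleftrightarrow> zariski_closed Z"
  by (simp only: closedin_def topspace_zariski subset_UNIV openin_zariski
      Compl_eq_Diff_UNIV[symmetric] double_compl simp_thms)

section \<open>Quatroids\<close>

definition realization_space :: "8 set set \<times> 8 set set \<Rightarrow> (8 \<Rightarrow> proj2) set" where
  "realization_space Q = {p. inj p \<and>
     {T. card T = 3 \<and> (\<exists>L. plane_line L \<and> p ` T \<subseteq> L)} = fst Q \<and>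
     {T. card T = 6 \<and> (\<exists>C. plane_conic C \<and> p ` T \<subseteq> C)} = snd Q}"

definition quatroid :: "8 set set \<times> 8 set set \<Rightarrow> bool" where
  "quatroid Q \<longleftrightarrow> (\<forall>T\<in>fst Q. card T = 3) \<and> (\<forall>T\<in>snd Q. card T = 6) \<and>
     realization_space Q \<noteq> {}"

definition S8_orbit :: "8 set set \<times> 8 set set \<Rightarrow> (8 set set \<times> 8 set set) set" where
  "S8_orbit Q = {((`) \<pi> ` fst Q, (`) \<pi> ` snd Q) | \<pi>. bij \<pi>}"

definition Q41 :: "8 set set \<times> 8 set set" where
  "Q41 = ({{1,2,3}, {1,4,5}, {1,6,7}, {2,4,6}, {2,5,8}, {3,5,7}, {3,6,8}, {4,7,8}}, {})"

end

theory Submission imports Defs begin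

text \<open>A realization space is covered by the set of its homogeneous coordinates, so it suffices
  that this set is irreducible, i.e. that no product of two polynomials vanishes on it unless one
  of them does. Points are added one at a time: if a point lies on at most two lines, on one conic
  and at most one line, or on two conics, and on nothing else, then it is the image of a free
  vector under a polynomial map, and irreducibility is inherited from the remaining points. On at
  most seven points such a removable point always exists, because the only obstruction is the Fano
  plane, which has no complex realization. The pairs on eight points without a removable point
  are a hexagon on a conic, a few configurations with several conics, all of which have explicit
  polynomial parametrizations, and the Moebius-Kantor configuration. The latter is determined up to
  projective equivalence by a root of \<open>\<gamma>\<^sup>2 - \<gamma> + 1\<close>, and the two roots give two disjoint closed
  irreducible pieces.\<close>

text \<open>Closed conditions cannot simply be imposed on an irreducible set, so every step has to
  produce them for free: \<open>irr_step\<close> asks that a polynomial map from an irreducible set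
  lands in the new stratum as soon as its value satisfies the open conditions. Solving for a point
  therefore has to be polynomial, without the choice of a root. A point on two lines is a cross
  product. For conics the Cremona map \<open>crem\<close> at three of their points is used; it turns
  conics through these points into lines, so that the missing intersection point is again a cross
  product. A third line through a point would constrain the other points, which is why whole
  configurations have to be parametrized. With three conics that omit disjoint pairs of points, the
  constraint is that the lines joining these pairs are concurrent, a radical axis statement. Only
  the Moebius-Kantor configuration leaves a genuine quadratic equation. Strata are taken relative to
  a realization \<open>Y\<close> instead of a combinatorial pair, so that deleting a point needs no
  bookkeeping of incidences.\<close>

section \<open>Cross product, determinant and incidence in complex three-space\<close>

text \<open>Bilinear rather than Hermitian: points and lines are both vectors, and incidence has to
  be a polynomial condition.\<close>

definition dot3 :: "complex^3 \<Rightarrow> complex^3 \<Rightarrow> complex" where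
  "dot3 x y = x$1 * y$1 + x$2 * y$2 + x$3 * y$3"

definition crs :: "complex^3 \<Rightarrow> complex^3 \<Rightarrow> complex^3" where
  "crs x y = vector [x$2 * y$3 - x$3 * y$2, x$3 * y$1 - x$1 * y$3, x$1 * y$2 - x$2 * y$1]"

definition det3 :: "complex^3 \<Rightarrow> complex^3 \<Rightarrow> complex^3 \<Rightarrow> complex" where
  "det3 x y z = dot3 x (crs y z)"

lemma crs_nth [simp]:
  "crs x y $ 1 = x$2 * y$3 - x$3 * y$2"
  "crs x y $ 2 = x$3 * y$1 - x$1 * y$3"
  "crs x y $ 3 = x$1 * y$2 - x$2 * y$1"
  by (simp_all add: crs_def vector_3)

lemma det3_expand: "det3 x y z =
    x$1 * (y$2 * z$3 - y$3 * z$2) + x$2 * (y$3 * z$1 - y$1 * z$3) + x$3 * (y$1 * z$2 - y$2 * z$1)"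
  by (simp add: det3_def dot3_def)

lemma vec3_eq_iff: "(x :: complex^3) = y \<longleftrightarrow> x$1 = y$1 \<and> x$2 = y$2 \<and> x$3 = y$3"
  by (simp add: vec_eq_iff forall_3)

lemma dot3_simps [simp]:
  "dot3 (x + y) z = dot3 x z + dot3 y z" "dot3 z (x + y) = dot3 z x + dot3 z y"
  "dot3 (c *s x) z = c * dot3 x z" "dot3 z (c *s x) = c * dot3 z x"
  "dot3 0 z = 0" "dot3 z 0 = 0"
  "dot3 x (crs x y) = 0" "dot3 y (crs x y) = 0" "dot3 (crs x y) x = 0" "dot3 (crs x y) y = 0"
  by (simp_all add: dot3_def algebra_simps)

lemma dot3_commute: "dot3 x y = dot3 y x"
  by (simp add: dot3_def mult.commute)

lemma det3_linear [simp]: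
  "det3 (x + y) z w = det3 x z w + det3 y z w"
  "det3 z (x + y) w = det3 z x w + det3 z y w"
  "det3 z w (x + y) = det3 z w x + det3 z w y"
  "det3 (x - y) z w = det3 x z w - det3 y z w"
  "det3 z (x - y) w = det3 z x w - det3 z y w"
  "det3 z w (x - y) = det3 z w x - det3 z w y"
  "det3 (c *s x) z w = c * det3 x z w"
  "det3 z (c *s x) w = c * det3 z x w"
  "det3 z w (c *s x) = c * det3 z w x"
  "det3 0 z w = 0" "det3 z 0 w = 0" "det3 z w 0 = 0"
  by (simp_all add: det3_expand algebra_simps)

lemma det3_repeat [simp]: "det3 x x y = 0" "det3 x y x = 0" "det3 y x x = 0"
  by (simp_all add: det3_expand algebra_simps)

lemma det3_swap: "det3 y x z = - det3 x y z" "det3 x z y = - det3 x y z" "det3 z y x = - det3 x y z"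
  by (simp_all add: det3_expand algebra_simps)

lemma crs_eq_0_iff:
  assumes "x \<noteq> 0"
  shows "crs x y = 0 \<longleftrightarrow> (\<exists>c. y = c *s x)"
proof
  assume *: "crs x y = 0"
  then have e: "x$2 * y$3 = x$3 * y$2" "x$3 * y$1 = x$1 * y$3" "x$1 * y$2 = x$2 * y$1"
    by (simp_all add: vec3_eq_iff)
  consider "x$1 \<noteq> 0" | "x$2 \<noteq> 0" | "x$3 \<noteq> 0" using assms by (auto simp: vec3_eq_iff)
  then show "\<exists>c. y = c *s x"
  proof cases
    case 1 with e show ?thesis
      by (intro exI[of _ "y$1 / x$1"]) (auto simp: vec3_eq_iff field_simps)
  next
    case 2 with e show ?thesis
      by (intro exI[of _ "y$2 / x$2"]) (auto simp: vec3_eq_iff field_simps)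
  next
    case 3 with e show ?thesis
      by (intro exI[of _ "y$3 / x$3"]) (auto simp: vec3_eq_iff field_simps)
  qed
qed (auto simp: vec3_eq_iff)

lemma crs_zero [simp]: "crs 0 y = 0" "crs x 0 = 0" "crs x x = 0"
  by (simp_all add: vec3_eq_iff)

lemma crs_commute: "crs y x = - crs x y"
  by (simp add: vec3_eq_iff)

text \<open>The left side represents the intersection of the lines ab and cd; the right side locates
  it on cd.\<close>

lemma crs_crs: "crs (crs a b) (crs c d) = det3 a b d *s c - det3 a b c *s d"
  by (simp add: vec3_eq_iff det3_expand algebra_simps)

lemma crs_scale [simp]: "crs (c *s x) y = c *s crs x y" "crs x (c *s y) = c *s crs x y"
  by (simp_all add: vec3_eq_iff algebra_simps)

lemma two_lines_meet:
  assumes "dot3 n x = 0" "dot3 m x = 0" "crs n m \<noteq> 0"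
  shows "\<exists>c. x = c *s crs n m"
proof -
  have "crs (crs n m) x = dot3 n x *s m - dot3 m x *s n"
    by (simp add: vec3_eq_iff dot3_def algebra_simps)
  then show ?thesis using assms crs_eq_0_iff by auto
qed

text \<open>Cramer's rule with the denominator cleared, hence a polynomial identity.\<close>

lemma basis_expand:
  "det3 a b c *s x = det3 x b c *s a + det3 a x c *s b + det3 a b x *s c"
  by (simp add: vec3_eq_iff det3_expand algebra_simps)

lemma basis_coords:
  assumes "det3 a b c \<noteq> 0"
  obtains r s t where "x = r *s a + s *s b + t *s c"
proof
  have "x = (1 / det3 a b c) *s (det3 a b c *s x)"
    using assms by (simp add: vector_smult_assoc)
  also have "\<dots> = (det3 x b c / det3 a b c) *s a + (det3 a x c / det3 a b c) *s b
      + (det3 a b x / det3 a b c) *s c"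
    by (subst basis_expand) (simp add: vector_add_ldistrib vector_smult_assoc)
  finally show "x = \<dots>" .
qed

lemma det3_alt:
  "det3 a b c = dot3 (crs a b) c" "det3 a b c = - dot3 (crs a c) b" "det3 a b c = dot3 (crs b c) a"
  by (simp_all add: det3_expand dot3_def algebra_simps)

text \<open>A nonzero cross product of two of the vectors is the required n. If all three cross
  products vanish, the vectors are multiples of a single vector v, and any n orthogonal to v
  works.\<close>

lemma det3_eq_0_iff: "det3 a b c = 0 \<longleftrightarrow> (\<exists>n. n \<noteq> 0 \<and> dot3 n a = 0 \<and> dot3 n b = 0 \<and> dot3 n c = 0)"
proof
  assume d: "det3 a b c = 0"
  consider "crs a b \<noteq> 0" | "crs a c \<noteq> 0" | "crs b c \<noteq> 0"
    | "crs a b = 0" "crs a c = 0" "crs b c = 0" by blast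
  then show "\<exists>n. n \<noteq> 0 \<and> dot3 n a = 0 \<and> dot3 n b = 0 \<and> dot3 n c = 0"
  proof cases
    case 1 then show ?thesis using d
      by (intro exI[of _ "crs a b"]) (simp add: det3_alt(1))
  next
    case 2 then show ?thesis using d
      by (intro exI[of _ "crs a c"]) (simp add: det3_alt(2))
  next
    case 3 then show ?thesis using d
      by (intro exI[of _ "crs b c"]) (simp add: det3_alt(3))
  next
    case 4
    have "\<exists>v. v \<noteq> 0 \<and> (\<forall>w. dot3 v w = 0 \<longrightarrow> dot3 a w = 0 \<and> dot3 b w = 0 \<and> dot3 c w = 0)"
    proof -
      consider "a \<noteq> 0" | "b \<noteq> 0" | "c \<noteq> 0" | "a = 0 \<and> b = 0 \<and> c = 0" by blast
      then show ?thesis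
      proof cases
        case 1 then show ?thesis using 4 crs_eq_0_iff by (intro exI[of _ a]) auto
      next
        case 2 then show ?thesis using 4 crs_eq_0_iff[OF 2] crs_commute[of a b] by (intro exI[of _ b]) auto
      next
        case 3 then show ?thesis using 4 crs_eq_0_iff[OF 3] crs_commute[of a c] crs_commute[of b c]
          by (intro exI[of _ c]) auto
      next
        case 4 then show ?thesis by (intro exI[of _ "vector [1, 0, 0]"]) (simp add: vec3_eq_iff[of "vector [1,0,0]"] vector_3)
      qed
    qed
    then obtain v where v: "v \<noteq> 0" "\<And>w. dot3 v w = 0 \<Longrightarrow> dot3 a w = 0 \<and> dot3 b w = 0 \<and> dot3 c w = 0"
      by blast
    have "\<exists>w. w \<noteq> 0 \<and> dot3 v w = 0"
    proof (cases "v$1 = 0 \<and> v$2 = 0")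
      case True then show ?thesis
        by (intro exI[of _ "vector [1, 0, 0]"]) (simp add: vec3_eq_iff vector_3 dot3_def)
    next
      case False then show ?thesis
        by (intro exI[of _ "vector [v$2, - v$1, 0]"]) (auto simp: vec3_eq_iff vector_3 dot3_def)
    qed
    then show ?thesis using v(2) dot3_commute by metis
  qed
next
  assume "\<exists>n. n \<noteq> 0 \<and> dot3 n a = 0 \<and> dot3 n b = 0 \<and> dot3 n c = 0"
  then obtain n where n: "n \<noteq> 0" "dot3 n a = 0" "dot3 n b = 0" "dot3 n c = 0" by blast
  \<comment> \<open>Cramer's rule for n in the dual basis of cross products.\<close>
  have "det3 a b c *s n = dot3 n a *s crs b c + dot3 n b *s crs c a + dot3 n c *s crs a b"
    by (simp add: vec3_eq_iff det3_expand dot3_def algebra_simps)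
  then have "det3 a b c *s n = 0" using n by simp
  then show "det3 a b c = 0" using n(1) by (auto simp: vec3_eq_iff)
qed

lemma complete_basis:
  assumes "crs a b \<noteq> 0" obtains z where "det3 a b z \<noteq> 0"
proof -
  obtain l where "crs a b $ l \<noteq> 0" using assms by (metis vec_eq_iff zero_index)
  then have "det3 a b (axis l 1) \<noteq> 0"
    using exhaust_3[of l] by (auto simp: det3_alt(1) dot3_def axis_def)
  then show ?thesis using that by blast
qed

lemma line_coords:
  assumes "crs a b \<noteq> 0" "det3 a b x = 0"
  obtains r s where "x = r *s a + s *s b"
proof -
  obtain z where z: "det3 a b z \<noteq> 0" using complete_basis[OF assms(1)] .
  obtain r s t where rs: "x = r *s a + s *s b + t *s z" using basis_coords[OF z] .
  have "t = 0" using assms(2) z unfolding rs by simp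
  then show ?thesis using rs that by simp
qed

section \<open>Polynomial functions on tuples of vectors\<close>

type_synonym tuple = "8 \<Rightarrow> complex^3"

text \<open>Functions instead of formal polynomials: substituting a polynomial map is then ordinary
  composition, handled by induction in \<open>regfun_compose\<close>, and
  \<open>regfun_peval\<close> covers the polynomials of the Zariski topology.\<close>

inductive_set regfun :: "(tuple \<Rightarrow> complex) set" where
  const [intro, simp]: "(\<lambda>X. c) \<in> regfun"
| coord [intro, simp]: "(\<lambda>X. X i $ j) \<in> regfun"
| add [intro]: "f \<in> regfun \<Longrightarrow> g \<in> regfun \<Longrightarrow> (\<lambda>X. f X + g X) \<in> regfun"
| mult [intro]: "f \<in> regfun \<Longrightarrow> g \<in> regfun \<Longrightarrow> (\<lambda>X. f X * g X) \<in> regfun"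

definition regvec :: "(tuple \<Rightarrow> complex^3) \<Rightarrow> bool" where
  "regvec F \<longleftrightarrow> (\<forall>j. (\<lambda>X. F X $ j) \<in> regfun)"

definition regmap :: "(tuple \<Rightarrow> tuple) \<Rightarrow> bool" where
  "regmap \<Phi> \<longleftrightarrow> (\<forall>i. regvec (\<lambda>X. \<Phi> X i))"

lemma regfun_minus [intro]: "f \<in> regfun \<Longrightarrow> (\<lambda>X. - f X) \<in> regfun"
  using regfun.mult[OF regfun.const[of "-1"]] by simp

lemma regfun_diff [intro]: "f \<in> regfun \<Longrightarrow> g \<in> regfun \<Longrightarrow> (\<lambda>X. f X - g X) \<in> regfun"
  using regfun.add[OF _ regfun_minus] by simp

lemma regfun_power [intro]: "f \<in> regfun \<Longrightarrow> (\<lambda>X. f X ^ n) \<in> regfun"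
  by (induction n) auto

lemma regfun_sum: "(\<And>a. a \<in> A \<Longrightarrow> h a \<in> regfun) \<Longrightarrow> (\<lambda>X. \<Sum>a\<in>A. h a X) \<in> regfun"
  by (induction A rule: infinite_finite_induct) auto

lemma regfun_prod: "(\<And>a. a \<in> A \<Longrightarrow> h a \<in> regfun) \<Longrightarrow> (\<lambda>X. \<Prod>a\<in>A. h a X) \<in> regfun"
  by (induction A rule: infinite_finite_induct) auto

lemma regfun_peval: "(\<lambda>X. peval (\<lambda>(i, j). X i $ j) f) \<in> regfun"
  unfolding peval_def
  by (intro regfun_sum regfun.mult regfun.const regfun_prod) (auto split: prod.split)

lemma regvec_nth [intro]: "regvec F \<Longrightarrow> (\<lambda>X. F X $ j) \<in> regfun"
  by (simp add: regvec_def)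

lemma regvec_coord [intro, simp]: "regvec (\<lambda>X. X i)"
  by (simp add: regvec_def)

lemma regvec_const [intro, simp]: "regvec (\<lambda>X. c)"
  by (simp add: regvec_def)

lemma regvec_add [intro]: "regvec F \<Longrightarrow> regvec G \<Longrightarrow> regvec (\<lambda>X. F X + G X)"
  by (auto simp: regvec_def)

lemma regvec_diff [intro]: "regvec F \<Longrightarrow> regvec G \<Longrightarrow> regvec (\<lambda>X. F X - G X)"
  by (auto simp: regvec_def)

lemma regvec_scale [intro]: "f \<in> regfun \<Longrightarrow> regvec F \<Longrightarrow> regvec (\<lambda>X. f X *s F X)"
  by (auto simp: regvec_def)

lemma regvec_crs [intro]: "regvec F \<Longrightarrow> regvec G \<Longrightarrow> regvec (\<lambda>X. crs (F X) (G X))"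
  by (auto simp: regvec_def forall_3)

lemma regvec_vector [intro]:
  "f \<in> regfun \<Longrightarrow> g \<in> regfun \<Longrightarrow> h \<in> regfun \<Longrightarrow> regvec (\<lambda>X. vector [f X, g X, h X])"
  by (auto simp: regvec_def forall_3 vector_3)

lemma regfun_dot3 [intro]: "regvec F \<Longrightarrow> regvec G \<Longrightarrow> (\<lambda>X. dot3 (F X) (G X)) \<in> regfun"
  unfolding dot3_def by (intro regfun.add regfun.mult regvec_nth)

lemma regfun_det3 [intro]:
  "regvec F \<Longrightarrow> regvec G \<Longrightarrow> regvec H \<Longrightarrow> (\<lambda>X. det3 (F X) (G X) (H X)) \<in> regfun"
  unfolding det3_def by auto

lemma regfun_compose:
  assumes "f \<in> regfun" "regmap \<Phi>"
  shows "(\<lambda>X. f (\<Phi> X)) \<in> regfun"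
  using assms by (induction) (auto simp: regmap_def regvec_def)

lemma regmap_upd: "regmap \<Phi> \<Longrightarrow> regvec F \<Longrightarrow> regmap (\<lambda>X. (\<Phi> X)(i := F X))"
  unfolding regmap_def
proof
  fix j assume "\<forall>i. regvec (\<lambda>X. \<Phi> X i)" "regvec F"
  then show "regvec (\<lambda>X. ((\<Phi> X)(i := F X)) j)" by (cases "j = i") simp_all
qed

lemma regmap_id [simp]: "regmap (\<lambda>X. X)"
  by (auto simp: regmap_def)

section \<open>Irreducible sets of tuples\<close>

text \<open>The polynomial functions vanishing on \<open>V\<close> form a prime ideal; nonemptiness
  makes it proper. The notion applies to sets that are not closed, such as strata.\<close>

definition irr :: "tuple set \<Rightarrow> bool" where
  "irr V \<longleftrightarrow> V \<noteq> {} \<and> (\<forall>f\<in>regfun. \<forall>g\<in>regfun. (\<forall>v\<in>V. f v * g v = 0) \<longrightarrow>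
     (\<forall>v\<in>V. f v = 0) \<or> (\<forall>v\<in>V. g v = 0))"

lemma irrD:
  assumes "irr V" "f \<in> regfun" "g \<in> regfun" "\<And>v. v \<in> V \<Longrightarrow> f v * g v = 0"
  shows "(\<forall>v\<in>V. f v = 0) \<or> (\<forall>v\<in>V. g v = 0)"
  using assms unfolding irr_def by simp

definition zopen :: "tuple set \<Rightarrow> bool" where
  "zopen U \<longleftrightarrow> (\<forall>v\<in>U. \<exists>h\<in>regfun. h v \<noteq> 0 \<and> (\<forall>w. h w \<noteq> 0 \<longrightarrow> w \<in> U))"

lemma regfun_on_line:
  assumes "f \<in> regfun"
  shows "\<exists>p :: complex poly. \<forall>t. f (\<lambda>i. v i + t *s (w i - v i)) = poly p t"
  using assms
proof induction
  case (const c) show ?case by (intro exI[of _ "[:c:]"]) simp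
next
  case (coord i j) show ?case
    by (intro exI[of _ "[:v i $ j, w i $ j - v i $ j:]"]) (simp add: algebra_simps)
next
  case (add f g)
  then obtain p q where "\<forall>t. f (\<lambda>i. v i + t *s (w i - v i)) = poly p t"
    "\<forall>t. g (\<lambda>i. v i + t *s (w i - v i)) = poly q t" by blast
  then show ?case by (intro exI[of _ "p + q"]) simp
next
  case (mult f g)
  then obtain p q where "\<forall>t. f (\<lambda>i. v i + t *s (w i - v i)) = poly p t"
    "\<forall>t. g (\<lambda>i. v i + t *s (w i - v i)) = poly q t" by blast
  then show ?case by (intro exI[of _ "p * q"]) simp
qed

text \<open>Join a point where f does not vanish to one where g does not. On this line both become
  nonzero polynomials in one variable, and their product has only finitely many zeros.\<close>

lemma irr_UNIV: "irr UNIV"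
  unfolding irr_def
proof (intro conjI ballI impI)
  fix f g assume fg: "f \<in> regfun" "g \<in> regfun" "\<forall>v\<in>UNIV. f v * g v = 0"
  show "(\<forall>v\<in>UNIV. f v = 0) \<or> (\<forall>v\<in>UNIV. g v = 0)"
  proof (rule ccontr)
    assume "\<not> ?thesis"
    then obtain v w where vw: "f v \<noteq> 0" "g w \<noteq> 0" by auto
    obtain p where p: "\<And>t. f (\<lambda>i. v i + t *s (w i - v i)) = poly p t"
      using regfun_on_line[OF fg(1)] by blast
    obtain q where q: "\<And>t. g (\<lambda>i. v i + t *s (w i - v i)) = poly q t"
      using regfun_on_line[OF fg(2)] by blast
    have "poly p 0 \<noteq> 0" "poly q 1 \<noteq> 0" using vw p[of 0] q[of 1] by simp_all
    then have "p \<noteq> 0" "q \<noteq> 0" by auto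
    then have "p * q \<noteq> 0" by simp
    moreover have "poly (p * q) t = 0" for t
    proof -
      have "poly (p * q) t = f (\<lambda>i. v i + t *s (w i - v i)) * g (\<lambda>i. v i + t *s (w i - v i))"
        by (simp only: poly_mult p q)
      then show ?thesis using fg(3) by simp
    qed
    ultimately show False using poly_all_0_iff_0 by blast
  qed
qed simp

text \<open>The product fg is only known to vanish on \<open>R'\<close>, while the map may lead
  outside. So f and g are multiplied by functions h and k that vanish outside \<open>U\<close>; the
  product of the composites then vanishes on all of \<open>R\<close>, and irreducibility of
  \<open>R\<close> applies.\<close>

lemma irr_step:
  assumes R: "irr R" and \<Phi>: "regmap \<Phi>" and U: "zopen U" and ne: "R' \<noteq> {}"
    and sur: "R' \<subseteq> \<Phi> ` R" and sub: "R' \<subseteq> U"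
    and cl: "\<And>v. v \<in> R \<Longrightarrow> \<Phi> v \<in> U \<Longrightarrow> \<Phi> v \<in> R'"
  shows "irr R'"
  unfolding irr_def
proof (intro conjI ballI impI)
  fix f g assume fg: "f \<in> regfun" "g \<in> regfun" "\<forall>v\<in>R'. f v * g v = 0"
  show "(\<forall>v\<in>R'. f v = 0) \<or> (\<forall>v\<in>R'. g v = 0)"
  proof (rule ccontr)
    assume "\<not> ?thesis"
    then obtain a b where ab: "a \<in> R'" "f a \<noteq> 0" "b \<in> R'" "g b \<noteq> 0" by auto
    obtain v w where vw: "v \<in> R" "a = \<Phi> v" "w \<in> R" "b = \<Phi> w" using sur ab by blast
    obtain h where h: "h \<in> regfun" "h a \<noteq> 0" "\<And>u. h u \<noteq> 0 \<Longrightarrow> u \<in> U"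
      using U sub ab(1) unfolding zopen_def by (metis subsetD)
    obtain k where k: "k \<in> regfun" "k b \<noteq> 0" "\<And>u. k u \<noteq> 0 \<Longrightarrow> u \<in> U"
      using U sub ab(3) unfolding zopen_def by (metis subsetD)
    have p: "(\<lambda>u. f (\<Phi> u) * h (\<Phi> u)) \<in> regfun" "(\<lambda>u. g (\<Phi> u) * k (\<Phi> u)) \<in> regfun"
      by (intro regfun.mult regfun_compose[OF _ \<Phi>] fg h k)+
    have "f (\<Phi> u) * h (\<Phi> u) * (g (\<Phi> u) * k (\<Phi> u)) = 0" if u: "u \<in> R" for u
    proof (cases "h (\<Phi> u) = 0")
      case False
      then have "\<Phi> u \<in> R'" using cl h(3) u by blast
      then have "f (\<Phi> u) * g (\<Phi> u) = 0" using fg(3) by blast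
      then show ?thesis by auto
    qed simp
    then have "(\<forall>u\<in>R. f (\<Phi> u) * h (\<Phi> u) = 0) \<or> (\<forall>u\<in>R. g (\<Phi> u) * k (\<Phi> u) = 0)"
      using irrD[OF R p] by blast
    then show False using vw ab h(2) k(2) by auto
  qed
qed (rule ne)

lemma zopen_nonzero: "f \<in> regfun \<Longrightarrow> zopen {X. f X \<noteq> 0}"
  unfolding zopen_def by auto

lemma zopen_Int:
  assumes "zopen U" "zopen V" shows "zopen (U \<inter> V)"
  unfolding zopen_def
proof
  fix v assume v: "v \<in> U \<inter> V"
  obtain h where "h \<in> regfun" "h v \<noteq> 0" "\<forall>w. h w \<noteq> 0 \<longrightarrow> w \<in> U"
    using assms(1) v unfolding zopen_def by blast
  moreover obtain k where "k \<in> regfun" "k v \<noteq> 0" "\<forall>w. k w \<noteq> 0 \<longrightarrow> w \<in> V"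
    using assms(2) v unfolding zopen_def by blast
  ultimately show "\<exists>h\<in>regfun. h v \<noteq> 0 \<and> (\<forall>w. h w \<noteq> 0 \<longrightarrow> w \<in> U \<inter> V)"
    by (intro bexI[of _ "\<lambda>X. h X * k X"]) auto
qed

lemma zopen_Un: "zopen U \<Longrightarrow> zopen V \<Longrightarrow> zopen (U \<union> V)"
  unfolding zopen_def by blast

lemma zopen_UNIV [simp]: "zopen UNIV"
  unfolding zopen_def by (intro ballI bexI[of _ "\<lambda>_. 1"]) auto

lemma zopen_INT: "finite I \<Longrightarrow> (\<And>i. i \<in> I \<Longrightarrow> zopen (U i)) \<Longrightarrow> zopen (\<Inter>i\<in>I. U i)"
  by (induction I rule: finite_induct) (simp_all add: zopen_Int)

lemma zopen_vec_nonzero: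
  assumes "regvec F" shows "zopen {X. F X \<noteq> 0}"
proof -
  have "{X. F X \<noteq> 0} = ({X. F X $ 1 \<noteq> 0} \<union> {X. F X $ 2 \<noteq> 0}) \<union> {X. F X $ 3 \<noteq> 0}"
    by (auto simp: vec3_eq_iff)
  moreover have "zopen \<dots>" using assms by (intro zopen_Un zopen_nonzero regvec_nth)
  ultimately show ?thesis by (rule ssubst)
qed

section \<open>Collinear points and points on a conic\<close>

definition coll :: "tuple \<Rightarrow> 8 set \<Rightarrow> bool" where
  "coll X T \<longleftrightarrow> (\<exists>n. n \<noteq> 0 \<and> (\<forall>i\<in>T. dot3 n (X i) = 0))"

definition qform :: "complex^3 \<Rightarrow> complex^3 \<Rightarrow> complex^3 \<Rightarrow> complex" where
  "qform a b x = a$1 * (x$1)^2 + a$2 * (x$2)^2 + a$3 * (x$3)^2 +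
     b$1 * (x$2 * x$3) + b$2 * (x$1 * x$3) + b$3 * (x$1 * x$2)"

text \<open>The quadric may be degenerate; together with \<open>nocoll\<close> this becomes
  incidence with an irreducible conic, see \<open>conic_iff_onconic\<close>.\<close>

definition onconic :: "tuple \<Rightarrow> 8 set \<Rightarrow> bool" where
  "onconic X S \<longleftrightarrow> (\<exists>a b. (a \<noteq> 0 \<or> b \<noteq> 0) \<and> (\<forall>i\<in>S. qform a b (X i) = 0))"

text \<open>A nonzero cross product says at once that both vectors are nonzero and that they
  represent different projective points.\<close>

definition gen :: "8 set \<Rightarrow> tuple \<Rightarrow> bool" where
  "gen A X \<longleftrightarrow> (\<forall>i\<in>A. \<forall>j\<in>A. i \<noteq> j \<longrightarrow> crs (X i) (X j) \<noteq> 0)"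

definition nocoll :: "tuple \<Rightarrow> 8 set \<Rightarrow> bool" where
  "nocoll X S \<longleftrightarrow> (\<forall>T\<subseteq>S. card T = 3 \<longrightarrow> \<not> coll X T)"

lemma coll_mono: "coll X T \<Longrightarrow> S \<subseteq> T \<Longrightarrow> coll X S"
  unfolding coll_def by blast

lemma onconic_mono: "onconic X T \<Longrightarrow> S \<subseteq> T \<Longrightarrow> onconic X S"
  unfolding onconic_def by blast

lemma nocoll_mono: "nocoll X T \<Longrightarrow> S \<subseteq> T \<Longrightarrow> nocoll X S"
  unfolding nocoll_def by blast

lemma gen_mono: "gen T X \<Longrightarrow> S \<subseteq> T \<Longrightarrow> gen S X"
  unfolding gen_def by blast

lemma coll_iff_det3: "coll X {i, j, k} \<longleftrightarrow> det3 (X i) (X j) (X k) = 0"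
  by (simp add: coll_def det3_eq_0_iff)

lemma nocollD: "nocoll X S \<Longrightarrow> {i, j, k} \<subseteq> S \<Longrightarrow> i \<noteq> j \<Longrightarrow> i \<noteq> k \<Longrightarrow> j \<noteq> k \<Longrightarrow>
    det3 (X i) (X j) (X k) \<noteq> 0"
  unfolding nocoll_def coll_iff_det3[symmetric] by simp

lemma coll_dot3:
  assumes "coll X T" "a \<in> T" "b \<in> T" "i \<in> T" "crs (X a) (X b) \<noteq> 0"
  shows "dot3 (crs (X a) (X b)) (X i) = 0"
proof -
  obtain n where "n \<noteq> 0" "\<forall>i\<in>T. dot3 n (X i) = 0" using assms(1) by (auto simp: coll_def)
  then have "det3 (X a) (X b) (X i) = 0" using assms det3_eq_0_iff by blast
  then show ?thesis by (simp add: det3_alt(1))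
qed

text \<open>Both sets lie on the line spanned by the two distinct common points.\<close>

lemma coll_join:
  assumes "coll X S" "coll X T" "a \<in> S \<inter> T" "b \<in> S \<inter> T" "crs (X a) (X b) \<noteq> 0"
  shows "coll X (S \<union> T)"
proof -
  have "dot3 (crs (X a) (X b)) (X i) = 0" if "i \<in> S \<union> T" for i
    using that coll_dot3[OF assms(1) _ _ _ assms(5)] coll_dot3[OF assms(2) _ _ _ assms(5)] assms by blast
  then show ?thesis unfolding coll_def using assms(5) by blast
qed

lemma card3E:
  assumes "card T = 3" obtains i j k where "T = {i, j, k}" "i \<noteq> j" "i \<noteq> k" "j \<noteq> k"
  using assms by (auto simp: card_3_iff)

lemma card5E:
  assumes "5 \<le> card T"
  obtains a b c d e where "{a, b, c, d, e} \<subseteq> T" "distinct [a, b, c, d, e]"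
proof -
  obtain B where B: "B \<subseteq> T" "card B = 5" "finite B" using obtain_subset_with_card_n[OF assms] by metis
  obtain xs where xs: "set xs = B" "distinct xs" using finite_distinct_list[OF B(3)] by blast
  then have "length xs = 5" using B(2) distinct_card by metis
  then obtain a b c d e where "xs = [a, b, c, d, e]"
    by (auto simp: length_Suc_conv numeral_eq_Suc)
  then show ?thesis using that xs B(1) by auto
qed

subsection \<open>Quadratic forms\<close>

text \<open>The polar form of the quadratic form, without the customary factor 1/2.\<close>

definition bil :: "complex^3 \<Rightarrow> complex^3 \<Rightarrow> complex^3 \<Rightarrow> complex^3 \<Rightarrow> complex" where
  "bil a b x y = qform a b (x + y) - qform a b x - qform a b y"

lemma qform_expand: "qform a b (r *s x + s *s y + t *s z) =
   r^2 * qform a b x + s^2 * qform a b y + t^2 * qform a b z +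
   s * t * bil a b y z + r * t * bil a b x z + r * s * bil a b x y"
  by (simp add: bil_def qform_def power2_eq_square algebra_simps)

lemma qform_scale: "qform a b (r *s x) = r^2 * qform a b x"
  by (simp add: qform_def power2_eq_square algebra_simps)

lemma qform_linear: "qform (r *s a + s *s c) (r *s b + s *s d) x = r * qform a b x + s * qform c d x"
  by (simp add: qform_def algebra_simps)

lemma qform_zero [simp]: "qform 0 0 x = 0" "qform a b 0 = 0"
  by (simp_all add: qform_def)

lemma qform_eq_zeroD:
  assumes "\<And>x. qform a b x = 0" shows "a = 0" "b = 0"
proof -
  have 1: "a$1 = 0" "a$2 = 0" "a$3 = 0"
    using assms[of "vector [1,0,0]"] assms[of "vector [0,1,0]"] assms[of "vector [0,0,1]"]
    by (simp_all add: qform_def vector_3)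
  then have "b$1 = 0" "b$2 = 0" "b$3 = 0"
    using assms[of "vector [0,1,1]"] assms[of "vector [1,0,1]"] assms[of "vector [1,1,0]"]
    by (simp_all add: qform_def vector_3)
  with 1 show "a = 0" "b = 0" by (simp_all add: vec3_eq_iff)
qed

lemma qform_product: "dot3 l x * dot3 m x =
   qform (vector [l$1 * m$1, l$2 * m$2, l$3 * m$3])
     (vector [l$2 * m$3 + l$3 * m$2, l$1 * m$3 + l$3 * m$1, l$1 * m$2 + l$2 * m$1]) x"
  by (simp add: qform_def dot3_def vector_3 power2_eq_square algebra_simps)

lemma qform_product_ex: "\<exists>a b. \<forall>x. dot3 l x * dot3 m x = qform a b x"
  by (intro exI allI) (rule qform_product)

text \<open>Expanded in a basis p, r, z, the form has no terms in p and r alone, so the coordinate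
  along z, which is the equation of the line pr, can be factored out.\<close>

lemma line_in_quadric:
  assumes n: "crs p r \<noteq> 0" and q: "qform a b p = 0" "qform a b r = 0" "bil a b p r = 0"
  shows "\<exists>m. \<forall>x. qform a b x = dot3 (crs p r) x * dot3 m x"
proof -
  obtain z where z: "det3 p r z \<noteq> 0" using complete_basis[OF n] .
  let ?D = "det3 p r z"
  \<comment> \<open>The summands collect the remaining terms: the square of the z-coordinate and its
    products with the r- and p-coordinates, over the squared determinant.\<close>
  define m where "m = (1 / ?D^2) *s (qform a b z *s crs p r + bil a b r z *s crs z p + bil a b p z *s crs r z)"
  have "qform a b x = dot3 (crs p r) x * dot3 m x" for x
  proof -
    have "?D^2 * qform a b x = qform a b (?D *s x)" by (simp add: qform_scale)
    also have "\<dots> = (det3 p r x)^2 * qform a b z + det3 p x z * det3 p r x * bil a b r z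
       + det3 x r z * det3 p r x * bil a b p z"
      by (subst basis_expand) (simp add: qform_expand q)
    also have "\<dots> = dot3 (crs p r) x * (?D^2 * dot3 m x)"
      using z by (simp add: m_def det3_alt(1)[of p r x] det3_alt(2)[of p x z] det3_alt(3)[of x r z]
          crs_commute[of p z] power2_eq_square dot3_commute algebra_simps
          dot3_def)
    finally show ?thesis using z by simp
  qed
  then show ?thesis by blast
qed

subsection \<open>The quadratic Cremona transformation\<close>

text \<open>In the basis \<open>a, b, c\<close> this is the map \<open>(r, s, t) \<mapsto> (st, rt, rs)\<close>; it turns the conics
  through \<open>a, b, c\<close> into lines, and it is its own inverse up to scaling.\<close>
definition crem :: "complex^3 \<Rightarrow> complex^3 \<Rightarrow> complex^3 \<Rightarrow> complex^3 \<Rightarrow> complex^3" where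
  "crem a b c x = vector [det3 a x c * det3 a b x, det3 x b c * det3 a b x, det3 x b c * det3 a x c]"

definition crem_inv :: "complex^3 \<Rightarrow> complex^3 \<Rightarrow> complex^3 \<Rightarrow> complex^3 \<Rightarrow> complex^3" where
  "crem_inv a b c n = (n$2 * n$3) *s a + (n$1 * n$3) *s b + (n$1 * n$2) *s c"

lemma crem_nth [simp]:
  "crem a b c x $ 1 = det3 a x c * det3 a b x"
  "crem a b c x $ 2 = det3 x b c * det3 a b x"
  "crem a b c x $ 3 = det3 x b c * det3 a x c"
  by (simp_all add: crem_def vector_3)

lemma crem_inv_crem: "crem_inv a b c (crem a b c x) =
    (det3 x b c * det3 a x c * det3 a b x * det3 a b c) *s x"
proof -
  let ?k = "det3 x b c * det3 a x c * det3 a b x"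
  have "crem_inv a b c (crem a b c x) = ?k *s (det3 x b c *s a + det3 a x c *s b + det3 a b x *s c)"
    by (simp add: crem_inv_def vector_add_ldistrib vector_smult_assoc mult_ac)
  also have "\<dots> = ?k *s (det3 a b c *s x)" by (subst basis_expand) simp
  finally show ?thesis by (simp add: vector_smult_assoc)
qed

lemma crem_crem_inv: "crem a b c (crem_inv a b c n) = ((det3 a b c)^2 * n$1 * n$2 * n$3) *s n"
  by (simp add: vec3_eq_iff crem_inv_def power2_eq_square)

lemma crem_inv_scale: "crem_inv a b c (r *s n) = r^2 *s crem_inv a b c n"
  by (simp add: crem_inv_def power2_eq_square vector_add_ldistrib vector_smult_assoc mult_ac)

lemma crem_scale: "crem a b c (r *s n) = r^2 *s crem a b c n"
  by (simp add: vec3_eq_iff power2_eq_square mult_ac)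

lemma crem_base [simp]: "crem a b c a = 0" "crem a b c b = 0" "crem a b c c = 0"
  by (simp_all add: vec3_eq_iff)

text \<open>Off the sides of the triangle the map is injective on projective points, since
  \<open>crem_inv\<close> recovers the argument up to a nonzero factor.\<close>

lemma crs_crem_nonzero:
  assumes "det3 d b c \<noteq> 0" "det3 a d c \<noteq> 0" "det3 a b d \<noteq> 0"
    "det3 e b c \<noteq> 0" "det3 a e c \<noteq> 0" "det3 a b e \<noteq> 0" "crs d e \<noteq> 0" "det3 a b c \<noteq> 0"
  shows "crs (crem a b c d) (crem a b c e) \<noteq> 0"
proof
  assume z: "crs (crem a b c d) (crem a b c e) = 0"
  have "crem a b c d \<noteq> 0" using assms by (simp add: vec3_eq_iff)
  then obtain k where k: "crem a b c e = k *s crem a b c d" using z crs_eq_0_iff by blast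
  have "crem_inv a b c (crem a b c e) = k^2 *s crem_inv a b c (crem a b c d)"
    unfolding k crem_inv_scale ..
  then have e: "(det3 e b c * det3 a e c * det3 a b e * det3 a b c) *s e
     = k^2 *s ((det3 d b c * det3 a d c * det3 a b d * det3 a b c) *s d)"
    unfolding crem_inv_crem .
  then have "crs d ((det3 e b c * det3 a e c * det3 a b e * det3 a b c) *s e)
     = crs d (k^2 *s ((det3 d b c * det3 a d c * det3 a b d * det3 a b c) *s d))"
    by (rule arg_cong)
  then have "(det3 e b c * det3 a e c * det3 a b e * det3 a b c) *s crs d e = 0"
    by simp
  then show False using assms by simp
qed

text \<open>Vanishing at the base points kills the squares, and the mixed products of coordinates
  are exactly the entries of \<open>crem\<close>.\<close>

lemma qform_crem:
  assumes "qform p q a = 0" "qform p q b = 0" "qform p q c = 0"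
  shows "(det3 a b c)^2 * qform p q x =
    dot3 (vector [bil p q b c, bil p q a c, bil p q a b]) (crem a b c x)"
proof -
  have "(det3 a b c)^2 * qform p q x = qform p q (det3 a b c *s x)" by (simp add: qform_scale)
  also have "\<dots> = det3 a x c * det3 a b x * bil p q b c + det3 x b c * det3 a b x * bil p q a c
     + det3 x b c * det3 a x c * bil p q a b"
    by (subst basis_expand) (simp add: qform_expand assms)
  finally show ?thesis by (simp add: dot3_def vector_3 mult_ac)
qed

text \<open>The passage back from lines to conics. The test points b + c, a + c and a + b isolate
  one coefficient each, which shows that the form is nonzero.\<close>

lemma crem_qform:
  assumes "det3 a b c \<noteq> 0" "\<beta> \<noteq> 0"
  shows "\<exists>p q. (p \<noteq> 0 \<or> q \<noteq> 0) \<and> (\<forall>x. qform p q x = dot3 \<beta> (crem a b c x))"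
proof -
  let ?r = "crs b c" and ?s = "crs c a" and ?t = "crs a b"
  have lin: "det3 x b c = dot3 ?r x" "det3 a x c = dot3 ?s x" "det3 a b x = dot3 ?t x" for x
    by (simp_all add: dot3_def det3_expand algebra_simps)
  obtain p1 q1 where 1: "\<And>x. dot3 ?s x * dot3 ?t x = qform p1 q1 x" using qform_product_ex[of ?s ?t] by blast
  obtain p2 q2 where 2: "\<And>x. dot3 ?r x * dot3 ?t x = qform p2 q2 x" using qform_product_ex[of ?r ?t] by blast
  obtain p3 q3 where 3: "\<And>x. dot3 ?r x * dot3 ?s x = qform p3 q3 x" using qform_product_ex[of ?r ?s] by blast
  define p where "p = 1 *s (\<beta>$1 *s p1 + \<beta>$2 *s p2) + \<beta>$3 *s p3"
  define q where "q = 1 *s (\<beta>$1 *s q1 + \<beta>$2 *s q2) + \<beta>$3 *s q3"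
  have pq: "qform p q x = dot3 \<beta> (crem a b c x)" for x
    unfolding p_def q_def qform_linear by (simp add: dot3_def[of \<beta>] lin 1 2 3)
  have "\<exists>x. dot3 \<beta> (crem a b c x) \<noteq> 0"
  proof -
    have "dot3 \<beta> (crem a b c (b + c)) = \<beta>$1 * (det3 a b c)^2"
      "dot3 \<beta> (crem a b c (a + c)) = \<beta>$2 * (det3 a b c)^2"
      "dot3 \<beta> (crem a b c (a + b)) = \<beta>$3 * (det3 a b c)^2"
      by (simp_all add: dot3_def power2_eq_square)
    moreover have "\<beta>$1 \<noteq> 0 \<or> \<beta>$2 \<noteq> 0 \<or> \<beta>$3 \<noteq> 0" using assms(2) by (simp add: vec3_eq_iff)
    ultimately consider "dot3 \<beta> (crem a b c (b + c)) \<noteq> 0" | "dot3 \<beta> (crem a b c (a + c)) \<noteq> 0"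
      | "dot3 \<beta> (crem a b c (a + b)) \<noteq> 0" using assms(1) by auto
    then show ?thesis by cases blast+
  qed
  then have "p \<noteq> 0 \<or> q \<noteq> 0" using pq qform_zero(1) by metis
  then show ?thesis using pq by blast
qed

lemma onconic_crem:
  assumes "det3 (X a) (X b) (X c) \<noteq> 0"
  shows "onconic X ({a, b, c} \<union> S) \<longleftrightarrow>
    (\<exists>\<beta>. \<beta> \<noteq> 0 \<and> (\<forall>i\<in>S. dot3 \<beta> (crem (X a) (X b) (X c) (X i)) = 0))"
proof
  assume "onconic X ({a, b, c} \<union> S)"
  then obtain p q where pq: "p \<noteq> 0 \<or> q \<noteq> 0" "\<forall>i\<in>{a, b, c} \<union> S. qform p q (X i) = 0"
    unfolding onconic_def by blast
  let ?\<beta> = "vector [bil p q (X b) (X c), bil p q (X a) (X c), bil p q (X a) (X b)] :: complex^3"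
  have e: "(det3 (X a) (X b) (X c))^2 * qform p q x = dot3 ?\<beta> (crem (X a) (X b) (X c) x)" for x
    using qform_crem[of p q "X a" "X b" "X c"] pq(2) by simp
  have "?\<beta> \<noteq> 0"
  proof
    assume "?\<beta> = 0"
    then have "(det3 (X a) (X b) (X c))^2 * qform p q x = 0" for x
      by (simp only: e dot3_simps)
    then have "qform p q x = 0" for x using assms by simp
    then show False using qform_eq_zeroD pq(1) by blast
  qed
  moreover have "\<forall>i\<in>S. dot3 ?\<beta> (crem (X a) (X b) (X c) (X i)) = 0"
    using pq(2) by (simp add: e[symmetric])
  ultimately show "\<exists>\<beta>. \<beta> \<noteq> 0 \<and> (\<forall>i\<in>S. dot3 \<beta> (crem (X a) (X b) (X c) (X i)) = 0)" by blast
next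
  assume "\<exists>\<beta>. \<beta> \<noteq> 0 \<and> (\<forall>i\<in>S. dot3 \<beta> (crem (X a) (X b) (X c) (X i)) = 0)"
  then obtain \<beta> where \<beta>: "\<beta> \<noteq> 0" "\<forall>i\<in>S. dot3 \<beta> (crem (X a) (X b) (X c) (X i)) = 0" by blast
  obtain p q where "p \<noteq> 0 \<or> q \<noteq> 0" "\<forall>x. qform p q x = dot3 \<beta> (crem (X a) (X b) (X c) x)"
    using crem_qform[OF assms \<beta>(1)] by blast
  then show "onconic X ({a, b, c} \<union> S)" unfolding onconic_def using \<beta>(2)
    by (intro exI[of _ p] exI[of _ q]) auto
qed

text \<open>A polynomial test for six points on a quadric, valid if the first three are not
  collinear: the Cremona images of the other three have to be collinear.\<close>

definition conic6 :: "tuple \<Rightarrow> 8 \<Rightarrow> 8 \<Rightarrow> 8 \<Rightarrow> 8 \<Rightarrow> 8 \<Rightarrow> 8 \<Rightarrow> complex" where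
  "conic6 X a b c d e f = det3 (crem (X a) (X b) (X c) (X d)) (crem (X a) (X b) (X c) (X e))
     (crem (X a) (X b) (X c) (X f))"

lemma onconic_iff_conic6:
  assumes "det3 (X a) (X b) (X c) \<noteq> 0"
  shows "onconic X {a, b, c, d, e, f} \<longleftrightarrow> conic6 X a b c d e f = 0"
proof -
  have "{a, b, c, d, e, f} = {a, b, c} \<union> {d, e, f}" by auto
  then show ?thesis using onconic_crem[OF assms, of "{d, e, f}"] by (simp add: conic6_def det3_eq_0_iff)
qed

text \<open>Two distinct image points span one line, so five points determine the quadric and each
  further point can be tested separately.\<close>

lemma onconic_five:
  assumes "det3 (X a) (X b) (X c) \<noteq> 0"
    "crs (crem (X a) (X b) (X c) (X d)) (crem (X a) (X b) (X c) (X e)) \<noteq> 0"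
  shows "onconic X ({a, b, c, d, e} \<union> S) \<longleftrightarrow> (\<forall>i\<in>S. conic6 X a b c d e i = 0)"
proof -
  let ?u = "\<lambda>i. crem (X a) (X b) (X c) (X i)"
  have "{a, b, c, d, e} \<union> S = {a, b, c} \<union> ({d, e} \<union> S)" by auto
  then have "onconic X ({a, b, c, d, e} \<union> S) \<longleftrightarrow>
      (\<exists>\<beta>. \<beta> \<noteq> 0 \<and> (\<forall>i\<in>{d, e} \<union> S. dot3 \<beta> (?u i) = 0))"
    by (simp only: onconic_crem[OF assms(1)])
  also have "\<dots> \<longleftrightarrow> (\<forall>i\<in>S. conic6 X a b c d e i = 0)"
  proof
    assume "\<exists>\<beta>. \<beta> \<noteq> 0 \<and> (\<forall>i\<in>{d, e} \<union> S. dot3 \<beta> (?u i) = 0)"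
    then show "\<forall>i\<in>S. conic6 X a b c d e i = 0" unfolding conic6_def det3_eq_0_iff by blast
  next
    assume "\<forall>i\<in>S. conic6 X a b c d e i = 0"
    then show "\<exists>\<beta>. \<beta> \<noteq> 0 \<and> (\<forall>i\<in>{d, e} \<union> S. dot3 \<beta> (?u i) = 0)"
      using assms(2) by (intro exI[of _ "crs (?u d) (?u e)"]) (auto simp: conic6_def det3_alt(1))
  qed
  finally show ?thesis .
qed

lemma nocoll_crem:
  assumes "nocoll X S" "gen S X" "{a, b, c, d, e} \<subseteq> S" "distinct [a, b, c, d, e]"
  shows "det3 (X a) (X b) (X c) \<noteq> 0"
    "crs (crem (X a) (X b) (X c) (X d)) (crem (X a) (X b) (X c) (X e)) \<noteq> 0"
proof -
  have d: "det3 (X i) (X j) (X k) \<noteq> 0"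
    if "{i, j, k} \<subseteq> {a, b, c, d, e}" "i \<noteq> j" "i \<noteq> k" "j \<noteq> k" for i j k
    using nocollD[OF assms(1) _ that(2-4)] that(1) assms(3) by blast
  show "det3 (X a) (X b) (X c) \<noteq> 0" using assms(4) by (intro d) auto
  have "crs (X d) (X e) \<noteq> 0" using assms(2-4) by (auto simp: gen_def)
  then show "crs (crem (X a) (X b) (X c) (X d)) (crem (X a) (X b) (X c) (X e)) \<noteq> 0"
    using assms(4) by (intro crs_crem_nonzero d) auto
qed

lemma conic_join:
  assumes "onconic X S" "onconic X T" "F \<subseteq> S" "F \<subseteq> T" "5 \<le> card F" "nocoll X F" "gen F X"
  shows "onconic X (S \<union> T)"
proof -
  obtain a b c d e where F: "{a, b, c, d, e} \<subseteq> F" "distinct [a, b, c, d, e]"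
    using card5E[OF assms(5)] .
  note nz = nocoll_crem[OF assms(6,7) F]
  have e: "S \<union> T = {a, b, c, d, e} \<union> (S \<union> T)" "S = {a, b, c, d, e} \<union> S" "T = {a, b, c, d, e} \<union> T"
    using F assms by auto
  have "\<forall>i\<in>S. conic6 X a b c d e i = 0" using assms(1) onconic_five[OF nz, of S] e(2) by simp
  moreover have "\<forall>i\<in>T. conic6 X a b c d e i = 0" using assms(2) onconic_five[OF nz, of T] e(3) by simp
  ultimately have "onconic X ({a, b, c, d, e} \<union> (S \<union> T))" unfolding onconic_five[OF nz] by blast
  then show ?thesis using e(1) by simp
qed

text \<open>In z = r x + s y both coefficients are nonzero because the points are distinct, so
  vanishing at z forces the polar form of x and y to vanish.\<close>

lemma quadric_contains_line:
  assumes q: "qform p q x = 0" "qform p q y = 0" "qform p q z = 0" and "det3 x y z = 0"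
    and n: "crs x y \<noteq> 0" "crs x z \<noteq> 0" "crs z y \<noteq> 0"
  shows "\<exists>m. \<forall>w. qform p q w = dot3 (crs x y) w * dot3 m w"
proof -
  obtain r s where z: "z = r *s x + s *s y" using line_coords[OF n(1) assms(4)] .
  have "r \<noteq> 0" using n(3) unfolding z by (auto simp: vec3_eq_iff)
  moreover have "s \<noteq> 0" using n(2) unfolding z by (auto simp: vec3_eq_iff)
  moreover have "qform p q z = r * s * bil p q x y"
    using qform_expand[of p q r x s y 0 0] q(1,2) unfolding z by simp
  ultimately have "bil p q x y = 0" using q(3) by auto
  then show ?thesis by (rule line_in_quadric[OF n(1) q(1,2)])
qed

text \<open>Otherwise the quadric splits into two lines by \<open>quadric_contains_line\<close>.
  Each of them contains at most two points of \<open>F\<close>, but \<open>F\<close> has at least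
  five.\<close>

lemma conic_nocoll:
  assumes on: "onconic X S" and F: "F \<subseteq> S" "5 \<le> card F" "nocoll X F" and gen: "gen S X"
  shows "nocoll X S"
  unfolding nocoll_def
proof (intro allI impI notI)
  fix T assume T: "T \<subseteq> S" "card T = 3" "coll X T"
  obtain i j k where ijk: "T = {i, j, k}" "i \<noteq> j" "i \<noteq> k" "j \<noteq> k" using card3E[OF T(2)] .
  obtain p q where pq: "p \<noteq> 0 \<or> q \<noteq> 0" "\<forall>i\<in>S. qform p q (X i) = 0"
    using on unfolding onconic_def by blast
  let ?n = "crs (X i) (X j)"
  have n: "?n \<noteq> 0" "crs (X i) (X k) \<noteq> 0" "crs (X k) (X j) \<noteq> 0"
    using gen ijk T(1) unfolding gen_def by auto
  have "det3 (X i) (X j) (X k) = 0" using T(3) ijk coll_iff_det3 by metis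
  moreover have "qform p q (X i) = 0" "qform p q (X j) = 0" "qform p q (X k) = 0"
    using pq(2) ijk T(1) by auto
  ultimately obtain m where m: "\<And>x. qform p q x = dot3 ?n x * dot3 m x"
    using quadric_contains_line n by metis
  have "m \<noteq> 0"
  proof
    assume "m = 0"
    then have "qform p q x = 0" for x using m by simp
    then show False using qform_eq_zeroD pq(1) by blast
  qed
  let ?A = "{i\<in>F. dot3 ?n (X i) = 0}" and ?B = "{i\<in>F. dot3 m (X i) = 0}"
  have "coll X ?A" "coll X ?B" unfolding coll_def using n(1) \<open>m \<noteq> 0\<close> by blast+
  have small: "card B < 3" if "coll X B" "B \<subseteq> F" for B
  proof (rule ccontr)
    assume "\<not> card B < 3"
    then have "3 \<le> card B" by simp
    then obtain C where C: "C \<subseteq> B" "card C = 3" by (rule obtain_subset_with_card_n)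
    then show False using C that F(3) coll_mono[of X B C] unfolding nocoll_def by blast
  qed
  have "F = ?A \<union> ?B"
  proof -
    have "dot3 ?n (X l) = 0 \<or> dot3 m (X l) = 0" if "l \<in> F" for l
      using m[of "X l"] pq(2) F(1) that by (metis mult_eq_0_iff subsetD)
    then show ?thesis by blast
  qed
  then have "card F \<le> card ?A + card ?B" using card_Un_le[of ?A ?B] by simp
  moreover have "card ?A < 3" "card ?B < 3"
    using small[OF \<open>coll X ?A\<close>] small[OF \<open>coll X ?B\<close>] by blast+
  ultimately show False using F(2) by simp
qed

section \<open>Strata\<close>

text \<open>Sextuples containing a collinear triple are not constrained, since they lie on no
  irreducible conic. The coordinates outside \<open>A\<close> are arbitrary.\<close>
definition stratum :: "8 set \<Rightarrow> tuple \<Rightarrow> tuple set" where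
  "stratum A Y = {X. gen A X \<and>
     (\<forall>T\<subseteq>A. card T = 3 \<longrightarrow> (coll X T \<longleftrightarrow> coll Y T)) \<and>
     (\<forall>S\<subseteq>A. card S = 6 \<longrightarrow> nocoll Y S \<longrightarrow> (onconic X S \<longleftrightarrow> onconic Y S))}"

text \<open>The open conditions among those defining the stratum.\<close>
definition generic :: "8 set \<Rightarrow> tuple \<Rightarrow> tuple set" where
  "generic A Y = {X. gen A X \<and>
     (\<forall>T\<subseteq>A. card T = 3 \<longrightarrow> \<not> coll Y T \<longrightarrow> \<not> coll X T) \<and>
     (\<forall>S\<subseteq>A. card S = 6 \<longrightarrow> nocoll Y S \<longrightarrow> \<not> onconic Y S \<longrightarrow> \<not> onconic X S)}"

lemma stratum_generic: "stratum A Y \<subseteq> generic A Y"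
  by (auto simp: stratum_def generic_def)

lemma stratum_refl: "gen A Y \<Longrightarrow> Y \<in> stratum A Y"
  by (simp add: stratum_def)

lemma stratum_nocoll:
  assumes "X \<in> stratum A Y" "S \<subseteq> A" shows "nocoll X S \<longleftrightarrow> nocoll Y S"
proof -
  have "coll X T \<longleftrightarrow> coll Y T" if "T \<subseteq> S" "card T = 3" for T
    using assms that subset_trans[OF that(1) assms(2)] by (simp add: stratum_def)
  then show ?thesis by (simp add: nocoll_def)
qed

lemma stratum_coll: "X \<in> stratum A Y \<Longrightarrow> {i, j, k} \<subseteq> A \<Longrightarrow> i \<noteq> j \<Longrightarrow> i \<noteq> k \<Longrightarrow> j \<noteq> k \<Longrightarrow>
    coll X {i, j, k} \<longleftrightarrow> coll Y {i, j, k}"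
  unfolding stratum_def by simp

lemma stratum_onconic: "X \<in> stratum A Y \<Longrightarrow> S \<subseteq> A \<Longrightarrow> card S = 6 \<Longrightarrow> nocoll Y S \<Longrightarrow>
    onconic X S \<longleftrightarrow> onconic Y S"
  unfolding stratum_def by blast

lemma stratum_mono: "X \<in> stratum A Y \<Longrightarrow> B \<subseteq> A \<Longrightarrow> X \<in> stratum B Y"
  unfolding stratum_def by (auto intro: gen_mono)

lemma generic_nocoll:
  assumes "X \<in> generic A Y" "S \<subseteq> A" "nocoll Y S" shows "nocoll X S"
proof -
  have "\<not> coll X T" if "T \<subseteq> S" "card T = 3" for T
    using assms that subset_trans[OF that(1) assms(2)] by (simp add: generic_def nocoll_def)
  then show ?thesis by (simp add: nocoll_def)
qed

lemma stratumI:
  assumes "X \<in> generic A Y"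
    "\<And>T. T \<subseteq> A \<Longrightarrow> card T = 3 \<Longrightarrow> coll Y T \<Longrightarrow> coll X T"
    "\<And>S. S \<subseteq> A \<Longrightarrow> card S = 6 \<Longrightarrow> nocoll Y S \<Longrightarrow> onconic Y S \<Longrightarrow> onconic X S"
  shows "X \<in> stratum A Y"
  using assms unfolding generic_def stratum_def by blast

lemma cong_on:
  assumes "\<And>i. i \<in> A \<Longrightarrow> X i = Z i"
  shows "S \<subseteq> A \<Longrightarrow> coll X S \<longleftrightarrow> coll Z S" "S \<subseteq> A \<Longrightarrow> onconic X S \<longleftrightarrow> onconic Z S"
    "gen A X \<longleftrightarrow> gen A Z"
proof -
  show "coll X S \<longleftrightarrow> coll Z S" if S: "S \<subseteq> A"
  proof -
    have "X i = Z i" if "i \<in> S" for i using that S assms by blast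
    then show ?thesis by (simp add: coll_def)
  qed
  show "onconic X S \<longleftrightarrow> onconic Z S" if S: "S \<subseteq> A"
  proof -
    have "X i = Z i" if "i \<in> S" for i using that S assms by blast
    then show ?thesis by (simp add: onconic_def)
  qed
  show "gen A X \<longleftrightarrow> gen A Z" by (simp add: gen_def assms)
qed

lemma stratum_cong:
  assumes "\<And>i. i \<in> A \<Longrightarrow> X i = Z i"
  shows "X \<in> stratum A Y \<longleftrightarrow> Z \<in> stratum A Y"
  unfolding stratum_def mem_Collect_eq using cong_on[of A X Z, OF assms] by simp

lemma stratum_upd: "x \<notin> A \<Longrightarrow> X(x := w) \<in> stratum A Y \<longleftrightarrow> X \<in> stratum A Y"
  by (rule stratum_cong) auto

text \<open>The test \<open>conic6\<close> is reliable only if its first three points are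
  independent. The condition that the sextuple has no collinear triple is therefore added to the
  open set; generic tuples satisfy it by \<open>generic_nocoll\<close>.\<close>

lemma zopen_generic: "zopen (generic A Y)"
proof -
  let ?\<T> = "{T. T \<subseteq> A \<and> card T = 3 \<and> \<not> coll Y T}"
  let ?\<S> = "{S. S \<subseteq> A \<and> card S = 6 \<and> nocoll Y S \<and> \<not> onconic Y S}"
  have 1: "zopen {X. \<not> coll X T}" if T: "card T = 3" for T
  proof -
    obtain i j k where "T = {i, j, k}" "i \<noteq> j" "i \<noteq> k" "j \<noteq> k" using card3E[OF T] .
    then show ?thesis by (simp add: coll_iff_det3 zopen_nonzero regfun_det3)
  qed
  have 2: "zopen {X. \<not> onconic X S \<and> nocoll X S}" if S: "card S = 6" for S
  proof -
    obtain xs where xs: "set xs = S" "distinct xs" using finite_distinct_list[of S] by auto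
    then have "length xs = 6" using S distinct_card by metis
    then obtain a b c d e f where "xs = [a, b, c, d, e, f]"
      by (auto simp: length_Suc_conv numeral_eq_Suc)
    then have abc: "S = {a, b, c, d, e, f}" "distinct [a, b, c, d, e, f]" using xs by auto
    have "{X. \<not> onconic X S \<and> nocoll X S} =
        {X. conic6 X a b c d e f \<noteq> 0} \<inter> (\<Inter>T\<in>{T. T \<subseteq> S \<and> card T = 3}. {X. \<not> coll X T})"
    proof -
      have "\<not> onconic X S \<and> nocoll X S \<longleftrightarrow> conic6 X a b c d e f \<noteq> 0 \<and> nocoll X S" for X
      proof (cases "nocoll X S")
        case True
        then have "det3 (X a) (X b) (X c) \<noteq> 0" using abc by (intro nocollD[OF True]) auto
        then show ?thesis using onconic_iff_conic6 abc(1) by blast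
      qed simp
      then show ?thesis by (auto simp: nocoll_def)
    qed
    moreover have "(\<lambda>X. conic6 X a b c d e f) \<in> regfun"
      unfolding conic6_def crem_def
      by (intro regfun_det3 regvec_vector regfun.mult regvec_coord)
    ultimately show ?thesis
      by (simp only:) (intro zopen_Int zopen_nonzero zopen_INT 1; simp)
  qed
  have "generic A Y = (\<Inter>i\<in>A. \<Inter>j\<in>A - {i}. {X. crs (X i) (X j) \<noteq> 0}) \<inter>
      ((\<Inter>T\<in>?\<T>. {X. \<not> coll X T}) \<inter> (\<Inter>S\<in>?\<S>. {X. \<not> onconic X S \<and> nocoll X S}))" (is "_ = ?R")
  proof (intro equalityI subsetI)
    fix X assume X: "X \<in> generic A Y"
    then show "X \<in> ?R" using generic_nocoll[OF X] by (auto simp: generic_def gen_def)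
  qed (auto simp: generic_def gen_def)
  moreover have "zopen ?R"
  proof (intro zopen_Int zopen_INT)
    show "finite A" "finite ?\<T>" "finite ?\<S>" "\<And>i. finite (A - {i})" by simp_all
    show "zopen {X. \<not> coll X T}" if "T \<in> ?\<T>" for T using that 1 by blast
    show "zopen {X. \<not> onconic X S \<and> nocoll X S}" if "S \<in> ?\<S>" for S using that 2 by blast
    show "zopen {X. crs (X i) (X j) \<noteq> 0}" for i j :: 8
      by (intro zopen_vec_nonzero regvec_crs regvec_coord)
  qed
  ultimately show ?thesis by simp
qed

section \<open>Adding a point\<close>

text \<open>The vector at \<open>x\<close> is arbitrary in the stratum on \<open>A\<close>, so it
  serves as the parameter: \<open>F\<close> reads it, and the map overwrites it with the new point.
  What remains to be shown is that every point arises in this way and that the closed conditions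
  involving \<open>x\<close> follow from the shape of the new point.\<close>

lemma irr_extend:
  assumes x: "x \<notin> A" and irr: "irr (stratum A Y)" and Y: "gen (insert x A) Y" and F: "regvec F"
    and sur: "\<And>X. X \<in> stratum (insert x A) Y \<Longrightarrow> \<exists>w. F (X(x := w)) = X x"
    and line: "\<And>X w y z. X \<in> generic (insert x A) Y \<Longrightarrow> X \<in> stratum A Y \<Longrightarrow> X x = F (X(x := w)) \<Longrightarrow>
      y \<in> A \<Longrightarrow> z \<in> A \<Longrightarrow> y \<noteq> z \<Longrightarrow> coll Y {x, y, z} \<Longrightarrow> coll X {x, y, z}"
    and conic: "\<And>X w S. X \<in> generic (insert x A) Y \<Longrightarrow> X \<in> stratum A Y \<Longrightarrow> X x = F (X(x := w)) \<Longrightarrow>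
      S \<subseteq> A \<Longrightarrow> card S = 5 \<Longrightarrow> nocoll Y (insert x S) \<Longrightarrow> onconic Y (insert x S) \<Longrightarrow> onconic X (insert x S)"
  shows "irr (stratum (insert x A) Y)"
proof (rule irr_step[OF irr, where \<Phi> = "\<lambda>X. X(x := F X)" and U = "generic (insert x A) Y"])
  show "regmap (\<lambda>X. X(x := F X))" by (intro regmap_upd F regmap_id)
  show "zopen (generic (insert x A) Y)" by (rule zopen_generic)
  show "stratum (insert x A) Y \<noteq> {}" using stratum_refl[OF Y] by blast
  show "stratum (insert x A) Y \<subseteq> generic (insert x A) Y" by (rule stratum_generic)
  show "stratum (insert x A) Y \<subseteq> (\<lambda>X. X(x := F X)) ` stratum A Y"
  proof
    fix X assume X: "X \<in> stratum (insert x A) Y"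
    obtain w where "F (X(x := w)) = X x" using sur[OF X] by blast
    then have "X = (\<lambda>X. X(x := F X)) (X(x := w))" by (auto simp: fun_eq_iff)
    moreover have "X(x := w) \<in> stratum A Y" using stratum_mono[OF X] stratum_upd[OF x] by blast
    ultimately show "X \<in> (\<lambda>X. X(x := F X)) ` stratum A Y" by blast
  qed
  fix v assume v: "v \<in> stratum A Y" and gen: "v(x := F v) \<in> generic (insert x A) Y"
  let ?X = "v(x := F v)"
  have X: "?X \<in> stratum A Y" using v stratum_upd[OF x] by blast
  have eq: "?X x = F (?X(x := v x))" by simp
  show "?X \<in> stratum (insert x A) Y"
  proof (rule stratumI[OF gen])
    fix T assume T: "T \<subseteq> insert x A" "card T = 3" "coll Y T"
    show "coll ?X T"
    proof (cases "x \<in> T")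
      case True
      obtain i j k where ijk: "T = {i, j, k}" "i \<noteq> j" "i \<noteq> k" "j \<noteq> k" using card3E[OF T(2)] .
      have "\<exists>y z. T = {x, y, z} \<and> y \<noteq> z \<and> y \<noteq> x \<and> z \<noteq> x" using True ijk by blast
      then obtain y z where yz: "T = {x, y, z}" "y \<noteq> z" "y \<noteq> x" "z \<noteq> x" by blast
      then show ?thesis using line[OF gen X eq, of y z] T by blast
    next
      case False
      then have "T \<subseteq> A" using T(1) by blast
      then show ?thesis using X T unfolding stratum_def by blast
    qed
  next
    fix S assume S: "S \<subseteq> insert x A" "card S = 6" "nocoll Y S" "onconic Y S"
    show "onconic ?X S"
    proof (cases "x \<in> S")
      case True
      then have "S = insert x (S - {x})" by blast
      moreover have "card (S - {x}) = 5" using True S(2) by simp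
      ultimately show ?thesis using conic[OF gen X eq, of "S - {x}"] S by (metis Diff_subset_conv insert_is_Un)
    next
      case False
      then have "S \<subseteq> A" using S(1) by blast
      then show ?thesis using X S unfolding stratum_def by blast
    qed
  qed
qed

lemma generic_gen: "X \<in> generic A Y \<Longrightarrow> gen A X"
  by (simp add: generic_def)

lemma stratum_gen: "X \<in> stratum A Y \<Longrightarrow> gen A X"
  by (simp add: stratum_def)

text \<open>The set \<open>C\<close> supplies representatives for the lines through \<open>x\<close>
  that carry two points of \<open>A\<close>; one or two of them are enough below.\<close>

definition pencil :: "tuple \<Rightarrow> 8 set \<Rightarrow> 8 \<Rightarrow> 8 set \<Rightarrow> bool" where
  "pencil Y A x C \<longleftrightarrow> (\<forall>y\<in>A. \<forall>z\<in>A. y \<noteq> z \<longrightarrow> coll Y {x, y, z} \<longrightarrow>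
     (\<exists>a\<in>C. coll Y {x, a, y} \<and> coll Y {x, a, z}))"

definition conics_at :: "tuple \<Rightarrow> 8 set \<Rightarrow> 8 \<Rightarrow> 8 set set \<Rightarrow> bool" where
  "conics_at Y A x \<C> \<longleftrightarrow> (\<forall>S\<subseteq>A. card S = 5 \<longrightarrow> nocoll Y (insert x S) \<longrightarrow> onconic Y (insert x S) \<longrightarrow>
     (\<exists>C\<in>\<C>. S \<subseteq> C))"

text \<open>One incidence x, a, b per line suffices: further points of the line are collinear with a
  and b, and this is already part of the stratum on \<open>A\<close>.\<close>

lemma pencil_closed:
  assumes gX: "gen (insert x A) X" and gY: "gen (insert x A) Y" and X: "X \<in> stratum A Y" and x: "x \<notin> A"
    and pen: "pencil Y A x C" and ab: "\<And>a. a \<in> C \<Longrightarrow> a \<in> A \<and> (\<exists>b\<in>A. b \<noteq> a \<and> coll Y {x, a, b} \<and> coll X {x, a, b})"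
    and yz: "y \<in> A" "z \<in> A" "y \<noteq> z" "coll Y {x, y, z}"
  shows "coll X {x, y, z}"
proof -
  obtain a where a: "a \<in> C" "coll Y {x, a, y}" "coll Y {x, a, z}"
    using pen yz unfolding pencil_def by blast
  obtain b where b: "a \<in> A" "b \<in> A" "b \<noteq> a" "coll Y {x, a, b}" "coll X {x, a, b}" using ab[OF a(1)] by blast
  have xa: "crs (Y x) (Y a) \<noteq> 0" "crs (X x) (X a) \<noteq> 0" "crs (X a) (X b) \<noteq> 0"
    using gX gY x b unfolding gen_def by auto
  have *: "coll X {x, a, b, i}" if i: "i \<in> A" "coll Y {x, a, i}" for i
  proof (cases "i = a \<or> i = b")
    case True then have "{x, a, b, i} = {x, a, b}" by auto then show ?thesis using b by simp
  next
    case False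
    have "coll Y ({x, a, b} \<union> {x, a, i})" by (rule coll_join[OF b(4) i(2) _ _ xa(1)]) auto
    then have "coll Y {a, b, i}" by (rule coll_mono) auto
    then have "coll X {a, b, i}" using stratum_coll[OF X, of a b i] b i False by blast
    then have "coll X ({x, a, b} \<union> {a, b, i})" by (intro coll_join[OF b(5) _ _ _ xa(3)]) auto
    then show ?thesis by (rule coll_mono) auto
  qed
  have "coll X ({x, a, b, y} \<union> {x, a, b, z})"
    by (rule coll_join[OF *[OF yz(1) a(2)] *[OF yz(2) a(3)] _ _ xa(2)]) auto
  then show ?thesis by (rule coll_mono) auto
qed

text \<open>Five points determine the conic, and the other points of \<open>C\<close> lie on it
  already in the stratum on \<open>A\<close>. So \<open>x\<close> has to be checked against one set
  of five only.\<close>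

lemma conic_closed:
  assumes X: "X \<in> stratum A Y" and gX: "gen (insert x A) X" and gen: "X \<in> generic (insert x A) Y"
    and x: "x \<notin> A" and C: "C \<subseteq> A" "nocoll Y (insert x C)" "onconic Y (insert x C)"
    and F: "F \<subseteq> C" "card F = 5" "onconic X (insert x F)" and S: "S \<subseteq> C"
  shows "onconic X (insert x S)"
proof -
  obtain a b c d e where F': "{a, b, c, d, e} \<subseteq> F" "distinct [a, b, c, d, e]" using F(2) card5E[of F] by (metis order_refl)
  then have "card {a, b, c, d, e} = card F" using F(2) by simp
  then have Feq: "F = {a, b, c, d, e}" using F'(1) by (metis card_subset_eq finite)
  have nc: "nocoll X (insert x C)" by (rule generic_nocoll[OF gen]) (use C in auto)
  have "nocoll X F" by (rule nocoll_mono[OF nc]) (use F(1) in auto)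
  moreover have "gen F X" by (rule gen_mono[OF gX]) (use F(1) C(1) in auto)
  ultimately have nz: "det3 (X a) (X b) (X c) \<noteq> 0"
    "crs (crem (X a) (X b) (X c) (X d)) (crem (X a) (X b) (X c) (X e)) \<noteq> 0"
    using nocoll_crem[OF _ _ F'] by blast+
  have "conic6 X a b c d e i = 0" if i: "i \<in> insert x S" for i
  proof -
    have on: "onconic X (insert i F)"
    proof (cases "i = x \<or> i \<in> F")
      case True
      then show ?thesis using onconic_mono[OF F(3), of "insert i F"] by auto
    next
      case False
      then have sub: "insert i F \<subseteq> C" using i S F(1) by blast
      have "card (insert i F) = 6" using False F(2) by simp
      moreover have "nocoll Y (insert i F)" using nocoll_mono[OF C(2)] sub by blast
      moreover have "onconic Y (insert i F)" using onconic_mono[OF C(3)] sub by blast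
      ultimately show ?thesis using stratum_onconic[OF X, of "insert i F"] sub C(1) by blast
    qed
    moreover have "insert i F = {a, b, c, d, e} \<union> {i}" using Feq by auto
    ultimately show ?thesis using onconic_five[OF nz, of "{i}"] by simp
  qed
  then have "onconic X ({a, b, c, d, e} \<union> insert x S)" using onconic_five[OF nz] by blast
  then show ?thesis by (rule onconic_mono) auto
qed

section \<open>The six kinds of removable points\<close>

lemma irr_free:
  assumes x: "x \<notin> A" and irr: "irr (stratum A Y)" and Y: "gen (insert x A) Y"
    and "pencil Y A x {}" "conics_at Y A x {}"
  shows "irr (stratum (insert x A) Y)"
proof (rule irr_extend[OF x irr Y, of "\<lambda>X. X x"])
  show "\<exists>w. (X(x := w)) x = X x" for X :: tuple by auto
qed (use assms(4,5) in \<open>auto simp: pencil_def conics_at_def\<close>)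

lemma irr_line:
  assumes x: "x \<notin> A" and irr: "irr (stratum A Y)" and Y: "gen (insert x A) Y"
    and ab: "a \<in> A" "b \<in> A" "a \<noteq> b" "coll Y {x, a, b}"
    and pen: "pencil Y A x {a}" and con: "conics_at Y A x {}"
  shows "irr (stratum (insert x A) Y)"
proof (rule irr_extend[OF x irr Y, of "\<lambda>X. (X x $ 1) *s X a + (X x $ 2) *s X b"])
  have xab: "x \<noteq> a" "x \<noteq> b" using x ab by auto
  show "regvec (\<lambda>X. (X x $ 1) *s X a + (X x $ 2) *s X b)" by (intro regvec_add regvec_scale) auto
  show "\<exists>w. ((X(x := w)) x $ 1) *s (X(x := w)) a + ((X(x := w)) x $ 2) *s (X(x := w)) b = X x"
    if X: "X \<in> stratum (insert x A) Y" for X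
  proof -
    have "coll X {x, a, b}" using stratum_coll[OF X, of x a b] ab xab by auto
    then have d: "det3 (X a) (X b) (X x) = 0" using coll_iff_det3[of X a b x] by (simp add: insert_commute)
    have n: "crs (X a) (X b) \<noteq> 0" using stratum_gen[OF X] ab by (simp add: gen_def)
    obtain r s where "X x = r *s X a + s *s X b" using line_coords[OF n d] .
    then show ?thesis using xab by (intro exI[of _ "vector [r, s, 0]"]) (auto simp: vector_3)
  qed
  fix X w y z assume gen: "X \<in> generic (insert x A) Y" and X: "X \<in> stratum A Y"
    and eq: "X x = ((X(x := w)) x $ 1) *s (X(x := w)) a + ((X(x := w)) x $ 2) *s (X(x := w)) b"
    and yz: "y \<in> A" "z \<in> A" "y \<noteq> z" "coll Y {x, y, z}"
  have "coll X {x, a, b}" unfolding coll_iff_det3 eq using xab by simp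
  then show "coll X {x, y, z}"
    by (intro pencil_closed[OF generic_gen[OF gen] Y X x pen _ yz]) (use ab in auto)
next
  fix S assume "S \<subseteq> A" "card S = 5" "nocoll Y (insert x S)" "onconic Y (insert x S)"
  then show "onconic X (insert x S)" for X using con by (auto simp: conics_at_def)
qed

text \<open>The intersection of the two lines is an iterated cross product, and the parameter at
  \<open>x\<close> merely scales it.\<close>

lemma irr_two_lines:
  assumes x: "x \<notin> A" and irr: "irr (stratum A Y)" and Y: "gen (insert x A) Y"
    and ab: "a \<in> A" "b \<in> A" "a \<noteq> b" "coll Y {x, a, b}"
    and cd: "c \<in> A" "d \<in> A" "c \<noteq> d" "coll Y {x, c, d}" and ac: "\<not> coll Y {x, a, c}"
    and pen: "pencil Y A x {a, c}" and con: "conics_at Y A x {}"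
  shows "irr (stratum (insert x A) Y)"
proof (rule irr_extend[OF x irr Y, of "\<lambda>X. (X x $ 1) *s crs (crs (X a) (X b)) (crs (X c) (X d))"])
  have xab: "x \<noteq> a" "x \<noteq> b" "x \<noteq> c" "x \<noteq> d" using x ab cd by auto
  have "a \<noteq> c" using ac ab(4) coll_mono[of Y "{x,a,b}" "{x,a,c}"] by auto
  show "regvec (\<lambda>X. (X x $ 1) *s crs (crs (X a) (X b)) (crs (X c) (X d)))"
    by (intro regvec_crs regvec_scale) auto
  show "\<exists>w. ((X(x := w)) x $ 1) *s crs (crs ((X(x := w)) a) ((X(x := w)) b)) (crs ((X(x := w)) c) ((X(x := w)) d)) = X x"
    if X: "X \<in> stratum (insert x A) Y" for X
  proof -
    have co: "coll X {x, a, b}" "coll X {x, c, d}" using stratum_coll[OF X] ab cd xab by auto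
    have g: "crs (X a) (X b) \<noteq> 0" "crs (X c) (X d) \<noteq> 0" "crs (X x) (X a) \<noteq> 0" "crs (X x) (X c) \<noteq> 0"
      using stratum_gen[OF X] ab cd xab by (auto simp: gen_def)
    \<comment> \<open>If the two lines coincided, x, a and c would be collinear, against
      \<open>ac\<close>.\<close>
    have "crs (crs (X a) (X b)) (crs (X c) (X d)) \<noteq> 0"
    proof
      assume "crs (crs (X a) (X b)) (crs (X c) (X d)) = 0"
      then obtain k where k: "crs (X c) (X d) = k *s crs (X a) (X b)" using crs_eq_0_iff[OF g(1)] by blast
      have "dot3 (crs (X a) (X b)) (X x) = 0" using coll_dot3[OF co(1) _ _ _ g(1)] by auto
      moreover have "dot3 (crs (X c) (X d)) (X c) = 0" by simp
      then have "dot3 (crs (X a) (X b)) (X c) = 0" using g(2) unfolding k by auto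
      ultimately have "coll X {x, a, c}" unfolding coll_def using g(1)
        by (intro exI[of _ "crs (X a) (X b)"]) auto
      then show False using stratum_coll[OF X, of x a c] ac ab cd xab \<open>a \<noteq> c\<close> by auto
    qed
    moreover have "dot3 (crs (X a) (X b)) (X x) = 0" "dot3 (crs (X c) (X d)) (X x) = 0"
      using coll_dot3[OF co(1) _ _ _ g(1)] coll_dot3[OF co(2) _ _ _ g(2)] by auto
    ultimately obtain k where "X x = k *s crs (crs (X a) (X b)) (crs (X c) (X d))"
      using two_lines_meet by blast
    then show ?thesis using xab by (intro exI[of _ "vector [k, 0, 0]"]) (auto simp: vector_3)
  qed
  fix X w y z assume gen: "X \<in> generic (insert x A) Y" and X: "X \<in> stratum A Y"
    and eq: "X x = ((X(x := w)) x $ 1) *s crs (crs ((X(x := w)) a) ((X(x := w)) b)) (crs ((X(x := w)) c) ((X(x := w)) d))"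
    and yz: "y \<in> A" "z \<in> A" "y \<noteq> z" "coll Y {x, y, z}"
  have "coll X {x, a, b}" "coll X {x, c, d}" unfolding coll_iff_det3 eq using xab
    by (simp_all add: det3_def)
  then show "coll X {x, y, z}"
    by (intro pencil_closed[OF generic_gen[OF gen] Y X x pen _ yz]) (use ab cd in auto)
next
  fix S assume "S \<subseteq> A" "card S = 5" "nocoll Y (insert x S)" "onconic Y (insert x S)"
  then show "onconic X (insert x S)" for X using con by (auto simp: conics_at_def)
qed

text \<open>The image of x is the intersection of two lines, and the inverse transformation recovers
  x from it up to scaling.\<close>

lemma crem_meet:
  assumes "det3 a b c \<noteq> 0" "det3 x b c \<noteq> 0" "det3 a x c \<noteq> 0" "det3 a b x \<noteq> 0"
    "dot3 \<beta> (crem a b c x) = 0" "dot3 \<gamma> (crem a b c x) = 0" "crs \<beta> \<gamma> \<noteq> 0"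
  shows "\<exists>k. x = k *s crem_inv a b c (crs \<beta> \<gamma>)"
proof -
  let ?K = "det3 x b c * det3 a x c * det3 a b x * det3 a b c"
  obtain k where k: "crem a b c x = k *s crs \<beta> \<gamma>" using two_lines_meet[OF assms(5-7)] by blast
  have "?K *s x = k^2 *s crem_inv a b c (crs \<beta> \<gamma>)"
    using crem_inv_crem[of a b c x] unfolding k crem_inv_scale by simp
  then have "(1 / ?K) *s (?K *s x) = (1 / ?K) *s (k^2 *s crem_inv a b c (crs \<beta> \<gamma>))" by simp
  then have "x = (1 / ?K * k^2) *s crem_inv a b c (crs \<beta> \<gamma>)"
    using assms(1-4) by (simp add: vector_smult_assoc)
  then show ?thesis by blast
qed

lemma dot3_crem_inv:
  "dot3 \<beta> n = 0 \<Longrightarrow> dot3 \<beta> (crem a b c (k *s crem_inv a b c n)) = 0"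
  by (simp add: crem_scale crem_crem_inv)

lemma regvec_crem [intro]:
  assumes "regvec F" "regvec G" "regvec H" "regvec K"
  shows "regvec (\<lambda>X. crem (F X) (G X) (H X) (K X))"
  unfolding crem_def using assms by (intro regvec_vector regfun.mult regfun_det3)

lemma regvec_crem_inv [intro]:
  assumes "regvec F" "regvec G" "regvec H" "regvec K"
  shows "regvec (\<lambda>X. crem_inv (F X) (G X) (H X) (K X))"
  unfolding crem_inv_def using assms by (intro regvec_add regvec_scale regfun.mult regvec_nth)

lemma conic_setup:
  assumes X: "X \<in> stratum (insert x A) Y" and x: "x \<notin> A"
    and C: "C \<subseteq> A" "nocoll Y (insert x C)" "onconic Y (insert x C)"
    and F: "{a, b, c, d, e} \<subseteq> C" "distinct [a, b, c, d, e]"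
  shows "det3 (X a) (X b) (X c) \<noteq> 0" "det3 (X x) (X b) (X c) \<noteq> 0" "det3 (X a) (X x) (X c) \<noteq> 0"
    "det3 (X a) (X b) (X x) \<noteq> 0"
    "crs (crem (X a) (X b) (X c) (X d)) (crem (X a) (X b) (X c) (X e)) \<noteq> 0"
    "conic6 X a b c d e x = 0"
proof -
  have nc: "nocoll X (insert x C)" using stratum_nocoll[OF X, of "insert x C"] C by blast
  have x': "x \<notin> {a, b, c, d, e}" using x F C by blast
  show 1: "det3 (X a) (X b) (X c) \<noteq> 0" "det3 (X x) (X b) (X c) \<noteq> 0" "det3 (X a) (X x) (X c) \<noteq> 0"
    "det3 (X a) (X b) (X x) \<noteq> 0"
    using F x' by (intro nocollD[OF nc]; auto)+
  have g: "gen (insert x C) X" by (rule gen_mono[OF stratum_gen[OF X]]) (use C in auto)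
  show "crs (crem (X a) (X b) (X c) (X d)) (crem (X a) (X b) (X c) (X e)) \<noteq> 0"
    by (rule nocoll_crem[OF nc g _ F(2)]) (use F in auto)
  have sub: "{a, b, c, d, e, x} \<subseteq> insert x C" using F by auto
  have "onconic X {a, b, c, d, e, x}"
  proof -
    have "nocoll Y {a, b, c, d, e, x}" "onconic Y {a, b, c, d, e, x}"
      using nocoll_mono[OF C(2) sub] onconic_mono[OF C(3) sub] by blast+
    moreover have "card {a, b, c, d, e, x} = 6" using F(2) x' by auto
    moreover have "{a, b, c, d, e, x} \<subseteq> insert x A" using sub C(1) by blast
    ultimately show ?thesis using stratum_onconic[OF X] by blast
  qed
  then show "conic6 X a b c d e x = 0" using onconic_iff_conic6[OF 1(1)] by blast
qed

lemma conic_closed':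
  assumes X: "X \<in> stratum A Y" and gen: "X \<in> generic (insert x A) Y" and x: "x \<notin> A"
    and C: "C \<subseteq> A" "nocoll Y (insert x C)" "onconic Y (insert x C)"
    and F: "{a, b, c, d, e} \<subseteq> C" "distinct [a, b, c, d, e]" "conic6 X a b c d e x = 0" and S: "S \<subseteq> C"
  shows "onconic X (insert x S)"
proof (rule conic_closed[OF X generic_gen[OF gen] gen x C F(1) _ _ S])
  show "card {a, b, c, d, e} = 5" using F(2) by simp
  have "nocoll X (insert x C)" by (rule generic_nocoll[OF gen]) (use C in auto)
  then have "det3 (X a) (X b) (X c) \<noteq> 0" by (rule nocollD) (use F in auto)
  then have "onconic X {a, b, c, d, e, x}" using onconic_iff_conic6 F(3) by blast
  then show "onconic X (insert x {a, b, c, d, e})" by (rule onconic_mono) auto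
qed

text \<open>The Cremona transformation at a, b, c turns the conic into the line through the images
  of d and e. Transforming back a general point of this line gives the general point of the conic:
  two entries of the parameter run along the line and the third one scales.\<close>

lemma irr_conic:
  assumes x: "x \<notin> A" and irr: "irr (stratum A Y)" and Y: "gen (insert x A) Y"
    and C: "C \<subseteq> A" "nocoll Y (insert x C)" "onconic Y (insert x C)" "5 \<le> card C"
    and pen: "pencil Y A x {}" and con: "conics_at Y A x {C}"
  shows "irr (stratum (insert x A) Y)"
proof -
  obtain a b c d e where F: "{a, b, c, d, e} \<subseteq> C" "distinct [a, b, c, d, e]" using card5E[OF C(4)] .
  have x': "x \<noteq> a" "x \<noteq> b" "x \<noteq> c" "x \<noteq> d" "x \<noteq> e" using x F C by blast+
  define u where "u = (\<lambda>X :: tuple. crem (X a) (X b) (X c))"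
  define G where "G = (\<lambda>X. (X x $ 3) *s crem_inv (X a) (X b) (X c)
     ((X x $ 1) *s u X (X d) + (X x $ 2) *s u X (X e)))"
  show ?thesis
  proof (rule irr_extend[OF x irr Y, of G])
    show "regvec G" unfolding G_def u_def
      by (intro regvec_scale regvec_crem_inv regvec_add regvec_crem regvec_coord regvec_nth)
    show "\<exists>w. G (X(x := w)) = X x" if X: "X \<in> stratum (insert x A) Y" for X
    proof -
      note s = conic_setup[OF X x C(1-3) F]
      obtain r t where rt: "u X (X x) = r *s u X (X d) + t *s u X (X e)"
        using line_coords[OF s(5)] s(6) unfolding conic6_def u_def by blast
      let ?K = "det3 (X x) (X b) (X c) * det3 (X a) (X x) (X c) * det3 (X a) (X b) (X x) * det3 (X a) (X b) (X c)"
      \<comment> \<open>The factor \<open>1 / ?K\<close> undoes the scaling in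
        \<open>crem_inv_crem\<close>.\<close>
      have "G (X(x := vector [r, t, 1 / ?K])) = (1 / ?K) *s crem_inv (X a) (X b) (X c) (u X (X x))"
        using x' by (simp add: G_def u_def rt[unfolded u_def] vector_3)
      also have "\<dots> = X x" unfolding u_def crem_inv_crem using s by (simp add: vector_smult_assoc)
      finally show ?thesis by blast
    qed
    show "coll X {x, y, z}" if "y \<in> A" "z \<in> A" "y \<noteq> z" "coll Y {x, y, z}" for X y z
      using pen that by (auto simp: pencil_def)
    show "onconic X (insert x S)" if gen: "X \<in> generic (insert x A) Y" and X: "X \<in> stratum A Y"
      and eq: "X x = G (X(x := w))" and S: "S \<subseteq> A" "card S = 5" "nocoll Y (insert x S)" "onconic Y (insert x S)" for X w S
    proof -
      have "S \<subseteq> C" using con S by (auto simp: conics_at_def)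
      moreover have "conic6 X a b c d e x = 0"
        unfolding conic6_def using eq x'
        by (simp add: G_def u_def crem_scale crem_crem_inv)
      ultimately show ?thesis using conic_closed'[OF X gen x C(1-3) F] by blast
    qed
  qed
qed

text \<open>A line meets a conic in two points, and solving for x would take a square root if the
  other point a were not known. With a as a base point of the Cremona transformation, lines through
  a become lines through (1, 0, 0), and x comes from the intersection of two lines.\<close>

lemma irr_conic_line:
  assumes x: "x \<notin> A" and irr: "irr (stratum A Y)" and Y: "gen (insert x A) Y"
    and C: "C \<subseteq> A" "nocoll Y (insert x C)" "onconic Y (insert x C)" "5 \<le> card C"
    and af: "a \<in> C" "f \<in> A" "f \<noteq> a" "coll Y {x, a, f}"
    and pen: "pencil Y A x {a}" and con: "conics_at Y A x {C}"
  shows "irr (stratum (insert x A) Y)"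
proof -
  have "finite (C - {a})" "4 \<le> card (C - {a})" using C(4) af(1) by auto
  then obtain B where B: "B \<subseteq> C - {a}" "card B = 4" using obtain_subset_with_card_n by metis
  then have "5 \<le> card (insert a B)" by (subst card_insert_disjoint) auto
  obtain xs where xs: "set xs = B" "distinct xs" using finite_distinct_list[of B] by auto
  then have "length xs = 4" using B distinct_card by metis
  then obtain b c d e where "xs = [b, c, d, e]" by (auto simp: length_Suc_conv numeral_eq_Suc)
  then have F: "{a, b, c, d, e} \<subseteq> C" "distinct [a, b, c, d, e]" using xs B af(1) by auto
  have x': "x \<noteq> a" "x \<noteq> b" "x \<noteq> c" "x \<noteq> d" "x \<noteq> e" "x \<noteq> f" using x F C af by blast+
  define u where "u = (\<lambda>X :: tuple. crem (X a) (X b) (X c))"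
  define \<beta> where "\<beta> = (\<lambda>X :: tuple. crs (u X (X d)) (u X (X e)))"
  \<comment> \<open>The transform of the line af: on a line through a the last two coordinates in
    the basis a, b, c keep their ratio, and \<open>crem\<close> inverts that ratio.\<close>
  define \<gamma> where "\<gamma> = (\<lambda>X :: tuple. vector [0, det3 (X a) (X f) (X c), - det3 (X a) (X b) (X f)] :: complex^3)"
  have \<beta>_upd: "\<beta> (X(x := w)) = \<beta> X" and \<gamma>_upd: "\<gamma> (X(x := w)) = \<gamma> X" for X w
    using x' by (simp_all add: \<beta>_def \<gamma>_def u_def)
  define G where "G = (\<lambda>X. (X x $ 1) *s crem_inv (X a) (X b) (X c) (crs (\<beta> X) (\<gamma> X)))"
  show ?thesis
  proof (rule irr_extend[OF x irr Y, of G])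
    show "regvec G" unfolding G_def u_def \<beta>_def \<gamma>_def
      by (intro regvec_scale regvec_crem_inv regvec_crs regvec_vector regvec_crem regvec_coord regvec_nth
          regfun_minus regfun_det3 regfun.const)
    show "\<exists>w. G (X(x := w)) = X x" if X: "X \<in> stratum (insert x A) Y" for X
    proof -
      note s = conic_setup[OF X x C(1-3) F]
      have g: "crs (X a) (X f) \<noteq> 0"
        using stratum_gen[OF X] af C by (auto simp: gen_def)
      have "coll X {x, a, f}" using stratum_coll[OF X, of x a f] af C x' by auto
      then have "det3 (X a) (X f) (X x) = 0" unfolding coll_iff_det3[symmetric] by (simp add: insert_commute)
      moreover have "det3 (X a) (X x) (X c) * det3 (X a) (X b) (X f) - det3 (X a) (X f) (X c) * det3 (X a) (X b) (X x)
          = det3 (X a) (X b) (X c) * det3 (X a) (X x) (X f)"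
        by (simp add: det3_expand algebra_simps)
      ultimately have e1: "det3 (X a) (X f) (X c) * det3 (X a) (X b) (X x) = det3 (X a) (X x) (X c) * det3 (X a) (X b) (X f)"
        using det3_swap(2)[of "X a" "X x" "X f"] by simp
      then have d2: "dot3 (\<gamma> X) (u X (X x)) = 0"
        by (simp add: \<gamma>_def u_def dot3_def vector_3 algebra_simps)
      have d1: "dot3 (\<beta> X) (u X (X x)) = 0"
        using s(6) by (simp add: conic6_def \<beta>_def u_def det3_alt(1))
      \<comment> \<open>If the two lines agreed, the first coordinate of \<beta> would vanish. Up to
        nonzero determinants that coordinate is the determinant of a, e, d.\<close>
      have "crs (\<beta> X) (\<gamma> X) \<noteq> 0"
      proof
        assume z: "crs (\<beta> X) (\<gamma> X) = 0"
        obtain k where k: "\<gamma> X = k *s \<beta> X"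
          using z s(5) crs_eq_0_iff unfolding \<beta>_def u_def by blast
        have "k \<noteq> 0"
        proof
          assume "k = 0"
          then have "det3 (X a) (X f) (X c) = 0" "det3 (X a) (X b) (X f) = 0" using k
            by (simp_all add: \<gamma>_def vec3_eq_iff vector_3)
          then have "det3 (X a) (X b) (X c) *s X f = det3 (X f) (X b) (X c) *s X a"
            by (subst basis_expand) simp
          then have "crs (X a) (det3 (X a) (X b) (X c) *s X f) = 0" by simp
          then show False using g s(1) by simp
        qed
        then have "\<beta> X $ 1 = 0" using k by (simp add: \<gamma>_def vec3_eq_iff vector_3)
        moreover have "\<beta> X $ 1 = det3 (X d) (X b) (X c) * det3 (X e) (X b) (X c) *
            (det3 (X a) (X b) (X d) * det3 (X a) (X e) (X c) - det3 (X a) (X d) (X c) * det3 (X a) (X b) (X e))"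
          by (simp add: \<beta>_def u_def algebra_simps)
        moreover have "det3 (X a) (X b) (X d) * det3 (X a) (X e) (X c) - det3 (X a) (X d) (X c) * det3 (X a) (X b) (X e)
            = det3 (X a) (X b) (X c) * det3 (X a) (X e) (X d)"
          by (simp add: det3_expand algebra_simps)
        moreover have nc: "nocoll X (insert x C)" using stratum_nocoll[OF X, of "insert x C"] C by blast
        have "det3 (X d) (X b) (X c) \<noteq> 0" "det3 (X e) (X b) (X c) \<noteq> 0" "det3 (X a) (X e) (X d) \<noteq> 0"
          using F by (intro nocollD[OF nc]; auto)+
        ultimately show False using s(1) by simp
      qed
      then obtain k where "X x = k *s crem_inv (X a) (X b) (X c) (crs (\<beta> X) (\<gamma> X))"
        using crem_meet[OF s(1-4)] d1 d2 unfolding u_def by blast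
      then show ?thesis using x'
        by (intro exI[of _ "vector [k, 0, 0]"]) (simp add: G_def \<beta>_upd \<gamma>_upd vector_3)
    qed
    show "coll X {x, y, z}" if gen: "X \<in> generic (insert x A) Y" and X: "X \<in> stratum A Y"
      and eq: "X x = G (X(x := w))" and yz: "y \<in> A" "z \<in> A" "y \<noteq> z" "coll Y {x, y, z}" for X w y z
    proof -
      let ?n = "crs (\<beta> X) (\<gamma> X)"
      have xe: "X x = (w $ 1) *s crem_inv (X a) (X b) (X c) ?n"
        using eq x' by (simp add: G_def \<beta>_upd \<gamma>_upd)
      have "dot3 (\<gamma> X) ?n = 0" by simp
      then have "?n $ 2 * det3 (X a) (X f) (X c) = ?n $ 3 * det3 (X a) (X b) (X f)"
        unfolding dot3_def[of "\<gamma> X"] by (simp add: \<gamma>_def vector_3 algebra_simps)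
      moreover have "det3 (X b) (X a) (X f) = - det3 (X a) (X b) (X f)"
        "det3 (X c) (X a) (X f) = det3 (X a) (X f) (X c)"
        by (simp_all add: det3_expand algebra_simps)
      moreover have "det3 (crem_inv (X a) (X b) (X c) n) (X a) (X f) =
          n $ 1 * (n $ 3 * det3 (X b) (X a) (X f) + n $ 2 * det3 (X c) (X a) (X f))" for n
        by (simp add: crem_inv_def algebra_simps)
      ultimately have "det3 (X x) (X a) (X f) = 0" unfolding xe det3_linear by simp
      then have "coll X {x, a, f}" by (simp add: coll_iff_det3)
      then show ?thesis
        by (intro pencil_closed[OF generic_gen[OF gen] Y X x pen _ yz]) (use af C in auto)
    qed
    show "onconic X (insert x S)" if gen: "X \<in> generic (insert x A) Y" and X: "X \<in> stratum A Y"
      and eq: "X x = G (X(x := w))" and S: "S \<subseteq> A" "card S = 5" "nocoll Y (insert x S)" "onconic Y (insert x S)" for X w S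
    proof -
      have "S \<subseteq> C" using con S by (auto simp: conics_at_def)
      moreover have "X x = (w $ 1) *s crem_inv (X a) (X b) (X c) (crs (\<beta> X) (\<gamma> X))"
        using eq x' by (simp add: G_def \<beta>_upd \<gamma>_upd)
      then have "dot3 (\<beta> X) (u X (X x)) = 0" unfolding u_def by (simp add: dot3_crem_inv)
      then have "conic6 X a b c d e x = 0"
        by (simp add: conic6_def det3_alt(1) \<beta>_def u_def)
      ultimately show ?thesis using conic_closed'[OF X gen x C(1-3) F] by blast
    qed
  qed
qed

text \<open>Two conics meet in four points, three of which are a, b, c; the fourth is x, the
  transform of the intersection of two lines.\<close>

lemma irr_two_conics:
  assumes x: "x \<notin> A" and irr: "irr (stratum A Y)" and Y: "gen (insert x A) Y"
    and C: "C = {a, b, c, d, e}" "C \<subseteq> A" "distinct [a, b, c, d, e]" "nocoll Y (insert x C)" "onconic Y (insert x C)"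
    and D: "D = {a, b, c, f, g}" "D \<subseteq> A" "distinct [a, b, c, f, g]" "nocoll Y (insert x D)" "onconic Y (insert x D)"
    and ne: "\<not> onconic Y (insert x (C \<union> D))"
    and pen: "pencil Y A x {}" and con: "conics_at Y A x {C, D}"
  shows "irr (stratum (insert x A) Y)"
proof -
  have x': "x \<noteq> a" "x \<noteq> b" "x \<noteq> c" "x \<noteq> d" "x \<noteq> e" "x \<noteq> f" "x \<noteq> g"
    using x C(1,2) D(1,2) by auto
  define u where "u = (\<lambda>X :: tuple. crem (X a) (X b) (X c))"
  define \<beta> where "\<beta> = (\<lambda>X :: tuple. crs (u X (X d)) (u X (X e)))"
  define \<gamma> where "\<gamma> = (\<lambda>X :: tuple. crs (u X (X f)) (u X (X g)))"
  have \<beta>_upd: "\<beta> (X(x := w)) = \<beta> X" and \<gamma>_upd: "\<gamma> (X(x := w)) = \<gamma> X" for X w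
    using x' by (simp_all add: \<beta>_def \<gamma>_def u_def)
  define G where "G = (\<lambda>X. (X x $ 1) *s crem_inv (X a) (X b) (X c) (crs (\<beta> X) (\<gamma> X)))"
  have c1: "{a, b, c, d, e} \<subseteq> C" and c2: "{a, b, c, f, g} \<subseteq> D" using C(1) D(1) by auto
  show ?thesis
  proof (rule irr_extend[OF x irr Y, of G])
    show "regvec G" unfolding G_def u_def \<beta>_def \<gamma>_def
      by (intro regvec_scale regvec_crem_inv regvec_crs regvec_crem regvec_coord regvec_nth)
    show "\<exists>w. G (X(x := w)) = X x" if X: "X \<in> stratum (insert x A) Y" for X
    proof -
      note s = conic_setup[OF X x C(2,4,5) c1 C(3)] and t = conic_setup[OF X x D(2,4,5) c2 D(3)]
      have d1: "dot3 (\<beta> X) (u X (X x)) = 0" using s(6) by (simp add: conic6_def \<beta>_def u_def det3_alt(1))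
      have d2: "dot3 (\<gamma> X) (u X (X x)) = 0" using t(6) by (simp add: conic6_def \<gamma>_def u_def det3_alt(1))
      \<comment> \<open>Coinciding lines would put the points of both conics on a single one in X.
        This is carried over to Y one sextuple at a time and contradicts \<open>ne\<close>.\<close>
      have "crs (\<beta> X) (\<gamma> X) \<noteq> 0"
      proof
        assume z: "crs (\<beta> X) (\<gamma> X) = 0"
        obtain k where k: "\<gamma> X = k *s \<beta> X"
          using z s(5) crs_eq_0_iff unfolding \<beta>_def u_def by blast
        have "k \<noteq> 0" using k t(5) unfolding \<gamma>_def u_def by auto
        have "dot3 (\<beta> X) (u X (X i)) = 0" if "i \<in> {d, e, f, g, x}" for i
        proof -
          have "dot3 (\<gamma> X) (u X (X f)) = 0" "dot3 (\<gamma> X) (u X (X g)) = 0" by (simp_all add: \<gamma>_def)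
          then have "dot3 (\<beta> X) (u X (X f)) = 0" "dot3 (\<beta> X) (u X (X g)) = 0"
            using \<open>k \<noteq> 0\<close> unfolding k by simp_all
          moreover have "dot3 (\<beta> X) (u X (X d)) = 0" "dot3 (\<beta> X) (u X (X e)) = 0" by (simp_all add: \<beta>_def)
          ultimately show ?thesis using that d1 by auto
        qed
        moreover have "\<beta> X \<noteq> 0" using s(5) by (simp add: \<beta>_def u_def)
        ultimately have "onconic X ({a, b, c} \<union> {d, e, f, g, x})"
          unfolding onconic_crem[of X a b c, OF s(1)] u_def by blast
        then have on: "onconic X (insert x (C \<union> D))" by (rule onconic_mono) (use C(1) D(1) in auto)
        have nX: "nocoll X (insert x (C \<union> D))"
        proof (rule conic_nocoll[OF on, of C])
          show "nocoll X C" using stratum_nocoll[OF X, of C] nocoll_mono[OF C(4), of C] C(2) by auto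
          show "gen (insert x (C \<union> D)) X"
            by (rule gen_mono[OF stratum_gen[OF X]]) (use C(2) D(2) in auto)
          show "5 \<le> card C" using C(1,3) by simp
        qed auto
        then have nY: "nocoll Y (insert x (C \<union> D))"
          using stratum_nocoll[OF X, of "insert x (C \<union> D)"] C(2) D(2) nX by blast
        have gY: "gen C Y" using gen_mono[OF Y, of C] C(2) by blast
        have nC: "nocoll Y C" using nocoll_mono[OF C(4), of C] by blast
        note nz = nocoll_crem[OF nC gY c1 C(3)]
        have "conic6 Y a b c d e i = 0" if "i \<in> {f, g, x}" for i
        proof (cases "i \<in> C")
          case True
          then have "onconic Y {a, b, c, d, e, i}"
            using onconic_mono[OF C(5), of "{a, b, c, d, e, i}"] C(1) by blast
          then show ?thesis using onconic_iff_conic6[OF nz(1)] by blast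
        next
          case False
          have sub: "insert i C \<subseteq> insert x (C \<union> D)" using that D(1) by auto
          have "card (insert i C) = 6" using False C(1,3) by simp
          then have "onconic Y (insert i C)"
            using stratum_onconic[OF X, of "insert i C"] sub C(2) D(2) nocoll_mono[OF nY sub]
              onconic_mono[OF on sub] by auto
          then have "onconic Y {a, b, c, d, e, i}" by (rule onconic_mono) (use C(1) in auto)
          then show ?thesis using onconic_iff_conic6[OF nz(1)] by blast
        qed
        then have "onconic Y ({a, b, c, d, e} \<union> {f, g, x})" using onconic_five[OF nz] by blast
        then have "onconic Y (insert x (C \<union> D))" by (rule onconic_mono) (use C(1) D(1) in auto)
        then show False using ne by blast
      qed
      then obtain k where "X x = k *s crem_inv (X a) (X b) (X c) (crs (\<beta> X) (\<gamma> X))"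
        using crem_meet[OF s(1-4)] d1 d2 unfolding u_def by blast
      then show ?thesis using x'
        by (intro exI[of _ "vector [k, 0, 0]"]) (simp add: G_def \<beta>_upd \<gamma>_upd vector_3)
    qed
    show "coll X {x, y, z}" if "y \<in> A" "z \<in> A" "y \<noteq> z" "coll Y {x, y, z}" for X y z
      using pen that by (auto simp: pencil_def)
    show "onconic X (insert x S)" if gen: "X \<in> generic (insert x A) Y" and X: "X \<in> stratum A Y"
      and eq: "X x = G (X(x := w))" and S: "S \<subseteq> A" "card S = 5" "nocoll Y (insert x S)" "onconic Y (insert x S)" for X w S
    proof -
      have xe: "X x = (w $ 1) *s crem_inv (X a) (X b) (X c) (crs (\<beta> X) (\<gamma> X))"
        using eq x' by (simp add: G_def \<beta>_upd \<gamma>_upd)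
      then have "dot3 (\<beta> X) (u X (X x)) = 0" "dot3 (\<gamma> X) (u X (X x)) = 0"
        unfolding u_def by (simp_all add: dot3_crem_inv)
      then have 1: "conic6 X a b c d e x = 0" "conic6 X a b c f g x = 0"
        by (simp_all add: conic6_def det3_alt(1) \<beta>_def \<gamma>_def u_def)
      have "S \<subseteq> C \<or> S \<subseteq> D" using con S by (auto simp: conics_at_def)
      then show ?thesis
        using conic_closed'[OF X gen x C(2,4,5) c1 C(3) 1(1)] conic_closed'[OF X gen x D(2,4,5) c2 D(3) 1(2)] by blast
    qed
  qed
qed

section \<open>Configurations with explicit parametrizations\<close>

text \<open>The coefficients are the values of the form on a basis and of its polar form on pairs of
  basis vectors, so they are not all zero. The factor \<kappa> allows each point its own
  scaling.\<close>

lemma onconic_coordsD: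
  assumes "onconic X S" "det3 a b c \<noteq> 0"
  obtains k1 k2 k3 k4 k5 k6 where
    "k1 \<noteq> 0 \<or> k2 \<noteq> 0 \<or> k3 \<noteq> 0 \<or> k4 \<noteq> 0 \<or> k5 \<noteq> 0 \<or> k6 \<noteq> 0"
    "\<And>i \<kappa> r s t. i \<in> S \<Longrightarrow> \<kappa> \<noteq> 0 \<Longrightarrow> X i = \<kappa> *s (r *s a + s *s b + t *s c) \<Longrightarrow>
       k1 * r^2 + k2 * s^2 + k3 * t^2 + k4 * (s * t) + k5 * (r * t) + k6 * (r * s) = 0"
proof -
  obtain p q where pq: "p \<noteq> 0 \<or> q \<noteq> 0" "\<forall>i\<in>S. qform p q (X i) = 0"
    using assms(1) unfolding onconic_def by blast
  show ?thesis
  proof (rule that)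
    show "qform p q a \<noteq> 0 \<or> qform p q b \<noteq> 0 \<or> qform p q c \<noteq> 0 \<or>
      bil p q b c \<noteq> 0 \<or> bil p q a c \<noteq> 0 \<or> bil p q a b \<noteq> 0"
    proof (rule ccontr)
      assume "\<not> ?thesis"
      then have z: "qform p q a = 0" "qform p q b = 0" "qform p q c = 0"
        "bil p q b c = 0" "bil p q a c = 0" "bil p q a b = 0" by simp_all
      have "qform p q x = 0" for x
      proof -
        obtain r s t where "x = r *s a + s *s b + t *s c" using basis_coords[OF assms(2)] .
        then show ?thesis using z by (simp add: qform_expand)
      qed
      then show False using qform_eq_zeroD pq(1) by blast
    qed
    fix i \<kappa> r s t assume i: "i \<in> S" "\<kappa> \<noteq> 0" "X i = \<kappa> *s (r *s a + s *s b + t *s c)"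
    then have "\<kappa>^2 * qform p q (r *s a + s *s b + t *s c) = 0" using pq(2) by (metis qform_scale)
    then have "qform p q (r *s a + s *s b + t *s c) = 0" using i(2) by simp
    then show "qform p q a * r^2 + qform p q b * s^2 + qform p q c * t^2 + bil p q b c * (s * t) +
        bil p q a c * (r * t) + bil p q a b * (r * s) = 0"
      by (simp add: qform_expand mult_ac)
  qed
qed

text \<open>Coordinates in the basis are, up to the determinant, values of linear forms given by
  cross products; the equation is therefore a combination of products of two linear forms.\<close>

lemma onconic_coordsI:
  assumes "det3 a b c \<noteq> 0" "k1 \<noteq> 0 \<or> k2 \<noteq> 0 \<or> k3 \<noteq> 0 \<or> k4 \<noteq> 0 \<or> k5 \<noteq> 0 \<or> k6 \<noteq> 0"
    and pts: "\<And>i. i \<in> S \<Longrightarrow> \<exists>\<kappa> r s t. X i = \<kappa> *s (r *s a + s *s b + t *s c) \<and>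
       k1 * r^2 + k2 * s^2 + k3 * t^2 + k4 * (s * t) + k5 * (r * t) + k6 * (r * s) = 0"
  shows "onconic X S"
proof -
  let ?r = "crs b c" and ?s = "crs c a" and ?t = "crs a b"
  let ?D = "det3 a b c"
  have ex: "\<exists>p q. \<forall>x. qform p q x = k1 * (dot3 ?r x * dot3 ?r x) + k2 * (dot3 ?s x * dot3 ?s x)
     + k3 * (dot3 ?t x * dot3 ?t x) + k4 * (dot3 ?s x * dot3 ?t x) + k5 * (dot3 ?r x * dot3 ?t x)
     + k6 * (dot3 ?r x * dot3 ?s x)"
  proof -
    have add: "\<exists>p q. \<forall>x. qform p q x = k * f x + l * g x"
      if "\<exists>p q. \<forall>x. qform p q x = f x" "\<exists>p q. \<forall>x. qform p q x = g x" for k l and f g :: "complex^3 \<Rightarrow> complex"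
    proof -
      obtain p q p' q' where "\<forall>x. qform p q x = f x" "\<forall>x. qform p' q' x = g x" using \<open>\<exists>p q. \<forall>x. qform p q x = f x\<close> \<open>\<exists>p q. \<forall>x. qform p q x = g x\<close> by blast
      then show ?thesis
        by (intro exI[of _ "k *s p + l *s p'"] exI[of _ "k *s q + l *s q'"]) (simp add: qform_linear)
    qed
    have pr: "\<exists>p q. \<forall>x. qform p q x = dot3 l x * dot3 m x" for l m
      using qform_product_ex[of l m] by (auto simp: eq_commute)
    note a1 = add[OF pr[of ?r ?r] pr[of ?s ?s], of k1 k2]
    note a2 = add[OF a1 pr[of ?t ?t], of 1 k3]
    note a3 = add[OF a2 pr[of ?s ?t], of 1 k4]
    note a4 = add[OF a3 pr[of ?r ?t], of 1 k5]
    note a5 = add[OF a4 pr[of ?r ?s], of 1 k6]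
    show ?thesis using a5 by simp
  qed
  then obtain p q where pq: "\<And>x. qform p q x = k1 * (dot3 ?r x * dot3 ?r x) + k2 * (dot3 ?s x * dot3 ?s x)
     + k3 * (dot3 ?t x * dot3 ?t x) + k4 * (dot3 ?s x * dot3 ?t x) + k5 * (dot3 ?r x * dot3 ?t x)
     + k6 * (dot3 ?r x * dot3 ?s x)" by blast
  have co: "dot3 ?r (\<kappa> *s (r *s a + s *s b + t *s c)) = \<kappa> * r * ?D"
    "dot3 ?s (\<kappa> *s (r *s a + s *s b + t *s c)) = \<kappa> * s * ?D"
    "dot3 ?t (\<kappa> *s (r *s a + s *s b + t *s c)) = \<kappa> * t * ?D" for \<kappa> r s t
    by (simp_all add: det3_alt(1)[of a b c, symmetric] det3_alt(3)[of a b c, symmetric])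
      (simp_all add: det3_expand dot3_def algebra_simps)
  have val: "qform p q (\<kappa> *s (r *s a + s *s b + t *s c)) = (\<kappa> * ?D)^2 *
      (k1 * r^2 + k2 * s^2 + k3 * t^2 + k4 * (s * t) + k5 * (r * t) + k6 * (r * s))" for \<kappa> r s t
    unfolding pq co by (simp add: power2_eq_square algebra_simps)
  have "p \<noteq> 0 \<or> q \<noteq> 0"
  proof (rule ccontr)
    assume "\<not> ?thesis"
    then have z: "k1 * r^2 + k2 * s^2 + k3 * t^2 + k4 * (s * t) + k5 * (r * t) + k6 * (r * s) = 0" for r s t
      using val[of 1 r s t] assms(1) by simp
    have "k1 = 0" "k2 = 0" "k3 = 0" using z[of 1 0 0] z[of 0 1 0] z[of 0 0 1] by simp_all
    then have "k4 = 0" "k5 = 0" "k6 = 0" using z[of 0 1 1] z[of 1 0 1] z[of 1 1 0] by simp_all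
    then show False using assms(2) \<open>k1 = 0\<close> \<open>k2 = 0\<close> \<open>k3 = 0\<close> by blast
  qed
  moreover have "qform p q (X i) = 0" if i: "i \<in> S" for i
  proof -
    obtain \<kappa> r s t where e: "X i = \<kappa> *s (r *s a + s *s b + t *s c)"
      "k1 * r^2 + k2 * s^2 + k3 * t^2 + k4 * (s * t) + k5 * (r * t) + k6 * (r * s) = 0"
      using pts[OF i] by blast
    show ?thesis unfolding e(1) val e(2) by simp
  qed
  ultimately show ?thesis unfolding onconic_def by blast
qed

text \<open>A triple or sextuple counts as special when it is contained in a listed set, so that
  configurations are described by short lists of lines and conics.\<close>

definition config :: "tuple \<Rightarrow> 8 set set \<Rightarrow> 8 set set \<Rightarrow> bool" where
  "config Y \<L> \<J> \<longleftrightarrow> gen UNIV Y \<and>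
     (\<forall>T. card T = 3 \<longrightarrow> (coll Y T \<longleftrightarrow> (\<exists>L\<in>\<L>. T \<subseteq> L))) \<and>
     (\<forall>S. card S = 6 \<longrightarrow> (nocoll Y S \<and> onconic Y S \<longleftrightarrow> (\<exists>C\<in>\<J>. S \<subseteq> C)))"

lemma config_stratum:
  assumes Y: "config Y \<L> \<J>" and X: "X \<in> stratum UNIV Y"
  shows "config X \<L> \<J>"
  unfolding config_def
proof (intro conjI allI impI)
  show "gen UNIV X" by (rule stratum_gen[OF X])
  show "coll X T \<longleftrightarrow> (\<exists>L\<in>\<L>. T \<subseteq> L)" if "card T = 3" for T
  proof -
    have "coll X T \<longleftrightarrow> coll Y T" using X that by (simp add: stratum_def)
    then show ?thesis using Y that by (simp add: config_def)
  qed
  show "nocoll X S \<and> onconic X S \<longleftrightarrow> (\<exists>C\<in>\<J>. S \<subseteq> C)" if S: "card S = 6" for S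
  proof -
    have "nocoll X S \<and> onconic X S \<longleftrightarrow> nocoll Y S \<and> onconic Y S"
      using stratum_nocoll[OF X, of S] stratum_onconic[OF X, of S] S by auto
    then show ?thesis using Y S by (simp add: config_def)
  qed
qed

lemma config_det3:
  "config X \<L> \<J> \<Longrightarrow> i \<noteq> j \<Longrightarrow> i \<noteq> k \<Longrightarrow> j \<noteq> k \<Longrightarrow>
     det3 (X i) (X j) (X k) = 0 \<longleftrightarrow> (\<exists>L\<in>\<L>. i \<in> L \<and> j \<in> L \<and> k \<in> L)"
  using coll_iff_det3[of X i j k] unfolding config_def by simp

lemma config_crs: "config X \<L> \<J> \<Longrightarrow> i \<noteq> j \<Longrightarrow> crs (X i) (X j) \<noteq> 0"
  by (simp add: config_def gen_def)

lemma config_coll_iff: "config X \<L> \<J> \<Longrightarrow> card T = 3 \<Longrightarrow> coll X T \<longleftrightarrow> (\<exists>L\<in>\<L>. T \<subseteq> L)"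
  by (simp add: config_def)

lemma config_onconic_iff:
  "config X \<L> \<J> \<Longrightarrow> card S = 6 \<Longrightarrow> nocoll X S \<and> onconic X S \<longleftrightarrow> (\<exists>C\<in>\<J>. S \<subseteq> C)"
  by (simp add: config_def)

lemma config_conic:
  assumes "config X \<L> \<J>" "C \<in> \<J>" "card C = 6" shows "onconic X C \<and> nocoll X C"
proof -
  have "nocoll X C \<and> onconic X C \<longleftrightarrow> (\<exists>C'\<in>\<J>. C \<subseteq> C')" using assms by (simp add: config_def)
  then show ?thesis using assms(2) by blast
qed

text \<open>All coordinates serve as free parameters here: the source of the map is the irreducible
  space of all tuples.\<close>

lemma irr_parametrized:
  assumes Y: "config Y \<L> \<J>" and \<Phi>: "regmap \<Phi>"
    and sur: "\<And>X. config X \<L> \<J> \<Longrightarrow> \<exists>v. \<Phi> v = X"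
    and line: "\<And>v L. \<Phi> v \<in> generic UNIV Y \<Longrightarrow> L \<in> \<L> \<Longrightarrow> coll (\<Phi> v) L"
    and conic: "\<And>v C. \<Phi> v \<in> generic UNIV Y \<Longrightarrow> C \<in> \<J> \<Longrightarrow> onconic (\<Phi> v) C"
  shows "irr (stratum UNIV Y)"
proof (rule irr_step[where R = UNIV and \<Phi> = \<Phi> and U = "generic UNIV Y"])
  show "irr UNIV" "regmap \<Phi>" "zopen (generic UNIV Y)" "stratum UNIV Y \<subseteq> generic UNIV Y"
    by (rule irr_UNIV \<Phi> zopen_generic stratum_generic)+
  have "gen UNIV Y" using Y by (simp add: config_def)
  then show "stratum UNIV Y \<noteq> {}" using stratum_refl by blast
  show "stratum UNIV Y \<subseteq> range \<Phi>"
  proof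
    fix X assume "X \<in> stratum UNIV Y"
    then obtain v where "\<Phi> v = X" using sur[OF config_stratum[OF Y]] by blast
    then show "X \<in> range \<Phi>" by blast
  qed
  fix v assume gen: "\<Phi> v \<in> generic UNIV Y"
  show "\<Phi> v \<in> stratum UNIV Y"
  proof (rule stratumI[OF gen])
    fix T assume T: "card T = 3" "coll Y T"
    then have "\<exists>L\<in>\<L>. T \<subseteq> L" using config_coll_iff[OF Y] by blast
    then obtain L where "L \<in> \<L>" "T \<subseteq> L" by blast
    then show "coll (\<Phi> v) T" using line[OF gen] coll_mono by blast
  next
    fix S assume S: "card S = 6" "nocoll Y S" "onconic Y S"
    then have "\<exists>C\<in>\<J>. S \<subseteq> C" using config_onconic_iff[OF Y] by blast
    then obtain C where "C \<in> \<J>" "S \<subseteq> C" by blast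
    then show "onconic (\<Phi> v) S" using conic[OF gen] onconic_mono by blast
  qed
qed

lemma generic_det3:
  "config Y \<L> \<J> \<Longrightarrow> X \<in> generic UNIV Y \<Longrightarrow> i \<noteq> j \<Longrightarrow> i \<noteq> k \<Longrightarrow> j \<noteq> k \<Longrightarrow>
    \<not> (\<exists>L\<in>\<L>. i \<in> L \<and> j \<in> L \<and> k \<in> L) \<Longrightarrow> det3 (X i) (X j) (X k) \<noteq> 0"
  using coll_iff_det3[of X i j k] unfolding config_def generic_def by simp

lemma generic_crs: "X \<in> generic UNIV Y \<Longrightarrow> i \<noteq> j \<Longrightarrow> crs (X i) (X j) \<noteq> 0"
  by (simp add: generic_def gen_def)

lemma generic_conic: "config Y \<L> \<J> \<Longrightarrow> X \<in> generic UNIV Y \<Longrightarrow> C \<in> \<J> \<Longrightarrow> card C = 6 \<Longrightarrow> nocoll X C"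
  using config_conic generic_nocoll[of X UNIV Y C] by blast

lemmas reg_intros = regmap_upd regvec_scale regvec_add regvec_diff regvec_crs regvec_coord regvec_const
  regvec_crem regvec_crem_inv
  regfun.add regfun.mult regfun_diff regfun_minus regfun.const regvec_nth

lemma regmap_zero: "regmap (\<lambda>v i. 0)"
  by (simp add: regmap_def)

lemma det3_perm:
  "det3 b c a = det3 a b c" "det3 c a b = det3 a b c"
  "det3 b a c = - det3 a b c" "det3 a c b = - det3 a b c" "det3 c b a = - det3 a b c"
  by (simp_all add: det3_expand algebra_simps)

text \<open>An affine chart with the line pq at infinity: off that line the coefficient of z can be
  normalized to 1.\<close>

lemma affine_form:
  assumes "det3 p q z \<noteq> 0" "det3 p q x \<noteq> 0"
  obtains t r s where "t \<noteq> 0" "x = t *s (r *s p + s *s q + 1 *s z)"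
proof -
  obtain r s t where x: "x = r *s p + s *s q + t *s z" using basis_coords[OF assms(1)] .
  have t: "t \<noteq> 0" using assms(2) unfolding x by auto
  then have "x = t *s ((r / t) *s p + (s / t) *s q + 1 *s z)"
    unfolding x by (simp add: vector_add_ldistrib vector_smult_assoc)
  then show ?thesis using that t by blast
qed

subsection \<open>Two concurrent perfect matchings of a hexagon inscribed in a conic\<close>

text \<open>With x and y at infinity and a as origin, lines through x have constant second
  coordinate and lines through y constant first coordinate. The hexagon thus has alternating
  horizontal and vertical sides and involves four numbers. The conic imposes one relation on them,
  which becomes linear after rescaling the representative of y.\<close>

lemma irr_hexagon:
  assumes Y: "config Y {{x,a,b},{x,c,d},{x,e,f},{y,b,c},{y,d,e},{y,f,a}} {{a,b,c,d,e,f}}"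
    and dist: "distinct [x,y,a,b,c,d,e,f]" and un: "UNIV = {x,y,a,b,c,d,e,f}"
  shows "irr (stratum UNIV Y)"
proof -
  define \<Phi> :: "tuple \<Rightarrow> tuple" where "\<Phi> = (\<lambda>v. (\<lambda>_. 0)(x := v x, y := (v d $ 2) *s v y, a := v a,
     b := (v b $ 3) *s ((v b $ 1) *s v x + 0 *s v y + 1 *s v a),
     c := (v c $ 1) *s ((v b $ 1) *s v x + (- (v b $ 2)) *s v y + 1 *s v a),
     d := (v c $ 2) *s ((v b $ 2) *s v x + (- (v b $ 2)) *s v y + 1 *s v a),
     e := (v c $ 3) *s ((v b $ 2) *s v x + (v b $ 1 - v b $ 2) *s v y + 1 *s v a),
     f := (v d $ 1) *s (0 *s v x + (v b $ 1 - v b $ 2) *s v y + 1 *s v a)))"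
  note ds = dist[simplified]
  have ds': "y \<noteq> x" "a \<noteq> x" "b \<noteq> x" "c \<noteq> x" "d \<noteq> x" "e \<noteq> x" "f \<noteq> x"
    "a \<noteq> y" "b \<noteq> y" "c \<noteq> y" "d \<noteq> y" "e \<noteq> y" "f \<noteq> y"
    "b \<noteq> a" "c \<noteq> a" "d \<noteq> a" "e \<noteq> a" "f \<noteq> a"
    "c \<noteq> b" "d \<noteq> b" "e \<noteq> b" "f \<noteq> b"
    "d \<noteq> c" "e \<noteq> c" "f \<noteq> c" "e \<noteq> d" "f \<noteq> d" "f \<noteq> e" using ds by auto
  have \<Phi>_eq: "\<Phi> v x = v x" "\<Phi> v y = (v d $ 2) *s v y" "\<Phi> v a = v a"
     "\<Phi> v b = (v b $ 3) *s ((v b $ 1) *s v x + 0 *s v y + 1 *s v a)"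
     "\<Phi> v c = (v c $ 1) *s ((v b $ 1) *s v x + (- (v b $ 2)) *s v y + 1 *s v a)"
     "\<Phi> v d = (v c $ 2) *s ((v b $ 2) *s v x + (- (v b $ 2)) *s v y + 1 *s v a)"
     "\<Phi> v e = (v c $ 3) *s ((v b $ 2) *s v x + (v b $ 1 - v b $ 2) *s v y + 1 *s v a)"
     "\<Phi> v f = (v d $ 1) *s (0 *s v x + (v b $ 1 - v b $ 2) *s v y + 1 *s v a)" for v
    using ds ds' by (simp_all add: \<Phi>_def)
  show ?thesis
  proof (rule irr_parametrized[OF Y, of \<Phi>])
    show "regmap \<Phi>" unfolding \<Phi>_def by (intro reg_intros regmap_zero)
  next
    fix X assume X: "config X {{x,a,b},{x,c,d},{x,e,f},{y,b,c},{y,d,e},{y,f,a}} {{a,b,c,d,e,f}}"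
    note cd = config_det3[OF X]
    let ?P = "X x" and ?Q = "X y" and ?Z = "X a"
    define D where "D = det3 ?P ?Q ?Z"
    have D: "D \<noteq> 0" unfolding D_def using ds ds' by (subst cd) auto
    have nf: "\<exists>t r s. t \<noteq> 0 \<and> X i = t *s (r *s ?P + s *s ?Q + 1 *s ?Z)"
      if "i \<noteq> x" "i \<noteq> y" "i \<noteq> a" for i
    proof -
      have "det3 ?P ?Q (X i) \<noteq> 0" using ds ds' that by (subst cd) auto
      then show ?thesis using affine_form D unfolding D_def by metis
    qed
    obtain tb pb qb where b: "tb \<noteq> 0" "X b = tb *s (pb *s ?P + qb *s ?Q + 1 *s ?Z)" using nf[of b] ds' by blast
    obtain tc pc qc where c: "tc \<noteq> 0" "X c = tc *s (pc *s ?P + qc *s ?Q + 1 *s ?Z)" using nf[of c] ds' by blast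
    obtain td pd qd where d: "td \<noteq> 0" "X d = td *s (pd *s ?P + qd *s ?Q + 1 *s ?Z)" using nf[of d] ds' by blast
    obtain te pe qe where e: "te \<noteq> 0" "X e = te *s (pe *s ?P + qe *s ?Q + 1 *s ?Z)" using nf[of e] ds' by blast
    obtain tf pf qf where f: "tf \<noteq> 0" "X f = tf *s (pf *s ?P + qf *s ?Q + 1 *s ?Z)" using nf[of f] ds' by blast
    have a: "X a = 1 *s (0 *s ?P + 0 *s ?Q + 1 *s ?Z)" by simp
    have lx: "det3 ?P (t *s (r *s ?P + s *s ?Q + 1 *s ?Z)) (t' *s (r' *s ?P + s' *s ?Q + 1 *s ?Z)) = t * t' * (s - s') * D"
      and ly: "det3 ?Q (t *s (r *s ?P + s *s ?Q + 1 *s ?Z)) (t' *s (r' *s ?P + s' *s ?Q + 1 *s ?Z)) = t * t' * (r' - r) * D"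
      for t r s t' r' s'
      by (simp_all add: D_def det3_perm[where a = ?P and b = ?Q and c = ?Z] algebra_simps)
    have lX: "det3 ?P (X i) (X j) = t * t' * (s - s') * D" and lY: "det3 ?Q (X i) (X j) = t * t' * (r' - r) * D"
      if "X i = t *s (r *s ?P + s *s ?Q + 1 *s ?Z)" "X j = t' *s (r' *s ?P + s' *s ?Q + 1 *s ?Z)" for i j t r s t' r' s'
      unfolding that by (rule lx, rule ly)
    have "det3 ?P (X a) (X b) = 0" using ds ds' by (subst cd) auto
    then have qb: "qb = 0" using lX[OF a b(2)] b(1) D by simp
    have "det3 ?P (X c) (X d) = 0" using ds ds' by (subst cd) auto
    then have qd: "qd = qc" using lX[OF c(2) d(2)] c(1) d(1) D by simp
    have "det3 ?P (X e) (X f) = 0" using ds ds' by (subst cd) auto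
    then have qf: "qf = qe" using lX[OF e(2) f(2)] e(1) f(1) D by simp
    have "det3 ?Q (X b) (X c) = 0" using ds ds' by (subst cd) auto
    then have pc: "pc = pb" using lY[OF b(2) c(2)] b(1) c(1) D by simp
    have "det3 ?Q (X d) (X e) = 0" using ds ds' by (subst cd) auto
    then have pe: "pe = pd" using lY[OF d(2) e(2)] d(1) e(1) D by simp
    have "det3 ?Q (X f) (X a) = 0" using ds ds' by (subst cd) auto
    then have pf: "pf = 0" using lY[OF f(2) a] f(1) D by simp
    have ne: "(r, s) \<noteq> (r', s')"
      if "i \<noteq> j" "X i = t *s (r *s ?P + s *s ?Q + 1 *s ?Z)" "X j = t' *s (r' *s ?P + s' *s ?Q + 1 *s ?Z)" for i j t r s t' r' s'
    proof
      assume "(r, s) = (r', s')"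
      then have e: "r = r'" "s = s'" by simp_all
      have "crs (X i) (X j) = 0" unfolding that(2,3) e crs_scale crs_zero by simp
      then show False using config_crs[OF X that(1)] by simp
    qed
    have u2: "pb \<noteq> 0" using ne[OF _ a b(2)] ds qb by auto
    have v3: "qe \<noteq> 0" using ne[OF _ a f(2)] ds pf qf by auto
    have v2: "qc \<noteq> 0" using ne[OF _ b(2) c(2)] ds qb pc by auto
    have u3: "pd \<noteq> 0" using ne[OF _ e(2) f(2)] ds pe pf qf by auto
    have u23: "pb \<noteq> pd" using ne[OF _ c(2) d(2)] ds pc qd by auto
    have v23: "qc \<noteq> qe" using ne[OF _ d(2) e(2)] ds pe qd by auto
    have "onconic X {a,b,c,d,e,f}" using config_conic[OF X] ds ds' by auto
    then obtain k1 k2 k3 k4 k5 k6 where k: "k1 \<noteq> 0 \<or> k2 \<noteq> 0 \<or> k3 \<noteq> 0 \<or> k4 \<noteq> 0 \<or> k5 \<noteq> 0 \<or> k6 \<noteq> 0"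
      "\<And>i \<kappa> r s t. i \<in> {a,b,c,d,e,f} \<Longrightarrow> \<kappa> \<noteq> 0 \<Longrightarrow> X i = \<kappa> *s (r *s ?P + s *s ?Q + t *s ?Z) \<Longrightarrow>
       k1 * r^2 + k2 * s^2 + k3 * t^2 + k4 * (s * t) + k5 * (r * t) + k6 * (r * s) = 0"
      using onconic_coordsD[of X "{a,b,c,d,e,f}" ?P ?Q ?Z] D unfolding D_def by blast
    have k3: "k3 = 0" using k(2)[OF _ _ a] by simp
    have "k1 * pb^2 + k5 * pb = 0" using k(2)[OF _ _ b(2)] b(1) k3 qb by simp
    then have "pb * (k1 * pb + k5) = 0" by algebra
    then have k5: "k5 = - k1 * pb" using u2 by (simp add: add_eq_0_iff)
    have "k2 * qe^2 + k4 * qe = 0" using k(2)[OF _ _ f(2)] f(1) k3 pf qf by simp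
    then have "qe * (k2 * qe + k4) = 0" by algebra
    then have k4: "k4 = - k2 * qe" using v3 by (simp add: add_eq_0_iff)
    have "k1 * pb^2 + k2 * qc^2 + k4 * qc + k5 * pb + k6 * (pb * qc) = 0"
      using k(2)[OF _ _ c(2)] c(1) k3 pc by simp
    then have "qc * (k2 * (qc - qe) + k6 * pb) = 0" using k4 k5 by algebra
    then have e1: "k2 * (qc - qe) = - k6 * pb" using v2 by (simp add: add_eq_0_iff)
    have "k1 * pd^2 + k2 * qe^2 + k4 * qe + k5 * pd + k6 * (pd * qe) = 0"
      using k(2)[OF _ _ e(2)] e(1) k3 pe by simp
    then have "pd * (k1 * (pd - pb) + k6 * qe) = 0" using k4 k5 by algebra
    then have e2: "k1 * (pd - pb) = - k6 * qe" using u3 by (simp add: add_eq_0_iff)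
    have "k1 * pd^2 + k2 * qc^2 + k4 * qc + k5 * pd + k6 * (pd * qc) = 0"
      using k(2)[OF _ _ d(2)] d(1) k3 qd by simp
    \<comment> \<open>Eliminating the other coefficients of the conic from the equations at the
      vertices leaves the relation between the coordinates.\<close>
    then have "k6 * (pd * qc - pd * qe - pb * qc) = 0" using k4 k5 e1 e2 by algebra
    moreover have "k6 \<noteq> 0"
    proof
      assume "k6 = 0"
      then have "k2 = 0" "k1 = 0" using e1 e2 u23 v23 by auto
      then show False using k(1) k3 k4 k5 \<open>k6 = 0\<close> by simp
    qed
    ultimately have "pd * qc - pd * qe - pb * qc = 0" by (simp only: mult_eq_0_iff simp_thms)
    then have rel: "pd * qe = (pd - pb) * qc" by algebra
    \<comment> \<open>Replacing y by \<alpha> y turns the second coordinates qc and qe into - pd and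
      pb - pd, so that \<open>rel\<close> is satisfied by polynomials in pb and pd.\<close>
    define \<alpha> where "\<alpha> = - qc / pd"
    have \<alpha>: "\<alpha> \<noteq> 0" "qc = \<alpha> * - pd" using v2 u3 by (simp_all add: \<alpha>_def)
    have qe: "qe = \<alpha> * (pb - pd)" using rel u3 by (simp add: \<alpha>_def field_simps)
    define v :: tuple where "v = (\<lambda>_. 0)(x := X x, y := \<alpha> *s X y, a := X a, b := vector [pb, pd, tb],
       c := vector [tc, td, te], d := vector [tf, 1 / \<alpha>, 0])"
    have v: "v x = ?P" "v y = \<alpha> *s ?Q" "v a = ?Z" "v b = vector [pb, pd, tb]" "v c = vector [tc, td, te]"
      "v d = vector [tf, 1 / \<alpha>, 0]" using ds ds' by (simp_all add: v_def)
    have "\<Phi> v i = X i" for i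
    proof -
      have "i \<in> {x,y,a,b,c,d,e,f}" using un by auto
      then consider "i = x" | "i = y" | "i = a" | "i = b" | "i = c" | "i = d" | "i = e" | "i = f" by blast
      then show ?thesis
      proof cases
        case 1 then show ?thesis by (simp add: \<Phi>_eq v)
      next
        case 2 then show ?thesis using \<alpha>(1) by (simp add: \<Phi>_eq v vector_3 vector_smult_assoc)
      next
        case 3 then show ?thesis by (simp add: \<Phi>_eq v)
      next
        case 4 then show ?thesis by (simp add: \<Phi>_eq v vector_3 b(2) qb)
      next
        case 5 then show ?thesis by (simp add: \<Phi>_eq v vector_3 c(2) pc \<alpha>(2) vector_smult_assoc mult_ac)
      next
        case 6 then show ?thesis by (simp add: \<Phi>_eq v vector_3 d(2) qd \<alpha>(2) vector_smult_assoc mult_ac)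
      next
        case 7 then show ?thesis by (simp add: \<Phi>_eq v vector_3 e(2) pe qe vector_smult_assoc mult_ac)
      next
        case 8 then show ?thesis by (simp add: \<Phi>_eq v vector_3 f(2) pf qf qe vector_smult_assoc mult_ac)
      qed
    qed
    then show "\<exists>v. \<Phi> v = X" by blast
  next
    fix v L assume L: "L \<in> {{x,a,b},{x,c,d},{x,e,f},{y,b,c},{y,d,e},{y,f,a}}"
    have "coll (\<Phi> v) {x,a,b}" "coll (\<Phi> v) {x,c,d}" "coll (\<Phi> v) {x,e,f}" "coll (\<Phi> v) {y,b,c}"
      "coll (\<Phi> v) {y,d,e}" "coll (\<Phi> v) {y,f,a}"
      unfolding coll_iff_det3 \<Phi>_eq
      by (simp_all add: det3_perm[where a = "v x" and b = "v y" and c = "v a"] algebra_simps)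
    then show "coll (\<Phi> v) L" using L by blast
  next
    fix v C assume gen: "\<Phi> v \<in> generic UNIV Y" and C: "C \<in> {{a,b,c,d,e,f}}"
    have "det3 (\<Phi> v x) (\<Phi> v y) (\<Phi> v a) \<noteq> 0" using ds ds' by (intro generic_det3[OF Y gen]) auto
    then have D: "det3 (v x) (v y) (v a) \<noteq> 0" by (simp add: \<Phi>_eq)
    let ?u = "v b $ 1" and ?w = "v b $ 2"
    show "onconic (\<Phi> v) C"
    proof (rule onconic_coordsI[OF D])
      show "(1::complex) \<noteq> 0 \<or> (1::complex) \<noteq> 0 \<or> (0::complex) \<noteq> 0 \<or> - (?u - ?w) \<noteq> 0 \<or> - ?u \<noteq> 0 \<or> (1::complex) \<noteq> 0" by simp
      have a: "\<Phi> v a = 1 *s (0 *s v x + 0 *s v y + 1 *s v a)" by (simp add: \<Phi>_eq)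
      fix i assume "i \<in> C"
      then consider "i = a" | "i = b" | "i = c" | "i = d" | "i = e" | "i = f" using C by blast
      then show "\<exists>\<kappa> r s t. \<Phi> v i = \<kappa> *s (r *s v x + s *s v y + t *s v a) \<and>
        1 * r^2 + 1 * s^2 + 0 * t^2 + - (?u - ?w) * (s * t) + - ?u * (r * t) + 1 * (r * s) = 0"
      proof cases
        case 1 show ?thesis unfolding 1 by (intro exI conjI, rule a) simp
      next
        case 2 show ?thesis unfolding 2 by (intro exI conjI, rule \<Phi>_eq) (simp add: power2_eq_square algebra_simps)
      next
        case 3 show ?thesis unfolding 3 by (intro exI conjI, rule \<Phi>_eq) (simp add: power2_eq_square algebra_simps)
      next
        case 4 show ?thesis unfolding 4 by (intro exI conjI, rule \<Phi>_eq) (simp add: power2_eq_square algebra_simps)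
      next
        case 5 show ?thesis unfolding 5 by (intro exI conjI, rule \<Phi>_eq) (simp add: power2_eq_square algebra_simps)
      next
        case 6 show ?thesis unfolding 6 by (intro exI conjI, rule \<Phi>_eq) (simp add: power2_eq_square algebra_simps)
      qed
    qed
  qed
qed

subsection \<open>Two conics and four lines\<close>

text \<open>In the frame with basis a, b, c and unit point d, each of e, f, g, h moves on a given
  line and has one coordinate. The two conics give two equations in these four coordinates, and away
  from degenerate solutions they are solved rationally by T = (u - 1) / u and V = (\<sigma> - 1) /
  \<sigma>.\<close>

lemma irr_four_lines_two_conics:
  assumes Y: "config Y {{a,c,e},{a,d,f},{b,c,g},{b,d,h}} {{a,b,e,f,g,h},{c,d,e,f,g,h}}"
    and dist: "distinct [a,b,c,d,e,f,g,h]" and un: "UNIV = {a,b,c,d,e,f,g,h}"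
  shows "irr (stratum UNIV Y)"
proof -
  note ds = dist[simplified]
  have ds': "b \<noteq> a" "c \<noteq> a" "d \<noteq> a" "e \<noteq> a" "f \<noteq> a" "g \<noteq> a" "h \<noteq> a"
    "c \<noteq> b" "d \<noteq> b" "e \<noteq> b" "f \<noteq> b" "g \<noteq> b" "h \<noteq> b"
    "d \<noteq> c" "e \<noteq> c" "f \<noteq> c" "g \<noteq> c" "h \<noteq> c"
    "e \<noteq> d" "f \<noteq> d" "g \<noteq> d" "h \<noteq> d" "f \<noteq> e" "g \<noteq> e" "h \<noteq> e" "g \<noteq> f" "h \<noteq> f" "h \<noteq> g" using ds by auto
  define \<Phi> :: "tuple \<Rightarrow> tuple" where "\<Phi> = (\<lambda>v. (\<lambda>_. 0)(
     a := (v d $ 1) *s (1 *s v a + 0 *s v b + 0 *s v c),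
     b := (v d $ 2) *s (0 *s v a + 1 *s v b + 0 *s v c),
     c := (v d $ 3) *s (0 *s v a + 0 *s v b + 1 *s v c),
     d := 1 *s (1 *s v a + 1 *s v b + 1 *s v c),
     e := (v e $ 2) *s (1 *s v a + 0 *s v b + (v g $ 1) *s v c),
     f := (v e $ 3) *s ((v g $ 2 - 1) *s v a + (v g $ 2) *s v b + (v g $ 2) *s v c),
     g := (v f $ 1) *s (0 *s v a + 1 *s v b + (v g $ 2) *s v c),
     h := (v f $ 2) *s ((v g $ 1) *s v a + (v g $ 1 - 1) *s v b + (v g $ 1) *s v c)))"
  have \<Phi>_eq: "\<Phi> v a = (v d $ 1) *s (1 *s v a + 0 *s v b + 0 *s v c)"
     "\<Phi> v b = (v d $ 2) *s (0 *s v a + 1 *s v b + 0 *s v c)"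
     "\<Phi> v c = (v d $ 3) *s (0 *s v a + 0 *s v b + 1 *s v c)"
     "\<Phi> v d = 1 *s (1 *s v a + 1 *s v b + 1 *s v c)"
     "\<Phi> v e = (v e $ 2) *s (1 *s v a + 0 *s v b + (v g $ 1) *s v c)"
     "\<Phi> v f = (v e $ 3) *s ((v g $ 2 - 1) *s v a + (v g $ 2) *s v b + (v g $ 2) *s v c)"
     "\<Phi> v g = (v f $ 1) *s (0 *s v a + 1 *s v b + (v g $ 2) *s v c)"
     "\<Phi> v h = (v f $ 2) *s ((v g $ 1) *s v a + (v g $ 1 - 1) *s v b + (v g $ 1) *s v c)" for v
    using ds ds' by (simp_all add: \<Phi>_def)
  show ?thesis
  proof (rule irr_parametrized[OF Y, of \<Phi>])
    show "regmap \<Phi>" unfolding \<Phi>_def by (intro reg_intros regmap_zero)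
  next
    fix X assume X: "config X {{a,c,e},{a,d,f},{b,c,g},{b,d,h}} {{a,b,e,f,g,h},{c,d,e,f,g,h}}"
    note cd = config_det3[OF X]
    have nc: "det3 (X a) (X b) (X c) \<noteq> 0" "det3 (X d) (X b) (X c) \<noteq> 0" "det3 (X a) (X d) (X c) \<noteq> 0"
      "det3 (X a) (X b) (X d) \<noteq> 0" "det3 (X b) (X c) (X f) \<noteq> 0" "det3 (X a) (X c) (X h) \<noteq> 0"
      "det3 (X b) (X d) (X e) \<noteq> 0" "det3 (X a) (X d) (X g) \<noteq> 0" "det3 (X e) (X f) (X g) \<noteq> 0"
      using ds ds' by (subst cd; auto)+
    have lin: "det3 (X a) (X c) (X e) = 0" "det3 (X a) (X d) (X f) = 0" "det3 (X b) (X c) (X g) = 0"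
      "det3 (X b) (X d) (X h) = 0"
      using ds ds' by (subst cd; auto)+
    obtain r s t where rst: "X d = r *s X a + s *s X b + t *s X c" using basis_coords[OF nc(1)] .
    have rst0: "r \<noteq> 0" "s \<noteq> 0" "t \<noteq> 0" using nc(2-4) unfolding rst by auto
    define A B C where "A = r *s X a" and "B = s *s X b" and "C = t *s X c"
    have a: "X a = (1 / r) *s (1 *s A + 0 *s B + 0 *s C)" and b: "X b = (1 / s) *s (0 *s A + 1 *s B + 0 *s C)"
      and c: "X c = (1 / t) *s (0 *s A + 0 *s B + 1 *s C)" and d: "X d = 1 *s (1 *s A + 1 *s B + 1 *s C)"
      using rst0 by (simp_all add: A_def B_def C_def rst vector_smult_assoc)
    define D where "D = det3 A B C"
    have D: "D \<noteq> 0" "det3 A B C \<noteq> 0" using nc(1) rst0 by (simp_all add: D_def A_def B_def C_def)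
    have dd: "det3 A C B = - D" "det3 B A C = - D" "det3 C B A = - D" "det3 B C A = D" "det3 C A B = D" "det3 A B C = D"
      by (simp_all add: D_def det3_perm[where a = A and b = B and c = C])
    obtain e1 e2 e3 where e: "X e = e1 *s A + e2 *s B + e3 *s C" using basis_coords[OF D(2)] .
    have "e2 = 0" using lin(1) rst0 D(1) unfolding a c e by (simp add: dd)
    have "e1 \<noteq> 0"
    proof
      assume "e1 = 0"
      then have "crs (X c) (X e) = 0" unfolding c e \<open>e2 = 0\<close> by simp
      then show False using config_crs[OF X] ds by blast
    qed
    define \<sigma> where "\<sigma> = e3 / e1"
    have e: "X e = e1 *s (1 *s A + 0 *s B + \<sigma> *s C)"
      unfolding e \<open>e2 = 0\<close> using \<open>e1 \<noteq> 0\<close> by (simp add: \<sigma>_def vector_add_ldistrib vector_smult_assoc)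
    obtain f1 f2 f3 where f: "X f = f1 *s A + f2 *s B + f3 *s C" using basis_coords[OF D(2)] .
    have "f3 = f2" using lin(2) rst0 D(1) unfolding a d f by (simp add: dd)
    have "f2 \<noteq> 0"
    proof
      assume "f2 = 0"
      then have "crs (X a) (X f) = 0" unfolding a f \<open>f3 = f2\<close> by simp
      then show False using config_crs[OF X] ds by blast
    qed
    define T where "T = f1 / f2"
    have f: "X f = f2 *s (T *s A + 1 *s B + 1 *s C)"
      unfolding f \<open>f3 = f2\<close> using \<open>f2 \<noteq> 0\<close> by (simp add: T_def vector_add_ldistrib vector_smult_assoc)
    obtain g1 g2 g3 where g: "X g = g1 *s A + g2 *s B + g3 *s C" using basis_coords[OF D(2)] .
    have "g1 = 0" using lin(3) rst0 D(1) unfolding b c g by (simp add: dd)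
    have "g2 \<noteq> 0"
    proof
      assume "g2 = 0"
      then have "crs (X c) (X g) = 0" unfolding c g \<open>g1 = 0\<close> by simp
      then show False using config_crs[OF X] ds by blast
    qed
    define u where "u = g3 / g2"
    have g: "X g = g2 *s (0 *s A + 1 *s B + u *s C)"
      unfolding g \<open>g1 = 0\<close> using \<open>g2 \<noteq> 0\<close> by (simp add: u_def vector_add_ldistrib vector_smult_assoc)
    obtain h1 h2 h3 where h: "X h = h1 *s A + h2 *s B + h3 *s C" using basis_coords[OF D(2)] .
    have "h3 = h1" using lin(4) rst0 D(1) unfolding b d h by (simp add: dd)
    have "h1 \<noteq> 0"
    proof
      assume "h1 = 0"
      then have "crs (X b) (X h) = 0" unfolding b h \<open>h3 = h1\<close> by simp
      then show False using config_crs[OF X] ds by blast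
    qed
    define V where "V = h2 / h1"
    have h: "X h = h1 *s (1 *s A + V *s B + 1 *s C)"
      unfolding h \<open>h3 = h1\<close> using \<open>h1 \<noteq> 0\<close> by (simp add: V_def vector_add_ldistrib vector_smult_assoc)
    have T0: "T \<noteq> 0" using nc(5) unfolding b c f by (auto simp: dd)
    have V0: "V \<noteq> 0" using nc(6) unfolding a c h by (auto simp: dd)
    have s1: "\<sigma> \<noteq> 1" using nc(7) unfolding b d e by (auto simp: dd)
    have u1: "u \<noteq> 1" using nc(8) unfolding a d g by (auto simp: dd)
    have "det3 (X e) (X f) (X g) = e1 * f2 * g2 * D * (u - 1 + \<sigma> * T)"
      unfolding e f g by (simp add: dd algebra_simps)
    then have sT: "\<sigma> * T - (1 - u) \<noteq> 0" using nc(9) by auto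
    have s0: "\<sigma> \<noteq> 0"
    proof
      assume "\<sigma> = 0"
      then have "crs (X a) (X e) = 0" unfolding a e by simp
      then show False using config_crs[OF X] ds by blast
    qed
    have u0: "u \<noteq> 0"
    proof
      assume "u = 0"
      then have "crs (X b) (X g) = 0" unfolding b g by simp
      then show False using config_crs[OF X] ds by blast
    qed
    have T1: "T \<noteq> 1"
    proof
      assume "T = 1"
      then have "crs (X d) (X f) = 0" unfolding d f \<open>T = 1\<close> crs_scale crs_zero by simp
      then show False using config_crs[OF X] ds by blast
    qed
    have V1: "V \<noteq> 1"
    proof
      assume "V = 1"
      then have "crs (X d) (X h) = 0" unfolding d h \<open>V = 1\<close> crs_scale crs_zero by simp
      then show False using config_crs[OF X] ds by blast
    qed
    have inv0: "1 / r \<noteq> 0" "1 / s \<noteq> 0" "1 / t \<noteq> 0" using rst0 by simp_all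
    have on1: "onconic X {a,b,e,f,g,h}" and on2: "onconic X {c,d,e,f,g,h}"
      using config_conic[OF X, of "{a,b,e,f,g,h}"] config_conic[OF X, of "{c,d,e,f,g,h}"] ds ds' by auto
    have star: "(1 - u) * V - (1 - \<sigma>) * T + (u - \<sigma>) * (T * V) = 0"
    proof -
      obtain k1 k2 k3 k4 k5 k6 where k: "k1 \<noteq> 0 \<or> k2 \<noteq> 0 \<or> k3 \<noteq> 0 \<or> k4 \<noteq> 0 \<or> k5 \<noteq> 0 \<or> k6 \<noteq> 0"
        "\<And>i \<kappa> r s t. i \<in> {a,b,e,f,g,h} \<Longrightarrow> \<kappa> \<noteq> 0 \<Longrightarrow> X i = \<kappa> *s (r *s A + s *s B + t *s C) \<Longrightarrow>
         k1 * r^2 + k2 * s^2 + k3 * t^2 + k4 * (s * t) + k5 * (r * t) + k6 * (r * s) = 0"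
        using onconic_coordsD[OF on1 D(2)] by blast
      have k12: "k1 = 0" "k2 = 0" using k(2)[OF _ inv0(1) a] k(2)[OF _ inv0(2) b] by simp_all
      have "k3 * \<sigma>^2 + k5 * \<sigma> = 0" using k(2)[OF _ \<open>e1 \<noteq> 0\<close> e] k12 by simp
      then have "\<sigma> * (k3 * \<sigma> + k5) = 0" by algebra
      then have k5: "k5 = - k3 * \<sigma>" using s0 by (simp add: add_eq_0_iff)
      have "k3 * u^2 + k4 * u = 0" using k(2)[OF _ \<open>g2 \<noteq> 0\<close> g] k12 by simp
      then have "u * (k3 * u + k4) = 0" by algebra
      then have k4: "k4 = - k3 * u" using u0 by (simp add: add_eq_0_iff)
      have kf: "k3 + k4 + k5 * T + k6 * T = 0" using k(2)[OF _ \<open>f2 \<noteq> 0\<close> f] k12 by simp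
      have kh: "k3 + k4 * V + k5 + k6 * V = 0" using k(2)[OF _ \<open>h1 \<noteq> 0\<close> h] k12 by simp
      have "k3 \<noteq> 0"
      proof
        assume "k3 = 0"
        then show False using k(1) k12 k4 k5 kf T0 by simp
      qed
      moreover have "k3 * ((1 - u) * V - (1 - \<sigma>) * T + (u - \<sigma>) * (T * V)) = 0" using kf kh k4 k5 by algebra
      ultimately show ?thesis by simp
    qed
    have star2: "\<sigma> * u * (T * V) = (1 - u) * (1 - \<sigma>)"
    proof -
      obtain k1 k2 k3 k4 k5 k6 where k: "k1 \<noteq> 0 \<or> k2 \<noteq> 0 \<or> k3 \<noteq> 0 \<or> k4 \<noteq> 0 \<or> k5 \<noteq> 0 \<or> k6 \<noteq> 0"
        "\<And>i \<kappa> r s t. i \<in> {c,d,e,f,g,h} \<Longrightarrow> \<kappa> \<noteq> 0 \<Longrightarrow> X i = \<kappa> *s (r *s A + s *s B + t *s C) \<Longrightarrow>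
         k1 * r^2 + k2 * s^2 + k3 * t^2 + k4 * (s * t) + k5 * (r * t) + k6 * (r * s) = 0"
        using onconic_coordsD[OF on2 D(2)] by blast
      have k3: "k3 = 0" using k(2)[OF _ inv0(3) c] by simp
      have kd: "k1 + k2 + k4 + k5 + k6 = 0" using k(2)[OF _ _ d] k3 by simp
      have ke: "k1 + k5 * \<sigma> = 0" using k(2)[OF _ \<open>e1 \<noteq> 0\<close> e] k3 by simp
      have kg: "k2 + k4 * u = 0" using k(2)[OF _ \<open>g2 \<noteq> 0\<close> g] k3 by simp
      have kf: "k1 * T^2 + k2 + k4 + k5 * T + k6 * T = 0" using k(2)[OF _ \<open>f2 \<noteq> 0\<close> f] k3 by simp
      have kh: "k1 + k2 * V^2 + k4 * V + k5 + k6 * V = 0" using k(2)[OF _ \<open>h1 \<noteq> 0\<close> h] k3 by simp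
      have "(T - 1) * (k5 * \<sigma> * T - k4 * (u - 1)) = 0" using kd ke kg kf by algebra
      then have x1: "k5 * \<sigma> * T = k4 * (u - 1)" using T1 by simp
      have "(V - 1) * (k5 * (\<sigma> - 1) - k4 * u * V) = 0" using kd ke kg kh by algebra
      then have x2: "k5 * (\<sigma> - 1) = k4 * u * V" using V1 by simp
      have "k4 \<noteq> 0"
      proof
        assume "k4 = 0"
        then have "k5 = 0" using x1 s0 T0 by simp
        then show False using k(1) k3 kd ke kg \<open>k4 = 0\<close> by simp
      qed
      moreover have "k5 \<noteq> 0"
      proof
        assume "k5 = 0"
        then show False using x2 u0 V0 \<open>k4 \<noteq> 0\<close> by simp
      qed
      moreover have "k4 * k5 * (\<sigma> * u * (T * V) - (1 - u) * (1 - \<sigma>)) = 0" using x1 x2 by algebra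
      ultimately show ?thesis by simp
    qed
    \<comment> \<open>Eliminating V from both conic conditions leaves a product. Its factor \<sigma>
      T - (1 - u) is, up to nonzero factors, the determinant of e, f, g.\<close>
    have "(1 - \<sigma>) * ((\<sigma> * T - (1 - u)) * (u * T + (1 - u))) = 0" using star star2 by algebra
    moreover have "1 - \<sigma> \<noteq> 0" using s1 by simp
    ultimately have "u * T + (1 - u) = 0" using sT by (simp only: mult_eq_0_iff simp_thms)
    then have uT: "u * T = u - 1" by algebra
    have "(u - 1) * (\<sigma> * V - (\<sigma> - 1)) = 0" using star2 uT by algebra
    then have sV: "\<sigma> * V = \<sigma> - 1" using u1 by simp
    define v :: tuple where "v = (\<lambda>_. 0)(a := A, b := B, c := C, d := vector [1 / r, 1 / s, 1 / t],
       e := vector [0, e1, f2 / u], f := vector [g2, h1 / \<sigma>, 0], g := vector [\<sigma>, u, 0])"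
    have v: "v a = A" "v b = B" "v c = C" "v d = vector [1 / r, 1 / s, 1 / t]"
      "v e = vector [0, e1, f2 / u]" "v f = vector [g2, h1 / \<sigma>, 0]" "v g = vector [\<sigma>, u, 0]"
      using ds ds' by (simp_all add: v_def)
    have f': "X f = (f2 / u) *s ((u - 1) *s A + u *s B + u *s C)"
      unfolding uT[symmetric] f using u0 by (simp add: vector_add_ldistrib vector_smult_assoc)
    have h': "X h = (h1 / \<sigma>) *s (\<sigma> *s A + (\<sigma> - 1) *s B + \<sigma> *s C)"
      unfolding sV[symmetric] h using s0 by (simp add: vector_add_ldistrib vector_smult_assoc)
    have "\<Phi> v i = X i" for i
    proof -
      have "i \<in> {a,b,c,d,e,f,g,h}" using un by auto
      then consider "i = a" | "i = b" | "i = c" | "i = d" | "i = e" | "i = f" | "i = g" | "i = h" by blast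
      then show ?thesis
      proof cases
        case 1 then show ?thesis by (simp only: \<Phi>_eq v vector_3 a)
      next
        case 2 then show ?thesis by (simp only: \<Phi>_eq v vector_3 b)
      next
        case 3 then show ?thesis by (simp only: \<Phi>_eq v vector_3 c)
      next
        case 4 then show ?thesis by (simp only: \<Phi>_eq v vector_3 d)
      next
        case 5 then show ?thesis by (simp only: \<Phi>_eq v vector_3 e)
      next
        case 6 then show ?thesis by (simp only: \<Phi>_eq v vector_3 f')
      next
        case 7 then show ?thesis by (simp only: \<Phi>_eq v vector_3 g)
      next
        case 8 then show ?thesis by (simp only: \<Phi>_eq v vector_3 h')
      qed
    qed
    then show "\<exists>v. \<Phi> v = X" by blast
  next
    fix v L assume L: "L \<in> {{a,c,e},{a,d,f},{b,c,g},{b,d,h}}"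
    have "coll (\<Phi> v) {a,c,e}" "coll (\<Phi> v) {a,d,f}" "coll (\<Phi> v) {b,c,g}" "coll (\<Phi> v) {b,d,h}"
      unfolding coll_iff_det3 \<Phi>_eq
      by (simp_all add: det3_perm[where a = "v a" and b = "v b" and c = "v c"] algebra_simps)
    then show "coll (\<Phi> v) L" using L by blast
  next
    fix v C assume gen: "\<Phi> v \<in> generic UNIV Y" and C: "C \<in> {{a,b,e,f,g,h},{c,d,e,f,g,h}}"
    have "det3 (\<Phi> v a) (\<Phi> v b) (\<Phi> v c) \<noteq> 0" using ds ds' by (intro generic_det3[OF Y gen]) auto
    then have D: "det3 (v a) (v b) (v c) \<noteq> 0" by (simp add: \<Phi>_eq)
    let ?s = "v g $ 1" and ?u = "v g $ 2"
    have "onconic (\<Phi> v) {a,b,e,f,g,h}"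
    proof (rule onconic_coordsI[OF D, of 0 0 1 "- ?u" "- ?s" "?u + ?s"])
      fix i assume "i \<in> {a,b,e,f,g,h}"
      then consider "i = a" | "i = b" | "i = e" | "i = f" | "i = g" | "i = h" by blast
      then show "\<exists>\<kappa> r s t. \<Phi> v i = \<kappa> *s (r *s v a + s *s v b + t *s v c) \<and>
        0 * r^2 + 0 * s^2 + 1 * t^2 + - ?u * (s * t) + - ?s * (r * t) + (?u + ?s) * (r * s) = 0"
        by cases (hypsubst, intro exI conjI, rule \<Phi>_eq, simp add: power2_eq_square algebra_simps)+
    qed simp
    moreover have "onconic (\<Phi> v) {c,d,e,f,g,h}"
    \<comment> \<open>If both parameters vanish, the equation used below is identically zero; but
      then b and h would be the same point.\<close>
    proof (cases "?s = 0 \<and> ?u = 0")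
      case True
      then have "crs (\<Phi> v b) (\<Phi> v h) = 0" "b \<noteq> h" using ds by (simp_all add: \<Phi>_eq vec3_eq_iff)
      then show ?thesis using generic_crs[OF gen] by blast
    next
      case False
      show ?thesis
      proof (rule onconic_coordsI[OF D, of "- ?s * ?u" "- ?s * ?u" 0 ?s ?u "?u * (?s - 1) + ?s * (?u - 1)"])
        show "- ?s * ?u \<noteq> 0 \<or> - ?s * ?u \<noteq> 0 \<or> (0::complex) \<noteq> 0 \<or> ?s \<noteq> 0 \<or> ?u \<noteq> 0 \<or> ?u * (?s - 1) + ?s * (?u - 1) \<noteq> 0"
          using False by blast
        fix i assume "i \<in> {c,d,e,f,g,h}"
        then consider "i = c" | "i = d" | "i = e" | "i = f" | "i = g" | "i = h" by blast
        then show "\<exists>\<kappa> r s t. \<Phi> v i = \<kappa> *s (r *s v a + s *s v b + t *s v c) \<and>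
          - ?s * ?u * r^2 + - ?s * ?u * s^2 + 0 * t^2 + ?s * (s * t) + ?u * (r * t) + (?u * (?s - 1) + ?s * (?u - 1)) * (r * s) = 0"
          by cases (hypsubst, intro exI conjI, rule \<Phi>_eq, simp add: power2_eq_square algebra_simps)+
      qed
    qed
    ultimately show "onconic (\<Phi> v) C" using C by blast
  qed
qed

subsection \<open>Three conics through two common points\<close>

text \<open>If the polar form vanished at two points of the conic, their line would split off and
  the other three points would lie on the residual line.\<close>

lemma bil_nonzero:
  assumes pq: "p \<noteq> 0 \<or> q \<noteq> 0" "\<forall>i\<in>S. qform p q (X i) = 0" and nc: "nocoll X S"
    and sub: "{i, j, k, l, m} \<subseteq> S" "distinct [i, j, k, l, m]"
  shows "bil p q (X i) (X j) \<noteq> 0"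
proof
  assume z: "bil p q (X i) (X j) = 0"
  have d: "det3 (X x) (X y) (X z) \<noteq> 0"
    if "{x, y, z} \<subseteq> {i, j, k, l, m}" "x \<noteq> y" "x \<noteq> z" "y \<noteq> z" for x y z
    using nocollD[OF nc _ that(2-4)] that(1) sub(1) by blast
  have d3: "det3 (X i) (X j) (X k) \<noteq> 0" "det3 (X i) (X j) (X l) \<noteq> 0" "det3 (X i) (X j) (X m) \<noteq> 0"
    "det3 (X k) (X l) (X m) \<noteq> 0" using sub(2) by (intro d; auto)+
  have "crs (X i) (X j) \<noteq> 0" using d3(1) by (auto simp: det3_alt(1))
  then obtain n where n: "\<And>x. qform p q x = dot3 (crs (X i) (X j)) x * dot3 n x"
    using line_in_quadric[of "X i" "X j" p q] pq(2) sub(1) z by auto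
  have "dot3 n (X k) = 0" "dot3 n (X l) = 0" "dot3 n (X m) = 0"
    using n[of "X k"] n[of "X l"] n[of "X m"] pq(2) sub(1) d3(1-3) by (simp_all add: det3_alt(1))
  moreover have "n \<noteq> 0"
  proof
    assume "n = 0"
    then have "qform p q x = 0" for x by (simp add: n)
    then show False using qform_eq_zeroD pq(1) by blast
  qed
  ultimately show False using d3(4) det3_eq_0_iff by blast
qed

text \<open>The combination is chosen so that its polar form vanishes at g and h. It therefore
  contains the line gh, and since it also vanishes at e and f, it is a multiple of the line pair gh,
  ef.\<close>

lemma radical_axis:
  assumes v: "qform p q e = 0" "qform p q f = 0" "qform p q g = 0" "qform p q h = 0"
    and v': "qform p' q' e = 0" "qform p' q' f = 0" "qform p' q' g = 0" "qform p' q' h = 0"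
    and d: "det3 g h e \<noteq> 0" "det3 g h f \<noteq> 0" "crs e f \<noteq> 0"
  obtains c where "\<And>x. bil p' q' g h * qform p q x - bil p q g h * qform p' q' x =
    c * (dot3 (crs g h) x * dot3 (crs e f) x)"
proof -
  let ?\<alpha> = "bil p q g h" and ?\<beta> = "bil p' q' g h"
  let ?p = "?\<beta> *s p + (- ?\<alpha>) *s p'" and ?q = "?\<beta> *s q + (- ?\<alpha>) *s q'"
  have G: "qform ?p ?q x = ?\<beta> * qform p q x - ?\<alpha> * qform p' q' x" for x
    by (simp only: qform_linear) simp
  have b: "bil ?p ?q g h = 0" unfolding bil_def[of ?p] G by (simp add: bil_def v v' algebra_simps)
  have gh: "crs g h \<noteq> 0" using d(1) by (auto simp: det3_alt(1))
  obtain m where m: "\<And>x. qform ?p ?q x = dot3 (crs g h) x * dot3 m x"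
    using line_in_quadric[OF gh, of ?p ?q] b unfolding G v v' by auto
  have "dot3 e m = 0" "dot3 f m = 0"
    using m[of e] m[of f] d unfolding G v v' by (simp_all add: det3_alt(1) dot3_commute)
  then obtain c where "m = c *s crs e f" using two_lines_meet[OF _ _ d(3)] by blast
  then have "?\<beta> * qform p q x - ?\<alpha> * qform p' q' x = c * (dot3 (crs g h) x * dot3 (crs e f) x)" for x
    using m[of x] unfolding G by simp
  then show ?thesis using that by blast
qed

lemma dot3_product_zero:
  assumes "n \<noteq> 0" "\<And>x. dot3 n x * dot3 m x = 0" shows "m = 0"
proof -
  have "vector [n$1 * m$1, n$2 * m$2, n$3 * m$3] = (0 :: complex^3)"
    "vector [n$2 * m$3 + n$3 * m$2, n$1 * m$3 + n$3 * m$1, n$1 * m$2 + n$2 * m$1] = (0 :: complex^3)"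
    using qform_eq_zeroD assms(2) unfolding qform_product by blast+
  then have "n$1 * m$1 = 0" "n$2 * m$2 = 0" "n$3 * m$3 = 0" "n$2 * m$3 + n$3 * m$2 = 0"
    "n$1 * m$3 + n$3 * m$1 = 0" "n$1 * m$2 + n$2 * m$1 = 0"
    by (simp_all add: vec3_eq_iff vector_3)
  then show ?thesis using assms(1) by (auto simp: vec3_eq_iff)
qed

text \<open>After scaling, the two given conics differ by a multiple of the line pair gh, ef.
  Concurrence writes ef as a combination of ab and cd. Moving the cd part to the first conic and the
  ab part to the second gives one form that vanishes at all six points.\<close>

lemma third_conic:
  assumes on: "onconic X {c,d,e,f,g,h}" "onconic X {a,b,e,f,g,h}"
    and nc: "nocoll X {c,d,e,f,g,h}" "nocoll X {a,b,e,f,g,h}"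
    and dist: "distinct [a,b,c,d,e,f,g,h]" and abc: "det3 (X a) (X b) (X c) \<noteq> 0" "crs (X c) (X d) \<noteq> 0"
    and conc: "det3 (crs (X a) (X b)) (crs (X c) (X d)) (crs (X e) (X f)) = 0"
  shows "onconic X {a,b,c,d,g,h}"
proof -
  obtain p q where pq: "p \<noteq> 0 \<or> q \<noteq> 0" "\<forall>i\<in>{c,d,e,f,g,h}. qform p q (X i) = 0"
    using on(1) unfolding onconic_def by blast
  obtain p' q' where pq': "p' \<noteq> 0 \<or> q' \<noteq> 0" "\<forall>i\<in>{a,b,e,f,g,h}. qform p' q' (X i) = 0"
    using on(2) unfolding onconic_def by blast
  let ?\<alpha> = "bil p q (X g) (X h)" and ?\<beta> = "bil p' q' (X g) (X h)"
  have \<alpha>: "?\<alpha> \<noteq> 0" by (rule bil_nonzero[OF pq nc(1), of g h c d e]) (use dist in auto)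
  have \<beta>: "?\<beta> \<noteq> 0" by (rule bil_nonzero[OF pq' nc(2), of g h a b e]) (use dist in auto)
  have d: "det3 (X g) (X h) (X e) \<noteq> 0" "det3 (X g) (X h) (X f) \<noteq> 0" "det3 (X e) (X f) (X g) \<noteq> 0"
    using dist by (intro nocollD[OF nc(1)]; auto)+
  then have ef: "crs (X e) (X f) \<noteq> 0" by (auto simp: det3_alt(1))
  let ?l = "dot3 (crs (X g) (X h))"
  obtain k where k: "\<And>x. ?\<beta> * qform p q x - ?\<alpha> * qform p' q' x = k * (?l x * dot3 (crs (X e) (X f)) x)"
    using radical_axis[of p q "X e" "X f" "X g" "X h" p' q'] pq(2) pq'(2) d ef by auto
  have "crs (crs (X a) (X b)) (crs (X c) (X d)) \<noteq> 0"
  proof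
    assume "crs (crs (X a) (X b)) (crs (X c) (X d)) = 0"
    then have "det3 (X a) (X b) (X d) *s X c = det3 (X a) (X b) (X c) *s X d" unfolding crs_crs by simp
    then have "crs (X c) (det3 (X a) (X b) (X c) *s X d) = crs (X c) (det3 (X a) (X b) (X d) *s X c)" by simp
    then show False using abc by simp
  qed
  then obtain r s where rs: "crs (X e) (X f) = r *s crs (X a) (X b) + s *s crs (X c) (X d)"
    using line_coords[OF _ conc] by blast
  obtain m1 m2 where m: "\<And>x. dot3 (crs (X c) (X d)) x * ?l x = qform m1 m2 x"
    using qform_product_ex[of "crs (X c) (X d)" "crs (X g) (X h)"] by blast
  let ?P = "?\<beta> *s p + (- (k * s)) *s m1" and ?Q = "?\<beta> *s q + (- (k * s)) *s m2"
  have H: "qform ?P ?Q x = ?\<beta> * qform p q x - k * s * (dot3 (crs (X c) (X d)) x * ?l x)" for x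
    by (simp only: qform_linear m) simp
  have H': "qform ?P ?Q x = ?\<alpha> * qform p' q' x + k * r * (dot3 (crs (X a) (X b)) x * ?l x)" for x
    using k[of x] unfolding H rs by (simp add: algebra_simps)
  have "qform ?P ?Q (X i) = 0" if i: "i \<in> {a,b,c,d,g,h}" for i
  proof (cases "i = a \<or> i = b")
    case True
    then show ?thesis unfolding H' using pq'(2) by auto
  next
    case False
    then have "i \<in> {c, d, g, h}" using i by blast
    then show ?thesis unfolding H using pq(2) by auto
  qed
  moreover have "?P \<noteq> 0 \<or> ?Q \<noteq> 0"
  proof (rule ccontr)
    assume "\<not> ?thesis"
    then have "qform ?P ?Q (X g + X h) = 0" by simp
    moreover have "qform p q (X g + X h) = ?\<alpha>" using pq(2) by (simp add: bil_def)
    ultimately show False using \<alpha> \<beta> unfolding H by simp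
  qed
  ultimately show ?thesis unfolding onconic_def by blast
qed

text \<open>Converse of \<open>third_conic\<close>. In a weighted sum of the radical axis relations
  of the three pairs of conics, the conics cancel, and gh times a combination of ab, cd, ef remains;
  so this combination is zero. Its coefficient at ef is nonzero, since otherwise two of the conics
  would coincide and contain all eight points.\<close>

lemma three_conics_concurrent:
  assumes on: "onconic X {c,d,e,f,g,h}" "onconic X {a,b,e,f,g,h}" "onconic X {a,b,c,d,g,h}"
    and nc: "nocoll X {c,d,e,f,g,h}" "nocoll X {a,b,e,f,g,h}" "nocoll X {a,b,c,d,g,h}"
    and dist: "distinct [a,b,c,d,e,f,g,h]" and all: "\<not> onconic X {a,b,c,d,e,f,g,h}"
  shows "det3 (crs (X a) (X b)) (crs (X c) (X d)) (crs (X e) (X f)) = 0"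
proof -
  obtain p q where pq: "p \<noteq> 0 \<or> q \<noteq> 0" "\<forall>i\<in>{c,d,e,f,g,h}. qform p q (X i) = 0"
    using on(1) unfolding onconic_def by blast
  obtain p' q' where pq': "p' \<noteq> 0 \<or> q' \<noteq> 0" "\<forall>i\<in>{a,b,e,f,g,h}. qform p' q' (X i) = 0"
    using on(2) unfolding onconic_def by blast
  obtain p'' q'' where pq'': "p'' \<noteq> 0 \<or> q'' \<noteq> 0" "\<forall>i\<in>{a,b,c,d,g,h}. qform p'' q'' (X i) = 0"
    using on(3) unfolding onconic_def by blast
  let ?\<alpha> = "bil p q (X g) (X h)" and ?\<beta> = "bil p' q' (X g) (X h)" and ?\<gamma> = "bil p'' q'' (X g) (X h)"
  have \<alpha>: "?\<alpha> \<noteq> 0" by (rule bil_nonzero[OF pq nc(1), of g h c d e]) (use dist in auto)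
  have \<beta>: "?\<beta> \<noteq> 0" by (rule bil_nonzero[OF pq' nc(2), of g h a b e]) (use dist in auto)
  have \<gamma>: "?\<gamma> \<noteq> 0" by (rule bil_nonzero[OF pq'' nc(3), of g h a b c]) (use dist in auto)
  have d1: "det3 (X g) (X h) (X e) \<noteq> 0" "det3 (X g) (X h) (X f) \<noteq> 0" "det3 (X e) (X f) (X g) \<noteq> 0"
    "det3 (X g) (X h) (X c) \<noteq> 0" "det3 (X g) (X h) (X d) \<noteq> 0" "det3 (X c) (X d) (X g) \<noteq> 0"
    using dist by (intro nocollD[OF nc(1)]; auto)+
  have d2: "det3 (X g) (X h) (X a) \<noteq> 0" "det3 (X g) (X h) (X b) \<noteq> 0" "det3 (X a) (X b) (X g) \<noteq> 0"
    using dist by (intro nocollD[OF nc(2)]; auto)+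
  have cr: "crs (X e) (X f) \<noteq> 0" "crs (X c) (X d) \<noteq> 0" "crs (X a) (X b) \<noteq> 0" "crs (X g) (X h) \<noteq> 0"
    using d1(1,3,6) d2(3) by (auto simp: det3_alt(1))
  let ?l = "dot3 (crs (X g) (X h))"
  obtain k1 where k1: "\<And>x. ?\<beta> * qform p q x - ?\<alpha> * qform p' q' x = k1 * (?l x * dot3 (crs (X e) (X f)) x)"
    using radical_axis[of p q "X e" "X f" "X g" "X h" p' q'] pq(2) pq'(2) d1 cr by auto
  obtain k2 where k2: "\<And>x. ?\<gamma> * qform p' q' x - ?\<beta> * qform p'' q'' x = k2 * (?l x * dot3 (crs (X a) (X b)) x)"
    using radical_axis[of p' q' "X a" "X b" "X g" "X h" p'' q''] pq'(2) pq''(2) d2 cr by auto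
  obtain k3 where k3: "\<And>x. ?\<alpha> * qform p'' q'' x - ?\<gamma> * qform p q x = k3 * (?l x * dot3 (crs (X c) (X d)) x)"
    using radical_axis[of p'' q'' "X c" "X d" "X g" "X h" p q] pq(2) pq''(2) d1 cr by auto
  let ?N = "(?\<gamma> * k1) *s crs (X e) (X f) + (?\<alpha> * k2) *s crs (X a) (X b) + (?\<beta> * k3) *s crs (X c) (X d)"
  have "?l x * dot3 ?N x = 0" for x
  proof -
    have "?l x * dot3 ?N x = ?\<gamma> * (k1 * (?l x * dot3 (crs (X e) (X f)) x)) +
        ?\<alpha> * (k2 * (?l x * dot3 (crs (X a) (X b)) x)) + ?\<beta> * (k3 * (?l x * dot3 (crs (X c) (X d)) x))"
      by (simp add: algebra_simps)
    also have "\<dots> = 0" unfolding k1[symmetric] k2[symmetric] k3[symmetric] by (simp add: algebra_simps)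
    finally show ?thesis .
  qed
  then have N: "?N = 0" using dot3_product_zero[OF cr(4)] by blast
  have "k1 \<noteq> 0"
  proof
    assume "k1 = 0"
    then have "?\<beta> * qform p q x = ?\<alpha> * qform p' q' x" for x using k1[of x] by simp
    then have "?\<beta> * qform p q (X a) = 0" "?\<beta> * qform p q (X b) = 0" using pq'(2) by simp_all
    then have "\<forall>i\<in>{a,b,c,d,e,f,g,h}. qform p q (X i) = 0" using pq(2) \<beta> by simp
    then show False using all pq(1) unfolding onconic_def by blast
  qed
  have "det3 (crs (X a) (X b)) (crs (X c) (X d)) ?N = ?\<gamma> * k1 * det3 (crs (X a) (X b)) (crs (X c) (X d)) (crs (X e) (X f))"
    by simp
  then show ?thesis unfolding N using \<gamma> \<open>k1 \<noteq> 0\<close> by simp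
qed

text \<open>A quadric through all points contains no collinear triple because of \<open>C\<close>,
  so that \<open>S\<close> would be a further sextuple on a conic.\<close>

lemma config_not_all:
  assumes X: "config X \<L> \<J>" and C: "C \<in> \<J>" "card C = 6" and S: "card S = 6" "\<And>C. C \<in> \<J> \<Longrightarrow> \<not> S \<subseteq> C"
  shows "\<not> onconic X UNIV"
proof
  assume on: "onconic X UNIV"
  have "nocoll X UNIV"
    by (rule conic_nocoll[OF on, of C]) (use config_conic[OF X C] C(2) X in \<open>auto simp: config_def\<close>)
  then have "nocoll X S" by (rule nocoll_mono) simp
  moreover have "onconic X S" using on by (rule onconic_mono) simp
  ultimately show False using config_onconic_iff[OF X S(1)] S(2) by blast
qed

text \<open>The fourth intersection of the conics through c, d, e, f, h and through a, b, e, f, h: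
  the Cremona transformation at the common points e, f, h makes it an intersection of two
  lines.\<close>

definition eighth_point :: "tuple \<Rightarrow> 8 \<Rightarrow> 8 \<Rightarrow> 8 \<Rightarrow> 8 \<Rightarrow> 8 \<Rightarrow> 8 \<Rightarrow> 8 \<Rightarrow> complex^3" where
  "eighth_point X a b c d e f h = crem_inv (X e) (X f) (X h) (crs
     (crs (crem (X e) (X f) (X h) (X c)) (crem (X e) (X f) (X h) (X d)))
     (crs (crem (X e) (X f) (X h) (X a)) (crem (X e) (X f) (X h) (X b))))"

lemma eighth_point_eq:
  assumes on: "onconic X {c,d,e,f,g,h}" "onconic X {a,b,e,f,g,h}"
    and nc: "nocoll X {c,d,e,f,g,h}" "nocoll X {a,b,e,f,g,h}" and gen: "gen UNIV X"
    and dist: "distinct [a,b,c,d,e,f,g,h]" and all: "\<not> onconic X {a,b,c,d,e,f,g,h}"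
  shows "\<exists>k. X g = k *s eighth_point X a b c d e f h"
proof -
  let ?u = "\<lambda>i. crem (X e) (X f) (X h) (X i)"
  have s1: "det3 (X e) (X f) (X h) \<noteq> 0" "crs (?u c) (?u d) \<noteq> 0"
    by (rule nocoll_crem[OF nc(1) gen_mono[OF gen], of e f h c d]; use dist in auto)+
  have s2: "crs (?u a) (?u b) \<noteq> 0"
    by (rule nocoll_crem(2)[OF nc(2) gen_mono[OF gen], of e f h a b]; use dist in auto)
  have g: "det3 (X g) (X f) (X h) \<noteq> 0" "det3 (X e) (X g) (X h) \<noteq> 0" "det3 (X e) (X f) (X g) \<noteq> 0"
    using dist by (intro nocollD[OF nc(1)]; auto)+
  have "onconic X {e,f,h,c,d,g}" "onconic X {e,f,h,a,b,g}"
    by (rule onconic_mono[OF on(1)], blast, rule onconic_mono[OF on(2)], blast)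
  then have d: "dot3 (crs (?u c) (?u d)) (?u g) = 0" "dot3 (crs (?u a) (?u b)) (?u g) = 0"
    using onconic_iff_conic6[OF s1(1)] by (simp_all add: conic6_def det3_alt(1))
  have "crs (crs (?u c) (?u d)) (crs (?u a) (?u b)) \<noteq> 0"
  proof
    assume "crs (crs (?u c) (?u d)) (crs (?u a) (?u b)) = 0"
    then obtain k where k: "crs (?u a) (?u b) = k *s crs (?u c) (?u d)" using crs_eq_0_iff[OF s1(2)] by blast
    have k0: "k \<noteq> 0" using s2 unfolding k by auto
    have "dot3 (crs (?u a) (?u b)) (?u a) = 0" "dot3 (crs (?u a) (?u b)) (?u b) = 0" by simp_all
    then have "dot3 (crs (?u c) (?u d)) (?u a) = 0" "dot3 (crs (?u c) (?u d)) (?u b) = 0"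
      unfolding k using k0 by simp_all
    moreover have "dot3 (crs (?u c) (?u d)) (?u c) = 0" "dot3 (crs (?u c) (?u d)) (?u d) = 0" by simp_all
    ultimately have "\<forall>i\<in>{a,b,c,d,g}. dot3 (crs (?u c) (?u d)) (?u i) = 0" using d(1) by blast
    then have "onconic X ({e, f, h} \<union> {a,b,c,d,g})" using onconic_crem[OF s1(1)] s1(2) by blast
    then have "onconic X {a,b,c,d,e,f,g,h}" by (rule onconic_mono) blast
    then show False using all by blast
  qed
  then show ?thesis unfolding eighth_point_def using crem_meet[OF s1(1) g d] by blast
qed

lemma eighth_point_conics:
  assumes "X g = k *s eighth_point X a b c d e f h" "det3 (X e) (X f) (X h) \<noteq> 0"
  shows "onconic X {c,d,e,f,g,h}" "onconic X {a,b,e,f,g,h}"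
proof -
  let ?u = "\<lambda>i. crem (X e) (X f) (X h) (X i)"
  have "dot3 (crs (?u c) (?u d)) (?u g) = 0" "dot3 (crs (?u a) (?u b)) (?u g) = 0"
    unfolding assms(1) eighth_point_def by (rule dot3_crem_inv; simp)+
  then have on: "onconic X {e,f,h,c,d,g}" "onconic X {e,f,h,a,b,g}"
    unfolding onconic_iff_conic6[OF assms(2)] by (simp_all add: conic6_def det3_alt(1))
  show "onconic X {c,d,e,f,g,h}" by (rule onconic_mono[OF on(1)]) blast
  show "onconic X {a,b,e,f,g,h}" by (rule onconic_mono[OF on(2)]) blast
qed

lemma regvec_compose:
  assumes "regvec F" "regmap \<Psi>" shows "regvec (\<lambda>v. F (\<Psi> v))"
  unfolding regvec_def
proof
  fix j show "(\<lambda>v. F (\<Psi> v) $ j) \<in> regfun"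
    using regfun_compose[OF regvec_nth[OF assms(1)] assms(2)] .
qed

lemma regvec_eighth_point: "regvec (\<lambda>X. eighth_point X a b c d e f h)"
  unfolding eighth_point_def by (intro reg_intros)

text \<open>The vector z represents the common point of the three lines; b and d are then in normal
  form along the lines za and zc.\<close>

lemma concurrent_coords:
  assumes nc: "det3 a b c \<noteq> 0" "det3 a b d \<noteq> 0" "det3 a c d \<noteq> 0" "det3 b c d \<noteq> 0"
    and conc: "det3 (crs a b) (crs c d) (crs e f) = 0"
  obtains z s \<alpha> t \<beta> where "det3 z a c \<noteq> 0" "s \<noteq> 0" "\<alpha> \<noteq> 0" "b = s *s (z + \<alpha> *s a)"
    "t \<noteq> 0" "\<beta> \<noteq> 0" "d = t *s (z + \<beta> *s c)" "det3 z e f = 0"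
proof -
  define z where "z = crs (crs a b) (crs c d)"
  have z: "z = det3 a b d *s c - det3 a b c *s d" unfolding z_def crs_crs ..
  have z': "z = det3 a c d *s b - det3 b c d *s a"
    unfolding z by (simp add: vec3_eq_iff det3_expand algebra_simps)
  have Oac: "det3 z a c = det3 a c d * - det3 a b c" unfolding z' by (simp add: det3_perm[where a = a and b = b and c = c])
  have e: "dot3 (crs e f) z = 0" using conc unfolding z_def by (simp add: det3_alt(1) dot3_commute)
  have b: "b = (1 / det3 a c d) *s (z + det3 b c d *s a)" unfolding z'
    using nc(3) by (simp add: vector_smult_assoc)
  have d: "d = (- 1 / det3 a b c) *s (z + (- det3 a b d) *s c)" unfolding z
    using nc(1) by (simp add: vector_smult_assoc vec3_eq_iff)
  show ?thesis
  proof (rule that[OF _ _ _ b _ _ d])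
    show "det3 z e f = 0" using e by (simp add: det3_def dot3_commute)
  qed (use nc Oac in auto)
qed

subsection \<open>Two disjoint lines and three conics\<close>

text \<open>The inequalities in the orientation that \<open>distinct\<close> does not produce, for
  use as rewrite rules.\<close>

lemma distinct_sym: "distinct [a,b,c,d,e,f,g,h] \<Longrightarrow> b \<noteq> a \<and> c \<noteq> a \<and> d \<noteq> a \<and> e \<noteq> a \<and> f \<noteq> a \<and> g \<noteq> a \<and> h \<noteq> a \<and>
    c \<noteq> b \<and> d \<noteq> b \<and> e \<noteq> b \<and> f \<noteq> b \<and> g \<noteq> b \<and> h \<noteq> b \<and>
    d \<noteq> c \<and> e \<noteq> c \<and> f \<noteq> c \<and> g \<noteq> c \<and> h \<noteq> c \<and>
    e \<noteq> d \<and> f \<noteq> d \<and> g \<noteq> d \<and> h \<noteq> d \<and> f \<noteq> e \<and> g \<noteq> e \<and> h \<noteq> e \<and> g \<noteq> f \<and> h \<noteq> f \<and> h \<noteq> g"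
  by auto

text \<open>The parametrizations below only differ in the first six points \<open>\<Psi>\<close>; the seventh is
  recovered as the eighth common point of two conics.\<close>
lemma irr_three_conics:
  assumes Y: "config Y \<L> \<J>" and \<J>: "\<J> = {{c,d,e,f,g,h},{a,b,e,f,g,h},{a,b,c,d,g,h}} \<union> \<J>'"
    and dist: "distinct [a,b,c,d,e,f,g,h]" and un: "UNIV = {a,b,c,d,e,f,g,h}"
    and S: "card S = 6" "\<And>C. C \<in> \<J> \<Longrightarrow> \<not> S \<subseteq> C"
    and \<L>: "\<And>L. L \<in> \<L> \<Longrightarrow> g \<notin> L \<and> h \<notin> L"
      "\<And>T L. T \<in> {{a,b,c},{a,b,d},{a,c,d},{b,c,d},{a,b,e},{a,b,f},{c,d,e},{c,d,f}} \<Longrightarrow> L \<in> \<L> \<Longrightarrow> \<not> T \<subseteq> L"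
    and \<J>': "\<And>C. C \<in> \<J>' \<Longrightarrow> g \<notin> C \<and> h \<notin> C"
    and reg: "\<And>i. regvec (\<lambda>v. \<Psi> v i)" and \<Psi>h: "\<And>v. \<Psi> v h = v h"
    and \<Psi>: "\<And>v w. (\<And>i. i \<noteq> h \<Longrightarrow> v i = w i) \<Longrightarrow> \<Psi> v g = \<Psi> w g \<and> (\<forall>i. i \<noteq> g \<longrightarrow> i \<noteq> h \<longrightarrow> \<Psi> v i = \<Psi> w i)"
    and scale: "\<And>v k. \<exists>w. \<Psi> w g $ 1 = k \<and> (\<forall>i. i \<noteq> g \<longrightarrow> \<Psi> w i = \<Psi> v i)"
    and sur: "\<And>X z s \<alpha> t \<beta>. config X \<L> \<J> \<Longrightarrow> det3 z (X a) (X c) \<noteq> 0 \<Longrightarrow> s \<noteq> 0 \<Longrightarrow> \<alpha> \<noteq> 0 \<Longrightarrow>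
      X b = s *s (z + \<alpha> *s X a) \<Longrightarrow> t \<noteq> 0 \<Longrightarrow> \<beta> \<noteq> 0 \<Longrightarrow> X d = t *s (z + \<beta> *s X c) \<Longrightarrow> det3 z (X e) (X f) = 0 \<Longrightarrow>
      \<exists>v. \<forall>i\<in>{a,b,c,d,e,f}. \<Psi> v i = X i"
    and line: "\<And>v L. L \<in> \<L> \<Longrightarrow> coll (\<Psi> v) L"
    and conc: "\<And>v. det3 (crs (\<Psi> v a) (\<Psi> v b)) (crs (\<Psi> v c) (\<Psi> v d)) (crs (\<Psi> v e) (\<Psi> v f)) = 0"
    and conic: "\<And>v C. C \<in> \<J>' \<Longrightarrow> det3 (\<Psi> v a) (\<Psi> v b) (\<Psi> v c) \<noteq> 0 \<Longrightarrow> det3 (\<Psi> v c) (\<Psi> v d) (\<Psi> v e) \<noteq> 0 \<Longrightarrow>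
      det3 (\<Psi> v a) (\<Psi> v b) (\<Psi> v e) \<noteq> 0 \<Longrightarrow> onconic (\<Psi> v) C"
  shows "irr (stratum UNIV Y)"
proof -
  note ds = dist[simplified] distinct_sym[OF dist]
  \<comment> \<open>Of the vector that \<Psi> assigns to g only the first entry matters, as the
    scale of the computed point.\<close>
  define \<Phi> :: "tuple \<Rightarrow> tuple" where
    "\<Phi> = (\<lambda>v. (\<Psi> v)(g := (\<Psi> v g $ 1) *s eighth_point (\<Psi> v) a b c d e f h))"
  have \<Phi>_other: "\<Phi> v i = \<Psi> v i" if "i \<noteq> g" for v i using that by (simp add: \<Phi>_def)
  have \<Phi>_g: "\<Phi> v g = (\<Psi> v g $ 1) *s eighth_point (\<Phi> v) a b c d e f h" for v
    using ds by (simp add: \<Phi>_def eighth_point_def)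
  have six: "card {c,d,e,f,g,h} = 6" "card {a,b,e,f,g,h} = 6" "card {a,b,c,d,g,h} = 6" using ds by simp_all
  have mem: "{c,d,e,f,g,h} \<in> \<J>" "{a,b,e,f,g,h} \<in> \<J>" "{a,b,c,d,g,h} \<in> \<J>" using \<J> by auto
  show ?thesis
  proof (rule irr_parametrized[OF Y, of \<Phi>])
    have "regmap \<Psi>" using reg by (simp add: regmap_def)
    then show "regmap \<Phi>" unfolding \<Phi>_def
      by (intro regmap_upd regvec_scale regvec_compose[OF regvec_eighth_point] regvec_nth reg)
  next
    fix X assume X: "config X \<L> \<J>"
    have all: "\<not> onconic X {a,b,c,d,e,f,g,h}"
      using config_not_all[OF X mem(1) six(1) S] unfolding un by blast
    note con = config_conic[OF X mem(1) six(1)] config_conic[OF X mem(2) six(2)] config_conic[OF X mem(3) six(3)]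
    have nl: "det3 (X i) (X j) (X k) \<noteq> 0" if "i \<noteq> j" "i \<noteq> k" "j \<noteq> k"
      "{i, j, k} \<in> {{a,b,c},{a,b,d},{a,c,d},{b,c,d},{a,b,e},{a,b,f},{c,d,e},{c,d,f}}" for i j k
      using config_det3[OF X that(1-3)] \<L>(2)[OF that(4)] by blast
    have d4: "det3 (X a) (X b) (X c) \<noteq> 0" "det3 (X a) (X b) (X d) \<noteq> 0" "det3 (X a) (X c) (X d) \<noteq> 0" "det3 (X b) (X c) (X d) \<noteq> 0"
      using ds by (intro nl; simp)+
    have cc: "det3 (crs (X a) (X b)) (crs (X c) (X d)) (crs (X e) (X f)) = 0"
      by (rule three_conics_concurrent[OF _ _ _ _ _ _ dist all]) (use con in auto)
    obtain z s \<alpha> t \<beta> where z: "det3 z (X a) (X c) \<noteq> 0" "s \<noteq> 0" "\<alpha> \<noteq> 0" "X b = s *s (z + \<alpha> *s X a)"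
      "t \<noteq> 0" "\<beta> \<noteq> 0" "X d = t *s (z + \<beta> *s X c)" "det3 z (X e) (X f) = 0"
      using concurrent_coords[OF d4 cc] .
    obtain v where v: "\<forall>i\<in>{a,b,c,d,e,f}. \<Psi> v i = X i" using sur[OF X z] by blast
    have "gen UNIV X" using X by (simp add: config_def)
    then obtain k where k: "X g = k *s eighth_point X a b c d e f h"
      using eighth_point_eq[OF _ _ _ _ _ dist all] con by blast
    \<comment> \<open>The vector at h can be set without disturbing the first six points; afterwards
      the scale k is set at g.\<close>
    have v': "\<forall>i\<in>{a,b,c,d,e,f}. \<Psi> (v(h := X h)) i = X i"
    proof
      fix i assume i: "i \<in> {a,b,c,d,e,f}"
      then have "i \<noteq> g" "i \<noteq> h" using ds by auto
      then have "\<Psi> (v(h := X h)) i = \<Psi> v i" using \<Psi>[of "v(h := X h)" v] by simp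
      then show "\<Psi> (v(h := X h)) i = X i" using bspec[OF v i] by simp
    qed
    obtain w where w: "\<Psi> w g $ 1 = k" "\<And>i. i \<noteq> g \<Longrightarrow> \<Psi> w i = \<Psi> (v(h := X h)) i"
      using scale[of k "v(h := X h)"] by blast
    have wX: "\<Psi> w i = X i" if "i \<noteq> g" for i
    proof (cases "i = h")
      case True then show ?thesis using w(2)[OF that] \<Psi>h by simp
    next
      case False
      then have "i \<in> {a,b,c,d,e,f}" using un that by blast
      then show ?thesis using w(2)[OF that] v' by simp
    qed
    have "eighth_point (\<Phi> w) a b c d e f h = eighth_point X a b c d e f h"
      using ds by (simp add: eighth_point_def \<Phi>_other wX)
    then have "\<Phi> w g = X g" unfolding \<Phi>_g w(1) k by simp
    then have "\<Phi> w i = X i" for i using \<Phi>_other wX by (cases "i = g") auto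
    then show "\<exists>v. \<Phi> v = X" by blast
  next
    fix v L assume L: "L \<in> \<L>"
    have "\<Phi> v i = \<Psi> v i" if "i \<in> L" for i using \<L>(1)[OF L] that by (intro \<Phi>_other) auto
    then show "coll (\<Phi> v) L" using line[OF L, of v] unfolding coll_def by auto
  next
    fix v C assume gen: "\<Phi> v \<in> generic UNIV Y" and C: "C \<in> \<J>"
    note con = generic_conic[OF Y gen mem(1) six(1)] generic_conic[OF Y gen mem(2) six(2)]
    have efh: "det3 (\<Phi> v e) (\<Phi> v f) (\<Phi> v h) \<noteq> 0" using ds by (intro nocollD[OF con(1)]) auto
    note on = eighth_point_conics[OF \<Phi>_g efh]
    have nl: "det3 (\<Phi> v i) (\<Phi> v j) (\<Phi> v k) \<noteq> 0" if "i \<noteq> j" "i \<noteq> k" "j \<noteq> k"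
      "{i, j, k} \<in> {{a,b,c},{a,b,d},{a,c,d},{b,c,d},{a,b,e},{a,b,f},{c,d,e},{c,d,f}}" for i j k
      by (rule generic_det3[OF Y gen that(1-3)]) (use \<L>(2)[OF that(4)] in blast)
    have abc: "det3 (\<Phi> v a) (\<Phi> v b) (\<Phi> v c) \<noteq> 0" "det3 (\<Phi> v c) (\<Phi> v d) (\<Phi> v e) \<noteq> 0"
      "det3 (\<Phi> v a) (\<Phi> v b) (\<Phi> v e) \<noteq> 0" using ds by (intro nl; simp)+
    have "crs (\<Phi> v c) (\<Phi> v d) \<noteq> 0" using generic_crs[OF gen] ds by blast
    moreover have "det3 (crs (\<Phi> v a) (\<Phi> v b)) (crs (\<Phi> v c) (\<Phi> v d)) (crs (\<Phi> v e) (\<Phi> v f)) = 0"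
      using conc[of v] ds by (simp add: \<Phi>_other)
    ultimately have third: "onconic (\<Phi> v) {a,b,c,d,g,h}"
      by (rule third_conic[OF on con dist abc(1)])
    show "onconic (\<Phi> v) C"
    proof (cases "C \<in> \<J>'")
      case True
      have "\<Phi> v i = \<Psi> v i" if "i \<in> C" for i using \<J>'[OF True] that by (intro \<Phi>_other) auto
      moreover have "onconic (\<Psi> v) C" using conic[OF True, of v] abc ds by (simp add: \<Phi>_other)
      ultimately show ?thesis unfolding onconic_def by auto
    next
      case False
      then show ?thesis using C \<J> on third by blast
    qed
  qed
qed

text \<open>The basis consists of the point z of concurrence, kept as the parameter at e, and of
  multiples A, C of a, c with e = A + C. With b on z + x A and d on z + y C, the point f, where bd
  meets ze, is y (z + x A) + x (z + y C).\<close>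

lemma irr_three_conics_opposite:
  assumes Y: "config Y {{a,c,e},{b,d,f}} {{c,d,e,f,g,h},{a,b,e,f,g,h},{a,b,c,d,g,h}}"
    and dist: "distinct [a,b,c,d,e,f,g,h]" and un: "UNIV = {a,b,c,d,e,f,g,h}"
  shows "irr (stratum UNIV Y)"
proof -
  note ds = dist[simplified] distinct_sym[OF dist]
  define \<Psi> :: "tuple \<Rightarrow> tuple" where "\<Psi> = (\<lambda>v. (\<lambda>_. 0)(
     a := (v b $ 1) *s v a, c := (v b $ 2) *s v c, e := v a + v c,
     b := (v d $ 1) *s (v e + (v f $ 1) *s v a),
     d := (v d $ 2) *s (v e + (v f $ 2) *s v c),
     f := (v d $ 3) *s ((v f $ 1 + v f $ 2) *s v e + (v f $ 1 * v f $ 2) *s (v a + v c)),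
     g := v g, h := v h))"
  have \<Psi>_eq: "\<Psi> v a = (v b $ 1) *s v a" "\<Psi> v c = (v b $ 2) *s v c" "\<Psi> v e = v a + v c"
     "\<Psi> v b = (v d $ 1) *s (v e + (v f $ 1) *s v a)"
     "\<Psi> v d = (v d $ 2) *s (v e + (v f $ 2) *s v c)"
     "\<Psi> v f = (v d $ 3) *s ((v f $ 1 + v f $ 2) *s v e + (v f $ 1 * v f $ 2) *s (v a + v c))"
     "\<Psi> v g = v g" "\<Psi> v h = v h" for v
    using ds by (simp_all add: \<Psi>_def)
  have D: "det3 (v a) (v c) (v e) = det3 (v e) (v a) (v c)" "det3 (v c) (v e) (v a) = det3 (v e) (v a) (v c)"
    "det3 (v a) (v e) (v c) = - det3 (v e) (v a) (v c)" "det3 (v c) (v a) (v e) = - det3 (v e) (v a) (v c)"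
    "det3 (v e) (v c) (v a) = - det3 (v e) (v a) (v c)" for v :: tuple
    by (simp_all add: det3_perm[where a = "v e" and b = "v a" and c = "v c"])
  show ?thesis
  proof (rule irr_three_conics[OF Y _ dist un, where S = "{a,b,c,d,e,f}" and \<J>' = "{}" and \<Psi> = \<Psi>])
    show "card {a,b,c,d,e,f} = 6" using ds by simp
    show "regvec (\<lambda>v. \<Psi> v i)" for i
    proof -
      have "regmap \<Psi>" unfolding \<Psi>_def by (intro reg_intros regmap_zero)
      then show ?thesis by (simp add: regmap_def)
    qed
    show "\<Psi> v g = \<Psi> w g \<and> (\<forall>i. i \<noteq> g \<longrightarrow> i \<noteq> h \<longrightarrow> \<Psi> v i = \<Psi> w i)" if "\<And>i. i \<noteq> h \<Longrightarrow> v i = w i" for v w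
      using ds by (simp add: \<Psi>_def that)
    show "\<exists>w. \<Psi> w g $ 1 = k \<and> (\<forall>i. i \<noteq> g \<longrightarrow> \<Psi> w i = \<Psi> v i)" for v k
      using ds by (intro exI[of _ "v(g := vector [k, 0, 0])"]) (simp add: \<Psi>_def vector_3)
  next
    fix X z s \<alpha> t \<beta> assume X: "config X {{a,c,e},{b,d,f}} {{c,d,e,f,g,h},{a,b,e,f,g,h},{a,b,c,d,g,h}}"
      and z: "det3 z (X a) (X c) \<noteq> 0" and b: "s \<noteq> 0" "\<alpha> \<noteq> 0" "X b = s *s (z + \<alpha> *s X a)"
      and d: "t \<noteq> 0" "\<beta> \<noteq> 0" "X d = t *s (z + \<beta> *s X c)" and ef: "det3 z (X e) (X f) = 0"
    note cd = config_det3[OF X]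
    have ac: "crs (X a) (X c) \<noteq> 0" using config_crs[OF X] ds by blast
    have "det3 (X a) (X c) (X e) = 0" "det3 (X b) (X d) (X f) = 0" using ds by (subst cd; simp)+
    then obtain p q where e: "X e = p *s X a + q *s X c" using line_coords[OF ac] by blast
    have p: "p \<noteq> 0"
    proof
      assume "p = 0"
      then have "crs (X c) (X e) = 0" unfolding e by simp
      then show False using config_crs[OF X] ds by blast
    qed
    have q: "q \<noteq> 0"
    proof
      assume "q = 0"
      then have "crs (X a) (X e) = 0" unfolding e by simp
      then show False using config_crs[OF X] ds by blast
    qed
    define A C where "A = p *s X a" and "C = q *s X c"
    have a: "X a = (1 / p) *s A" and c: "X c = (1 / q) *s C" and e: "X e = A + C"
      using p q by (simp_all add: A_def C_def e vector_smult_assoc)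
    have E: "det3 z A C \<noteq> 0" using z p q by (simp add: A_def C_def)
    define x y where "x = \<alpha> / p" and "y = \<beta> / q"
    have b': "X b = s *s (z + x *s A)" and d': "X d = t *s (z + y *s C)" and xy: "x \<noteq> 0" "y \<noteq> 0"
      using b d p q by (simp_all add: x_def y_def a c vector_smult_assoc)
    have "crs z (X e) \<noteq> 0"
    proof
      assume "crs z (X e) = 0"
      then have "det3 z (X e) A = 0" by (simp add: det3_alt(1) dot3_def)
      then show False using E unfolding e by (simp add: det3_perm[where a = z and b = A and c = C])
    qed
    then obtain o' \<phi> where f: "X f = o' *s z + \<phi> *s (A + C)" using line_coords ef e by metis
    have "det3 (X b) (X d) (X f) = s * t * det3 z A C * (x * y * o' - \<phi> * (x + y))"
      unfolding b' d' f by (simp add: det3_perm[where a = z and b = A and c = C] algebra_simps diff_divide_distrib)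
    then have rel: "\<phi> * (x + y) = x * y * o'" using \<open>det3 (X b) (X d) (X f) = 0\<close> b(1) d(1) E by simp
    have o0: "o' \<noteq> 0"
    proof
      assume "o' = 0"
      then have "X f = \<phi> *s X e" unfolding e f by simp
      then have "crs (X e) (X f) = 0" by simp
      then show False using config_crs[OF X] ds by blast
    qed
    then have xy0: "x + y \<noteq> 0" using rel xy by (metis mult_eq_0_iff)
    have f': "X f = (o' / (x + y)) *s ((x + y) *s z + (x * y) *s (A + C))"
    proof -
      have o: "o' / (x + y) * (x + y) = o'" and \<phi>: "o' / (x + y) * (x * y) = \<phi>"
        using rel xy0 by (simp_all add: field_simps)
      have "(o' / (x + y)) *s ((x + y) *s z + (x * y) *s (A + C)) =
          (o' / (x + y) * (x + y)) *s z + (o' / (x + y) * (x * y)) *s (A + C)"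
        by (simp only: vector_add_ldistrib vector_smult_assoc)
      then show ?thesis unfolding f o \<phi> by simp
    qed
    define v :: tuple where "v = (\<lambda>_. 0)(a := A, c := C, e := z, b := vector [1 / p, 1 / q, 0],
       d := vector [s, t, o' / (x + y)], f := vector [x, y, 0])"
    have v: "v a = A" "v c = C" "v e = z" "v b = vector [1 / p, 1 / q, 0]" "v d = vector [s, t, o' / (x + y)]"
       "v f = vector [x, y, 0]" using ds by (simp_all add: v_def)
    have "\<Psi> v a = X a" "\<Psi> v b = X b" "\<Psi> v c = X c" "\<Psi> v d = X d" "\<Psi> v e = X e" "\<Psi> v f = X f"
      by (simp_all only: \<Psi>_eq v vector_3 a b' c d' e f')
    then show "\<exists>v. \<forall>i\<in>{a,b,c,d,e,f}. \<Psi> v i = X i" by blast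
  next
    fix v L assume L: "L \<in> {{a,c,e},{b,d,f}}"
    have "coll (\<Psi> v) {a,c,e}" "coll (\<Psi> v) {b,d,f}"
      unfolding coll_iff_det3 \<Psi>_eq by (simp_all add: D algebra_simps)
    then show "coll (\<Psi> v) L" using L by blast
  next
    fix v
    have "dot3 (crs (\<Psi> v a) (\<Psi> v b)) (v e) = 0" "dot3 (crs (\<Psi> v c) (\<Psi> v d)) (v e) = 0"
      "dot3 (crs (\<Psi> v e) (\<Psi> v f)) (v e) = 0"
      unfolding det3_alt(1)[symmetric] \<Psi>_eq by (simp_all add: D algebra_simps)
    moreover show "det3 (crs (\<Psi> v a) (\<Psi> v b)) (crs (\<Psi> v c) (\<Psi> v d)) (crs (\<Psi> v e) (\<Psi> v f)) = 0"
    proof (cases "v e = 0")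
      case True
      then have "crs (\<Psi> v a) (\<Psi> v b) = 0" unfolding \<Psi>_eq by simp
      then show ?thesis by simp
    next
      case False
      then show ?thesis unfolding det3_eq_0_iff using calculation dot3_commute by metis
    qed
  qed (use ds in \<open>auto simp: \<Psi>_eq\<close>)
qed

text \<open>In the basis z, A, C with e = A + C, the incidences of f with ad and with bc force b = z
  + x A and d = z + y C to have x = y. This common value is absorbed into the scale of z.\<close>

lemma irr_three_conics_triangle:
  assumes Y: "config Y {{a,c,e},{a,d,f},{b,c,f}} {{c,d,e,f,g,h},{a,b,e,f,g,h},{a,b,c,d,g,h}}"
    and dist: "distinct [a,b,c,d,e,f,g,h]" and un: "UNIV = {a,b,c,d,e,f,g,h}"
  shows "irr (stratum UNIV Y)"
proof -
  note ds = dist[simplified] distinct_sym[OF dist]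
  define \<Psi> :: "tuple \<Rightarrow> tuple" where "\<Psi> = (\<lambda>v. (\<lambda>_. 0)(
     a := (v b $ 1) *s v a, c := (v b $ 2) *s v c, e := v a + v c,
     b := (v d $ 1) *s (v e + v a),
     d := (v d $ 2) *s (v e + v c),
     f := (v d $ 3) *s (v e + v a + v c),
     g := v g, h := v h))"
  have \<Psi>_eq: "\<Psi> v a = (v b $ 1) *s v a" "\<Psi> v c = (v b $ 2) *s v c" "\<Psi> v e = v a + v c"
     "\<Psi> v b = (v d $ 1) *s (v e + v a)"
     "\<Psi> v d = (v d $ 2) *s (v e + v c)"
     "\<Psi> v f = (v d $ 3) *s (v e + v a + v c)"
     "\<Psi> v g = v g" "\<Psi> v h = v h" for v
    using ds by (simp_all add: \<Psi>_def)
  have D: "det3 (v a) (v c) (v e) = det3 (v e) (v a) (v c)" "det3 (v c) (v e) (v a) = det3 (v e) (v a) (v c)"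
    "det3 (v a) (v e) (v c) = - det3 (v e) (v a) (v c)" "det3 (v c) (v a) (v e) = - det3 (v e) (v a) (v c)"
    "det3 (v e) (v c) (v a) = - det3 (v e) (v a) (v c)" for v :: tuple
    by (simp_all add: det3_perm[where a = "v e" and b = "v a" and c = "v c"])
  show ?thesis
  proof (rule irr_three_conics[OF Y _ dist un, where S = "{a,b,c,d,e,f}" and \<J>' = "{}" and \<Psi> = \<Psi>])
    show "card {a,b,c,d,e,f} = 6" using ds by simp
    show "regvec (\<lambda>v. \<Psi> v i)" for i
    proof -
      have "regmap \<Psi>" unfolding \<Psi>_def by (intro reg_intros regmap_zero)
      then show ?thesis by (simp add: regmap_def)
    qed
    show "\<Psi> v g = \<Psi> w g \<and> (\<forall>i. i \<noteq> g \<longrightarrow> i \<noteq> h \<longrightarrow> \<Psi> v i = \<Psi> w i)" if "\<And>i. i \<noteq> h \<Longrightarrow> v i = w i" for v w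
      using ds by (simp add: \<Psi>_def that)
    show "\<exists>w. \<Psi> w g $ 1 = k \<and> (\<forall>i. i \<noteq> g \<longrightarrow> \<Psi> w i = \<Psi> v i)" for v k
      using ds by (intro exI[of _ "v(g := vector [k, 0, 0])"]) (simp add: \<Psi>_def vector_3)
  next
    fix X z s \<alpha> t \<beta> assume X: "config X {{a,c,e},{a,d,f},{b,c,f}} {{c,d,e,f,g,h},{a,b,e,f,g,h},{a,b,c,d,g,h}}"
      and z: "det3 z (X a) (X c) \<noteq> 0" and b: "s \<noteq> 0" "\<alpha> \<noteq> 0" "X b = s *s (z + \<alpha> *s X a)"
      and d: "t \<noteq> 0" "\<beta> \<noteq> 0" "X d = t *s (z + \<beta> *s X c)" and ef: "det3 z (X e) (X f) = 0"
    note cd = config_det3[OF X]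
    have ac: "crs (X a) (X c) \<noteq> 0" using config_crs[OF X] ds by blast
    have l: "det3 (X a) (X c) (X e) = 0" "det3 (X a) (X d) (X f) = 0" "det3 (X b) (X c) (X f) = 0"
      using ds by (subst cd; simp)+
    then obtain p q where e: "X e = p *s X a + q *s X c" using line_coords[OF ac] by blast
    have p: "p \<noteq> 0"
    proof
      assume "p = 0"
      then have "crs (X c) (X e) = 0" unfolding e by simp
      then show False using config_crs[OF X] ds by blast
    qed
    have q: "q \<noteq> 0"
    proof
      assume "q = 0"
      then have "crs (X a) (X e) = 0" unfolding e by simp
      then show False using config_crs[OF X] ds by blast
    qed
    define A C where "A = p *s X a" and "C = q *s X c"
    have a: "X a = (1 / p) *s A" and c: "X c = (1 / q) *s C" and e: "X e = A + C"
      using p q by (simp_all add: A_def C_def e vector_smult_assoc)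
    have E: "det3 z A C \<noteq> 0" using z p q by (simp add: A_def C_def)
    define x y where "x = \<alpha> / p" and "y = \<beta> / q"
    have b': "X b = s *s (z + x *s A)" and d': "X d = t *s (z + y *s C)" and xy: "x \<noteq> 0" "y \<noteq> 0"
      using b d p q by (simp_all add: x_def y_def a c vector_smult_assoc)
    have "crs z (X e) \<noteq> 0"
    proof
      assume "crs z (X e) = 0"
      then have "det3 z (X e) A = 0" by (simp add: det3_alt(1) dot3_def)
      then show False using E unfolding e by (simp add: det3_perm[where a = z and b = A and c = C])
    qed
    then obtain o' \<phi> where f: "X f = o' *s z + \<phi> *s (A + C)" using line_coords ef e by metis
    have "det3 (X a) (X d) (X f) = 1 / p * t * det3 z A C * (y * o' - \<phi>)"
      unfolding a d' f by (simp add: det3_perm[where a = z and b = A and c = C] algebra_simps diff_divide_distrib)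
    then have r1: "\<phi> = y * o'" using l(2) p d(1) E by simp
    have "det3 (X b) (X c) (X f) = s * (1 / q) * det3 z A C * (x * o' - \<phi>)"
      unfolding b' c f by (simp add: det3_perm[where a = z and b = A and c = C] algebra_simps diff_divide_distrib)
    then have r2: "\<phi> = x * o'" using l(3) q b(1) E by simp
    have o0: "o' \<noteq> 0"
    proof
      assume "o' = 0"
      then have "X f = \<phi> *s X e" unfolding e f by simp
      then have "crs (X e) (X f) = 0" by simp
      then show False using config_crs[OF X] ds by blast
    qed
    then have "y = x" using r1 r2 by simp
    define z' where "z' = (1 / x) *s z"
    have zz: "z = x *s z'" using xy by (simp add: z'_def vector_smult_assoc)
    have f': "X f = (x * o') *s (z' + A + C)" unfolding f r2 zz by (simp add: vector_add_ldistrib vector_smult_assoc mult_ac)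
    have b'': "X b = (s * x) *s (z' + A)" and d'': "X d = (t * x) *s (z' + C)"
      unfolding b' d' zz \<open>y = x\<close> by (simp_all add: vector_add_ldistrib vector_smult_assoc mult_ac)
    define v :: tuple where "v = (\<lambda>_. 0)(a := A, c := C, e := z', b := vector [1 / p, 1 / q, 0],
       d := vector [s * x, t * x, x * o'])"
    have v: "v a = A" "v c = C" "v e = z'" "v b = vector [1 / p, 1 / q, 0]" "v d = vector [s * x, t * x, x * o']"
      using ds by (simp_all add: v_def)
    have "\<Psi> v a = X a" "\<Psi> v b = X b" "\<Psi> v c = X c" "\<Psi> v d = X d" "\<Psi> v e = X e" "\<Psi> v f = X f"
      by (simp_all only: \<Psi>_eq v vector_3 a b'' c d'' e f')
    then show "\<exists>v. \<forall>i\<in>{a,b,c,d,e,f}. \<Psi> v i = X i" by blast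
  next
    fix v L assume L: "L \<in> {{a,c,e},{a,d,f},{b,c,f}}"
    have "coll (\<Psi> v) {a,c,e}" "coll (\<Psi> v) {a,d,f}" "coll (\<Psi> v) {b,c,f}"
      unfolding coll_iff_det3 \<Psi>_eq by (simp_all add: D algebra_simps)
    then show "coll (\<Psi> v) L" using L by blast
  next
    fix v
    have "dot3 (crs (\<Psi> v a) (\<Psi> v b)) (v e) = 0" "dot3 (crs (\<Psi> v c) (\<Psi> v d)) (v e) = 0"
      "dot3 (crs (\<Psi> v e) (\<Psi> v f)) (v e) = 0"
      unfolding det3_alt(1)[symmetric] \<Psi>_eq by (simp_all add: D algebra_simps)
    moreover show "det3 (crs (\<Psi> v a) (\<Psi> v b)) (crs (\<Psi> v c) (\<Psi> v d)) (crs (\<Psi> v e) (\<Psi> v f)) = 0"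
    proof (cases "v e = 0")
      case True
      then have "crs (\<Psi> v a) (\<Psi> v b) = 0" unfolding \<Psi>_eq by simp
      then show ?thesis by simp
    next
      case False
      then show ?thesis unfolding det3_eq_0_iff using calculation dot3_commute by metis
    qed
  qed (use ds in \<open>auto simp: \<Psi>_eq\<close>)
qed

subsection \<open>Four conics\<close>

text \<open>The points e and f lie on a line through z, so they can be scaled to differ only in the
  coordinate along z. On that line the conic through the six points a, ..., f is a quadratic in this
  coordinate with sum of roots x + y, and e, f give its two roots. One root is thus a polynomial in
  the other and x, y.\<close>

lemma irr_four_conics:
  assumes Y: "config Y {} {{c,d,e,f,g,h},{a,b,e,f,g,h},{a,b,c,d,g,h},{a,b,c,d,e,f}}"
    and dist: "distinct [a,b,c,d,e,f,g,h]" and un: "UNIV = {a,b,c,d,e,f,g,h}"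
  shows "irr (stratum UNIV Y)"
proof -
  note ds = dist[simplified] distinct_sym[OF dist]
  define \<Psi> :: "tuple \<Rightarrow> tuple" where "\<Psi> = (\<lambda>v. (\<lambda>_. 0)(
     a := (v d $ 1) *s (0 *s v e + 1 *s v a + 0 *s v c), c := (v d $ 2) *s (0 *s v e + 0 *s v a + 1 *s v c),
     e := 1 *s ((v b $ 1) *s v e + (v b $ 2) *s v a + (v b $ 3) *s v c),
     b := (v d $ 3) *s (1 *s v e + 1 *s v a + 0 *s v c),
     d := (v f $ 1) *s (1 *s v e + 0 *s v a + 1 *s v c),
     f := (v f $ 2) *s ((v b $ 2 + v b $ 3 - v b $ 1) *s v e + (v b $ 2) *s v a + (v b $ 3) *s v c),
     g := v g, h := v h))"
  have \<Psi>_eq: "\<Psi> v a = (v d $ 1) *s (0 *s v e + 1 *s v a + 0 *s v c)"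
     "\<Psi> v c = (v d $ 2) *s (0 *s v e + 0 *s v a + 1 *s v c)"
     "\<Psi> v e = 1 *s ((v b $ 1) *s v e + (v b $ 2) *s v a + (v b $ 3) *s v c)"
     "\<Psi> v b = (v d $ 3) *s (1 *s v e + 1 *s v a + 0 *s v c)"
     "\<Psi> v d = (v f $ 1) *s (1 *s v e + 0 *s v a + 1 *s v c)"
     "\<Psi> v f = (v f $ 2) *s ((v b $ 2 + v b $ 3 - v b $ 1) *s v e + (v b $ 2) *s v a + (v b $ 3) *s v c)"
     "\<Psi> v g = v g" "\<Psi> v h = v h" for v
    using ds by (simp_all add: \<Psi>_def)
  have D: "det3 (v a) (v c) (v e) = det3 (v e) (v a) (v c)" "det3 (v c) (v e) (v a) = det3 (v e) (v a) (v c)"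
    "det3 (v a) (v e) (v c) = - det3 (v e) (v a) (v c)" "det3 (v c) (v a) (v e) = - det3 (v e) (v a) (v c)"
    "det3 (v e) (v c) (v a) = - det3 (v e) (v a) (v c)" for v :: tuple
    by (simp_all add: det3_perm[where a = "v e" and b = "v a" and c = "v c"])
  show ?thesis
  proof (rule irr_three_conics[OF Y _ dist un, where S = "{a,b,c,d,e,g}" and \<J>' = "{{a,b,c,d,e,f}}" and \<Psi> = \<Psi>])
    show "card {a,b,c,d,e,g} = 6" using ds by simp
    show "{{c,d,e,f,g,h},{a,b,e,f,g,h},{a,b,c,d,g,h},{a,b,c,d,e,f}} =
      {{c,d,e,f,g,h},{a,b,e,f,g,h},{a,b,c,d,g,h}} \<union> {{a,b,c,d,e,f}}" by auto
    show "regvec (\<lambda>v. \<Psi> v i)" for i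
    proof -
      have "regmap \<Psi>" unfolding \<Psi>_def by (intro reg_intros regmap_zero)
      then show ?thesis by (simp add: regmap_def)
    qed
    show "\<Psi> v g = \<Psi> w g \<and> (\<forall>i. i \<noteq> g \<longrightarrow> i \<noteq> h \<longrightarrow> \<Psi> v i = \<Psi> w i)" if "\<And>i. i \<noteq> h \<Longrightarrow> v i = w i" for v w
      using ds by (simp add: \<Psi>_def that)
    show "\<exists>w. \<Psi> w g $ 1 = k \<and> (\<forall>i. i \<noteq> g \<longrightarrow> \<Psi> w i = \<Psi> v i)" for v k
      using ds by (intro exI[of _ "v(g := vector [k, 0, 0])"]) (simp add: \<Psi>_def vector_3)
  next
    fix X z s \<alpha> t \<beta> assume X: "config X {} {{c,d,e,f,g,h},{a,b,e,f,g,h},{a,b,c,d,g,h},{a,b,c,d,e,f}}"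
      and z: "det3 z (X a) (X c) \<noteq> 0" and b: "s \<noteq> 0" "\<alpha> \<noteq> 0" "X b = s *s (z + \<alpha> *s X a)"
      and d: "t \<noteq> 0" "\<beta> \<noteq> 0" "X d = t *s (z + \<beta> *s X c)" and ef: "det3 z (X e) (X f) = 0"
    note cd = config_det3[OF X]
    define A C where "A = \<alpha> *s X a" and "C = \<beta> *s X c"
    have a: "X a = (1 / \<alpha>) *s (0 *s z + 1 *s A + 0 *s C)" and c: "X c = (1 / \<beta>) *s (0 *s z + 0 *s A + 1 *s C)"
      using b(2) d(2) by (simp_all add: A_def C_def vector_smult_assoc)
    have E: "det3 z A C \<noteq> 0" using z b(2) d(2) by (simp add: A_def C_def)
    have b': "X b = s *s (1 *s z + 1 *s A + 0 *s C)" and d': "X d = t *s (1 *s z + 0 *s A + 1 *s C)"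
      using b d by (simp_all add: A_def C_def)
    obtain o' x y where e0: "X e = o' *s z + x *s A + y *s C" using basis_coords[OF E] .
    have e: "X e = 1 *s (o' *s z + x *s A + y *s C)" using e0 by simp
    have nl: "det3 (X c) (X d) (X e) \<noteq> 0" "det3 (X a) (X b) (X e) \<noteq> 0" "det3 (X a) (X b) (X f) \<noteq> 0"
      using ds by (subst cd; simp)+
    have x: "x \<noteq> 0" using nl(1) unfolding c d' e by (auto simp: det3_perm[where a = z and b = A and c = C])
    have y: "y \<noteq> 0" using nl(2) unfolding a b' e by (auto simp: det3_perm[where a = z and b = A and c = C])
    have "det3 z (X e) C \<noteq> 0" using x E unfolding e by simp
    then have "crs z (X e) \<noteq> 0" by (auto simp: det3_alt(1))
    then obtain r q where f0: "X f = r *s z + q *s X e" using line_coords[OF _ ef] by blast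
    have q: "q \<noteq> 0"
    proof
      assume "q = 0"
      then have "det3 (X a) (X b) (X f) = 0" unfolding a b' f0
        by (simp add: det3_perm[where a = z and b = A and c = C])
      then show False using nl(3) by blast
    qed
    define p where "p = r / q + o'"
    have f: "X f = q *s (p *s z + x *s A + y *s C)"
      unfolding f0 e using q by (simp add: p_def vector_add_ldistrib vector_smult_assoc vector_sadd_rdistrib algebra_simps)
    have "onconic X {a,b,c,d,e,f}" using config_conic[OF X, of "{a,b,c,d,e,f}"] ds by auto
    then obtain k1 k2 k3 k4 k5 k6 where k: "k1 \<noteq> 0 \<or> k2 \<noteq> 0 \<or> k3 \<noteq> 0 \<or> k4 \<noteq> 0 \<or> k5 \<noteq> 0 \<or> k6 \<noteq> 0"
        "\<And>i \<kappa> r s t. i \<in> {a,b,c,d,e,f} \<Longrightarrow> \<kappa> \<noteq> 0 \<Longrightarrow> X i = \<kappa> *s (r *s z + s *s A + t *s C) \<Longrightarrow>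
         k1 * r^2 + k2 * s^2 + k3 * t^2 + k4 * (s * t) + k5 * (r * t) + k6 * (r * s) = 0"
      using onconic_coordsD[OF _ E] by blast
    have k23: "k2 = 0" "k3 = 0" using k(2)[OF _ _ a] k(2)[OF _ _ c] b(2) d(2) by simp_all
    have k6: "k6 = - k1" using k(2)[OF _ b(1) b'] k23 by (simp add: add_eq_0_iff)
    have k5: "k5 = - k1" using k(2)[OF _ d(1) d'] k23 by (simp add: add_eq_0_iff)
    have ke: "k1 * o'^2 + k4 * (x * y) + k5 * (o' * y) + k6 * (o' * x) = 0" using k(2)[OF _ _ e] k23 by simp
    have kf: "k1 * p^2 + k4 * (x * y) + k5 * (p * y) + k6 * (p * x) = 0" using k(2)[OF _ q f] k23 by simp
    have "k1 * ((o' - p) * (o' + p - x - y)) = 0" using ke kf k5 k6 by algebra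
    moreover have "k1 \<noteq> 0"
    proof
      assume "k1 = 0"
      then have "k4 = 0" using ke k5 k6 x y by simp
      then show False using k(1) k23 k5 k6 \<open>k1 = 0\<close> by simp
    qed
    moreover have "o' - p \<noteq> 0"
    proof
      assume "o' - p = 0"
      then have "X f = q *s X e" unfolding f e0 by simp
      then have "crs (X e) (X f) = 0" by simp
      then show False using config_crs[OF X] ds by blast
    qed
    ultimately have "o' + p - x - y = 0" by (simp only: mult_eq_0_iff simp_thms)
    then have p: "p = x + y - o'" by algebra
    define v :: tuple where "v = (\<lambda>_. 0)(a := A, c := C, e := z, b := vector [o', x, y],
       d := vector [1 / \<alpha>, 1 / \<beta>, s], f := vector [t, q, 0])"
    have v: "v a = A" "v c = C" "v e = z" "v b = vector [o', x, y]" "v d = vector [1 / \<alpha>, 1 / \<beta>, s]"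
      "v f = vector [t, q, 0]"
      using ds by (simp_all add: v_def)
    have "\<Psi> v a = X a" "\<Psi> v b = X b" "\<Psi> v c = X c" "\<Psi> v d = X d" "\<Psi> v e = X e" "\<Psi> v f = X f"
      by (simp_all only: \<Psi>_eq v vector_3 a b' c d' e f[unfolded p])
    then show "\<exists>v. \<forall>i\<in>{a,b,c,d,e,f}. \<Psi> v i = X i" by blast
  next
    fix v
    have "dot3 (crs (\<Psi> v a) (\<Psi> v b)) (v e) = 0" "dot3 (crs (\<Psi> v c) (\<Psi> v d)) (v e) = 0"
      "dot3 (crs (\<Psi> v e) (\<Psi> v f)) (v e) = 0"
      unfolding det3_alt(1)[symmetric] \<Psi>_eq by (simp_all add: D algebra_simps)
    moreover show "det3 (crs (\<Psi> v a) (\<Psi> v b)) (crs (\<Psi> v c) (\<Psi> v d)) (crs (\<Psi> v e) (\<Psi> v f)) = 0"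
    proof (cases "v e = 0")
      case True
      then have "crs (\<Psi> v a) (\<Psi> v b) = 0" unfolding \<Psi>_eq by simp
      then show ?thesis by simp
    next
      case False
      then show ?thesis unfolding det3_eq_0_iff using calculation dot3_commute by metis
    qed
  next
    fix v K assume K: "K \<in> {{a,b,c,d,e,f}}" and nz: "det3 (\<Psi> v a) (\<Psi> v b) (\<Psi> v c) \<noteq> 0" "det3 (\<Psi> v c) (\<Psi> v d) (\<Psi> v e) \<noteq> 0"
      "det3 (\<Psi> v a) (\<Psi> v b) (\<Psi> v e) \<noteq> 0"
    have E: "det3 (v e) (v a) (v c) \<noteq> 0" using nz(1) unfolding \<Psi>_eq by (auto simp: D)
    let ?o = "v b $ 1" and ?x = "v b $ 2" and ?y = "v b $ 3"
    have x: "?x \<noteq> 0" using nz(2) unfolding \<Psi>_eq by (auto simp: D)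
    have y: "?y \<noteq> 0" using nz(3) unfolding \<Psi>_eq by (auto simp: D)
    have "onconic (\<Psi> v) {a,b,c,d,e,f}"
    proof (rule onconic_coordsI[OF E, of "?x * ?y" 0 0 "- (?o^2 - ?o * ?x - ?o * ?y)" "- (?x * ?y)" "- (?x * ?y)"])
      show "?x * ?y \<noteq> 0 \<or> (0::complex) \<noteq> 0 \<or> (0::complex) \<noteq> 0 \<or> - (?o^2 - ?o * ?x - ?o * ?y) \<noteq> 0 \<or> - (?x * ?y) \<noteq> 0 \<or> - (?x * ?y) \<noteq> 0"
        using x y by simp
      fix i assume "i \<in> {a,b,c,d,e,f}"
      then consider "i = a" | "i = b" | "i = c" | "i = d" | "i = e" | "i = f" by blast
      then show "\<exists>\<kappa> r s t. \<Psi> v i = \<kappa> *s (r *s v e + s *s v a + t *s v c) \<and>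
          ?x * ?y * r^2 + 0 * s^2 + 0 * t^2 + - (?o^2 - ?o * ?x - ?o * ?y) * (s * t) + - (?x * ?y) * (r * t) + - (?x * ?y) * (r * s) = 0"
        by cases (hypsubst, intro exI conjI, rule \<Psi>_eq, simp add: power2_eq_square algebra_simps)+
    qed
    then show "onconic (\<Psi> v) K" using K by blast
  qed (use ds in \<open>auto simp: \<Psi>_eq\<close>)
qed

section \<open>Finding a removable point\<close>

definition cl :: "tuple \<Rightarrow> 8 \<Rightarrow> 8 \<Rightarrow> 8 \<Rightarrow> bool" where
  "cl Y i j k \<longleftrightarrow> coll Y {i, j, k}"

definition conicset :: "tuple \<Rightarrow> 8 set \<Rightarrow> bool" where
  "conicset Y C \<longleftrightarrow> nocoll Y C \<and> onconic Y C"

text \<open>The obstruction to removing x by means of lines; the representatives a, c, e make the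
  three lines distinct.\<close>

definition three_lines :: "tuple \<Rightarrow> 8 set \<Rightarrow> 8 \<Rightarrow> bool" where
  "three_lines Y A x \<longleftrightarrow> (\<exists>a b c d e f. {a, b, c, d, e, f} \<subseteq> A \<and> distinct [a, b, c, d, e, f] \<and>
     cl Y x a b \<and> cl Y x c d \<and> cl Y x e f \<and> \<not> cl Y x a c \<and> \<not> cl Y x a e \<and> \<not> cl Y x c e)"

lemma three_linesE:
  assumes "three_lines Y A x"
  obtains a b c d e f where "{a, b, c, d, e, f} \<subseteq> A" "distinct [a, b, c, d, e, f]"
    "cl Y x a b" "cl Y x c d" "cl Y x e f" "\<not> cl Y x a c" "\<not> cl Y x a e" "\<not> cl Y x c e"
  using assms unfolding three_lines_def by (elim exE conjE) (rule that)

lemma cl_swap: "cl Y i j k \<Longrightarrow> cl Y j i k" "cl Y i j k \<Longrightarrow> cl Y i k j"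
  by (simp_all add: cl_def insert_commute)

lemma nocoll_cl: "nocoll Y S \<Longrightarrow> i \<in> S \<Longrightarrow> j \<in> S \<Longrightarrow> k \<in> S \<Longrightarrow> i \<noteq> j \<Longrightarrow> i \<noteq> k \<Longrightarrow> j \<noteq> k \<Longrightarrow> \<not> cl Y i j k"
  unfolding nocoll_def cl_def by simp

lemma conicset_mono: "conicset Y T \<Longrightarrow> S \<subseteq> T \<Longrightarrow> conicset Y S"
  unfolding conicset_def using nocoll_mono onconic_mono by blast

lemma pencilI:
  assumes "\<And>y z. y \<in> A \<Longrightarrow> z \<in> A \<Longrightarrow> y \<noteq> z \<Longrightarrow> cl Y x y z \<Longrightarrow> \<exists>a\<in>C. cl Y x a y \<and> cl Y x a z"
  shows "pencil Y A x C"
  using assms unfolding pencil_def cl_def by blast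

lemma conics_atI:
  assumes "\<And>S. S \<subseteq> A \<Longrightarrow> card S = 5 \<Longrightarrow> conicset Y (insert x S) \<Longrightarrow> \<exists>C\<in>\<C>. S \<subseteq> C"
  shows "conics_at Y A x \<C>"
  using assms unfolding conics_at_def conicset_def by blast

locale general_tuple =
  fixes Y :: tuple
  assumes g: "gen UNIV Y"
begin

lemma gA: "gen A Y"
  using gen_mono[OF g] by simp

lemma cl_refl: "cl Y x a a" "cl Y x x a" "cl Y x a x"
proof -
  have "coll Y {i, j}" for i j :: 8
  proof (cases "i = j")
    case False
    then have "crs (Y i) (Y j) \<noteq> 0" using g by (simp add: gen_def)
    then show ?thesis unfolding coll_def by (intro exI[of _ "crs (Y i) (Y j)"]) simp
  next
    case True
    have "\<exists>k :: 8. k \<noteq> i" by (rule exI[of _ "i + 1"]) simp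
    then obtain k where "k \<noteq> i" by blast
    then have "crs (Y i) (Y k) \<noteq> 0" using g by (simp add: gen_def)
    then show ?thesis unfolding coll_def True by (intro exI[of _ "crs (Y i) (Y k)"]) (use True in simp)
  qed
  then show "cl Y x a a" "cl Y x x a" "cl Y x a x" by (simp_all add: cl_def insert_commute)
qed

text \<open>For fixed x the relation \<open>cl Y x\<close> is thereby an equivalence on the points
  other than x; its classes correspond to the lines through x.\<close>

lemma cl_trans:
  assumes "x \<noteq> b" "cl Y x a b" "cl Y x b c" shows "cl Y x a c"
proof -
  have "coll Y ({x, a, b} \<union> {x, b, c})"
    using assms g unfolding cl_def by (intro coll_join[of _ _ _ x b]) (auto simp: gen_def)
  then have "coll Y {x, a, c}" by (rule coll_mono) auto
  then show ?thesis by (simp add: cl_def)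
qed

lemma conicset_join:
  assumes "conicset Y S" "conicset Y T" "F \<subseteq> S" "F \<subseteq> T" "5 \<le> card F"
  shows "conicset Y (S \<union> T)"
proof -
  have F: "nocoll Y F" using assms(1,3) nocoll_mono unfolding conicset_def by blast
  have on: "onconic Y (S \<union> T)"
    using conic_join[of Y S T F] assms F gA unfolding conicset_def by blast
  have "nocoll Y (S \<union> T)" by (rule conic_nocoll[OF on _ assms(5) F gA]) (use assms(3) in auto)
  then show ?thesis using on by (simp add: conicset_def)
qed

text \<open>Lines through x are collected one after the other. A third line outside the first two
  would yield \<open>three_lines\<close>, so one of the cases without line, with one line or with
  two lines applies.\<close>

lemma few_lines:
  assumes x: "x \<notin> A" and irr: "irr (stratum A Y)" and con: "conics_at Y A x {}"
    and few: "\<not> three_lines Y A x"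
  shows "irr (stratum (insert x A) Y)"
proof (cases "\<exists>a\<in>A. \<exists>b\<in>A. a \<noteq> b \<and> cl Y x a b")
  case False
  then show ?thesis by (intro irr_free[OF x irr gA _ con] pencilI) blast
next
  case True
  then obtain a b where ab: "a \<in> A" "b \<in> A" "a \<noteq> b" "cl Y x a b" by blast
  have xn: "x \<noteq> y" if "y \<in> A" for y using x that by blast
  show ?thesis
  proof (cases "\<exists>c\<in>A. \<exists>d\<in>A. c \<noteq> d \<and> cl Y x c d \<and> \<not> (cl Y x a c \<and> cl Y x a d)")
    case False
    then show ?thesis using ab(4) unfolding cl_def
      by (intro irr_line[OF x irr gA ab(1-3) _ _ con] pencilI) (auto simp: cl_def)
  next
    case True
    then obtain c d where cd: "c \<in> A" "d \<in> A" "c \<noteq> d" "cl Y x c d" "\<not> (cl Y x a c \<and> cl Y x a d)" by blast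
    have ac: "\<not> cl Y x a c" using cl_trans[OF xn[OF cd(1)], of a d] cd(4,5) by blast
    show ?thesis
    proof (cases "\<exists>e\<in>A. \<exists>f\<in>A. e \<noteq> f \<and> cl Y x e f \<and> \<not> (cl Y x a e \<and> cl Y x a f) \<and> \<not> (cl Y x c e \<and> cl Y x c f)")
      case False
      have "pencil Y A x {a, c}" by (rule pencilI) (use False in blast)
      moreover have "coll Y {x, a, b}" "coll Y {x, c, d}" "\<not> coll Y {x, a, c}" using ab(4) cd(4) ac by (simp_all add: cl_def)
      ultimately show ?thesis using irr_two_lines[OF x irr gA ab(1-3) _ cd(1-3) _ _ _ con] by blast
    next
      case True
      then obtain e f where ef: "e \<in> A" "f \<in> A" "e \<noteq> f" "cl Y x e f" "\<not> (cl Y x a e \<and> cl Y x a f)" "\<not> (cl Y x c e \<and> cl Y x c f)" by blast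
      have ae: "\<not> cl Y x a e" using cl_trans[OF xn[OF ef(1)], of a f] ef(4,5) by blast
      have ce: "\<not> cl Y x c e" using cl_trans[OF xn[OF ef(1)], of c f] ef(4,6) by blast
      have apart: "distinct [p, q, p', q']" if "p \<in> A" "q \<in> A" "p' \<in> A" "q' \<in> A" "p \<noteq> q" "p' \<noteq> q'" "cl Y x p q" "cl Y x p' q'" "\<not> cl Y x p p'"
        for p q p' q'
      proof -
        have "p \<noteq> p'" using that(9) cl_refl(1) by auto
        moreover have "p \<noteq> q'" using that(8,9) cl_swap(2) by auto
        moreover have "q \<noteq> p'" using that(7,9) by auto
        moreover have "q \<noteq> q'" using that(7,8,9) cl_trans[OF xn[OF that(2)], of p p'] cl_swap(2) by blast
        ultimately show ?thesis using that(5,6) by simp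
      qed
      have "distinct [a, b, c, d, e, f]"
        using apart[of a b c d] apart[of a b e f] apart[of c d e f] ab cd ef ac ae ce by simp
      then have "three_lines Y A x" unfolding three_lines_def using ab cd ef ac ae ce
        by - (rule exI[of _ a], rule exI[of _ b], rule exI[of _ c], rule exI[of _ d], rule exI[of _ e], rule exI[of _ f], simp)
      then show ?thesis using few by blast
    qed
  qed
qed

lemma conic_all:
  assumes C: "conicset Y A" "6 \<le> card A" and IH: "\<And>x. x \<in> A \<Longrightarrow> irr (stratum (A - {x}) Y)"
  shows "irr (stratum A Y)"
proof -
  obtain x where x: "x \<in> A" using C(2) by fastforce
  have A: "insert x (A - {x}) = A" using x by blast
  have "irr (stratum (insert x (A - {x})) Y)"
  proof (rule irr_conic[OF _ IH[OF x] gA, where C = "A - {x}"])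
    show "nocoll Y (insert x (A - {x}))" "onconic Y (insert x (A - {x}))" unfolding A using C by (auto simp: conicset_def)
    show "5 \<le> card (A - {x})" using C(2) x by simp
    show "pencil Y (A - {x}) x {}"
    proof (rule pencilI)
      fix y z assume "y \<in> A - {x}" "z \<in> A - {x}" "y \<noteq> z" "cl Y x y z"
      then show "\<exists>a\<in>{}. cl Y x a y \<and> cl Y x a z"
        using nocoll_cl[of Y A x y z] C(1) x unfolding conicset_def by blast
    qed
    show "conics_at Y (A - {x}) x {A - {x}}" by (rule conics_atI) blast
  qed auto
  then show ?thesis unfolding A .
qed

text \<open>A line through a meets the conic in at most one more point, so a line with two further
  points contains some q outside \<open>S\<close>. The hypothesis \<open>lines\<close> then
  identifies it with the line ab.\<close>

lemma irr_on_conic_and_line: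
  assumes S: "conicset Y S" "6 \<le> card S" "S \<subseteq> A" and a: "a \<in> S" and irr: "irr (stratum (A - {a}) Y)"
    and b: "b \<in> S" "b \<noteq> a" and f: "f \<in> A" "f \<notin> S" and ab: "cl Y a b f"
    and lines: "\<And>q. q \<in> A \<Longrightarrow> q \<notin> S \<Longrightarrow> cl Y a b q \<or> (\<forall>p\<in>A. p \<noteq> a \<longrightarrow> p \<noteq> q \<longrightarrow> \<not> cl Y a q p)"
    and con: "\<And>C. C \<subseteq> A \<Longrightarrow> a \<in> C \<Longrightarrow> card C = 6 \<Longrightarrow> conicset Y C \<Longrightarrow> C \<subseteq> S"
  shows "irr (stratum A Y)"
proof -
  have A: "insert a (A - {a}) = A" and S': "insert a (S - {a}) = S" using a S(3) by blast+
  have "irr (stratum (insert a (A - {a})) Y)"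
  proof (rule irr_conic_line[OF _ irr gA, where C = "S - {a}" and a = b and f = f])
    show "nocoll Y (insert a (S - {a}))" "onconic Y (insert a (S - {a}))" unfolding S' using S by (auto simp: conicset_def)
    show "5 \<le> card (S - {a})" using S(2) a by simp
    show "coll Y {a, b, f}" using ab by (simp add: cl_def)
    show "pencil Y (A - {a}) a {b}"
    proof (rule pencilI)
      fix y z assume yz: "y \<in> A - {a}" "z \<in> A - {a}" "y \<noteq> z" "cl Y a y z"
      have "y \<notin> S \<or> z \<notin> S" using nocoll_cl[of Y S a y z] S(1) a yz unfolding conicset_def by blast
      then show "\<exists>p\<in>{b}. cl Y a p y \<and> cl Y a p z"
      proof
        assume "y \<notin> S"
        then have "cl Y a b y" using lines[of y] yz by blast
        then show ?thesis using cl_trans[of a y b z] yz by blast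
      next
        assume "z \<notin> S"
        then have "cl Y a b z" using lines[of z] yz cl_swap(2)[OF yz(4)] by blast
        then show ?thesis using cl_trans[of a z b y] yz cl_swap(2)[OF yz(4)] by blast
      qed
    qed
    show "conics_at Y (A - {a}) a {S - {a}}"
    proof (rule conics_atI)
      fix T assume T: "T \<subseteq> A - {a}" "card T = 5" "conicset Y (insert a T)"
      then have "a \<notin> T" by blast
      then have "card (insert a T) = 6" using T(2) by simp
      moreover have "insert a T \<subseteq> A" using T(1) a S(3) by blast
      ultimately have "insert a T \<subseteq> S" using con[of "insert a T"] T(3) by simp
      then show "\<exists>C\<in>{S - {a}}. T \<subseteq> C" using \<open>a \<notin> T\<close> by (simp add: subset_Diff_insert)
    qed
    show "b \<in> S - {a}" "f \<in> A - {a}" "f \<noteq> b" "S - {a} \<subseteq> A - {a}" using S(3) b f a by blast+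
  qed simp
  then show ?thesis unfolding A .
qed

lemma irr_on_conic_only:
  assumes S: "conicset Y S" "6 \<le> card S" "S \<subseteq> A" and a: "a \<in> S" and irr: "irr (stratum (A - {a}) Y)"
    and lines: "\<And>p q. p \<in> A \<Longrightarrow> q \<in> A \<Longrightarrow> p \<noteq> a \<Longrightarrow> q \<noteq> a \<Longrightarrow> p \<noteq> q \<Longrightarrow> \<not> cl Y a p q"
    and con: "\<And>C. C \<subseteq> A \<Longrightarrow> a \<in> C \<Longrightarrow> card C = 6 \<Longrightarrow> conicset Y C \<Longrightarrow> C \<subseteq> S"
  shows "irr (stratum A Y)"
proof -
  have A: "insert a (A - {a}) = A" and S': "insert a (S - {a}) = S" using a S(3) by blast+
  have "irr (stratum (insert a (A - {a})) Y)"
  proof (rule irr_conic[OF _ irr gA, where C = "S - {a}"])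
    show "nocoll Y (insert a (S - {a}))" "onconic Y (insert a (S - {a}))" unfolding S' using S by (auto simp: conicset_def)
    show "5 \<le> card (S - {a})" using S(2) a by simp
    show "pencil Y (A - {a}) a {}" by (rule pencilI) (use lines in blast)
    show "conics_at Y (A - {a}) a {S - {a}}"
    proof (rule conics_atI)
      fix T assume T: "T \<subseteq> A - {a}" "card T = 5" "conicset Y (insert a T)"
      then have "a \<notin> T" by blast
      then have "card (insert a T) = 6" using T(2) by simp
      moreover have "insert a T \<subseteq> A" using T(1) a S(3) by blast
      ultimately have "insert a T \<subseteq> S" using con[of "insert a T"] T(3) by simp
      then show "\<exists>C\<in>{S - {a}}. T \<subseteq> C" using \<open>a \<notin> T\<close> by (simp add: subset_Diff_insert)
    qed
    show "S - {a} \<subseteq> A - {a}" using S(3) by blast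
  qed simp
  then show ?thesis unfolding A .
qed

text \<open>A further conic through y would share five points with \<open>S\<close>, which would put
  y on the conic of \<open>S\<close>. If y lies on at most two lines it is removed. Otherwise y is
  on some line ab with a, b in \<open>S\<close>; this is the only line through a, because y is the
  only point off the conic, and a is removed.\<close>

lemma conic_plus_point:
  assumes S: "conicset Y S" "6 \<le> card S" and y: "y \<notin> S" and n: "\<not> conicset Y (insert y S)"
    and IH: "\<And>x. x \<in> insert y S \<Longrightarrow> irr (stratum (insert y S - {x}) Y)"
  shows "irr (stratum (insert y S) Y)"
proof -
  have only: "y \<notin> C" if "C \<subseteq> insert y S" "card C = 6" "conicset Y C" for C
  proof
    assume yC: "y \<in> C"
    have "5 \<le> card (C - {y})" using yC that(2) by simp
    then have "conicset Y (S \<union> C)" using conicset_join[OF S(1) that(3), of "C - {y}"] that(1) by blast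
    then show False using conicset_mono n yC by blast
  qed
  have con: "conics_at Y S y {}"
  proof (rule conics_atI)
    fix T assume T: "T \<subseteq> S" "card T = 5" "conicset Y (insert y T)"
    have "card (insert y T) = 6" using T y by (subst card_insert_disjoint) auto
    then show "\<exists>C\<in>{}. T \<subseteq> C" using only[of "insert y T"] T by blast
  qed
  show ?thesis
  proof (cases "three_lines Y S y")
    case False
    have "irr (stratum S Y)" using IH[of y] y by simp
    then show ?thesis using few_lines[OF y _ con False] by blast
  next
    case True
    then obtain a b where ab: "a \<in> S" "b \<in> S" "a \<noteq> b" "cl Y y a b" by (elim three_linesE) auto
    show ?thesis
    proof (rule irr_on_conic_and_line[OF S, of "insert y S" a b y])
      show aby: "cl Y a b y" using ab(4) cl_swap by blast
      show "cl Y a b q \<or> (\<forall>p\<in>insert y S. p \<noteq> a \<longrightarrow> p \<noteq> q \<longrightarrow> \<not> cl Y a q p)" if "q \<in> insert y S" "q \<notin> S" for q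
        using that aby by blast
      show "C \<subseteq> S" if "C \<subseteq> insert y S" "a \<in> C" "card C = 6" "conicset Y C" for C
        using only[of C] that by blast
    qed (use ab IH y in auto)
  qed
qed

text \<open>The seven points of the Fano plane are not realizable: the determinant equals a unit times \<open>2\<close>.\<close>
lemma fano:
  assumes nc: "det3 a b c \<noteq> 0" "det3 a b d \<noteq> 0" "det3 a c d \<noteq> 0" "det3 b c d \<noteq> 0"
    and p: "p \<noteq> 0" "det3 a b p = 0" "det3 c d p = 0"
    and q: "q \<noteq> 0" "det3 a c q = 0" "det3 b d q = 0"
    and r: "r \<noteq> 0" "det3 a d r = 0" "det3 b c r = 0"
  shows "det3 p q r \<noteq> 0"
proof -
  \<comment> \<open>The points p, q, r are the diagonal points of the quadrangle a, b, c, d, so each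
    is an intersection of opposite sides up to a nonzero factor.\<close>
  have meet: "\<exists>k. k \<noteq> 0 \<and> x = k *s crs (crs a' b') (crs c' d')"
    if h: "det3 a' b' c' \<noteq> 0" "crs c' d' \<noteq> 0" "x \<noteq> 0" "det3 a' b' x = 0" "det3 c' d' x = 0" for a' b' c' d' x
  proof -
    have "crs (crs a' b') (crs c' d') \<noteq> 0"
    proof
      assume z: "crs (crs a' b') (crs c' d') = 0"
      have "crs c' (crs (crs a' b') (crs c' d')) = - (det3 a' b' c' *s crs c' d')"
        unfolding crs_crs by (simp add: vec3_eq_iff algebra_simps)
      then show False unfolding z using h(1,2) by simp
    qed
    then obtain k where "x = k *s crs (crs a' b') (crs c' d')"
      using two_lines_meet[of "crs a' b'" x "crs c' d'"] h(4,5) by (auto simp: det3_alt(1))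
    then show ?thesis using h(3) by auto
  qed
  have cr: "crs c d \<noteq> 0" "crs b d \<noteq> 0" "crs b c \<noteq> 0"
    using nc(1-3) unfolding det3_def by auto
  obtain k1 where k1: "k1 \<noteq> 0" "p = k1 *s crs (crs a b) (crs c d)" using meet[OF nc(1) cr(1) p] by blast
  have "det3 a c b \<noteq> 0" "det3 a d b \<noteq> 0" using nc by (simp_all add: det3_perm[of b c a] det3_perm(4)[of b c a] det3_swap(2)[of a b c] det3_swap(2)[of a b d])
  then obtain k2 k3 where k2: "k2 \<noteq> 0" "q = k2 *s crs (crs a c) (crs b d)"
    and k3: "k3 \<noteq> 0" "r = k3 *s crs (crs a d) (crs b c)" using meet[OF _ cr(2) q] meet[OF _ cr(3) r] by blast
  define A B C D where "A = det3 b c d" and "B = det3 a c d" and "C = det3 a b d" and "D = det3 a b c"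
  have e1: "crs (crs a b) (crs c d) = C *s c - D *s d" by (simp add: crs_crs C_def D_def)
  have e2: "crs (crs a c) (crs b d) = B *s b + D *s d"
    by (simp add: crs_crs B_def D_def vec3_eq_iff det3_expand algebra_simps)
  have e3: "crs (crs a d) (crs b c) = - (B *s b) + C *s c"
    by (simp add: crs_crs B_def C_def vec3_eq_iff det3_expand algebra_simps)
  have "det3 (crs (crs a b) (crs c d)) (crs (crs a c) (crs b d)) (crs (crs a d) (crs b c)) = 2 * (A * B * C * D) \<or>
    det3 (crs (crs a b) (crs c d)) (crs (crs a c) (crs b d)) (crs (crs a d) (crs b c)) = - 2 * (A * B * C * D)"
    unfolding e1 e2 e3 A_def by (simp add: det3_expand algebra_simps)
  then show ?thesis unfolding k1(2) k2(2) k3(2) using k1 k2 k3 nc by (auto simp: A_def B_def C_def D_def)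
qed

lemma cl_det3: "cl Y i j k \<longleftrightarrow> det3 (Y i) (Y j) (Y k) = 0"
  by (simp add: cl_def coll_iff_det3)

lemma Y_nonzero: "Y i \<noteq> 0"
proof -
  have "crs (Y i) (Y (i + 1)) \<noteq> 0" using g by (simp add: gen_def)
  then show ?thesis by auto
qed

lemma no_fano:
  assumes "distinct [a, b, c, d]" "\<not> cl Y a b c" "cl Y a b p" "cl Y c d p" "cl Y a c q" "cl Y b d q" "cl Y a d r" "cl Y b c r"
    "cl Y p q r" "\<not> cl Y a b d" "\<not> cl Y a c d" "\<not> cl Y b c d"
  shows False
  using fano[of "Y a" "Y b" "Y c" "Y d" "Y p" "Y q" "Y r"] assms Y_nonzero by (simp add: cl_det3)

text \<open>Three lines through a point use up all six others, so any two points have a third one on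
  their line. Starting from lines xab, xcd, xef, the third point of ac is e or f, and this choice
  forces the remaining lines of a Fano plane, excluded by \<open>no_fano\<close>.\<close>

lemma seven_points:
  assumes A: "card A = 7" and three: "\<And>x. x \<in> A \<Longrightarrow> three_lines Y (A - {x}) x"
  shows False
proof -
  have partner: "\<exists>r\<in>A. r \<noteq> p \<and> r \<noteq> q \<and> cl Y p q r" if pq: "p \<in> A" "q \<in> A" "p \<noteq> q" for p q
  proof -
    obtain a b c d e f where t: "{a, b, c, d, e, f} \<subseteq> A - {p}" "distinct [a, b, c, d, e, f]" "cl Y p a b" "cl Y p c d" "cl Y p e f"
      by (rule three_linesE[OF three[OF pq(1)]])
    have "card {a, b, c, d, e, f} = card (A - {p})" using t(2) A pq(1) by simp
    then have "A - {p} = {a, b, c, d, e, f}" using t(1) by (metis card_subset_eq finite)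
    then have "q \<in> {a, b, c, d, e, f}" using pq by blast
    then consider "q = a" | "q = b" | "q = c" | "q = d" | "q = e" | "q = f" by blast
    moreover have "cl Y p b a" "cl Y p d c" "cl Y p f e" using t(3-5) cl_swap(2) by blast+
    ultimately have "\<exists>r\<in>{a, b, c, d, e, f}. r \<noteq> q \<and> cl Y p q r" using t(2-5) by cases auto
    then show ?thesis using t(1) by blast
  qed
  obtain x where x: "x \<in> A" using A by fastforce
  obtain a b c d e f where t: "{a, b, c, d, e, f} \<subseteq> A - {x}" "distinct [a, b, c, d, e, f]" "cl Y x a b" "cl Y x c d" "cl Y x e f"
    "\<not> cl Y x a c" "\<not> cl Y x a e" "\<not> cl Y x c e"
    by (rule three_linesE[OF three[OF x]])
  have "card {a, b, c, d, e, f} = card (A - {x})" using t(2) A x by simp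
  then have "A - {x} = {a, b, c, d, e, f}" using t(1) by (metis card_subset_eq finite)
  then have Aeq: "A = {x, a, b, c, d, e, f}" using x by blast
  have core: False
    if t: "distinct [x, a, b, c, d, e, f]" "A = {x, a, b, c, d, e, f}" "cl Y x a b" "cl Y x c d" "cl Y x e f"
    "\<not> cl Y x a c" "\<not> cl Y x a e" "\<not> cl Y x c e" and ace: "cl Y a c e" for a b c d e f
  proof -
    note ds = t(1)[simplified]
    have mem: "a \<in> A" "b \<in> A" "c \<in> A" "d \<in> A" using t(2) by simp_all
    have ab: "\<not> cl Y a b c" "\<not> cl Y a b d" "\<not> cl Y a c d" "\<not> cl Y b c d" "\<not> cl Y x a d" "\<not> cl Y x b c" "\<not> cl Y x b d"
    proof -
      show 1: "\<not> cl Y x a d" using cl_trans[of x d a c] t(4,6) ds cl_swap(2) by metis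
      show 2: "\<not> cl Y x b c" using cl_trans[of x b a c] t(3,6) ds by metis
      show 3: "\<not> cl Y x b d" using cl_trans[of x b a d] t(3) 1 ds by metis
      show "\<not> cl Y a b c" using cl_trans[of a b x c] t(3,6) ds cl_swap by metis
      show "\<not> cl Y a b d" using cl_trans[of a b x d] t(3) 1 ds cl_swap by metis
      show "\<not> cl Y a c d" using cl_trans[of c d x a] t(4,6) ds cl_swap by metis
      show "\<not> cl Y b c d" using cl_trans[of c d x b] t(4) 2 ds cl_swap by metis
    qed
    have ef: "\<not> cl Y x a f" "\<not> cl Y x c f" "\<not> cl Y x b e" "\<not> cl Y x b f" "\<not> cl Y x d e" "\<not> cl Y x d f"
    proof -
      show 1: "\<not> cl Y x a f" using cl_trans[of x f a e] t(5,7) ds cl_swap(2) by metis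
      show 2: "\<not> cl Y x c f" using cl_trans[of x f c e] t(5,8) ds cl_swap(2) by metis
      show "\<not> cl Y x b e" using cl_trans[of x b a e] t(3,7) ds by metis
      show "\<not> cl Y x b f" using cl_trans[of x b a f] t(3) 1 ds by metis
      show "\<not> cl Y x d e" using cl_trans[of x d c e] t(4,8) ds by metis
      show "\<not> cl Y x d f" using cl_trans[of x d c f] t(4) 2 ds by metis
    qed
    have adf: "cl Y a d f"
    proof -
      obtain r where r: "r \<in> A" "r \<noteq> a" "r \<noteq> d" "cl Y a d r" using partner[OF mem(1) mem(4)] ds by blast
      moreover have "r \<noteq> x" "r \<noteq> b" "r \<noteq> c" using r(4) ab cl_swap by metis+
      moreover have "r \<noteq> e" using r(4) ace cl_trans[of a e d c] ab(3) ds cl_swap by metis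
      ultimately show ?thesis using t(2) by blast
    qed
    have bcf: "cl Y b c f"
    proof -
      obtain r where r: "r \<in> A" "r \<noteq> b" "r \<noteq> c" "cl Y b c r" using partner[OF mem(2) mem(3)] ds by blast
      moreover have "r \<noteq> x" "r \<noteq> a" "r \<noteq> d" using r(4) ab cl_swap by metis+
      moreover have "r \<noteq> e" using r(4) ace cl_trans[of c e b a] ab(1) ds cl_swap by metis
      ultimately show ?thesis using t(2) by blast
    qed
    have bde: "cl Y b d e"
    proof -
      obtain r where r: "r \<in> A" "r \<noteq> b" "r \<noteq> d" "cl Y b d r" using partner[OF mem(2) mem(4)] ds by blast
      moreover have "r \<noteq> x" "r \<noteq> a" "r \<noteq> c" using r(4) ab cl_swap by metis+
      moreover have "r \<noteq> f" using r(4) bcf cl_trans[of b f d c] ab(4) ds cl_swap by metis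
      ultimately show ?thesis using t(2) by blast
    qed
    have "cl Y a b x" "cl Y c d x" using t(3,4) cl_swap by blast+
    moreover have "distinct [a, b, c, d]" using ds by simp
    ultimately show False using no_fano[of a b c d x e f] ab t(5) ace adf bcf bde by blast
  qed
  have ds: "distinct [x, a, b, c, d, e, f]" using t(1,2) by auto
  obtain r where r: "r \<in> A" "r \<noteq> a" "r \<noteq> c" "cl Y a c r" using partner[of a c] Aeq t(2) by auto
  have "r \<noteq> x" using r(4) t(6) cl_swap by metis
  moreover have "r \<noteq> b" using r(4) t(3,6) cl_trans[of a b c x] ds cl_swap by (metis distinct_length_2_or_more)
  moreover have "r \<noteq> d" using r(4) t(4,6) cl_trans[of c d a x] ds cl_swap by (metis distinct_length_2_or_more)
  ultimately have "r = e \<or> r = f" using r Aeq by blast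
  then show False
  proof
    assume "r = e"
    then show False using core[OF ds Aeq t(3-8)] r(4) by blast
  next
    \<comment> \<open>The points e and f exchange their roles.\<close>
    assume rf: "r = f"
    have "\<not> cl Y x a f" "\<not> cl Y x c f" using cl_trans[of x f a e] cl_trans[of x f c e] t(5,7,8) ds cl_swap(2) by auto
    moreover have "A = {x, a, b, c, d, f, e}" "distinct [x, a, b, c, d, f, e]" using Aeq ds by auto
    ultimately show False using core[of a b c d f e] t(3,4,5,6) r(4) rf cl_swap(2) by blast
  qed
qed

lemma irr_le_7: "card A \<le> 7 \<Longrightarrow> irr (stratum A Y)"
proof (induction "card A" arbitrary: A rule: less_induct)
  case less
  have IH: "irr (stratum (A - {x}) Y)" if "x \<in> A" for x
  proof -
    have "card (A - {x}) < card A" using that by (intro card_Diff1_less) auto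
    then show ?thesis using less(1)[of "A - {x}"] less(2) by linarith
  qed
  show ?case
  proof (cases "A = {}")
    case True
    have "X \<in> stratum {} Y" for X unfolding stratum_def gen_def by auto
    then have "stratum {} Y = UNIV" by blast
    then show ?thesis using irr_UNIV True by simp
  next
    case ne: False
    show ?thesis
    proof (cases "\<exists>S\<subseteq>A. card S = 6 \<and> conicset Y S")
      case True
      then obtain S where S: "S \<subseteq> A" "card S = 6" "conicset Y S" by blast
      show ?thesis
      proof (cases "conicset Y A")
        case True
        have "6 \<le> card A" using card_mono[of A S] S by simp
        then show ?thesis using conic_all[OF True] IH by blast
      next
        case False
        then have "A \<noteq> S" using S by blast
        then have "card S < card A" using S(1) by (simp add: psubset_card_mono psubset_eq)
        then have "card (A - S) = 1" using S less(2) by (simp add: card_Diff_subset)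
        then obtain y where "A - S = {y}" using card_1_singletonE by blast
        then have "A = insert y S" "y \<notin> S" using S(1) by blast+
        then show ?thesis using conic_plus_point[OF S(3), of y] S(2) False IH by simp
      qed
    next
      case noconic: False
      have con: "conics_at Y (A - {x}) x {}" if "x \<in> A" for x
      proof (rule conics_atI)
        fix T assume T: "T \<subseteq> A - {x}" "card T = 5" "conicset Y (insert x T)"
        have "card (insert x T) = 6" using T by (subst card_insert_disjoint) auto
        moreover have "insert x T \<subseteq> A" using T(1) that by blast
        ultimately show "\<exists>C\<in>{}. T \<subseteq> C" using noconic T(3) by blast
      qed
      \<comment> \<open>A point on three lines needs six companions, so only sets of seven points
        could fail, and these are excluded by \<open>seven_points\<close>.\<close>
      have "\<exists>x\<in>A. \<not> three_lines Y (A - {x}) x"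
      proof (rule ccontr)
        assume "\<not> ?thesis"
        then have three: "three_lines Y (A - {x}) x" if "x \<in> A" for x using that by blast
        obtain x where x: "x \<in> A" using ne by blast
        obtain a b c d e f where "{a, b, c, d, e, f} \<subseteq> A - {x}" "distinct [a, b, c, d, e, f]"
          by (rule three_linesE[OF three[OF x]])
        then have "6 \<le> card (A - {x})" using card_mono[of "A - {x}" "{a, b, c, d, e, f}"] by simp
        then have "card A = 7" using less(2) x by simp
        then show False using seven_points three by blast
      qed
      then obtain x where x: "x \<in> A" "\<not> three_lines Y (A - {x}) x" by blast
      have "irr (stratum (insert x (A - {x})) Y)" by (rule few_lines[OF _ IH[OF x(1)] con[OF x(1)] x(2)]) simp
      then show ?thesis using x(1) by (simp add: insert_absorb)
    qed
  qed
qed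

end

section \<open>Removing one of eight points\<close>

context general_tuple
begin

lemma irr_delete: "irr (stratum (UNIV - {x}) Y)"
  by (rule irr_le_7) (simp add: card_Diff_singleton)

lemma irr_few_lines_UNIV:
  assumes "\<not> three_lines Y (UNIV - {x}) x" "\<And>C. card C = 6 \<Longrightarrow> conicset Y C \<Longrightarrow> x \<notin> C"
  shows "irr (stratum UNIV Y)"
proof -
  have "conics_at Y (UNIV - {x}) x {}"
  proof (rule conics_atI)
    fix T assume T: "T \<subseteq> UNIV - {x}" "card T = 5" "conicset Y (insert x T)"
    have "card (insert x T) = 6" using T by (subst card_insert_disjoint) auto
    then show "\<exists>C\<in>{}. T \<subseteq> C" using assms(2) T(3) by blast
  qed
  then have "irr (stratum (insert x (UNIV - {x})) Y)" by (intro few_lines irr_delete assms(1)) auto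
  then show ?thesis by (simp add: insert_absorb)
qed

lemma three_linesD:
  assumes "three_lines Y (UNIV - {p}) p"
  obtains a b c d e f l where "UNIV = {p, l, a, b, c, d, e, f}" "distinct [p, l, a, b, c, d, e, f]"
    "cl Y p a b" "cl Y p c d" "cl Y p e f" "\<not> cl Y p a c" "\<not> cl Y p a e" "\<not> cl Y p c e"
proof -
  obtain a b c d e f where t: "{a, b, c, d, e, f} \<subseteq> UNIV - {p}" "distinct [a, b, c, d, e, f]"
    "cl Y p a b" "cl Y p c d" "cl Y p e f" "\<not> cl Y p a c" "\<not> cl Y p a e" "\<not> cl Y p c e"
    by (rule three_linesE[OF assms])
  have p: "card {p, a, b, c, d, e, f} = 7" using t(1,2) by auto
  have "card (UNIV - {p, a, b, c, d, e, f}) = 1" using p by (subst card_Diff_subset) auto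
  then obtain l where l: "UNIV - {p, a, b, c, d, e, f} = {l}" using card_1_singletonE by blast
  show ?thesis
  proof (rule that[OF _ _ t(3-8)])
    show "UNIV = {p, l, a, b, c, d, e, f}" using l by blast
    have "l \<notin> {p, a, b, c, d, e, f}" using l by blast
    then show "distinct [p, l, a, b, c, d, e, f]" using t(1,2) by auto
  qed
qed

section \<open>The Moebius-Kantor configuration\<close>

text \<open>Suppose that L has at least four points. Each i on L is on at least two further lines,
  each with two points off L; these exhaust the complement. Hence for a fixed x off L every line ix
  has a second point off L. Different i give different such points because x is not on L, so |L|
  would be at most 8 - |L| - 1.\<close>

lemma no_four_on_line:
  assumes three: "\<And>x. three_lines Y (UNIV - {x}) x"
    and pq: "p \<noteq> q" "cl Y p q r" "cl Y p q s" "r \<noteq> p" "r \<noteq> q" "s \<noteq> p" "s \<noteq> q"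
  shows "r = s"
proof (rule ccontr)
  assume rs: "r \<noteq> s"
  define L where "L = {i. cl Y p q i}"
  have rel: "cl Y i j k" if "i \<in> L" "j \<in> L" "k \<in> L" for i j k
  proof -
    have "crs (Y p) (Y q) \<noteq> 0" using g pq(1) by (simp add: gen_def)
    moreover have "dot3 (crs (Y p) (Y q)) (Y x) = 0" if "x \<in> L" for x
      using that by (simp add: L_def cl_det3 det3_alt(1))
    ultimately show ?thesis using that unfolding cl_def coll_def by blast
  qed
  have closed: "k \<in> L" if "i \<in> L" "j \<in> L" "i \<noteq> j" "cl Y i j k" for i j k
  proof -
    have 1: "cl Y i j p" "cl Y i j q" using rel that cl_refl L_def by auto
    show ?thesis
    proof (cases "i = p")
      case True
      then show ?thesis using that 1 cl_trans[of p j q k] cl_swap(2) by (auto simp: L_def)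
    next
      case False
      have a: "cl Y i p k" using cl_trans[of i j p k] 1(1) that(3,4) cl_swap(2) False that
        by (metis cl_refl(2) cl_refl(3))
      have b: "cl Y p i q" using rel[of p i q] that cl_refl by (auto simp: L_def)
      have "cl Y p q i" "cl Y p i k" using a b cl_swap by blast+
      then show ?thesis using cl_trans[of p i q k] False by (simp add: L_def)
    qed
  qed
  have "{p, q, r, s} \<subseteq> L" using pq cl_refl by (auto simp: L_def)
  moreover have "card {p, q, r, s} = 4" using pq rs by simp
  ultimately have L4: "4 \<le> card L" by (metis card_mono finite)
  have partner: "\<exists>y. y \<in> - L - {x} \<and> cl Y i x y" if i: "i \<in> L" and x: "x \<notin> L" for i x
  proof -
    obtain a b c d e f l where t: "UNIV = {i, l, a, b, c, d, e, f}" "distinct [i, l, a, b, c, d, e, f]"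
      "cl Y i a b" "cl Y i c d" "cl Y i e f" "\<not> cl Y i a c" "\<not> cl Y i a e" "\<not> cl Y i c e"
      using three_linesD[OF three[of i]] .
    note ds = t(2)[simplified]
    have pc: "u \<in> L \<longleftrightarrow> v \<in> L" if "cl Y i u v" "i \<noteq> u" "i \<noteq> v" for u v
      using closed[OF i, of u v] closed[OF i, of v u] that cl_swap(2) by blast
    have ab: "a \<in> L \<longleftrightarrow> b \<in> L" and cd: "c \<in> L \<longleftrightarrow> d \<in> L" and ef: "e \<in> L \<longleftrightarrow> f \<in> L"
      using pc t(3-5) ds by auto
    have no2: "\<not> (a \<in> L \<and> c \<in> L)" "\<not> (a \<in> L \<and> e \<in> L)" "\<not> (c \<in> L \<and> e \<in> L)"
      using rel[OF i] t(6-8) by blast+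
    have out: "\<exists>y. y \<in> - L - {x} \<and> cl Y i x y"
      if "u \<notin> L" "v \<notin> L" "u' \<notin> L" "v' \<notin> L" "distinct [u, v, u', v']" "cl Y i u v" "cl Y i u' v'" for u v u' v'
    proof -
      have "card {u, v, u', v'} = 4" using that by simp
      moreover have "card (- L) \<le> 4" using L4 by (simp add: Compl_eq_Diff_UNIV card_Diff_subset)
      ultimately have "{u, v, u', v'} = - L" using that(1-4) by (intro card_seteq) auto
      then have "x \<in> {u, v, u', v'}" using x by blast
      then show ?thesis using that cl_swap(2) by auto
    qed
    consider "a \<notin> L" "c \<notin> L" | "a \<notin> L" "e \<notin> L" | "c \<notin> L" "e \<notin> L" using no2 by blast
    then show ?thesis
    proof cases
      case 1 then show ?thesis using out[of a b c d] ab cd t(3,4) ds by simp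
    next
      case 2 then show ?thesis using out[of a b e f] ab ef t(3,5) ds by simp
    next
      case 3 then show ?thesis using out[of c d e f] cd ef t(4,5) ds by simp
    qed
  qed
  have "- L \<noteq> {}"
  proof
    assume "- L = {}"
    then have "L = UNIV" by blast
    then have "\<not> three_lines Y (UNIV - {p}) p" using rel unfolding three_lines_def by blast
    then show False using three by blast
  qed
  then obtain x where x: "x \<notin> L" by blast
  obtain \<rho> where \<rho>: "\<And>i. i \<in> L \<Longrightarrow> \<rho> i \<in> - L - {x} \<and> cl Y i x (\<rho> i)"
    using partner[OF _ x] by metis
  have "inj_on \<rho> L"
  proof (rule inj_onI, rule ccontr)
    fix i j assume ij: "i \<in> L" "j \<in> L" "\<rho> i = \<rho> j" "i \<noteq> j"
    have c: "cl Y x (\<rho> i) i" "cl Y x (\<rho> i) j" using \<rho>[OF ij(1)] \<rho>[OF ij(2)] ij(3) cl_swap by metis+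
    have "x \<noteq> \<rho> i" using \<rho>[OF ij(1)] by blast
    then have "cl Y x i j" using c cl_trans[of x "\<rho> i" i j] cl_swap(2) by blast
    then have "x \<in> L" using closed[of i j x] ij cl_swap by blast
    then show False using x by blast
  qed
  then have "card L \<le> card (- L - {x})" using \<rho> by (intro card_inj_on_le[of \<rho>]) auto
  also have "\<dots> = 8 - card L - 1" using x by (simp add: Compl_eq_Diff_UNIV card_Diff_subset)
  finally show False using L4 by simp
qed

text \<open>Every point lies on exactly three lines with three points each, so it is joined to six
  of the other seven and has one opposite point. Opposition is an involution. Together with the
  uniqueness of the third point on a line it forces the whole configuration.\<close>

lemma moebius_kantor_labels:
  assumes three: "\<And>x. three_lines Y (UNIV - {x}) x"
  obtains a b c d e f h0 h where "distinct [a, b, c, d, e, f, h0, h]" "UNIV = {a, b, c, d, e, f, h0, h}"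
    "\<And>T. card T = 3 \<Longrightarrow> coll Y T \<longleftrightarrow>
      T \<in> {{a,b,c},{a,d,e},{a,f,h0},{b,d,f},{b,e,h},{c,e,h0},{c,f,h},{d,h0,h}}"
proof -
  note result = that
  define opp where "opp p l \<longleftrightarrow> p \<noteq> l \<and> (\<forall>r. r \<noteq> p \<longrightarrow> r \<noteq> l \<longrightarrow> \<not> cl Y p l r) \<and>
      (\<forall>q. q \<noteq> p \<longrightarrow> q \<noteq> l \<longrightarrow> (\<exists>r. r \<noteq> p \<and> r \<noteq> q \<and> r \<noteq> l \<and> cl Y p q r))" for p l
  have uniq: "r = s" if "p \<noteq> q" "cl Y p q r" "cl Y p q s" "r \<noteq> p" "r \<noteq> q" "s \<noteq> p" "s \<noteq> q" for p q r s
    using no_four_on_line[OF three that] .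
  have oppI: "opp p l" if t: "UNIV = {p, l, a, b, c, d, e, f}" "distinct [p, l, a, b, c, d, e, f]"
    "cl Y p a b" "cl Y p c d" "cl Y p e f" for p l a b c d e f
  proof -
    note ds = t(2)[simplified]
    have sw: "cl Y p b a" "cl Y p d c" "cl Y p f e" using t(3-5) cl_swap(2) by blast+
    have part: "\<exists>r. r \<noteq> p \<and> r \<noteq> q \<and> r \<noteq> l \<and> cl Y p q r" if "q \<noteq> p" "q \<noteq> l" for q
    proof -
      have "q \<in> {a, b, c, d, e, f}" using t(1) that by blast
      then show ?thesis using sw t(3-5) ds by (metis insertE singletonD)
    qed
    moreover have "\<not> cl Y p l r" if rn: "r \<noteq> p" "r \<noteq> l" for r
    proof
      assume lr: "cl Y p l r"
      obtain s where s: "s \<noteq> p" "s \<noteq> r" "s \<noteq> l" "cl Y p r s" using part[OF rn] by blast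
      have "cl Y p r l" using lr cl_swap(2) by blast
      then show False using uniq[of p r l s] s rn ds by blast
    qed
    ultimately show ?thesis unfolding opp_def using ds by blast
  qed
  have opp_ex: "\<exists>l. opp p l" for p
    using three_linesD[OF three[of p]] oppI by metis
  have opp_sym: "opp l p" if "opp p l" for p l
  proof -
    obtain m where m: "opp l m" using opp_ex by blast
    have "m = p"
    proof (rule ccontr)
      assume "m \<noteq> p"
      then obtain r where "r \<noteq> l" "r \<noteq> p" "cl Y l p r" using m \<open>opp p l\<close> unfolding opp_def by metis
      then show False using that cl_swap(1) unfolding opp_def by blast
    qed
    then show ?thesis using m by simp
  qed
  have opp_uniq: "l = m" if "opp p l" "opp p m" for p l m
    using that unfolding opp_def by metis
  have part: "\<exists>r. r \<noteq> p \<and> r \<noteq> q \<and> r \<noteq> l \<and> cl Y p q r" if "opp p l" "q \<noteq> p" "q \<noteq> l" for p l q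
    using that unfolding opp_def by blast
  \<comment> \<open>The standard situation: h opposite a, k opposite b, and a line bdf. Each
    remaining line is found by excluding all but one candidate for its third point.\<close>
  have core: thesis
    if un: "UNIV = {a, b, c, d, e, f, k, h}" and dist: "distinct [a, b, c, d, e, f, k, h]"
      and l1: "cl Y a b c" "cl Y a d e" "cl Y a f k" and bdf: "cl Y b d f" and oa: "opp a h" and ob: "opp b k"
    for a b c d e f k h
  proof -
    note ds = dist[simplified] distinct_sym[OF dist]
    have ruled: "r \<noteq> z" if "cl Y x y r" "cl Y y z w" "x \<noteq> y" "y \<noteq> z" "x \<noteq> z" "x \<noteq> w" "w \<noteq> y" "w \<noteq> z" for x y z w r
    proof
      assume "r = z"
      then have "cl Y y z x" using that(1) cl_swap by metis
      then show False using uniq[of y z x w] that by blast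
    qed
    have beh: "cl Y b e h"
    proof -
      obtain r where r: "r \<noteq> b" "r \<noteq> e" "r \<noteq> k" "cl Y b e r" using part[OF ob, of e] ds by blast
      have "r \<noteq> a" using ruled[OF r(4), of a d] l1(2) ds cl_swap by metis
      moreover have "r \<noteq> c" using uniq[of b c a e] l1(1) r(4) ds cl_swap by metis
      moreover have "r \<noteq> d" using uniq[of b d f e] bdf r(4) ds cl_swap by metis
      moreover have "r \<noteq> f" using uniq[of b f d e] bdf r(4) ds cl_swap by metis
      moreover have "r \<in> {a, b, c, d, e, f, k, h}" using un by blast
      ultimately show ?thesis using r by blast
    qed
    have oh: "opp h a" and ok: "opp k b" using opp_sym oa ob by blast+
    have hfc: "cl Y h f c"
    proof -
      obtain r where r: "r \<noteq> h" "r \<noteq> f" "r \<noteq> a" "cl Y h f r" using part[OF oh, of f] ds by blast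
      have "r \<noteq> b" using uniq[of b f d h] bdf r(4) ds cl_swap by metis
      moreover have "r \<noteq> d" using uniq[of d f b h] bdf r(4) ds cl_swap by metis
      moreover have "r \<noteq> e" using uniq[of e h b f] beh r(4) ds cl_swap by metis
      moreover have "r \<noteq> k" using uniq[of f k a h] l1(3) r(4) ds cl_swap by metis
      moreover have "r \<in> {a, b, c, d, e, f, k, h}" using un by blast
      ultimately show ?thesis using r by blast
    qed
    have hdk: "cl Y h d k"
    proof -
      obtain r where r: "r \<noteq> h" "r \<noteq> d" "r \<noteq> a" "cl Y h d r" using part[OF oh, of d] ds by blast
      have "r \<noteq> b" using uniq[of b d f h] bdf r(4) ds cl_swap by metis
      moreover have "r \<noteq> f" using uniq[of d f b h] bdf r(4) ds cl_swap by metis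
      moreover have "r \<noteq> e" using uniq[of e h b d] beh r(4) ds cl_swap by metis
      moreover have "r \<noteq> c" using uniq[of h c f d] hfc r(4) ds cl_swap by metis
      moreover have "r \<in> {a, b, c, d, e, f, k, h}" using un by blast
      ultimately show ?thesis using r by blast
    qed
    have oc: "opp c d"
    proof -
      obtain m where m: "opp c m" using opp_ex by blast
      have "m \<noteq> c" using m unfolding opp_def by blast
      moreover have "m \<noteq> a" using opp_uniq[OF oa] opp_sym[OF m] ds by metis
      moreover have "m \<noteq> b" using opp_uniq[OF ob] opp_sym[OF m] ds by metis
      moreover have "m \<noteq> h" using opp_uniq[OF oh] opp_sym[OF m] ds by metis
      moreover have "m \<noteq> k" using opp_uniq[OF ok] opp_sym[OF m] ds by metis
      moreover have "m \<noteq> f" using m hfc ds cl_swap unfolding opp_def by metis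
      moreover have "m \<noteq> e"
      proof
        assume me: "m = e"
        obtain r where r: "r \<noteq> c" "r \<noteq> d" "r \<noteq> e" "cl Y c d r" using part[OF m, of d] ds me by blast
        have "r \<noteq> a" using uniq[of c a b d] l1(1) r(4) ds cl_swap by metis
        moreover have "r \<noteq> b" using uniq[of c b a d] l1(1) r(4) ds cl_swap by metis
        moreover have "r \<noteq> f" using uniq[of c f h d] hfc r(4) ds cl_swap by metis
        moreover have "r \<noteq> h" using uniq[of c h f d] hfc r(4) ds cl_swap by metis
        moreover have "r \<noteq> k" using uniq[of d k h c] hdk r(4) ds cl_swap by metis
        moreover have "r \<in> {a, b, c, d, e, f, k, h}" using un by blast
        ultimately show False using r by blast
      qed
      moreover have "m \<in> {a, b, c, d, e, f, k, h}" using un by blast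
      ultimately have "m = d" by blast
      then show ?thesis using m by simp
    qed
    have cek: "cl Y c e k"
    proof -
      obtain r where r: "r \<noteq> c" "r \<noteq> e" "r \<noteq> d" "cl Y c e r" using part[OF oc, of e] ds by blast
      have "r \<noteq> a" using uniq[of c a b e] l1(1) r(4) ds cl_swap by metis
      moreover have "r \<noteq> b" using uniq[of c b a e] l1(1) r(4) ds cl_swap by metis
      moreover have "r \<noteq> f" using uniq[of c f h e] hfc r(4) ds cl_swap by metis
      moreover have "r \<noteq> h" using uniq[of c h f e] hfc r(4) ds cl_swap by metis
      moreover have "r \<in> {a, b, c, d, e, f, k, h}" using un by blast
      ultimately show ?thesis using r by blast
    qed
    have oe: "opp e f"
    proof -
      obtain m where m: "opp e m" using opp_ex by blast
      have "m \<noteq> e" using m unfolding opp_def by blast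
      moreover have "m \<noteq> a" using opp_uniq[OF oa] opp_sym[OF m] ds by metis
      moreover have "m \<noteq> b" using opp_uniq[OF ob] opp_sym[OF m] ds by metis
      moreover have "m \<noteq> h" using opp_uniq[OF oh] opp_sym[OF m] ds by metis
      moreover have "m \<noteq> k" using opp_uniq[OF ok] opp_sym[OF m] ds by metis
      moreover have "m \<noteq> c" using opp_uniq[OF oc] opp_sym[OF m] ds by metis
      moreover have "m \<noteq> d" using opp_uniq[OF opp_sym[OF oc]] opp_sym[OF m] ds by metis
      moreover have "m \<in> {a, b, c, d, e, f, k, h}" using un by blast
      ultimately show ?thesis using m by blast
    qed
    let ?\<L> = "{{a,b,c},{a,d,e},{a,f,k},{b,d,f},{b,e,h},{c,e,k},{c,f,h},{d,k,h}}"
    have lines: "coll Y L" "card L = 3" if "L \<in> ?\<L>" for L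
    proof -
      have "coll Y {a,b,c}" "coll Y {a,d,e}" "coll Y {a,f,k}" "coll Y {b,d,f}" "coll Y {b,e,h}" "coll Y {c,e,k}"
        "coll Y {c,f,h}" "coll Y {d,k,h}"
        using l1 bdf beh cek cl_swap(1)[OF cl_swap(2)[OF cl_swap(1)[OF hfc]]] hfc hdk
        unfolding cl_def by (simp_all add: insert_commute)
      then show "coll Y L" using that by blast
      show "card L = 3" using that ds by auto
    qed
    define P where "P i j \<longleftrightarrow> (\<exists>L\<in>?\<L>. i \<in> L \<and> j \<in> L)" for i j
    have Ps: "P a b" "P a c" "P a d" "P a e" "P a f" "P a k" "P b a" "P b c"
      "P b d" "P b e" "P b f" "P b h" "P c a" "P c b" "P c e" "P c f"
      "P c k" "P c h" "P d a" "P d b" "P d e" "P d f" "P d k" "P d h"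
      "P e a" "P e b" "P e c" "P e d" "P e k" "P e h" "P f a" "P f b"
      "P f c" "P f d" "P f k" "P f h" "P k a" "P k c" "P k d" "P k e"
      "P k f" "P k h" "P h b" "P h c" "P h d" "P h e" "P h f" "P h k"
      by (simp_all add: P_def)
    \<comment> \<open>Every pair of points is joined by one of the eight lines or is opposite, so
      there is no ninth line.\<close>
    have pairs: "i = j \<or> P i j \<or> opp i j" for i j
    proof -
      note o = oa ob oc oe oh ok opp_sym[OF oc] opp_sym[OF oe]
      have "i \<in> {a, b, c, d, e, f, k, h}" "j \<in> {a, b, c, d, e, f, k, h}" using un by blast+
      then show ?thesis by (elim insertE emptyE; simp add: o Ps)
    qed
    show thesis
    proof (rule result[OF dist un])
      fix T :: "8 set" assume T: "card T = 3"
      show "coll Y T \<longleftrightarrow> T \<in> ?\<L>"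
      proof
        assume c: "coll Y T"
        obtain x y z where xyz: "T = {x, y, z}" "x \<noteq> y" "x \<noteq> z" "y \<noteq> z" using card3E[OF T] .
        have cxyz: "cl Y x y z" using c xyz by (simp add: cl_def)
        then have "\<not> opp x y" using xyz unfolding opp_def by metis
        then obtain L where L: "L \<in> ?\<L>" "x \<in> L" "y \<in> L" using pairs[of x y] xyz unfolding P_def by blast
        have "card (L - {x, y}) = 1" using lines(2)[OF L(1)] L xyz by (simp add: card_Diff_subset)
        then obtain w where w: "L - {x, y} = {w}" using card_1_singletonE by blast
        then have Lw: "L = {x, y, w}" "w \<noteq> x" "w \<noteq> y" using L by blast+
        have "cl Y x y w" using lines(1)[OF L(1)] Lw by (simp add: cl_def)
        then have "z = w" using uniq[of x y z w] cxyz xyz Lw by blast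
        then have "T = L" using Lw(1) xyz(1) by simp
        then show "T \<in> ?\<L>" using L(1) by simp
      next
        assume "T \<in> ?\<L>" then show "coll Y T" by (rule lines(1))
      qed
    qed
  qed
  obtain a b c d e f k h where t: "UNIV = {a, h, b, c, d, e, f, k}" "distinct [a, h, b, c, d, e, f, k]"
    "cl Y a b c" "cl Y a d e" "cl Y a f k"
    using three_linesD[of undefined] three by metis
  note ds = t(2)[simplified] distinct_sym[OF t(2)]
  have oa: "opp a h" by (rule oppI[OF t])
  obtain m where m: "opp b m" using opp_ex by blast
  have mbc: "m \<noteq> b" "m \<noteq> a" "m \<noteq> c" "m \<noteq> h"
  proof -
    show "m \<noteq> b" using m unfolding opp_def by blast
    show "m \<noteq> a" using opp_uniq[OF oa] opp_sym[OF m] ds by metis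
    show "m \<noteq> h" using opp_uniq[OF opp_sym[OF oa]] opp_sym[OF m] ds by metis
    show "m \<noteq> c" using m t(3) ds cl_swap unfolding opp_def by metis
  qed
  \<comment> \<open>The point opposite b is one of d, e, f, k; exchanging the lines ade and afk, or
    the points on them, moves it to k.\<close>
  have step: thesis
    if un: "UNIV = {a, h, b, c, d, e, f, k}" and dist: "distinct [a, h, b, c, d, e, f, k]"
      and l: "cl Y a b c" "cl Y a d e" "cl Y a f k" and ob: "opp b k" for d e f k
  proof -
    note ds = dist[simplified] distinct_sym[OF dist]
    obtain r where r: "r \<noteq> b" "r \<noteq> f" "r \<noteq> k" "cl Y b f r" using part[OF ob, of f] ds by blast
    have "r \<noteq> a" using uniq[of a f k b] l(3) r(4) ds cl_swap by metis
    moreover have "r \<noteq> c" using uniq[of b c a f] l(1) r(4) ds cl_swap by metis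
    \<comment> \<open>If bfh were a line, no candidate would be left for the third point of
      bd.\<close>
    moreover have "r \<noteq> h"
    proof
      assume rh: "r = h"
      obtain s where s: "s \<noteq> b" "s \<noteq> d" "s \<noteq> k" "cl Y b d s" using part[OF ob, of d] ds by blast
      have "s \<noteq> a" using uniq[of a d e b] l(2) s(4) ds cl_swap by metis
      moreover have "s \<noteq> c" using uniq[of b c a d] l(1) s(4) ds cl_swap by metis
      moreover have "s \<noteq> f" using uniq[of b f h d] r(4) rh s(4) ds cl_swap by metis
      moreover have "s \<noteq> h" using uniq[of b h f d] r(4) rh s(4) ds cl_swap by metis
      moreover have "s \<noteq> e" using uniq[of d e a b] l(2) s(4) ds cl_swap by metis
      moreover have "s \<in> {a, h, b, c, d, e, f, k}" using un by blast
      ultimately show False using s by blast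
    qed
    moreover have "r \<in> {a, h, b, c, d, e, f, k}" using un by blast
    ultimately have "r = d \<or> r = e" using r by blast
    then show thesis
    proof
      assume "r = d"
      then have "cl Y b d f" using r(4) cl_swap(2) by blast
      then show thesis by (intro core[of a b c d e f k h] l oa ob) (use un dist in auto)
    next
      assume "r = e"
      then have "cl Y b e f" using r(4) cl_swap(2) by blast
      then show thesis by (intro core[of a b c e d f k h] l oa ob cl_swap(2)[OF l(2)]) (use un dist in auto)
    qed
  qed
  have "m \<in> {a, h, b, c, d, e, f, k}" using t(1) by blast
  then consider "m = d" | "m = e" | "m = f" | "m = k" using mbc by blast
  then show thesis
  proof cases
    case 1 then show thesis using m t by (intro step[of f k e d] t cl_swap(2)[OF t(4)]) auto
  next
    case 2 then show thesis using m t by (intro step[of f k d e] t) auto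
  next
    case 3 then show thesis using m t by (intro step[of d e k f] t cl_swap(2)[OF t(5)]) auto
  next
    case 4 then show thesis using m t by (intro step[of d e f k] t) auto
  qed
qed

end

section \<open>Eight points with a single conic\<close>

context general_tuple
begin

lemma config_coll_exact:
  assumes "\<And>L. L \<in> \<L> \<Longrightarrow> card L = 3 \<and> coll Y L"
    and "\<And>i j k. i \<noteq> j \<Longrightarrow> i \<noteq> k \<Longrightarrow> j \<noteq> k \<Longrightarrow> cl Y i j k \<Longrightarrow> \<exists>L\<in>\<L>. {i, j, k} \<subseteq> L"
    and "\<And>C. C \<in> \<J> \<Longrightarrow> card C = 6 \<and> conicset Y C"
    and "\<And>C. card C = 6 \<Longrightarrow> conicset Y C \<Longrightarrow> C \<in> \<J>"
  shows "config Y \<L> \<J>"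
  unfolding config_def
proof (intro conjI allI impI g)
  fix T :: "8 set" assume T: "card T = 3"
  show "coll Y T \<longleftrightarrow> (\<exists>L\<in>\<L>. T \<subseteq> L)"
  proof
    assume c: "coll Y T"
    obtain i j k where "T = {i, j, k}" "i \<noteq> j" "i \<noteq> k" "j \<noteq> k" using card3E[OF T] .
    then show "\<exists>L\<in>\<L>. T \<subseteq> L" using assms(2) c unfolding cl_def by blast
  next
    assume "\<exists>L\<in>\<L>. T \<subseteq> L"
    then show "coll Y T" using assms(1) coll_mono by blast
  qed
next
  fix S :: "8 set" assume S: "card S = 6"
  show "nocoll Y S \<and> onconic Y S \<longleftrightarrow> (\<exists>C\<in>\<J>. S \<subseteq> C)"
  proof
    assume "nocoll Y S \<and> onconic Y S"
    then show "\<exists>C\<in>\<J>. S \<subseteq> C" using assms(4)[OF S] unfolding conicset_def by blast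
  next
    assume "\<exists>C\<in>\<J>. S \<subseteq> C"
    then show "nocoll Y S \<and> onconic Y S" using assms(3) conicset_mono unfolding conicset_def by blast
  qed
qed

lemma conicset_no_line: "conicset Y S \<Longrightarrow> i \<in> S \<Longrightarrow> j \<in> S \<Longrightarrow> k \<in> S \<Longrightarrow> i \<noteq> j \<Longrightarrow> i \<noteq> k \<Longrightarrow> j \<noteq> k \<Longrightarrow> \<not> cl Y i j k"
  using nocoll_cl unfolding conicset_def by blast

text \<open>Joining points of \<open>S\<close> that are collinear with x, or with y, gives two
  matchings, because a line meets the conic at most twice. If the line xy meets \<open>S\<close>,
  some point of \<open>S\<close> is removable; if x or y is on at most two lines, that point is.
  Otherwise both matchings are perfect and disjoint, and on six points their union is a
  hexagon.\<close>

lemma irr_one_conic: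
  assumes S: "conicset Y S" "card S = 6" and only: "\<And>C. card C = 6 \<Longrightarrow> conicset Y C \<Longrightarrow> C = S"
    and un: "UNIV = insert x (insert y S)" and xy: "x \<noteq> y" "x \<notin> S" "y \<notin> S"
  shows "irr (stratum UNIV Y)"
proof (cases "\<exists>a\<in>S. cl Y x y a")
  case True
  then obtain a where a: "a \<in> S" "cl Y x y a" by blast
  have S6: "6 \<le> card S" using S(2) by simp
  have con: "C \<subseteq> S" if "card C = 6" "conicset Y C" for C using only[OF that] by simp
  show ?thesis
  proof (cases "\<exists>b\<in>S. b \<noteq> a \<and> cl Y x y b")
    case True
    then obtain b where b: "b \<in> S" "b \<noteq> a" "cl Y x y b" by blast
    have ax: "cl Y a b x" using cl_trans[of x y a b] a(2) b(3) xy cl_swap by metis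
    have "cl Y y x a" "cl Y y x b" using a(2) b(3) cl_swap by blast+
    then have "cl Y y a b" using cl_trans[of y x a b] xy cl_swap(2) by metis
    then have ay: "cl Y a b y" using cl_swap by blast
    show ?thesis
    proof (rule irr_on_conic_and_line[OF S(1) S6 _ a(1) irr_delete b(1,2) _ _ ax])
      show "cl Y a b q \<or> (\<forall>p\<in>UNIV. p \<noteq> a \<longrightarrow> p \<noteq> q \<longrightarrow> \<not> cl Y a q p)" if "q \<notin> S" for q
      proof -
        have "q = x \<or> q = y" using un that by blast
        then show ?thesis using ax ay by blast
      qed
    qed (use xy con in auto)
  next
    case False
    then have a_only: "b = a" if "b \<in> S" "cl Y x y b" for b using that by blast
    have uniq: "p = q" if "b \<in> S" "p \<in> S" "q \<in> S" "b \<noteq> p" "b \<noteq> q" "cl Y x b p" "cl Y x b q" for b p q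
    proof (rule ccontr)
      assume pq: "p \<noteq> q"
      have "b \<noteq> x" using that(1) xy by blast
      then have "cl Y b p q" using cl_trans[of b x p q] that(6,7) cl_swap by metis
      then show False using conicset_no_line[OF S(1) that(1-3)] that pq by blast
    qed
    \<comment> \<open>Otherwise the lines through x would pair off the five points of
      \<open>S\<close> other than a, but five is odd.\<close>
    have "\<exists>b\<in>S. b \<noteq> a \<and> (\<forall>p\<in>S. p \<noteq> b \<longrightarrow> \<not> cl Y x b p)"
    proof (rule ccontr)
      assume "\<not> ?thesis"
      then have part: "\<exists>p\<in>S. p \<noteq> b \<and> cl Y x b p" if "b \<in> S" "b \<noteq> a" for b using that by blast
      have pa: "p \<noteq> a" if "b \<in> S" "b \<noteq> a" "cl Y x b p" for b p
      proof
        assume "p = a"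
        then have "cl Y x a b" using that(3) cl_swap(2) by blast
        then have "cl Y x y b" using cl_trans[of x a y b] a xy by blast
        then show False using a_only that by blast
      qed
      have "card (S - {a}) = 5" using S(2) a(1) by simp
      then have "S - {a} \<noteq> {}" using card_gt_0_iff[of "S - {a}"] by simp
      then obtain b where b: "b \<in> S" "b \<noteq> a" by blast
      obtain p where p: "p \<in> S" "p \<noteq> b" "cl Y x b p" using part[OF b] by blast
      have "card (S - {a, b, p}) = 3" using S(2) a(1) b p pa[OF b p(3)] by (simp add: card_Diff_subset)
      then have "S - {a, b, p} \<noteq> {}" using card_gt_0_iff[of "S - {a, b, p}"] by simp
      then obtain d where d: "d \<in> S" "d \<noteq> a" "d \<noteq> b" "d \<noteq> p" by blast
      obtain e where e: "e \<in> S" "e \<noteq> d" "cl Y x d e" using part[OF d(1,2)] by blast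
      have p': "cl Y x p b" and e': "cl Y x e d" using p(3) e(3) cl_swap(2) by blast+
      have eb: "e \<noteq> b" using uniq[of b p d] p b d e' by metis
      have ep: "e \<noteq> p" using uniq[of p b d] p p' b d e' by metis
      have ea: "e \<noteq> a" using pa d e by blast
      have "card (S - {a, b, p, d, e}) = 1"
        using S(2) a(1) b p pa[OF b p(3)] d e eb ep ea by (subst card_Diff_subset) auto
      then obtain f where f: "S - {a, b, p, d, e} = {f}" using card_1_singletonE by blast
      then have f: "f \<in> S" "f \<noteq> a" "f \<noteq> b" "f \<noteq> p" "f \<noteq> d" "f \<noteq> e" "S = {a, b, p, d, e, f}"
        using a b p d e by blast+
      obtain q where q: "q \<in> S" "q \<noteq> f" "cl Y x f q" using part[OF f(1,2)] by blast
      have q': "cl Y x q f" using q(3) cl_swap(2) by blast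
      have "q \<noteq> a" using pa f q by blast
      moreover have "q \<noteq> b" using uniq[of b p f] p b f q' by metis
      moreover have "q \<noteq> p" using uniq[of p b f] p p' b f q' by metis
      moreover have "q \<noteq> d" using uniq[of d e f] d e f q' by metis
      moreover have "q \<noteq> e" using uniq[of e d f] d e e' f q' by metis
      ultimately show False using q f by blast
    qed
    then obtain b where b: "b \<in> S" "b \<noteq> a" and bx: "\<And>p. p \<in> S \<Longrightarrow> p \<noteq> b \<Longrightarrow> \<not> cl Y x b p" by blast
    have bxy: "\<not> cl Y x y b" using a_only b by blast
    have bx': "\<not> cl Y b x p" if "p \<noteq> b" "p \<noteq> x" for p
    proof
      assume c: "cl Y b x p"
      have "p = y \<or> p \<in> S" using un that by blast
      then show False
      proof
        assume "p = y"
        then show False using c bxy cl_swap by blast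
      next
        assume "p \<in> S"
        then show False using bx[of p] that c cl_swap by blast
      qed
    qed
    show ?thesis
    \<comment> \<open>No line joins b to x, so every line through b and two other points passes
      through y.\<close>
    proof (cases "\<exists>q\<in>S. q \<noteq> b \<and> cl Y y b q")
      case True
      then obtain q where q: "q \<in> S" "q \<noteq> b" "cl Y y b q" by blast
      have bqy: "cl Y b q y" using q(3) cl_swap by blast
      show ?thesis
      proof (rule irr_on_conic_and_line[OF S(1) S6 _ b(1) irr_delete q(1,2) _ _ bqy])
        show "cl Y b q r \<or> (\<forall>p\<in>UNIV. p \<noteq> b \<longrightarrow> p \<noteq> r \<longrightarrow> \<not> cl Y b r p)" if "r \<notin> S" for r
        proof -
          have "r = x \<or> r = y" using un that by blast
          then show ?thesis using bqy bx' by blast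
        qed
      qed (use xy con in auto)
    next
      case False
      show ?thesis
      proof (rule irr_on_conic_only[OF S(1) S6 _ b(1) irr_delete])
        fix p q assume pq: "p \<noteq> b" "q \<noteq> b" "p \<noteq> q"
        show "\<not> cl Y b p q"
        proof
          assume c: "cl Y b p q"
          have "p \<noteq> x" using bx'[of q] pq c by blast
          moreover have "q \<noteq> x" using bx'[of p] pq c cl_swap(2) by blast
          moreover have "p \<notin> S \<or> q \<notin> S" using conicset_no_line[OF S(1), of b p q] b pq c by blast
          ultimately have "p = y \<and> q \<in> S \<or> q = y \<and> p \<in> S" using un pq by blast
          then show False using False pq c cl_swap by blast
        qed
      qed (use con in auto)
    qed
  qed
next
  case noxy: False
  show ?thesis
  proof (cases "three_lines Y (UNIV - {x}) x \<and> three_lines Y (UNIV - {y}) y")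
    case False
    then show ?thesis using irr_few_lines_UNIV only xy by blast
  next
    case True
    have uniq: "p = q" if "b \<in> S" "p \<in> S" "q \<in> S" "b \<noteq> p" "b \<noteq> q" "cl Y z b p" "cl Y z b q" "z \<in> {x, y}" for b p q z
    proof (rule ccontr)
      assume pq: "p \<noteq> q"
      have "b \<noteq> z" using that(1,8) xy by blast
      then have "cl Y b p q" using cl_trans[of b z p q] that(6,7) cl_swap by metis
      then show False using conicset_no_line[OF S(1) that(1-3)] that pq by blast
    qed
    have part: "\<exists>t\<in>S. t \<noteq> s \<and> cl Y z s t" if z: "{z, z'} = {x, y}" and s: "s \<in> S" for z z' s
    proof -
      have t3: "three_lines Y (UNIV - {z}) z" using True z by (metis doubleton_eq_iff)
      have nz: "\<not> cl Y z z' t" if "t \<in> S" for t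
      proof -
        have "z = x \<and> z' = y \<or> z = y \<and> z' = x" using z by (metis doubleton_eq_iff)
        then show ?thesis using noxy that cl_swap(1) by blast
      qed
      have zS: "z \<notin> S" "z' \<notin> S" "z \<noteq> z'" using z xy by (metis doubleton_eq_iff)+
      have zu: "UNIV = insert z (insert z' S)" using un z by (metis insert_commute doubleton_eq_iff)
      obtain a b c d e f l where t: "UNIV = {z, l, a, b, c, d, e, f}" "distinct [z, l, a, b, c, d, e, f]"
        "cl Y z a b" "cl Y z c d" "cl Y z e f" using three_linesD[OF t3] by metis
      note ds = t(2)[simplified] distinct_sym[OF t(2)]
      have sw: "cl Y z b a" "cl Y z d c" "cl Y z f e" using t(3-5) cl_swap(2) by blast+
      have no: "u \<noteq> z'" if "cl Y z u v" "v \<noteq> u" "v \<noteq> z" for u v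
      proof
        assume "u = z'"
        moreover have "v \<in> S" using zu that \<open>u = z'\<close> by blast
        ultimately show False using nz that by blast
      qed
      have "l = z'"
      proof -
        have "z' \<in> {z, l, a, b, c, d, e, f}" using t(1) by blast
        moreover have "a \<noteq> z'" "b \<noteq> z'" "c \<noteq> z'" "d \<noteq> z'" "e \<noteq> z'" "f \<noteq> z'"
          using no t(3-5) sw ds by blast+
        ultimately show ?thesis using zS by blast
      qed
      then have "{a, b, c, d, e, f} \<subseteq> S" using zu ds by blast
      moreover have "s \<in> {z, l, a, b, c, d, e, f}" using t(1) by blast
      then have "s \<in> {a, b, c, d, e, f}" using s zS(1,2) \<open>l = z'\<close> by auto
      ultimately show ?thesis using t(3-5) sw ds by (elim insertE emptyE; simp; metis)
    qed
    have px: "\<exists>t\<in>S. t \<noteq> s \<and> cl Y x s t" and py: "\<exists>t\<in>S. t \<noteq> s \<and> cl Y y s t" if "s \<in> S" for s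
      using part[of x y s] part[of y x s] that by (simp_all add: insert_commute)
    have ux: "p = q" if "cl Y x b p" "cl Y x b q" "b \<in> S" "p \<in> S" "q \<in> S" "b \<noteq> p" "b \<noteq> q" for b p q
      using uniq[of b p q x] that by blast
    have uy: "p = q" if "cl Y y b p" "cl Y y b q" "b \<in> S" "p \<in> S" "q \<in> S" "b \<noteq> p" "b \<noteq> q" for b p q
      using uniq[of b p q y] that by blast
    \<comment> \<open>A common edge of the two matchings would lie on the line xy, which misses
      \<open>S\<close>.\<close>
    have nxy: "\<not> (cl Y x s t \<and> cl Y y s t)" if "s \<in> S" "t \<in> S" "s \<noteq> t" for s t
    proof
      assume "cl Y x s t \<and> cl Y y s t"
      then have "cl Y s x t" "cl Y s t y" using cl_swap by blast+
      then have "cl Y s x y" using cl_trans[of s t x y] that by blast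
      then show False using noxy that cl_swap by blast
    qed
    have "S \<noteq> {}" using S(2) by auto
    then obtain a where a: "a \<in> S" by blast
    obtain b where b: "b \<in> S" "b \<noteq> a" "cl Y x a b" using px[OF a] by blast
    obtain c where c: "c \<in> S" "c \<noteq> b" "cl Y y b c" using py[OF b(1)] by blast
    obtain d where d: "d \<in> S" "d \<noteq> c" "cl Y x c d" using px[OF c(1)] by blast
    obtain e where e: "e \<in> S" "e \<noteq> d" "cl Y y d e" using py[OF d(1)] by blast
    obtain f where f: "f \<in> S" "f \<noteq> e" "cl Y x e f" using px[OF e(1)] by blast
    have b': "cl Y x b a" and c': "cl Y y c b" and d': "cl Y x d c" and e': "cl Y y e d" and f': "cl Y x f e"
      using b c d e f cl_swap(2) by blast+
    have ca: "c \<noteq> a" using nxy[of a b] a b c' by blast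
    have da: "d \<noteq> a" using ux[of a b c] a b c d' ca by metis
    have db: "d \<noteq> b" using ux[of b a c] a b b' c d' ca by metis
    have ec: "e \<noteq> c" using nxy[of c d] c d e' by blast
    have eb: "e \<noteq> b" using uy[of b c d] b c d e' db by metis
    \<comment> \<open>A closed quadrangle a, b, c, d would leave two points joined to each other by
      both matchings, against \<open>nxy\<close>.\<close>
    have ea: "e \<noteq> a"
    proof
      assume ea: "e = a"
      have "card (S - {a, b, c, d}) = 2" using S(2) a b c d ca da db by (subst card_Diff_subset) auto
      then obtain p q where pq: "S - {a, b, c, d} = {p, q}" "p \<noteq> q" by (metis card_2_iff)
      then have p: "p \<in> S" "p \<noteq> a" "p \<noteq> b" "p \<noteq> c" "p \<noteq> d" and Sq: "S = {a, b, c, d, p, q}" using a b c d by blast+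
      obtain r where r: "r \<in> S" "r \<noteq> p" "cl Y x p r" using px[OF p(1)] by blast
      obtain s where s: "s \<in> S" "s \<noteq> p" "cl Y y p s" using py[OF p(1)] by blast
      have r': "cl Y x r p" and s': "cl Y y s p" using r s cl_swap(2) by blast+
      have "r \<noteq> a" using ux[of a b p] a b p r' by metis
      moreover have "r \<noteq> b" using ux[of b a p] a b b' p r' by metis
      moreover have "r \<noteq> c" using ux[of c d p] c d p r' by metis
      moreover have "r \<noteq> d" using ux[of d c p] c d d' p r' by metis
      ultimately have "r = q" using r Sq by blast
      have "s \<noteq> b" using uy[of b c p] b c p s' by metis
      moreover have "s \<noteq> c" using uy[of c b p] b c c' p s' by metis
      moreover have "s \<noteq> d" using uy[of d e p] d e ea a p s' by metis
      moreover have "s \<noteq> a" using uy[of e d p] d e e' ea a p s' by metis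
      ultimately have "s = q" using s Sq by blast
      then show False using nxy[of p q] p r s \<open>r = q\<close> by blast
    qed
    have fa: "f \<noteq> a" using ux[of a b e] a b e f' eb ea by metis
    have fb: "f \<noteq> b" using ux[of b a e] a b b' e f' eb ea by metis
    have fc: "f \<noteq> c" using ux[of c d e] c d e f' ec by metis
    have fd: "f \<noteq> d" using ux[of d c e] c d d' e f' ec by metis
    have six: "{a, b, c, d, e, f} \<subseteq> S" "card {a, b, c, d, e, f} = 6"
      using a b c d e f ca da db ec eb ea fa fb fc fd by auto
    then have Seq: "S = {a, b, c, d, e, f}" using S(2) by (metis card_subset_eq finite)
    obtain k where k: "k \<in> S" "k \<noteq> f" "cl Y y f k" using py[OF f(1)] by blast
    have k': "cl Y y k f" using k cl_swap(2) by blast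
    have "k \<noteq> b" using uy[of b c f] b c f k' fb fc by metis
    moreover have "k \<noteq> c" using uy[of c b f] b c c' f k' fb fc by metis
    moreover have "k \<noteq> d" using uy[of d e f] d e f k' fd by metis
    moreover have "k \<noteq> e" using nxy[of e f] e f k' by blast
    ultimately have fka: "cl Y y f a" using k Seq by blast
    then have fka': "cl Y y a f" using cl_swap(2) by blast
    have dist: "distinct [x, y, a, b, c, d, e, f]" using a b c d e f ca da db ec eb ea fa fb fc fd xy by auto
    let ?\<L> = "{{x,a,b},{x,c,d},{x,e,f},{y,b,c},{y,d,e},{y,f,a}}"
    have linex: "\<exists>L\<in>?\<L>. {x, p, q} \<subseteq> L" if "p \<in> S" "q \<in> S" "p \<noteq> q" "cl Y x p q" for p q
    proof -
      have "p \<in> {a, b, c, d, e, f}" using that(1) Seq by simp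
      then consider "p = a" | "p = b" | "p = c" | "p = d" | "p = e" | "p = f" by blast
      then show ?thesis
      proof cases
        case 1
        then have "q = b" using ux[of a q b] that a b c d e f b' c' d' e' f' fka fka' ca da db ec eb ea fa fb fc fd by metis
        then show ?thesis using 1 by simp
      next
        case 2
        then have "q = a" using ux[of b q a] that a b c d e f b' c' d' e' f' fka fka' ca da db ec eb ea fa fb fc fd by metis
        then show ?thesis using 2 by simp
      next
        case 3
        then have "q = d" using ux[of c q d] that a b c d e f b' c' d' e' f' fka fka' ca da db ec eb ea fa fb fc fd by metis
        then show ?thesis using 3 by simp
      next
        case 4
        then have "q = c" using ux[of d q c] that a b c d e f b' c' d' e' f' fka fka' ca da db ec eb ea fa fb fc fd by metis
        then show ?thesis using 4 by simp
      next
        case 5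
        then have "q = f" using ux[of e q f] that a b c d e f b' c' d' e' f' fka fka' ca da db ec eb ea fa fb fc fd by metis
        then show ?thesis using 5 by simp
      next
        case 6
        then have "q = e" using ux[of f q e] that a b c d e f b' c' d' e' f' fka fka' ca da db ec eb ea fa fb fc fd by metis
        then show ?thesis using 6 by simp
      qed
    qed
    have liney: "\<exists>L\<in>?\<L>. {y, p, q} \<subseteq> L" if "p \<in> S" "q \<in> S" "p \<noteq> q" "cl Y y p q" for p q
    proof -
      have "p \<in> {a, b, c, d, e, f}" using that(1) Seq by simp
      then consider "p = a" | "p = b" | "p = c" | "p = d" | "p = e" | "p = f" by blast
      then show ?thesis
      proof cases
        case 1
        then have "q = f" using uy[of a q f] that a b c d e f b' c' d' e' f' fka fka' ca da db ec eb ea fa fb fc fd by metis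
        then show ?thesis using 1 by simp
      next
        case 2
        then have "q = c" using uy[of b q c] that a b c d e f b' c' d' e' f' fka fka' ca da db ec eb ea fa fb fc fd by metis
        then show ?thesis using 2 by simp
      next
        case 3
        then have "q = b" using uy[of c q b] that a b c d e f b' c' d' e' f' fka fka' ca da db ec eb ea fa fb fc fd by metis
        then show ?thesis using 3 by simp
      next
        case 4
        then have "q = e" using uy[of d q e] that a b c d e f b' c' d' e' f' fka fka' ca da db ec eb ea fa fb fc fd by metis
        then show ?thesis using 4 by simp
      next
        case 5
        then have "q = d" using uy[of e q d] that a b c d e f b' c' d' e' f' fka fka' ca da db ec eb ea fa fb fc fd by metis
        then show ?thesis using 5 by simp
      next
        case 6
        then have "q = a" using uy[of f q a] that a b c d e f b' c' d' e' f' fka fka' ca da db ec eb ea fa fb fc fd by metis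
        then show ?thesis using 6 by simp
      qed
    qed
    have "config Y ?\<L> {{a,b,c,d,e,f}}"
    proof (rule config_coll_exact)
      fix L assume L: "L \<in> ?\<L>"
      have "coll Y {x,a,b}" "coll Y {x,c,d}" "coll Y {x,e,f}" "coll Y {y,b,c}" "coll Y {y,d,e}" "coll Y {y,f,a}"
        using b c d e f fka unfolding cl_def by blast+
      then show "card L = 3 \<and> coll Y L" using L dist by auto
    next
      fix i j k assume ijk: "i \<noteq> j" "i \<noteq> k" "j \<noteq> k" "cl Y i j k"
      have inU: "t = x \<or> t = y \<or> t \<in> S" for t using un by blast
      have main: "\<exists>L\<in>?\<L>. {i, j, k} \<subseteq> L" if ijk: "i \<noteq> j" "i \<noteq> k" "j \<noteq> k" "cl Y i j k" "i \<notin> S" for i j k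
      proof -
        have i: "i = x \<or> i = y" using un ijk by blast
        have "j \<in> S"
        proof (rule ccontr)
          assume "j \<notin> S"
          then have "i = x \<and> j = y \<or> i = y \<and> j = x" "k \<in> S" using inU[of j] inU[of k] ijk(1-3) i by blast+
          then show False using noxy ijk(4) cl_swap by blast
        qed
        moreover have "k \<in> S"
        proof (rule ccontr)
          assume "k \<notin> S"
          then have "i = x \<and> k = y \<or> i = y \<and> k = x" using inU[of k] ijk(1-3) i by blast
          then show False using noxy ijk(4) cl_swap \<open>j \<in> S\<close> by blast
        qed
        ultimately show ?thesis using i linex[of j k] liney[of j k] ijk by blast
      qed
      have "i \<notin> S \<or> j \<notin> S \<or> k \<notin> S" using conicset_no_line[OF S(1)] ijk by blast
      then consider "i \<notin> S" | "j \<notin> S" | "k \<notin> S" by blast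
      then show "\<exists>L\<in>?\<L>. {i, j, k} \<subseteq> L"
      proof cases
        case 1 then show ?thesis using main[of i j k] ijk by blast
      next
        case 2 then show ?thesis using main[of j i k] ijk cl_swap(1)[OF ijk(4)] by (simp add: insert_commute)
      next
        case 3 then show ?thesis using main[of k i j] ijk cl_swap(1)[OF cl_swap(2)[OF ijk(4)]] by (simp add: insert_commute)
      qed
    next
      fix C assume "C \<in> {{a,b,c,d,e,f}}" then show "card C = 6 \<and> conicset Y C" using S Seq by simp
    next
      fix C assume "card C = 6" "conicset Y C" then show "C \<in> {{a,b,c,d,e,f}}" using only Seq by simp
    qed
    then show ?thesis using irr_hexagon[OF _ dist] un Seq by blast
  qed
qed

end

section \<open>Two or four conics on eight points\<close>

context general_tuple
begin

text \<open>Conics sharing five points coincide and would contain seven points. So the two share at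
  most four, and 6 + 6 - 4 = 8. In other words, different conics omit disjoint pairs of
  points.\<close>

lemma conicset_cover:
  assumes no7: "\<And>T. card T = 7 \<Longrightarrow> \<not> conicset Y T"
    and C: "conicset Y C" "card C = 6" "conicset Y D" "card D = 6" "C \<noteq> D"
  shows "C \<union> D = UNIV"
proof -
  have "card (C \<inter> D) < 5"
  proof (rule ccontr)
    assume "\<not> ?thesis"
    then have u: "conicset Y (C \<union> D)" using conicset_join[OF C(1,3), of "C \<inter> D"] by simp
    have "\<not> D \<subseteq> C" using C(2,4,5) by (metis card_subset_eq finite)
    then obtain x where x: "x \<in> D" "x \<notin> C" by blast
    have "card (insert x C) = 7" using x C(2) by simp
    moreover have "conicset Y (insert x C)" using conicset_mono[OF u] x by blast
    ultimately show False using no7 by blast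
  qed
  moreover have "card (C \<union> D) + card (C \<inter> D) = 12" using card_Un_Int[of C D] C(2,4) by simp
  ultimately have "8 \<le> card (C \<union> D)" by simp
  then show ?thesis by (intro card_seteq) auto
qed

lemma irr_two_conics_no_line:
  assumes no7: "\<And>T. card T = 7 \<Longrightarrow> \<not> conicset Y T"
    and C: "conicset Y C" "card C = 6" "conicset Y D" "card D = 6" "C \<noteq> D" and x: "x \<in> C" "x \<in> D"
    and only: "\<And>K. card K = 6 \<Longrightarrow> conicset Y K \<Longrightarrow> x \<in> K \<Longrightarrow> K = C \<or> K = D"
    and line: "\<And>i j. i \<noteq> x \<Longrightarrow> j \<noteq> x \<Longrightarrow> i \<noteq> j \<Longrightarrow> \<not> cl Y x i j"
  shows "irr (stratum UNIV Y)"
proof -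
  have cov: "C \<union> D = UNIV" by (rule conicset_cover[OF no7 C])
  have "card (C \<inter> D) = 4" using card_Un_Int[of C D] C(2,4) cov by simp
  then have "card (C \<inter> D - {x}) = 3" using x by simp
  then obtain p q r where pqr: "C \<inter> D - {x} = {p, q, r}" "p \<noteq> q" "p \<noteq> r" "q \<noteq> r" using card3E by metis
  have "card (C - D) = 2" "card (D - C) = 2"
    using C(2,4) \<open>card (C \<inter> D) = 4\<close> by (simp_all add: card_Diff_subset_Int Int_commute)
  then obtain s t u v where st: "C - D = {s, t}" "s \<noteq> t" and uv: "D - C = {u, v}" "u \<noteq> v" by (metis card_2_iff)
  have Cx: "C - {x} = {p, q, r, s, t}" and Dx: "D - {x} = {p, q, r, u, v}" using pqr st uv x by blast+
  have d1: "distinct [p, q, r, s, t]" and d2: "distinct [p, q, r, u, v]" using pqr st uv by auto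
  have iC: "insert x (C - {x}) = C" "insert x (D - {x}) = D" using x by blast+
  have U: "insert x (UNIV - {x}) = UNIV" by blast
  have "irr (stratum (insert x (UNIV - {x})) Y)"
  proof (rule irr_two_conics[OF _ irr_delete gA Cx _ d1 _ _ Dx _ d2])
    show "nocoll Y (insert x (C - {x}))" "onconic Y (insert x (C - {x}))"
      "nocoll Y (insert x (D - {x}))" "onconic Y (insert x (D - {x}))"
      unfolding iC using C by (simp_all add: conicset_def)
    have U': "insert x ((C - {x}) \<union> (D - {x})) = UNIV" using cov x by blast
    show "\<not> onconic Y (insert x ((C - {x}) \<union> (D - {x})))"
    proof
      assume "onconic Y (insert x ((C - {x}) \<union> (D - {x})))"
      then have on: "onconic Y UNIV" unfolding U' .
      have "nocoll Y UNIV" by (rule conic_nocoll[OF on, of C]) (use C g in \<open>auto simp: conicset_def\<close>)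
      then have cs: "conicset Y UNIV" using on by (simp add: conicset_def)
      have "7 \<le> card (UNIV :: 8 set)" by simp
      then obtain T :: "8 set" where "card T = 7" using obtain_subset_with_card_n by metis
      then show False using no7 conicset_mono[OF cs, of T] by blast
    qed
    show "pencil Y (UNIV - {x}) x {}" by (rule pencilI) (use line in blast)
    show "conics_at Y (UNIV - {x}) x {C - {x}, D - {x}}"
    proof (rule conics_atI)
      fix T assume T: "T \<subseteq> UNIV - {x}" "card T = 5" "conicset Y (insert x T)"
      then have "x \<notin> T" by blast
      then have "card (insert x T) = 6" using T(2) by simp
      then have "insert x T = C \<or> insert x T = D" using only[of "insert x T"] T(3) by simp
      then show "\<exists>K\<in>{C - {x}, D - {x}}. T \<subseteq> K" using \<open>x \<notin> T\<close> by blast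
    qed
  qed auto
  then show ?thesis unfolding U .
qed

lemma not_in_conic: "conicset Y C \<Longrightarrow> cl Y i j k \<Longrightarrow> i \<noteq> j \<Longrightarrow> i \<noteq> k \<Longrightarrow> j \<noteq> k \<Longrightarrow> i \<notin> C \<or> j \<notin> C \<or> k \<notin> C"
  using conicset_no_line by blast

lemma two_points_line:
  assumes "cl Y p q r" "cl Y p q s" "p \<noteq> q" shows "cl Y p r s" "cl Y q r s"
proof -
  show "cl Y p r s" using cl_trans[of p q r s] assms cl_swap(2) by blast
  have "cl Y q p r" "cl Y q p s" using assms cl_swap(1) by blast+
  then show "cl Y q r s" using cl_trans[of q p r s] assms(3) cl_swap(2) by blast
qed

text \<open>A line has to leave both conics, so it contains one of a, b and one of c, d. If one of
  e, f, g, h is on no line, it is on two conics only and is removed. Otherwise the line through each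
  of these four points gives an injection into the four pairs, hence a bijection, and the
  configuration is that of \<open>irr_four_lines_two_conics\<close>.\<close>

lemma irr_exactly_two_conics:
  assumes no7: "\<And>T. card T = 7 \<Longrightarrow> \<not> conicset Y T"
    and dist: "distinct [a,b,c,d,e,f,g,h]" and un: "UNIV = {a,b,c,d,e,f,g,h}"
    and con: "conicset Y {c,d,e,f,g,h}" "conicset Y {a,b,e,f,g,h}"
    and only: "\<And>K. card K = 6 \<Longrightarrow> conicset Y K \<Longrightarrow> K = {c,d,e,f,g,h} \<or> K = {a,b,e,f,g,h}"
  shows "irr (stratum UNIV Y)"
proof -
  note ds = dist[simplified] distinct_sym[OF dist]
  have c6: "card {c,d,e,f,g,h} = 6" "card {a,b,e,f,g,h} = 6" using ds by simp_all
  have ne: "{c,d,e,f,g,h} \<noteq> {a,b,e,f,g,h}" using ds by blast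
  have meet: "\<exists>p\<in>{a, b}. p \<in> {i, j, k}" "\<exists>q\<in>{c, d}. q \<in> {i, j, k}"
    if "cl Y i j k" "i \<noteq> j" "i \<noteq> k" "j \<noteq> k" for i j k
  proof -
    have "i \<notin> {c,d,e,f,g,h} \<or> j \<notin> {c,d,e,f,g,h} \<or> k \<notin> {c,d,e,f,g,h}" by (rule not_in_conic[OF con(1) that])
    then show "\<exists>p\<in>{a, b}. p \<in> {i, j, k}" using un by blast
    have "i \<notin> {a,b,e,f,g,h} \<or> j \<notin> {a,b,e,f,g,h} \<or> k \<notin> {a,b,e,f,g,h}" by (rule not_in_conic[OF con(2) that])
    then show "\<exists>q\<in>{c, d}. q \<in> {i, j, k}" using un by blast
  qed
  define E where E: "E = {e,f,g,h}"
  show ?thesis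
  proof (cases "\<exists>x\<in>E. \<forall>i j. i \<noteq> x \<longrightarrow> j \<noteq> x \<longrightarrow> i \<noteq> j \<longrightarrow> \<not> cl Y x i j")
    case True
    then obtain x where x: "x \<in> E" "\<And>i j. i \<noteq> x \<Longrightarrow> j \<noteq> x \<Longrightarrow> i \<noteq> j \<Longrightarrow> \<not> cl Y x i j" by blast
    show ?thesis
      by (rule irr_two_conics_no_line[OF no7 con(1) c6(1) con(2) c6(2) ne, of x]) (use x only E in auto)
  next
    case False
    have apart: "p \<notin> E" if "p \<in> {a, b, c, d}" for p using that ds unfolding E by auto
    have AB: "p \<in> {a, b} \<Longrightarrow> p \<in> {a, b, c, d}" and CD: "p \<in> {c, d} \<Longrightarrow> p \<in> {a, b, c, d}" for p by auto
    have ex: "\<exists>p\<in>{a, b}. \<exists>q\<in>{c, d}. cl Y p q x" if x: "x \<in> E" for x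
    proof -
      obtain i j where ij: "i \<noteq> x" "j \<noteq> x" "i \<noteq> j" "cl Y x i j" using False x by blast
      obtain p where p: "p \<in> {a, b}" "p \<in> {x, i, j}" using meet(1)[of x i j] ij by blast
      obtain q where q: "q \<in> {c, d}" "q \<in> {x, i, j}" using meet(2)[of x i j] ij by blast
      have "p \<noteq> x" "q \<noteq> x" using apart[OF AB[OF p(1)]] apart[OF CD[OF q(1)]] that by auto
      moreover have "p \<noteq> q" using p(1) q(1) ds by blast
      ultimately have "p = i \<and> q = j \<or> p = j \<and> q = i" using p(2) q(2) by blast
      then have "cl Y p q x" using ij(4) cl_swap by blast
      then show ?thesis using p(1) q(1) by blast
    qed
    have inj: "x = y" if "cl Y p q x" "cl Y p q y" "p \<in> {a, b}" "q \<in> {c, d}" "x \<in> E" "y \<in> E" for p q x y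
    proof (rule ccontr)
      assume xy: "x \<noteq> y"
      have "p \<noteq> q" using that(3,4) ds by blast
      then have "cl Y p x y" using two_points_line(1)[OF that(1,2)] by blast
      moreover have "p \<noteq> x" "p \<noteq> y" using apart[OF AB[OF that(3)]] that(5,6) by auto
      ultimately obtain r where "r \<in> {c, d}" "r \<in> {p, x, y}" using meet(2)[of p x y] xy by blast
      then have "r = x \<or> r = y" using that(3) ds by auto
      then show False using apart[OF CD[OF \<open>r \<in> {c, d}\<close>]] that(5,6) by auto
    qed
    obtain \<rho> where \<rho>: "\<And>x. x \<in> E \<Longrightarrow> \<rho> x \<in> {a, b} \<times> {c, d} \<and> cl Y (fst (\<rho> x)) (snd (\<rho> x)) x"
    proof -
      have "\<exists>z. z \<in> {a, b} \<times> {c, d} \<and> cl Y (fst z) (snd z) x" if x: "x \<in> E" for x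
      proof -
        obtain p q where "p \<in> {a, b}" "q \<in> {c, d}" "cl Y p q x" using ex[OF x] by blast
        then show ?thesis by (intro exI[of _ "(p, q)"]) auto
      qed
      then have "\<exists>\<rho>. \<forall>x\<in>E. \<rho> x \<in> {a, b} \<times> {c, d} \<and> cl Y (fst (\<rho> x)) (snd (\<rho> x)) x"
        by (intro bchoice) blast
      then show ?thesis using that by blast
    qed
    have "inj_on \<rho> E"
      using \<rho> inj by (intro inj_onI) (metis mem_Times_iff)
    moreover have "card E = card ({a, b} \<times> {c, d})" using ds by (simp add: E card_cartesian_product)
    moreover have "\<rho> ` E \<subseteq> {a, b} \<times> {c, d}" using \<rho> by blast
    ultimately have img: "\<rho> ` E = {a, b} \<times> {c, d}" by (metis card_image card_subset_eq finite)
    have get: "\<exists>x\<in>E. cl Y p q x" if "p \<in> {a, b}" "q \<in> {c, d}" for p q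
    proof -
      have "(p, q) \<in> \<rho> ` E" using img that by blast
      then obtain x where "(p, q) = \<rho> x" "x \<in> E" by blast
      then show ?thesis using \<rho>[of x] by (metis fst_conv snd_conv)
    qed
    obtain e' where e': "e' \<in> E" "cl Y a c e'" using get[of a c] by blast
    obtain f' where f': "f' \<in> E" "cl Y a d f'" using get[of a d] by blast
    obtain g' where g': "g' \<in> E" "cl Y b c g'" using get[of b c] by blast
    obtain h' where h': "h' \<in> E" "cl Y b d h'" using get[of b d] by blast
    have line2: "p = p' \<and> q = q'" if "cl Y p q x" "cl Y p' q' x" "p \<in> {a, b}" "q \<in> {c, d}" "p' \<in> {a, b}" "q' \<in> {c, d}" "x \<in> E" for p q p' q' x
    proof -
      have img2: "\<rho> x = (p, q)" if "cl Y p q x" "p \<in> {a, b}" "q \<in> {c, d}" "x \<in> E" for p q x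
      proof -
        have "(p, q) \<in> \<rho> ` E" using img that by blast
        then obtain z where z: "z \<in> E" "\<rho> z = (p, q)" by (metis imageE)
        then have "z = x" using \<rho>[OF z(1)] inj[of p q z x] that by simp
        then show ?thesis using z by simp
      qed
      show ?thesis using img2[of p q x] img2[of p' q' x] that by simp
    qed
    have ds': "e' \<noteq> f'" "e' \<noteq> g'" "e' \<noteq> h'" "f' \<noteq> g'" "f' \<noteq> h'" "g' \<noteq> h'"
      using line2[of a c e' a d] line2[of a c e' b c] line2[of a c e' b d] line2[of a d f' b c]
        line2[of a d f' b d] line2[of b c g' b d] e' f' g' h' ds by blast+
    have "{e', f', g', h'} \<subseteq> E" using e' f' g' h' by simp
    moreover have "card {e', f', g', h'} = card E" using ds' ds by (simp add: E)
    ultimately have "{e', f', g', h'} = E" by (intro card_subset_eq) auto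
    then have efgh: "{e,f,g,h} = {e', f', g', h'}" by (simp add: E)
    have un': "UNIV = {a,b,c,d,e',f',g',h'}" using un efgh by simp
    have "a \<notin> E" "b \<notin> E" "c \<notin> E" "d \<notin> E" using apart by blast+
    then have dist': "distinct [a,b,c,d,e',f',g',h']" using e' f' g' h' ds' ds by auto
    have eqs: "{c,d,e,f,g,h} = {c,d,e',f',g',h'}" "{a,b,e,f,g,h} = {a,b,e',f',g',h'}" by (simp_all only: efgh)
    let ?\<L> = "{{a,c,e'},{a,d,f'},{b,c,g'},{b,d,h'}}"
    have "config Y ?\<L> {{a,b,e',f',g',h'},{c,d,e',f',g',h'}}"
    proof (rule config_coll_exact)
      fix L assume L: "L \<in> ?\<L>"
      have "coll Y {a,c,e'}" "coll Y {a,d,f'}" "coll Y {b,c,g'}" "coll Y {b,d,h'}"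
        using e' f' g' h' unfolding cl_def by blast+
      then show "card L = 3 \<and> coll Y L" using L dist' by auto
    next
      fix i j k assume ijk: "i \<noteq> j" "i \<noteq> k" "j \<noteq> k" "cl Y i j k"
      obtain p where p: "p \<in> {a, b}" "p \<in> {i, j, k}" using meet(1)[OF ijk(4,1-3)] by blast
      obtain q where q: "q \<in> {c, d}" "q \<in> {i, j, k}" using meet(2)[OF ijk(4,1-3)] by blast
      have pq: "p \<noteq> q" using p(1) q(1) ds by blast
      have "\<exists>r. {i, j, k} = {p, q, r} \<and> r \<noteq> p \<and> r \<noteq> q" using p(2) q(2) pq ijk by blast
      then obtain r where r: "{i, j, k} = {p, q, r}" "r \<noteq> p" "r \<noteq> q" by blast
      have cr: "cl Y p q r" using ijk(4) r(1) by (simp add: cl_def)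
      obtain L x where L: "L \<in> ?\<L>" "L = {p, q, x}" "x \<in> E" "cl Y p q x"
        using p(1) q(1) e' f' g' h' by blast
      have px: "p \<noteq> x" "q \<noteq> x" using apart[OF AB[OF p(1)]] apart[OF CD[OF q(1)]] L(3) by auto
      have xn: "x \<notin> {a, b, c, d}" using apart[of x] L(3) by blast
      have "r = x"
      proof (rule ccontr)
        assume n: "r \<noteq> x"
        have "cl Y p r x" "cl Y q r x" using two_points_line[OF cr L(4) pq] by blast+
        then obtain s t where "s \<in> {c, d}" "s \<in> {p, r, x}" "t \<in> {a, b}" "t \<in> {q, r, x}"
          using meet(2)[of p r x] meet(1)[of q r x] r px n by metis
        then have "r \<in> {c, d}" "r \<in> {a, b}" using p(1) q(1) xn ds by auto
        then show False using ds by blast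
      qed
      then have "{i, j, k} = L" using L(2) r(1) by simp
      then show "\<exists>L\<in>?\<L>. {i, j, k} \<subseteq> L" using L(1) by (intro bexI[of _ L]) auto
    next
      fix C assume C: "C \<in> {{a,b,e',f',g',h'},{c,d,e',f',g',h'}}"
      then show "card C = 6 \<and> conicset Y C" using con c6 unfolding eqs by blast
    next
      fix C assume "card C = 6" "conicset Y C"
      then show "C \<in> {{a,b,e',f',g',h'},{c,d,e',f',g',h'}}" using only unfolding eqs by blast
    qed
    then show ?thesis using irr_four_lines_two_conics[OF _ dist' un'] by blast
  qed
qed

text \<open>There are no lines: three points cannot meet the four disjoint pairs omitted by the
  conics.\<close>

lemma irr_exactly_four_conics:
  assumes dist: "distinct [a,b,c,d,e,f,g,h]" and un: "UNIV = {a,b,c,d,e,f,g,h}"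
    and con: "conicset Y {c,d,e,f,g,h}" "conicset Y {a,b,e,f,g,h}" "conicset Y {a,b,c,d,g,h}" "conicset Y {a,b,c,d,e,f}"
    and only: "\<And>K. card K = 6 \<Longrightarrow> conicset Y K \<Longrightarrow> K \<in> {{c,d,e,f,g,h},{a,b,e,f,g,h},{a,b,c,d,g,h},{a,b,c,d,e,f}}"
  shows "irr (stratum UNIV Y)"
proof -
  note ds = dist[simplified] distinct_sym[OF dist]
  have "config Y {} {{c,d,e,f,g,h},{a,b,e,f,g,h},{a,b,c,d,g,h},{a,b,c,d,e,f}}"
  proof (rule config_coll_exact)
    fix i j k assume ijk: "i \<noteq> j" "i \<noteq> k" "j \<noteq> k" "cl Y i j k"
    have U: "x \<in> {a,b,c,d,e,f,g,h}" for x using un by blast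
    obtain p where p: "p \<in> {a, b}" "p \<in> {i, j, k}" using not_in_conic[OF con(1) ijk(4,1-3)] U by blast
    obtain q where q: "q \<in> {c, d}" "q \<in> {i, j, k}" using not_in_conic[OF con(2) ijk(4,1-3)] U by blast
    obtain r where r: "r \<in> {e, f}" "r \<in> {i, j, k}" using not_in_conic[OF con(3) ijk(4,1-3)] U by blast
    obtain s where s: "s \<in> {g, h}" "s \<in> {i, j, k}" using not_in_conic[OF con(4) ijk(4,1-3)] U by blast
    have "distinct [p, q, r, s]" using p(1) q(1) r(1) s(1) ds by auto
    then have "{p, q, r, s} \<subseteq> {i, j, k}" "card {p, q, r, s} = 4" using p(2) q(2) r(2) s(2) by auto
    then have "4 \<le> card {i, j, k}" by (metis card_mono finite)
    then show "\<exists>L\<in>{}. {i, j, k} \<subseteq> L" using ijk by simp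
  next
    fix C assume "C \<in> {{c,d,e,f,g,h},{a,b,e,f,g,h},{a,b,c,d,g,h},{a,b,c,d,e,f}}"
    then show "card C = 6 \<and> conicset Y C" using con ds by (elim insertE emptyE) simp_all
  qed (use only in auto)
  then show ?thesis using irr_four_conics[OF _ dist un] by blast
qed

end

section \<open>Three conics, with lines as vertices of a cube\<close>

context general_tuple
begin

text \<open>A line has to leave each of the conics, so it takes one point from each omitted pair.
  The possible lines are the eight vertices of a cube.\<close>

lemma cube_line:
  assumes con: "conicset Y {c,d,e,f,g,h}" "conicset Y {a,b,e,f,g,h}" "conicset Y {a,b,c,d,g,h}"
    and dist: "distinct [a,b,c,d,e,f,g,h]" and un: "UNIV = {a,b,c,d,e,f,g,h}"
    and ijk: "cl Y i j k" "i \<noteq> j" "i \<noteq> k" "j \<noteq> k"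
  shows "\<exists>p\<in>{a, b}. \<exists>q\<in>{c, d}. \<exists>r\<in>{e, f}. {i, j, k} = {p, q, r} \<and> cl Y p q r"
proof -
  note ds = dist[simplified] distinct_sym[OF dist]
  have U: "x \<in> {a,b,c,d,e,f,g,h}" for x using un by blast
  obtain p where p: "p \<in> {a, b}" "p \<in> {i, j, k}" using not_in_conic[OF con(1) ijk] U by blast
  obtain q where q: "q \<in> {c, d}" "q \<in> {i, j, k}" using not_in_conic[OF con(2) ijk] U by blast
  obtain r where r: "r \<in> {e, f}" "r \<in> {i, j, k}" using not_in_conic[OF con(3) ijk] U by blast
  have "p \<noteq> q" "p \<noteq> r" "q \<noteq> r" using p(1) q(1) r(1) ds by auto
  then have "{i, j, k} = {p, q, r}" using p(2) q(2) r(2) by blast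
  moreover from this have "cl Y p q r" using ijk(1) by (simp add: cl_def)
  ultimately show ?thesis using p(1) q(1) r(1) by blast
qed

text \<open>Lines with two common points coincide, and would then contain both points of one omitted
  pair together with a third point, all on a conic that omits another pair. So no two lines are
  adjacent vertices of the cube.\<close>

lemma cube_share:
  assumes con: "conicset Y {c,d,e,f,g,h}" "conicset Y {a,b,e,f,g,h}" "conicset Y {a,b,c,d,g,h}"
    and dist: "distinct [a,b,c,d,e,f,g,h]" and un: "UNIV = {a,b,c,d,e,f,g,h}"
    and pqr: "p \<in> {a, b}" "p' \<in> {a, b}" "q \<in> {c, d}" "q' \<in> {c, d}" "r \<in> {e, f}" "r' \<in> {e, f}" "cl Y p q r" "cl Y p' q' r'"
    and share: "p = p' \<and> q = q' \<or> p = p' \<and> r = r' \<or> q = q' \<and> r = r'"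
  shows "p = p' \<and> q = q' \<and> r = r'"
proof -
  note ds = dist[simplified] distinct_sym[OF dist]
  have np: "p \<noteq> q" "p \<noteq> r" "q \<noteq> r" "p \<noteq> r'" "p \<noteq> q'" "p' \<noteq> q" "p' \<noteq> r" "q \<noteq> r'" "q' \<noteq> r" using pqr(1-6) ds by auto
  from share show ?thesis
  proof (elim disjE conjE)
    assume e: "p = p'" "q = q'"
    have "r = r'"
    proof (rule ccontr)
      assume n: "r \<noteq> r'"
      have "cl Y p r r'" using two_points_line(1)[OF pqr(7), of r'] pqr(8) e np by blast
      then have "p \<notin> {a,b,e,f,g,h} \<or> r \<notin> {a,b,e,f,g,h} \<or> r' \<notin> {a,b,e,f,g,h}"
        using not_in_conic[OF con(2), of p r r'] n np by blast
      then show False using pqr(1-6) by blast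
    qed
    then show ?thesis using e by blast
  next
    assume e: "p = p'" "r = r'"
    have "q = q'"
    proof (rule ccontr)
      assume n: "q \<noteq> q'"
      have "cl Y p r q" "cl Y p r q'" using pqr(7,8) e cl_swap(2) by blast+
      then have "cl Y p q q'" using two_points_line(1) np by blast
      then have "p \<notin> {a,b,c,d,g,h} \<or> q \<notin> {a,b,c,d,g,h} \<or> q' \<notin> {a,b,c,d,g,h}"
        using not_in_conic[OF con(3), of p q q'] n np by blast
      then show False using pqr(1-6) by blast
    qed
    then show ?thesis using e by blast
  next
    assume e: "q = q'" "r = r'"
    have "p = p'"
    proof (rule ccontr)
      assume n: "p \<noteq> p'"
      have "cl Y q r p" "cl Y q r p'" using pqr(7,8) e cl_swap by blast+
      then have "cl Y q p p'" using two_points_line(1) np by blast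
      then have "q \<notin> {a,b,c,d,g,h} \<or> p \<notin> {a,b,c,d,g,h} \<or> p' \<notin> {a,b,c,d,g,h}"
        using not_in_conic[OF con(3), of q p p'] n np by blast
      then show False using pqr(1-6) by blast
    qed
    then show ?thesis using e by blast
  qed
qed

lemma config_cube:
  assumes con: "conicset Y {c,d,e,f,g,h}" "conicset Y {a,b,e,f,g,h}" "conicset Y {a,b,c,d,g,h}"
    and dist: "distinct [a,b,c,d,e,f,g,h]" and un: "UNIV = {a,b,c,d,e,f,g,h}"
    and only: "\<And>K. card K = 6 \<Longrightarrow> conicset Y K \<Longrightarrow> K \<in> {{c,d,e,f,g,h},{a,b,e,f,g,h},{a,b,c,d,g,h}}"
    and \<L>: "\<And>L. L \<in> \<L> \<Longrightarrow> card L = 3 \<and> coll Y L"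
    and cube: "\<And>p q r. p \<in> {a, b} \<Longrightarrow> q \<in> {c, d} \<Longrightarrow> r \<in> {e, f} \<Longrightarrow> cl Y p q r \<Longrightarrow> {p, q, r} \<in> \<L>"
  shows "config Y \<L> {{c,d,e,f,g,h},{a,b,e,f,g,h},{a,b,c,d,g,h}}"
proof (rule config_coll_exact[OF \<L>])
  fix i j k assume ijk: "i \<noteq> j" "i \<noteq> k" "j \<noteq> k" "cl Y i j k"
  obtain p q r where "p \<in> {a, b}" "q \<in> {c, d}" "r \<in> {e, f}" "{i, j, k} = {p, q, r}" "cl Y p q r"
    using cube_line[OF con dist un ijk(4,1-3)] by blast
  then have "{i, j, k} \<in> \<L>" using cube[of p q r] by simp
  then show "\<exists>L\<in>\<L>. {i, j, k} \<subseteq> L" by (rule bexI[rotated]) simp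
next
  note ds = dist[simplified]
  fix C assume "C \<in> {{c,d,e,f,g,h},{a,b,e,f,g,h},{a,b,c,d,g,h}}"
  then show "card C = 6 \<and> conicset Y C" using con ds by (elim insertE emptyE) simp_all
qed (use only in auto)

text \<open>The fourth vertex bde of the tetrahedron is not a line. Otherwise e, f and the
  intersection of ab and cd would be the diagonal points of the quadrangle a, b, c, d, collinear by
  \<open>three_conics_concurrent\<close>, which contradicts \<open>fano\<close>.\<close>

lemma irr_three_conics_three_lines:
  assumes no7: "\<And>T. card T = 7 \<Longrightarrow> \<not> conicset Y T"
    and con: "conicset Y {c,d,e,f,g,h}" "conicset Y {a,b,e,f,g,h}" "conicset Y {a,b,c,d,g,h}"
    and dist: "distinct [a,b,c,d,e,f,g,h]" and un: "UNIV = {a,b,c,d,e,f,g,h}"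
    and only: "\<And>K. card K = 6 \<Longrightarrow> conicset Y K \<Longrightarrow> K \<in> {{c,d,e,f,g,h},{a,b,e,f,g,h},{a,b,c,d,g,h}}"
    and l: "cl Y a c e" "cl Y a d f" "cl Y b c f"
  shows "irr (stratum UNIV Y)"
proof -
  note ds = dist[simplified] distinct_sym[OF dist]
  note sh = cube_share[OF con dist un]
  have acf: "\<not> cl Y a c f" using sh[of a a c c e f] l(1) ds by auto
  have ade: "\<not> cl Y a d e" using sh[of a a c d e e] l(1) ds by auto
  have bce: "\<not> cl Y b c e" using sh[of a b c c e e] l(1) ds by auto
  have bdf: "\<not> cl Y b d f" using sh[of a b d d f f] l(2) ds by auto
  have nocl: "\<not> cl Y i j k" if "i \<noteq> j" "i \<noteq> k" "j \<noteq> k" "{i, j, k} \<subseteq> {a, b, c, d}" for i j k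
    using not_in_conic[OF con(3), of i j k] that by blast
  have bde: "\<not> cl Y b d e"
  proof
    assume bde: "cl Y b d e"
    have all: "\<not> onconic Y {a,b,c,d,e,f,g,h}"
    proof
      assume "onconic Y {a,b,c,d,e,f,g,h}"
      then have on: "onconic Y UNIV" using un by simp
      have "nocoll Y UNIV" by (rule conic_nocoll[OF on, of "{c,d,e,f,g,h}"]) (use con ds g in \<open>auto simp: conicset_def\<close>)
      then have cs: "conicset Y UNIV" using on by (simp add: conicset_def)
      have "7 \<le> card (UNIV :: 8 set)" by simp
      then obtain T :: "8 set" where "card T = 7" using obtain_subset_with_card_n by metis
      then show False using no7 conicset_mono[OF cs, of T] by blast
    qed
    have conc: "det3 (crs (Y a) (Y b)) (crs (Y c) (Y d)) (crs (Y e) (Y f)) = 0"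
      by (rule three_conics_concurrent[OF _ _ _ _ _ _ dist all]) (use con in \<open>simp_all add: conicset_def\<close>)
    let ?p = "crs (crs (Y a) (Y b)) (crs (Y c) (Y d))"
    have nz: "det3 (Y a) (Y b) (Y c) \<noteq> 0" "det3 (Y a) (Y b) (Y d) \<noteq> 0" "det3 (Y a) (Y c) (Y d) \<noteq> 0" "det3 (Y b) (Y c) (Y d) \<noteq> 0"
      unfolding cl_det3[symmetric] using ds by (intro nocl; simp)+
    have "?p \<noteq> 0"
    proof
      assume "?p = 0"
      then have "det3 (Y a) (Y b) ?p = 0" by simp
      have "crs (Y c) ?p = - (det3 (Y a) (Y b) (Y c) *s crs (Y c) (Y d))"
        unfolding crs_crs by (simp add: vec3_eq_iff algebra_simps)
      moreover have "crs (Y c) (Y d) \<noteq> 0" using g ds by (simp add: gen_def)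
      ultimately show False using \<open>?p = 0\<close> nz(1) by simp
    qed
    moreover have "det3 (Y a) (Y b) ?p = 0" "det3 (Y c) (Y d) ?p = 0" by (simp_all add: det3_alt(1))
    moreover have "det3 (Y a) (Y c) (Y e) = 0" "det3 (Y b) (Y d) (Y e) = 0" "det3 (Y a) (Y d) (Y f) = 0" "det3 (Y b) (Y c) (Y f) = 0"
      using l bde unfolding cl_det3 by blast+
    ultimately have "det3 ?p (Y e) (Y f) \<noteq> 0" using fano[OF nz] Y_nonzero by blast
    then show False using conc det3_alt(1)[of "crs (Y a) (Y b)" "crs (Y c) (Y d)" "crs (Y e) (Y f)"]
        det3_def[of ?p "Y e" "Y f"] by simp
  qed
  have "config Y {{a,c,e},{a,d,f},{b,c,f}} {{c,d,e,f,g,h},{a,b,e,f,g,h},{a,b,c,d,g,h}}"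
  proof (rule config_cube[OF con dist un only])
    fix L assume L: "L \<in> {{a,c,e},{a,d,f},{b,c,f}}"
    have "coll Y {a,c,e}" "coll Y {a,d,f}" "coll Y {b,c,f}" using l unfolding cl_def by blast+
    then show "card L = 3 \<and> coll Y L" using L ds by auto
  next
    fix p q r assume pqr: "p \<in> {a, b}" "q \<in> {c, d}" "r \<in> {e, f}" "cl Y p q r"
    show "{p, q, r} \<in> {{a,c,e},{a,d,f},{b,c,f}}"
      using pqr acf ade bce bdf bde by (elim insertE emptyE; simp)
  qed
  then show ?thesis using irr_three_conics_triangle[OF _ dist un] by blast
qed

text \<open>Pairwise nonadjacent vertices of the cube that meet all faces and include ace are either
  ace with its antipode bdf, or at least three vertices of the tetrahedron ace, adf, bcf,
  bde.\<close>

lemma irr_three_conics_covering: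
  assumes no7: "\<And>T. card T = 7 \<Longrightarrow> \<not> conicset Y T"
    and con: "conicset Y {c,d,e,f,g,h}" "conicset Y {a,b,e,f,g,h}" "conicset Y {a,b,c,d,g,h}"
    and dist: "distinct [a,b,c,d,e,f,g,h]" and un: "UNIV = {a,b,c,d,e,f,g,h}"
    and only: "\<And>K. card K = 6 \<Longrightarrow> conicset Y K \<Longrightarrow> K \<in> {{c,d,e,f,g,h},{a,b,e,f,g,h},{a,b,c,d,g,h}}"
    and ace: "cl Y a c e" and onb: "\<exists>q\<in>{c, d}. \<exists>r\<in>{e, f}. cl Y b q r"
    and ond: "\<exists>p\<in>{a, b}. \<exists>r\<in>{e, f}. cl Y p d r" and onf: "\<exists>p\<in>{a, b}. \<exists>q\<in>{c, d}. cl Y p q f"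
  shows "irr (stratum UNIV Y)"
proof -
  note ds = dist[simplified] distinct_sym[OF dist]
  note sh = cube_share[OF con dist un]
  have acf: "\<not> cl Y a c f" using sh[of a a c c e f] ace ds by auto
  have ade: "\<not> cl Y a d e" using sh[of a a c d e e] ace ds by auto
  have bce: "\<not> cl Y b c e" using sh[of a b c c e e] ace ds by auto
  consider "cl Y b d f" | "cl Y b c f" | "cl Y b d e" using onb bce by blast
  then show ?thesis
  proof cases
    case bdf: 1
    have bde: "\<not> cl Y b d e" using sh[of b b d d f e] bdf ds by auto
    have bcf: "\<not> cl Y b c f" using sh[of b b d c f f] bdf ds by auto
    have adf: "\<not> cl Y a d f" using sh[of b a d d f f] bdf ds by auto
    have "config Y {{a,c,e},{b,d,f}} {{c,d,e,f,g,h},{a,b,e,f,g,h},{a,b,c,d,g,h}}"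
    proof (rule config_cube[OF con dist un only])
      fix L assume L: "L \<in> {{a,c,e},{b,d,f}}"
      have "coll Y {a,c,e}" "coll Y {b,d,f}" using ace bdf unfolding cl_def by blast+
      then show "card L = 3 \<and> coll Y L" using L ds by auto
    next
      fix p q r assume pqr: "p \<in> {a, b}" "q \<in> {c, d}" "r \<in> {e, f}" "cl Y p q r"
      show "{p, q, r} \<in> {{a,c,e},{b,d,f}}"
        using pqr acf ade bce bde bcf adf by (elim insertE emptyE; simp)
    qed
    then show ?thesis using irr_three_conics_opposite[OF _ dist un] by blast
  next
    case bcf: 2
    have bdf: "\<not> cl Y b d f" using sh[of b b c d f f] bcf ds by auto
    have "cl Y a d f \<or> cl Y b d e" using ond ade bdf by blast
    then show ?thesis
    proof
      assume "cl Y a d f"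
      then show ?thesis using irr_three_conics_three_lines[OF no7 con dist un only ace _ bcf] by blast
    next
      \<comment> \<open>A symmetry of the cube brings the three lines into standard
        position.\<close>
      assume bde: "cl Y b d e"
      show ?thesis
        by (rule irr_three_conics_three_lines[OF no7, of c d f e g h b a])
          (use con dist ds un only bcf bde ace in \<open>simp_all add: insert_commute\<close>)
    qed
  next
    case bde: 3
    have bdf: "\<not> cl Y b d f" using sh[of b b d d e f] bde ds by auto
    have "cl Y a d f \<or> cl Y b c f" using onf acf bdf by blast
    then show ?thesis
    proof
      assume adf: "cl Y a d f"
      show ?thesis
        by (rule irr_three_conics_three_lines[OF no7, of d c f e g h a b])
          (use con dist ds un only adf bde ace in \<open>simp_all add: insert_commute\<close>)
    next
      assume bcf: "cl Y b c f"
      show ?thesis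
        by (rule irr_three_conics_three_lines[OF no7, of c d f e g h b a])
          (use con dist ds un only bcf bde ace in \<open>simp_all add: insert_commute\<close>)
    qed
  qed
qed

text \<open>A point among a, ..., f on no line is on exactly two conics and is removed. Otherwise
  the lines meet all six faces of the cube, and exchanging c with d or e with f turns some line
  through a into ace.\<close>

lemma irr_exactly_three_conics:
  assumes no7: "\<And>T. card T = 7 \<Longrightarrow> \<not> conicset Y T"
    and con: "conicset Y {c,d,e,f,g,h}" "conicset Y {a,b,e,f,g,h}" "conicset Y {a,b,c,d,g,h}"
    and dist: "distinct [a,b,c,d,e,f,g,h]" and un: "UNIV = {a,b,c,d,e,f,g,h}"
    and only: "\<And>K. card K = 6 \<Longrightarrow> conicset Y K \<Longrightarrow> K \<in> {{c,d,e,f,g,h},{a,b,e,f,g,h},{a,b,c,d,g,h}}"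
  shows "irr (stratum UNIV Y)"
proof -
  define E where E: "E = {a,b,c,d,e,f}"
  note ds = dist[simplified] distinct_sym[OF dist]
  show ?thesis
  proof (cases "\<exists>x\<in>E. \<forall>i j. i \<noteq> x \<longrightarrow> j \<noteq> x \<longrightarrow> i \<noteq> j \<longrightarrow> \<not> cl Y x i j")
  have c6: "card {c,d,e,f,g,h} = 6" "card {a,b,e,f,g,h} = 6" "card {a,b,c,d,g,h} = 6" using ds by simp_all
  have ne: "{c,d,e,f,g,h} \<noteq> {a,b,e,f,g,h}" "{c,d,e,f,g,h} \<noteq> {a,b,c,d,g,h}" "{a,b,e,f,g,h} \<noteq> {a,b,c,d,g,h}" using ds by blast+
  case True
  then obtain x where x: "x \<in> E" "\<And>i j. i \<noteq> x \<Longrightarrow> j \<noteq> x \<Longrightarrow> i \<noteq> j \<Longrightarrow> \<not> cl Y x i j" by blast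
  consider "x \<in> {a, b}" | "x \<in> {c, d}" | "x \<in> {e, f}" using x(1) unfolding E by blast
  then show ?thesis
  proof cases
    case 1
    then have "x \<notin> {c,d,e,f,g,h}" using ds by auto
    note out = this
    show ?thesis
    proof (rule irr_two_conics_no_line[OF no7 con(2) c6(2) con(3) c6(3) ne(3) _ _ _ x(2)])
      show "K = {a,b,e,f,g,h} \<or> K = {a,b,c,d,g,h}" if "card K = 6" "conicset Y K" "x \<in> K" for K
        using only[OF that(1,2)] that(3) out by auto
    qed (use 1 in auto)
  next
    case 2
    then have "x \<notin> {a,b,e,f,g,h}" using ds by auto
    note out = this
    show ?thesis
    proof (rule irr_two_conics_no_line[OF no7 con(1) c6(1) con(3) c6(3) ne(2) _ _ _ x(2)])
      show "K = {c,d,e,f,g,h} \<or> K = {a,b,c,d,g,h}" if "card K = 6" "conicset Y K" "x \<in> K" for K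
        using only[OF that(1,2)] that(3) out by auto
    qed (use 2 in auto)
  next
    case 3
    then have "x \<notin> {a,b,c,d,g,h}" using ds by auto
    note out = this
    show ?thesis
    proof (rule irr_two_conics_no_line[OF no7 con(1) c6(1) con(2) c6(2) ne(1) _ _ _ x(2)])
      show "K = {c,d,e,f,g,h} \<or> K = {a,b,e,f,g,h}" if "card K = 6" "conicset Y K" "x \<in> K" for K
        using only[OF that(1,2)] that(3) out by auto
    qed (use 3 in auto)
  qed
next
  case False
  have line: "\<exists>p\<in>{a, b}. \<exists>q\<in>{c, d}. \<exists>r\<in>{e, f}. x \<in> {p, q, r} \<and> cl Y p q r" if x: "x \<in> E" for x
  proof -
    obtain i j where ij: "i \<noteq> x" "j \<noteq> x" "i \<noteq> j" "cl Y x i j" using False x by blast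
    have "\<exists>p\<in>{a, b}. \<exists>q\<in>{c, d}. \<exists>r\<in>{e, f}. {x, i, j} = {p, q, r} \<and> cl Y p q r"
      by (rule cube_line[OF con dist un ij(4)]) (use ij in auto)
    then show ?thesis by blast
  qed
  have l1: "\<exists>q\<in>{c, d}. \<exists>r\<in>{e, f}. cl Y x q r" if "x \<in> {a, b}" for x
  proof -
    have "x \<notin> {c, d, e, f}" using that ds by auto
    then show ?thesis using line[of x] that unfolding E by blast
  qed
  have l2: "\<exists>p\<in>{a, b}. \<exists>r\<in>{e, f}. cl Y p x r" if "x \<in> {c, d}" for x
  proof -
    have "x \<notin> {a, b, e, f}" using that ds by auto
    then show ?thesis using line[of x] that unfolding E by blast
  qed
  have l3: "\<exists>p\<in>{a, b}. \<exists>q\<in>{c, d}. cl Y p q x" if "x \<in> {e, f}" for x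
  proof -
    have "x \<notin> {a, b, c, d}" using that ds by auto
    then show ?thesis using line[of x] that unfolding E by blast
  qed
  have on: "\<exists>q\<in>{c, d}. \<exists>r\<in>{e, f}. cl Y b q r" "\<exists>p\<in>{a, b}. \<exists>r\<in>{e, f}. cl Y p c r" "\<exists>p\<in>{a, b}. \<exists>r\<in>{e, f}. cl Y p d r"
    "\<exists>p\<in>{a, b}. \<exists>q\<in>{c, d}. cl Y p q e" "\<exists>p\<in>{a, b}. \<exists>q\<in>{c, d}. cl Y p q f"
    by (rule l1 l2 l3; simp)+
  obtain q r where qr: "q \<in> {c, d}" "r \<in> {e, f}" "cl Y a q r" using l1[of a] by blast
  then consider "q = c" "r = e" | "q = c" "r = f" | "q = d" "r = e" | "q = d" "r = f" by blast
  then show ?thesis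
  proof cases
    case 1
    then show ?thesis using irr_three_conics_covering[OF no7 con dist un only] on qr(3) by blast
  next
    case 2
    show ?thesis
      by (rule irr_three_conics_covering[OF no7, of c d f e g h a b])
        (use con dist ds un only on qr(3) 2 in \<open>simp_all add: insert_commute disj_commute\<close>)
  next
    case 3
    show ?thesis
      by (rule irr_three_conics_covering[OF no7, of d c e f g h a b])
        (use con dist ds un only on qr(3) 3 in \<open>simp_all add: insert_commute disj_commute\<close>)
  next
    case 4
    show ?thesis
      by (rule irr_three_conics_covering[OF no7, of d c f e g h a b])
        (use con dist ds un only on qr(3) 4 in \<open>simp_all add: insert_commute disj_commute\<close>)
  qed
qed
qed

section \<open>Case distinction by the number of conics\<close>

lemma complement_pair:
  assumes "card C = 6"
  obtains x y :: 8 where "- C = {x, y}" "x \<noteq> y"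
proof -
  have "card (- C) = 2" using assms by (simp add: Compl_eq_Diff_UNIV card_Diff_subset)
  then show ?thesis using that by (metis card_2_iff)
qed

text \<open>If no seven points are on a conic, the pairs omitted by the conics are disjoint. Hence
  there are at most four conics, and their number determines them up to relabelling.\<close>

theorem irr_or_moebius_kantor:
  obtains "irr (stratum UNIV Y)"
  | a b c d e f k h where "distinct [a, b, c, d, e, f, k, h]" "UNIV = {a, b, c, d, e, f, k, h}"
    "config Y {{a,b,c},{a,d,e},{a,f,k},{b,d,f},{b,e,h},{c,e,k},{c,f,h},{d,k,h}} {}"
proof (cases "\<exists>S. card S = 6 \<and> conicset Y S")
  case False
  then have none: "\<not> conicset Y C" if "card C = 6" for C using that by blast
  show thesis
  proof (cases "\<forall>x. three_lines Y (UNIV - {x}) x")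
    case False
    then show thesis using irr_few_lines_UNIV none that(1) by blast
  next
    case True
    then obtain a b c d e f k h where l: "distinct [a, b, c, d, e, f, k, h]" "UNIV = {a, b, c, d, e, f, k, h}"
      "\<And>T. card T = 3 \<Longrightarrow> coll Y T \<longleftrightarrow>
        T \<in> {{a,b,c},{a,d,e},{a,f,k},{b,d,f},{b,e,h},{c,e,k},{c,f,h},{d,k,h}}"
      using moebius_kantor_labels by metis
    have "config Y {{a,b,c},{a,d,e},{a,f,k},{b,d,f},{b,e,h},{c,e,k},{c,f,h},{d,k,h}} {}"
    proof (rule config_coll_exact)
      fix L assume L: "L \<in> {{a,b,c},{a,d,e},{a,f,k},{b,d,f},{b,e,h},{c,e,k},{c,f,h},{d,k,h}}"
      have c: "card L = 3" using L l(1) by (elim insertE emptyE) simp_all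
      show "card L = 3 \<and> coll Y L" using c iffD2[OF l(3)[OF c] L] by simp
    next
      fix i j k' assume "i \<noteq> j" "i \<noteq> k'" "j \<noteq> k'" "cl Y i j k'"
      then have "{i, j, k'} \<in> {{a,b,c},{a,d,e},{a,f,k},{b,d,f},{b,e,h},{c,e,k},{c,f,h},{d,k,h}}"
        using l(3)[of "{i, j, k'}"] by (simp add: cl_def)
      then show "\<exists>L\<in>{{a,b,c},{a,d,e},{a,f,k},{b,d,f},{b,e,h},{c,e,k},{c,f,h},{d,k,h}}. {i, j, k'} \<subseteq> L"
        by (rule bexI[rotated]) simp
    qed (use none in auto)
    then show thesis using that(2) l(1,2) by blast
  qed
next
  case True
  then obtain S where S: "card S = 6" "conicset Y S" by blast
  have "irr (stratum UNIV Y)"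
  proof (cases "\<exists>T. card T = 7 \<and> conicset Y T")
    case True
    then obtain T where T: "card T = 7" "conicset Y T" by blast
    have "card (UNIV - T) = 1" using T(1) by (simp add: card_Diff_subset)
    then obtain y where "UNIV - T = {y}" using card_1_singletonE by blast
    then have y: "insert y T = UNIV" "y \<notin> T" by blast+
    show ?thesis
    proof (cases "conicset Y UNIV")
      case True then show ?thesis using conic_all[of UNIV] irr_delete by simp
    next
      case False then show ?thesis using conic_plus_point[OF T(2) _ y(2)] T(1) irr_delete y(1) by simp
    qed
  next
    case False
    then have no7: "\<not> conicset Y T" if "card T = 7" for T using that by blast
    obtain a b where ab: "- S = {a, b}" "a \<noteq> b" using complement_pair[OF S(1)] .
    show ?thesis
    proof (cases "\<exists>C. card C = 6 \<and> conicset Y C \<and> C \<noteq> S")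
      case False
      then show ?thesis using irr_one_conic[OF S(2,1), of a b] ab by blast
    next
      case True
      then obtain C where C: "card C = 6" "conicset Y C" "C \<noteq> S" by blast
      have disj: "- K \<inter> - L = {}" if "card K = 6" "conicset Y K" "card L = 6" "conicset Y L" "K \<noteq> L" for K L
        using conicset_cover[OF no7 that(2,1,4,3,5)] by blast
      obtain c d where cd: "- C = {c, d}" "c \<noteq> d" using complement_pair[OF C(1)] .
      have abcd: "{a, b} \<inter> {c, d} = {}" using disj[OF S C(1,2)] C(3) ab(1) cd(1) by auto
      have cpl: "- A = B" if "A \<union> B = UNIV" "A \<inter> B = {}" for A B :: "8 set" using that by blast
      show ?thesis
      proof (cases "\<exists>D. card D = 6 \<and> conicset Y D \<and> D \<noteq> S \<and> D \<noteq> C")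
        case False
        then have only: "K = S \<or> K = C" if "card K = 6" "conicset Y K" for K using that by blast
        have "distinct [a, b, c, d]" using ab(2) cd(2) abcd by auto
        then have "card (- {a, b, c, d}) = 4" by (simp add: Compl_eq_Diff_UNIV card_Diff_subset)
        then obtain e f g h where efgh: "- {a, b, c, d} = {e, f, g, h}" "distinct [e, f, g, h]"
        proof -
          obtain xs where xs: "set xs = - {a, b, c, d}" "distinct xs" using finite_distinct_list[of "- {a, b, c, d}"] by auto
          then have "length xs = 4" using \<open>card (- {a, b, c, d}) = 4\<close> distinct_card by metis
          then obtain e f g h where "xs = [e, f, g, h]" by (auto simp: length_Suc_conv numeral_eq_Suc)
          then have "- {a, b, c, d} = {e, f, g, h}" "distinct [e, f, g, h]" using xs by simp_all
          then show ?thesis by (rule that)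
        qed
        have dist: "distinct [a,b,c,d,e,f,g,h]" using efgh ab(2) cd(2) abcd by auto
        have un: "UNIV = {a,b,c,d,e,f,g,h}" using efgh(1) by blast
        note ds = dist[simplified] distinct_sym[OF dist]
        have "- {a, b} = {c,d,e,f,g,h}" "- {c, d} = {a,b,e,f,g,h}"
          by (rule cpl; use un ds in \<open>simp add: insert_commute\<close>)+
        then have "S = {c,d,e,f,g,h}" "C = {a,b,e,f,g,h}" using ab(1) cd(1) by (metis double_compl)+
        then show ?thesis using irr_exactly_two_conics[OF no7 dist un] S C only by simp
      next
        case True
        then obtain D where D: "card D = 6" "conicset Y D" "D \<noteq> S" "D \<noteq> C" by blast
        obtain e f where ef: "- D = {e, f}" "e \<noteq> f" using complement_pair[OF D(1)] .
        have abef: "{a, b} \<inter> {e, f} = {}" using disj[OF S D(1,2)] D(3) ab(1) ef(1) by auto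
        have cdef: "{c, d} \<inter> {e, f} = {}" using disj[OF C(1,2) D(1,2)] D(4) cd(1) ef(1) by auto
        have "distinct [a, b, c, d, e, f]" using ab(2) cd(2) ef(2) abcd abef cdef by auto
        then have "card (- {a, b, c, d, e, f}) = 2" by (simp add: Compl_eq_Diff_UNIV card_Diff_subset)
        then obtain g h where gh: "- {a, b, c, d, e, f} = {g, h}" "g \<noteq> h" by (metis card_2_iff)
        have dist: "distinct [a,b,c,d,e,f,g,h]" using gh ab(2) cd(2) ef(2) abcd abef cdef by auto
        have un: "UNIV = {a,b,c,d,e,f,g,h}" using gh(1) by blast
        note ds = dist[simplified] distinct_sym[OF dist]
        have "- {a, b} = {c,d,e,f,g,h}" "- {c, d} = {a,b,e,f,g,h}" "- {e, f} = {a,b,c,d,g,h}"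
          by (rule cpl; use un ds in \<open>simp add: insert_commute\<close>)+
        then have SCD: "S = {c,d,e,f,g,h}" "C = {a,b,e,f,g,h}" "D = {a,b,c,d,g,h}"
          using ab(1) cd(1) ef(1) by (metis double_compl)+
        \<comment> \<open>A further conic omits a pair disjoint from the three others, and only g, h
          are left.\<close>
        have only: "K = S \<or> K = C \<or> K = D \<or> K = {a,b,c,d,e,f}" if K: "card K = 6" "conicset Y K" for K
        proof (rule ccontr)
          assume n: "\<not> ?thesis"
          obtain x y where xy: "- K = {x, y}" "x \<noteq> y" using complement_pair[OF K(1)] .
          have K': "K \<noteq> S" "K \<noteq> C" "K \<noteq> D" using n by simp_all
          have "{x, y} \<inter> {a, b} = {}" "{x, y} \<inter> {c, d} = {}" "{x, y} \<inter> {e, f} = {}"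
            using disj[OF K S K'(1)] disj[OF K C(1,2) K'(2)] disj[OF K D(1,2) K'(3)]
            unfolding xy(1) ab(1) cd(1) ef(1) by simp_all
          then have "{x, y} \<subseteq> {g, h}" using un by blast
          then have "{x, y} = {g, h}" using xy(2) by blast
          then have "K = - {g, h}" using xy(1) by blast
          then have "K = {a,b,c,d,e,f}" using gh(1) by blast
          then show False using n by blast
        qed
        show ?thesis
        proof (cases "conicset Y {a,b,c,d,e,f}")
          case True
          show ?thesis
            by (rule irr_exactly_four_conics[OF dist un]) (use S C D True only SCD in auto)
        next
          case False
          then have "K \<in> {{c,d,e,f,g,h},{a,b,e,f,g,h},{a,b,c,d,g,h}}" if "card K = 6" "conicset Y K" for K
            using only[OF that] that(2) False unfolding SCD by auto
          then show ?thesis using irr_exactly_three_conics[OF no7 _ _ _ dist un] S C D SCD by simp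
        qed
      qed
    qed
  qed
  then show thesis by (rule that(1))
qed

end

section \<open>The two components of the Moebius-Kantor configuration\<close>

locale moebius_kantor_labels =
  fixes a b c d e f k h :: 8
  assumes dist: "distinct [a, b, c, d, e, f, k, h]"
    and un: "UNIV = {a, b, c, d, e, f, k, h}"
begin

definition lines :: "8 set set" where
  "lines = {{a,b,c},{a,d,e},{a,f,k},{b,d,f},{b,e,h},{c,e,k},{c,f,h},{d,k,h}}"

text \<open>In the projective frame \<open>a, b, d, k\<close> the point \<open>c\<close> on the line \<open>ab\<close> is \<open>(1, \<gamma>, 0)\<close>, and the
  lines force \<open>\<gamma>\<^sup>2 - \<gamma> + 1 = 0\<close>; the two roots give the two components.\<close>
definition mk_tuple :: "complex \<Rightarrow> tuple \<Rightarrow> tuple" where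
  "mk_tuple \<gamma> v = (\<lambda>_. 0)(a := (v c $ 3) *s v a, b := (v e $ 1) *s v b, d := (v e $ 2) *s v d,
     k := v a + v b + v d, c := (v k $ 2) *s (v a + \<gamma> *s v b),
     e := (v k $ 3) *s (v a + (1 - \<gamma>) *s v d), f := (v c $ 1) *s (v b + v d),
     h := (v c $ 2) *s (v a + v b + (1 - \<gamma>) *s v d))"

text \<open>The cross ratio of the lines from d to a, b, k, c with denominators cleared; for c on
  the line ab it says that c is (1, \<gamma>, 0) in the frame. Both terms have the same degree in
  each point, so the condition is meaningful for projective points.\<close>

definition ratio_eq :: "complex \<Rightarrow> tuple \<Rightarrow> complex" where
  "ratio_eq \<gamma> X = det3 (X a) (X c) (X d) * det3 (X k) (X b) (X d) +
     - \<gamma> * (det3 (X c) (X b) (X d) * det3 (X a) (X k) (X d))"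

lemmas labels = dist[simplified] distinct_sym[OF dist]

lemma label_cases:
  obtains "i = a" | "i = b" | "i = c" | "i = d" | "i = e" | "i = f" | "i = k" | "i = h"
proof -
  have "i \<in> {a, b, c, d, e, f, k, h}" using un by simp
  then show ?thesis using that by blast
qed

lemma mk_tuple_simps:
  "mk_tuple \<gamma> v a = (v c $ 3) *s v a" "mk_tuple \<gamma> v b = (v e $ 1) *s v b"
  "mk_tuple \<gamma> v d = (v e $ 2) *s v d" "mk_tuple \<gamma> v k = v a + v b + v d"
  "mk_tuple \<gamma> v c = (v k $ 2) *s (v a + \<gamma> *s v b)"
  "mk_tuple \<gamma> v e = (v k $ 3) *s (v a + (1 - \<gamma>) *s v d)"
  "mk_tuple \<gamma> v f = (v c $ 1) *s (v b + v d)"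
  "mk_tuple \<gamma> v h = (v c $ 2) *s (v a + v b + (1 - \<gamma>) *s v d)"
  using labels by (simp_all add: mk_tuple_def)

lemma regmap_mk_tuple: "regmap (mk_tuple \<gamma>)"
  unfolding mk_tuple_def by (intro reg_intros regmap_zero)

lemma ratio_eq_mk_tuple: "ratio_eq \<gamma> (mk_tuple \<gamma> v) = 0"
  unfolding ratio_eq_def mk_tuple_simps
  by (simp add: det3_perm[where a = "v a" and b = "v b" and c = "v d"] algebra_simps)

lemma coll_mk_tuple:
  assumes "\<gamma> * \<gamma> = \<gamma> - 1" "L \<in> lines" shows "coll (mk_tuple \<gamma> v) L"
proof -
  have \<gamma>: "\<gamma> * (\<gamma> * x) = \<gamma> * x - x" for x using assms(1) by algebra
  have "coll (mk_tuple \<gamma> v) {a,b,c}" "coll (mk_tuple \<gamma> v) {a,d,e}" "coll (mk_tuple \<gamma> v) {a,f,k}"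
    "coll (mk_tuple \<gamma> v) {b,d,f}" "coll (mk_tuple \<gamma> v) {b,e,h}" "coll (mk_tuple \<gamma> v) {c,e,k}"
    "coll (mk_tuple \<gamma> v) {c,f,h}" "coll (mk_tuple \<gamma> v) {d,k,h}"
    unfolding coll_iff_det3 mk_tuple_simps
    by (simp_all add: det3_perm[where a = "v a" and b = "v b" and c = "v d"] algebra_simps \<gamma>)
  then show ?thesis using assms(2) unfolding lines_def by blast
qed

text \<open>Five of the lines bring c, e, f, h into normal form with coordinates \<gamma>,
  \<epsilon>, \<eta>. Then beh and cfh give \<epsilon> = \<eta> = 1 - \<gamma>, and the last line
  cek yields the quadratic equation.\<close>

lemma config_mk_tuple:
  assumes X: "config X lines {}"
  shows "\<exists>\<gamma> v. \<gamma> * \<gamma> = \<gamma> - 1 \<and> mk_tuple \<gamma> v = X"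
proof -
  note cd = config_det3[OF X]
  have nz: "det3 (X a) (X b) (X d) \<noteq> 0" "det3 (X k) (X b) (X d) \<noteq> 0" "det3 (X a) (X k) (X d) \<noteq> 0"
    "det3 (X a) (X b) (X k) \<noteq> 0" "det3 (X b) (X d) (X c) \<noteq> 0" "det3 (X b) (X d) (X e) \<noteq> 0"
    "det3 (X a) (X b) (X f) \<noteq> 0" "det3 (X a) (X d) (X h) \<noteq> 0"
    using labels by (subst cd; auto simp: lines_def)+
  have z: "det3 (X a) (X b) (X c) = 0" "det3 (X a) (X d) (X e) = 0" "det3 (X a) (X f) (X k) = 0"
    "det3 (X b) (X d) (X f) = 0" "det3 (X b) (X e) (X h) = 0" "det3 (X c) (X e) (X k) = 0"
    "det3 (X c) (X f) (X h) = 0" "det3 (X d) (X k) (X h) = 0"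
    using labels by (subst cd; auto simp: lines_def)+
  have n: "crs (X i) (X j) \<noteq> 0" if "i \<noteq> j" for i j using config_crs[OF X that] .
  obtain r s t where kk: "X k = r *s X a + s *s X b + t *s X d" using basis_coords[OF nz(1)] .
  have rst: "r \<noteq> 0" "s \<noteq> 0" "t \<noteq> 0" using nz(2-4) unfolding kk by auto
  define P Q R where "P = r *s X a" "Q = s *s X b" "R = t *s X d"
  have pqr: "X a = (1/r) *s P" "X b = (1/s) *s Q" "X d = (1/t) *s R"
    using rst by (simp_all add: P_Q_R_def vector_smult_assoc)
  have k: "X k = P + Q + R" by (simp add: kk P_Q_R_def)
  define D where "D = det3 P Q R"
  have D: "D \<noteq> 0" using nz(1) rst by (simp add: D_def P_Q_R_def)
  note D' = det3_perm[where a = P and b = Q and c = R] D_def[symmetric]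
  have nn: "crs P Q \<noteq> 0" "crs P R \<noteq> 0" "crs Q R \<noteq> 0" "crs R (P + Q + R) \<noteq> 0"
    using n[of a b] n[of a d] n[of b d] n[of d k] labels rst unfolding k[symmetric]
    by (auto simp: P_Q_R_def vec3_eq_iff)
  obtain c1 c2 where c: "X c = c1 *s P + c2 *s Q"
    using line_coords[OF nn(1), of "X c"] z(1) rst by (auto simp: P_Q_R_def)
  obtain e1 e2 where e: "X e = e1 *s P + e2 *s R"
    using line_coords[OF nn(2), of "X e"] z(2) rst by (auto simp: P_Q_R_def)
  obtain f1 f2 where f: "X f = f1 *s Q + f2 *s R"
    using line_coords[OF nn(3), of "X f"] z(4) rst by (auto simp: P_Q_R_def)
  obtain h1 h2 where h: "X h = h1 *s R + h2 *s (P + Q + R)"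
  proof (rule line_coords[OF nn(4), of "X h"])
    have "(1/t) * det3 R (P + Q + R) (X h) = 0" using z(8) unfolding k pqr det3_linear(7) .
    then show "det3 R (P + Q + R) (X h) = 0" using rst by (simp del: det3_linear)
  qed
  have c1: "c1 \<noteq> 0" using nz(5) unfolding c pqr by (auto simp: D')
  have e1: "e1 \<noteq> 0" using nz(6) unfolding e pqr by (auto simp: D')
  have f2: "f2 \<noteq> 0" using nz(7) unfolding f pqr by (auto simp: D')
  have h2: "h2 \<noteq> 0" using nz(8) unfolding h pqr by (auto simp: D')
  have ff: "f1 = f2" using z(3) rst D unfolding f k pqr by (simp add: D' algebra_simps)
  define \<gamma> \<epsilon> \<eta> where "\<gamma> = c2 / c1" "\<epsilon> = e2 / e1" "\<eta> = (h1 + h2) / h2"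
  have c': "X c = c1 *s (P + \<gamma> *s Q)" and e': "X e = e1 *s (P + \<epsilon> *s R)"
    and f': "X f = f2 *s (Q + R)" and h': "X h = h2 *s (P + Q + \<eta> *s R)"
    using c1 e1 h2 by (simp_all add: c e f h ff vec3_eq_iff \<gamma>_\<epsilon>_\<eta>_def field_simps)
  have 1: "\<eta> = \<epsilon>" using z(5) rst e1 h2 D unfolding e' h' pqr by (simp add: D' algebra_simps)
  have "c1 * f2 * h2 * D * (\<eta> - 1 + \<gamma>) = 0" using z(7) unfolding c' f' h' by (simp add: D' algebra_simps)
  then have "\<eta> - 1 + \<gamma> = 0" using c1 f2 h2 D by simp
  then have 2: "\<eta> = 1 - \<gamma>" by algebra
  have "c1 * e1 * D * (\<gamma> * \<epsilon> - \<gamma> - \<epsilon>) = 0" using z(6) unfolding c' e' k by (simp add: D' algebra_simps)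
  then have "\<gamma> * \<epsilon> - \<gamma> - \<epsilon> = 0" using c1 e1 D by simp
  then have 3: "\<gamma> * \<gamma> = \<gamma> - 1" using 1 2 by algebra
  define v :: tuple where "v = (\<lambda>_. 0)(a := P, b := Q, d := R, c := vector [f2, h2, 1/r],
     e := vector [1/s, 1/t, 0], k := vector [0, c1, e1])"
  have v: "v a = P" "v b = Q" "v d = R" "v c = vector [f2, h2, 1/r]" "v e = vector [1/s, 1/t, 0]"
    "v k = vector [0, c1, e1]" using labels by (simp_all add: v_def)
  have "mk_tuple \<gamma> v i = X i" for i
    by (cases i rule: label_cases)
      (simp_all only: mk_tuple_simps v vector_3 pqr k c' e' f' h' 1[symmetric] 2[symmetric])
  then have "mk_tuple \<gamma> v = X" by blast
  with 3 show ?thesis by blast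
qed

text \<open>Each root gives a polynomial parametrization. Within the stratum the ratio equation
  singles out its image: the equation is linear in \<gamma> with nonzero leading coefficient, so it
  determines the root.\<close>

lemma irr_ratio_eq:
  assumes Y: "config Y lines {}" and \<gamma>: "\<gamma> * \<gamma> = \<gamma> - 1" and ne: "{X \<in> stratum UNIV Y. ratio_eq \<gamma> X = 0} \<noteq> {}"
  shows "irr {X \<in> stratum UNIV Y. ratio_eq \<gamma> X = 0}"
proof (rule irr_step[where R = UNIV and \<Phi> = "mk_tuple \<gamma>" and U = "generic UNIV Y"])
  show "irr UNIV" "regmap (mk_tuple \<gamma>)" "zopen (generic UNIV Y)"
    by (rule irr_UNIV regmap_mk_tuple zopen_generic)+
  show "{X \<in> stratum UNIV Y. ratio_eq \<gamma> X = 0} \<noteq> {}" by (rule ne)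
  show "{X \<in> stratum UNIV Y. ratio_eq \<gamma> X = 0} \<subseteq> generic UNIV Y" using stratum_generic by blast
  show "{X \<in> stratum UNIV Y. ratio_eq \<gamma> X = 0} \<subseteq> range (mk_tuple \<gamma>)"
  proof clarify
    fix X assume X: "X \<in> stratum UNIV Y" "ratio_eq \<gamma> X = 0"
    have cX: "config X lines {}" by (rule config_stratum[OF Y X(1)])
    obtain \<delta> v where v: "mk_tuple \<delta> v = X" using config_mk_tuple[OF cX] by blast
    have "det3 (X c) (X b) (X d) \<noteq> 0" "det3 (X a) (X k) (X d) \<noteq> 0"
      using labels by (subst config_det3[OF cX]; auto simp: lines_def)+
    moreover have "ratio_eq \<delta> X = 0" using ratio_eq_mk_tuple v by metis
    then have "(\<delta> - \<gamma>) * (det3 (X c) (X b) (X d) * det3 (X a) (X k) (X d)) = 0"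
      using X(2) unfolding ratio_eq_def by algebra
    ultimately have "\<delta> = \<gamma>" by simp
    then show "X \<in> range (mk_tuple \<gamma>)" using v by blast
  qed
  fix v assume gen: "mk_tuple \<gamma> v \<in> generic UNIV Y"
  have "mk_tuple \<gamma> v \<in> stratum UNIV Y"
  proof (rule stratumI[OF gen])
    fix T assume T: "card T = 3" "coll Y T"
    then obtain L where "L \<in> lines" "T \<subseteq> L" using config_coll_iff[OF Y] by blast
    then show "coll (mk_tuple \<gamma> v) T" using coll_mk_tuple[OF \<gamma>] coll_mono by blast
  next
    fix S assume "card S = 6" "nocoll Y S" "onconic Y S"
    then show "onconic (mk_tuple \<gamma> v) S" using config_onconic_iff[OF Y] by blast
  qed
  then show "mk_tuple \<gamma> v \<in> {X \<in> stratum UNIV Y. ratio_eq \<gamma> X = 0}" using ratio_eq_mk_tuple by simp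
qed

lemma ratio_eq_cases:
  assumes "config X lines {}" obtains \<gamma> where "\<gamma> * \<gamma> = \<gamma> - 1" "ratio_eq \<gamma> X = 0"
  using config_mk_tuple[OF assms] ratio_eq_mk_tuple by metis

lemma ratio_eq_unique:
  assumes "config X lines {}" "ratio_eq \<gamma> X = 0" "ratio_eq \<delta> X = 0" shows "\<gamma> = \<delta>"
proof -
  have "det3 (X c) (X b) (X d) \<noteq> 0" "det3 (X a) (X k) (X d) \<noteq> 0"
    using labels by (subst config_det3[OF assms(1)]; auto simp: lines_def)+
  moreover have "(\<delta> - \<gamma>) * (det3 (X c) (X b) (X d) * det3 (X a) (X k) (X d)) = 0"
    using assms(2,3) unfolding ratio_eq_def by algebra
  ultimately show ?thesis by simp
qed

text \<open>Puts a triple into increasing positions in the list of labels, which reduces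
  collinearity of all triples to a finite check in \<open>config_realized\<close>.\<close>

lemma card3_cases:
  assumes "card (T :: 8 set) = 3"
  obtains p q r where "p < q" "q < r" "r < 8"
    "T = {[a,b,c,d,e,f,k,h] ! p, [a,b,c,d,e,f,k,h] ! q, [a,b,c,d,e,f,k,h] ! r}"
proof -
  let ?xs = "[a,b,c,d,e,f,k,h]"
  let ?I = "{p. p < 8 \<and> ?xs ! p \<in> T}"
  have "bij_betw ((!) ?xs) {..<8} UNIV"
    using bij_betw_nth[OF dist, of "{..<8}" UNIV] un by simp
  then have inj: "inj_on ((!) ?xs) {..<8}" and im: "(!) ?xs ` {..<8} = UNIV"
    by (auto simp: bij_betw_def)
  have T: "T = (!) ?xs ` ?I"
  proof
    show "T \<subseteq> (!) ?xs ` ?I"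
    proof
      fix x assume "x \<in> T"
      moreover have "x \<in> (!) ?xs ` {..<8}" using im by simp
      ultimately show "x \<in> (!) ?xs ` ?I" by blast
    qed
  qed blast
  have "inj_on ((!) ?xs) ?I" by (rule inj_on_subset[OF inj]) auto
  from card_image[OF this] have "card ?I = 3" using assms unfolding T[symmetric] by simp
  then obtain i j l where I: "?I = {i, j, l}" "i \<noteq> j" "i \<noteq> l" "j \<noteq> l" by (auto simp: card_3_iff)
  have "\<exists>p q r. p < q \<and> q < r \<and> ?I = {p, q, r}"
  proof -
    consider "i < j" "j < l" | "i < l" "l < j" | "j < i" "i < l" | "j < l" "l < i" | "l < i" "i < j" | "l < j" "j < i"
      using I(2-4) by linarith
    then show ?thesis unfolding I(1) by cases (metis insert_commute)+
  qed
  then obtain p q r where pqr: "p < q" "q < r" "?I = {p, q, r}" by blast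
  have "r \<in> ?I" using pqr(3) by simp
  then have "r < 8" by simp
  moreover have "T = {?xs ! p, ?xs ! q, ?xs ! r}" using T unfolding pqr(3) by simp
  ultimately show thesis using that pqr(1,2) by blast
qed

text \<open>Each label is on three of the eight lines, so the two points outside \<open>S\<close>
  meet at most six of them.\<close>

lemma line_in_card6:
  assumes "card (S :: 8 set) = 6" shows "\<exists>L\<in>lines. L \<subseteq> S"
proof -
  have "card (- S) = 2" using assms by (simp add: Compl_eq_Diff_UNIV card_Diff_subset)
  then obtain x y where xy: "- S = {x, y}" by (auto simp: card_2_iff)
  have "\<exists>L\<in>lines. x \<notin> L \<and> y \<notin> L"
    by (cases x rule: label_cases; cases y rule: label_cases) (use labels in \<open>simp_all add: lines_def\<close>)
  then obtain L where L: "L \<in> lines" "x \<notin> L" "y \<notin> L" by blast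
  have "z \<in> S" if "z \<in> L" for z
  proof -
    have "z \<notin> - S" unfolding xy using that L by blast
    then show ?thesis by simp
  qed
  then show ?thesis using L(1) by blast
qed

lemma lines_card: "L \<in> lines \<Longrightarrow> card L = 3"
  using labels by (auto simp: lines_def)

text \<open>Both roots have to occur with the same incidences, since otherwise one of the two pieces
  would be empty.\<close>

lemma config_realized:
  assumes \<gamma>: "\<gamma> * \<gamma> = \<gamma> - 1"
  shows "\<exists>Z. config Z lines {} \<and> ratio_eq \<gamma> Z = 0"
proof -
  define v :: tuple where "v = (\<lambda>_. vector [1, 1, 1])(a := vector [1, 0, 0], b := vector [0, 1, 0], d := vector [0, 0, 1])"
  define Z where "Z = mk_tuple \<gamma> v"
  have Z: "Z a = vector [1, 0, 0]" "Z b = vector [0, 1, 0]" "Z d = vector [0, 0, 1]"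
    "Z k = vector [1, 1, 1]" "Z c = vector [1, \<gamma>, 0]" "Z e = vector [1, 0, 1 - \<gamma>]"
    "Z f = vector [0, 1, 1]" "Z h = vector [1, 1, 1 - \<gamma>]"
    using labels by (simp_all add: Z_def mk_tuple_simps v_def vec3_eq_iff vector_3)
  have g: "\<gamma> \<noteq> 0" "\<gamma> \<noteq> 1" using \<gamma> by auto
  have gg: "\<gamma> * (\<gamma> * x) = \<gamma> * x - x" for x using \<gamma> by algebra
  let ?xs = "[a,b,c,d,e,f,k,h]"
  have "gen UNIV Z"
    unfolding gen_def
  proof (intro ballI impI)
    fix i j :: 8 assume "i \<noteq> j"
    then show "crs (Z i) (Z j) \<noteq> 0"
      by (cases i rule: label_cases; cases j rule: label_cases)
        (use labels g in \<open>simp_all add: Z vec3_eq_iff vector_3\<close>)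
  qed
  \<comment> \<open>All 56 triples of labels are evaluated, with squares of \<gamma> reduced by the
    quadratic equation.\<close>
  have tri: "\<forall>r<8. \<forall>q<r. \<forall>p<q. det3 (Z (?xs ! p)) (Z (?xs ! q)) (Z (?xs ! r)) = 0 \<longleftrightarrow>
     (\<exists>L\<in>lines. {?xs ! p, ?xs ! q, ?xs ! r} \<subseteq> L)"
    using labels g
    by (simp add: eval_nat_numeral All_less_Suc Z det3_expand vector_3 lines_def algebra_simps \<gamma> gg)
  have coll: "coll Z T \<longleftrightarrow> (\<exists>L\<in>lines. T \<subseteq> L)" if T: "card T = 3" for T
  proof -
    obtain p q r where "p < q" "q < r" "r < 8" "T = {?xs ! p, ?xs ! q, ?xs ! r}" using card3_cases[OF T] .
    then show ?thesis using tri by (simp only: coll_iff_det3)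
  qed
  have "\<not> nocoll Z S" if S: "card S = 6" for S
  proof -
    obtain L where L: "L \<in> lines" "L \<subseteq> S" using line_in_card6[OF S] by blast
    then have "coll Z L" using coll lines_card by blast
    then show ?thesis using L lines_card unfolding nocoll_def by blast
  qed
  then have "config Z lines {}" using \<open>gen UNIV Z\<close> coll by (simp add: config_def)
  moreover have "ratio_eq \<gamma> Z = 0" unfolding Z_def by (rule ratio_eq_mk_tuple)
  ultimately show ?thesis by blast
qed

end

section \<open>Linear and quadratic forms as polynomials\<close>

definition mon :: "nat \<Rightarrow> nat \<Rightarrow> nat \<Rightarrow> 3 \<Rightarrow>\<^sub>0 nat" where
  "mon i j k = Poly_Mapping.single 1 i + Poly_Mapping.single 2 j + Poly_Mapping.single 3 k"

lemma three_distinct: "(1::3) \<noteq> 2" "(1::3) \<noteq> 3" "(2::3) \<noteq> 3" "(2::3) \<noteq> 1" "(3::3) \<noteq> 1" "(3::3) \<noteq> 2"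
  by simp_all

lemma lookup_mon [simp]: "Poly_Mapping.lookup (mon i j k) 1 = i" "Poly_Mapping.lookup (mon i j k) 2 = j"
  "Poly_Mapping.lookup (mon i j k) 3 = k"
  by (simp_all add: mon_def lookup_add lookup_single when_def three_distinct)

lemma mon_eq_iff [simp]: "mon i j k = mon i' j' k' \<longleftrightarrow> i = i' \<and> j = j' \<and> k = k'"
  using lookup_mon by metis

lemma mon_lookup: "m = mon (Poly_Mapping.lookup m 1) (Poly_Mapping.lookup m 2) (Poly_Mapping.lookup m 3)"
proof (rule poly_mapping_eqI)
  fix v :: 3
  show "Poly_Mapping.lookup m v =
    Poly_Mapping.lookup (mon (Poly_Mapping.lookup m 1) (Poly_Mapping.lookup m 2) (Poly_Mapping.lookup m 3)) v"
    using exhaust_3[of v] by auto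
qed

lemma peval_mon: "peval (\<lambda>j. (x :: complex^3) $ j) (Poly_Mapping.single (mon i j k) c) =
    c * ((x$1)^i * (x$2)^j * (x$3)^k)"
proof -
  have "(\<Prod>v\<in>UNIV. h v) = h 1 * h 2 * h 3" for h :: "3 \<Rightarrow> complex"
    unfolding UNIV_3 by (simp add: mult.assoc)
  then show ?thesis by (simp only: peval_single lookup_mon)
qed

abbreviation tdeg :: "(3 \<Rightarrow>\<^sub>0 nat) \<Rightarrow> nat" where
  "tdeg m \<equiv> (\<Sum>v\<in>UNIV. Poly_Mapping.lookup m v)"

lemma tdeg_mon: "tdeg (mon i j k) = i + j + k"
  by (simp only: sum_3 lookup_mon)

definition linear_form :: "complex^3 \<Rightarrow> 3 cpoly" where
  "linear_form n = Poly_Mapping.single (mon 1 0 0) (n$1) + Poly_Mapping.single (mon 0 1 0) (n$2)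
     + Poly_Mapping.single (mon 0 0 1) (n$3)"

definition quadratic_form :: "complex^3 \<Rightarrow> complex^3 \<Rightarrow> 3 cpoly" where
  "quadratic_form a b = Poly_Mapping.single (mon 2 0 0) (a$1) + Poly_Mapping.single (mon 0 2 0) (a$2)
     + Poly_Mapping.single (mon 0 0 2) (a$3) + Poly_Mapping.single (mon 0 1 1) (b$1)
     + Poly_Mapping.single (mon 1 0 1) (b$2) + Poly_Mapping.single (mon 1 1 0) (b$3)"

lemma peval_linear_form: "peval (\<lambda>j. x $ j) (linear_form n) = dot3 n x"
  by (simp add: linear_form_def peval_add peval_mon dot3_def del: One_nat_def)

lemma peval_quadratic_form: "peval (\<lambda>j. x $ j) (quadratic_form a b) = qform a b x"
  by (simp add: quadratic_form_def peval_add peval_mon qform_def del: One_nat_def)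

lemma homogeneous_add: "homogeneous d f \<Longrightarrow> homogeneous d g \<Longrightarrow> homogeneous d (f + g)"
  unfolding homogeneous_def using Poly_Mapping.keys_add[of f g] by blast

lemma homogeneous_diff: "homogeneous d f \<Longrightarrow> homogeneous d g \<Longrightarrow> homogeneous d (f - g)"
  unfolding homogeneous_def using keys_diff[of f g] by blast

lemma homogeneous_sum: "(\<And>a. a \<in> A \<Longrightarrow> homogeneous d (h a)) \<Longrightarrow> homogeneous d (sum h A)"
  by (induction A rule: infinite_finite_induct) (auto simp: homogeneous_add, simp_all add: homogeneous_def)

lemma homogeneous_single: "(\<Sum>v\<in>UNIV. Poly_Mapping.lookup m v) = d \<Longrightarrow> homogeneous d (Poly_Mapping.single m c)"
  by (simp add: homogeneous_def)

lemma homogeneous_mult: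
  assumes "homogeneous d f" "homogeneous e g" shows "homogeneous (d + e) (f * g)"
  unfolding homogeneous_def
proof
  fix m assume "m \<in> Poly_Mapping.keys (f * g)"
  then obtain a b where "m = a + b" "a \<in> Poly_Mapping.keys f" "b \<in> Poly_Mapping.keys g"
    using keys_mult by blast
  then show "(\<Sum>v\<in>UNIV. Poly_Mapping.lookup m v) = d + e"
    using assms by (simp add: homogeneous_def lookup_add sum.distrib)
qed

lemma homogeneous_linear_form: "homogeneous 1 (linear_form n)"
  unfolding linear_form_def by (intro homogeneous_add homogeneous_single) (simp_all add: tdeg_mon del: One_nat_def)

lemma homogeneous_quadratic_form: "homogeneous 2 (quadratic_form a b)"
  unfolding quadratic_form_def by (intro homogeneous_add homogeneous_single) (simp_all add: tdeg_mon)

lemma homogeneous_cases: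
  assumes "homogeneous d f" "m \<in> Poly_Mapping.keys f"
  obtains i j k where "m = mon i j k" "i + j + k = d"
  using assms mon_lookup[of m] tdeg_mon unfolding homogeneous_def by metis

lemma homogeneous_0:
  assumes "homogeneous 0 (f :: 3 cpoly)" obtains c where "f = Poly_Mapping.single 0 c"
proof -
  have "m = 0" if "m \<in> Poly_Mapping.keys f" for m
    using homogeneous_cases[OF assms that] by (auto simp: mon_def)
  then have "f = Poly_Mapping.single 0 (Poly_Mapping.lookup f 0)"
    by (intro poly_mapping_eqI) (auto simp: lookup_single when_def in_keys_iff)
  then show ?thesis by (rule that)
qed

lemma homogeneous_1:
  assumes "homogeneous 1 f" obtains n where "f = linear_form n"
proof -
  let ?n = "vector [Poly_Mapping.lookup f (mon 1 0 0), Poly_Mapping.lookup f (mon 0 1 0),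
    Poly_Mapping.lookup f (mon 0 0 1)] :: complex^3"
  have mem: "m \<in> {mon 1 0 0, mon 0 1 0, mon 0 0 1}" if m: "m \<in> Poly_Mapping.keys f" for m
  proof -
    obtain i j k where "m = mon i j k" "i + j + k = 1" using homogeneous_cases[OF assms m] .
    then show ?thesis by (auto simp: add_eq_if split: if_splits)
  qed
  have "f = linear_form ?n"
  proof (rule poly_mapping_eqI)
    fix m
    show "Poly_Mapping.lookup f m = Poly_Mapping.lookup (linear_form ?n) m"
    proof (cases "m \<in> {mon 1 0 0, mon 0 1 0, mon 0 0 1}")
      case True
      then show ?thesis by (auto simp: linear_form_def lookup_add lookup_single when_def vector_3)
    next
      case False
      then have "m \<notin> Poly_Mapping.keys f" using mem by blast
      then show ?thesis using False by (auto simp: linear_form_def lookup_add lookup_single when_def in_keys_iff)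
    qed
  qed
  then show ?thesis by (rule that)
qed

lemma homogeneous_2:
  assumes "homogeneous 2 f" obtains a b where "f = quadratic_form a b"
proof -
  let ?a = "vector [Poly_Mapping.lookup f (mon 2 0 0), Poly_Mapping.lookup f (mon 0 2 0),
    Poly_Mapping.lookup f (mon 0 0 2)] :: complex^3"
  let ?b = "vector [Poly_Mapping.lookup f (mon 0 1 1), Poly_Mapping.lookup f (mon 1 0 1),
    Poly_Mapping.lookup f (mon 1 1 0)] :: complex^3"
  let ?M = "{mon 2 0 0, mon 0 2 0, mon 0 0 2, mon 0 1 1, mon 1 0 1, mon 1 1 0}"
  have mem: "m \<in> ?M" if m: "m \<in> Poly_Mapping.keys f" for m
  proof -
    obtain i j k where ijk: "m = mon i j k" "i + j + k = 2" using homogeneous_cases[OF assms m] .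
    then consider "i = 0" | "i = 1" | "i = 2" by linarith
    then show ?thesis
    proof cases
      case 1
      then have "j = 0 \<and> k = 2 \<or> j = 1 \<and> k = 1 \<or> j = 2 \<and> k = 0" using ijk(2) by linarith
      then show ?thesis unfolding ijk(1) 1 by auto
    next
      case 2
      then have "j = 0 \<and> k = 1 \<or> j = 1 \<and> k = 0" using ijk(2) by linarith
      then show ?thesis unfolding ijk(1) 2 by auto
    next
      case 3
      then have "j = 0 \<and> k = 0" using ijk(2) by linarith
      then show ?thesis unfolding ijk(1) 3 by auto
    qed
  qed
  have "f = quadratic_form ?a ?b"
  proof (rule poly_mapping_eqI)
    fix m
    show "Poly_Mapping.lookup f m = Poly_Mapping.lookup (quadratic_form ?a ?b) m"
    proof (cases "m \<in> ?M")
      case True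
      then show ?thesis by (auto simp: quadratic_form_def lookup_add lookup_single when_def vector_3)
    next
      case False
      then have "m \<notin> Poly_Mapping.keys f" using mem by blast
      then show ?thesis using False by (auto simp: quadratic_form_def lookup_add lookup_single when_def in_keys_iff)
    qed
  qed
  then show ?thesis by (rule that)
qed

lemma peval_diff: "peval x (f - g) = peval x f - peval x g"
  using peval_add[of x "f - g" g] by simp

text \<open>The difference is a quadratic form that vanishes everywhere, so its coefficients vanish
  by \<open>qform_eq_zeroD\<close>.\<close>

lemma quadratic_form_eqI:
  assumes "homogeneous 2 f" "homogeneous 2 g" "\<And>x. peval (\<lambda>j. (x :: complex^3) $ j) f = peval (\<lambda>j. x $ j) g"
  shows "f = g"
proof -
  obtain a b where ab: "f - g = quadratic_form a b"
    using homogeneous_2 homogeneous_diff[OF assms(1,2)] by blast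
  have "qform a b x = 0" for x
    unfolding peval_quadratic_form[symmetric] ab[symmetric] by (simp add: peval_diff assms(3))
  then have "a = 0" "b = 0" by (rule qform_eq_zeroD)+
  then have "f - g = 0" unfolding ab by (simp add: quadratic_form_def)
  then show ?thesis by simp
qed

text \<open>Recording the degree of each monomial by a new variable.\<close>
definition grade :: "3 cpoly \<Rightarrow> 3 cpoly poly" where
  "grade f = (\<Sum>m\<in>Poly_Mapping.keys f. monom (Poly_Mapping.single m (Poly_Mapping.lookup f m)) (tdeg m))"

lemma grade_superset:
  assumes "finite A" "Poly_Mapping.keys f \<subseteq> A"
  shows "grade f = (\<Sum>m\<in>A. monom (Poly_Mapping.single m (Poly_Mapping.lookup f m)) (tdeg m))"
  unfolding grade_def using assms by (intro sum.mono_neutral_left) (auto simp: in_keys_iff)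

lemma grade_zero: "grade 0 = 0"
  by (simp add: grade_def)

lemma grade_add: "grade (f + g) = grade f + grade g"
proof -
  let ?A = "Poly_Mapping.keys f \<union> Poly_Mapping.keys g"
  have "Poly_Mapping.keys (f + g) \<subseteq> ?A" by (rule Poly_Mapping.keys_add)
  then show ?thesis
    by (simp add: grade_superset[of ?A] lookup_add sum.distrib single_add add_monom[symmetric])
qed

lemma grade_sum: "grade (\<Sum>a\<in>A. h a) = (\<Sum>a\<in>A. grade (h a))"
  by (induction A rule: infinite_finite_induct) (simp_all add: grade_add grade_zero)

lemma grade_single: "grade (Poly_Mapping.single m c) = monom (Poly_Mapping.single m c) (tdeg m)"
  by (simp add: grade_superset[of "{m}"])

text \<open>Total degrees of monomials add under multiplication, so the exponents of the new
  variable add as well.\<close>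

lemma grade_mult: "grade (f * g) = grade f * grade g"
proof -
  have "f * g = (\<Sum>m\<in>Poly_Mapping.keys f. Poly_Mapping.single m (Poly_Mapping.lookup f m))
      * (\<Sum>n\<in>Poly_Mapping.keys g. Poly_Mapping.single n (Poly_Mapping.lookup g n))"
    by (rule arg_cong2[where f = "(*)", OF cpoly_sum_singles cpoly_sum_singles])
  also have "\<dots> = (\<Sum>m\<in>Poly_Mapping.keys f. \<Sum>n\<in>Poly_Mapping.keys g.
      Poly_Mapping.single (m + n) (Poly_Mapping.lookup f m * Poly_Mapping.lookup g n))"
    by (simp only: sum_product mult_single)
  finally show ?thesis
    by (simp only: grade_sum grade_single)
      (simp add: grade_def sum_product mult_monom mult_single lookup_add sum.distrib)
qed

lemma poly_grade: "poly (grade f) 1 = f"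
  using cpoly_sum_singles[of f] by (simp add: grade_def poly_sum poly_monom)

lemma homogeneous_coeff_grade: "homogeneous k (coeff (grade f) k)"
  unfolding grade_def coeff_sum by (intro homogeneous_sum) (auto simp: homogeneous_def)

lemma grade_homogeneous:
  assumes "homogeneous d f" shows "grade f = monom f d"
proof -
  have "grade f = (\<Sum>m\<in>Poly_Mapping.keys f. monom (Poly_Mapping.single m (Poly_Mapping.lookup f m)) d)"
    unfolding grade_def using assms by (intro sum.cong) (auto simp: homogeneous_def)
  also have "\<dots> = monom (\<Sum>m\<in>Poly_Mapping.keys f. Poly_Mapping.single m (Poly_Mapping.lookup f m)) d"
    by (rule monom_sum[symmetric])
  finally show ?thesis using cpoly_sum_singles[of f] by simp
qed

text \<open>Degree 0 in the new variable leaves only a constant, and a nonzero constant is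
  invertible.\<close>

lemma degree_grade_0:
  assumes "degree (grade g) = 0" "g \<noteq> 0" shows "g dvd 1"
proof -
  have "g = coeff (grade g) 0"
  proof -
    obtain c where "grade g = [:c:]" using assms(1) by (rule degree_eq_zeroE)
    then show ?thesis using poly_grade[of g] by simp
  qed
  then have "homogeneous 0 g" using homogeneous_coeff_grade[of 0 g] by simp
  then obtain c where c: "g = Poly_Mapping.single 0 c" by (rule homogeneous_0)
  then have "c \<noteq> 0" using assms(2) by auto
  then have "1 = g * Poly_Mapping.single 0 (inverse c)" unfolding c by (simp add: mult_single)
  then show ?thesis by (rule dvdI)
qed

text \<open>The degrees of the graded factors add up to 2, and neither is 0 because the factors are
  not units; so both are 1. The graded product is concentrated in degree 2, which forces the
  constant coefficients of both factors to vanish.\<close>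

lemma quadratic_form_factors:
  fixes f g h :: "3 cpoly"
  assumes f: "homogeneous 2 f" "f \<noteq> 0" "f = g * h" and nu: "\<not> g dvd 1" "\<not> h dvd 1"
  shows "homogeneous 1 g" "homogeneous 1 h"
proof -
  have g0: "g \<noteq> 0" "h \<noteq> 0" using f by auto
  have nz: "grade g \<noteq> 0" "grade h \<noteq> 0" using g0 poly_grade by (metis poly_0)+
  have gh: "grade g * grade h = monom f 2" using grade_homogeneous[OF f(1)] f(3) grade_mult by metis
  have "degree (grade g) + degree (grade h) = 2"
    using degree_mult_eq[OF nz] gh degree_monom_eq[OF f(2)] by metis
  moreover have "degree (grade g) \<noteq> 0" "degree (grade h) \<noteq> 0" using degree_grade_0 g0 nu by blast+
  ultimately have d: "degree (grade g) = 1" "degree (grade h) = 1" by linarith+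
  obtain g0 g1 where G: "grade g = [:g0, g1:]" using degree1_coeffs[OF d(1)] by metis
  obtain h0 h1 where H: "grade h = [:h0, h1:]" using degree1_coeffs[OF d(2)] by metis
  have "g1 \<noteq> 0" "h1 \<noteq> 0" using d G H by auto
  moreover have "coeff (grade g * grade h) 0 = 0" "coeff (grade g * grade h) 1 = 0" by (simp_all add: gh)
  then have "g0 * h0 = 0" "g0 * h1 + g1 * h0 = 0" unfolding G H by (simp_all add: ac_simps)
  ultimately have "g0 = 0" "h0 = 0" by auto
  then have "g = coeff (grade g) 1" "h = coeff (grade h) 1" using poly_grade[of g] poly_grade[of h] by (simp_all add: G H)
  then show "homogeneous 1 g" "homogeneous 1 h" using homogeneous_coeff_grade by metis+
qed

section \<open>Realization spaces in homogeneous coordinates\<close>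

definition coords :: "(8 \<Rightarrow> proj2) \<Rightarrow> tuple \<Rightarrow> bool" where
  "coords p X \<longleftrightarrow> (\<forall>i. homogeneous_coords (p i) (X i))"

lemma coords_exist: "\<exists>X. coords p X"
  unfolding coords_def by (rule choice) (simp add: homogeneous_coords_exist)

lemma homogeneous_coords_eq_iff:
  assumes "homogeneous_coords p x" "homogeneous_coords q y"
  shows "p = q \<longleftrightarrow> crs x y = 0"
proof
  assume "p = q"
  then obtain c where "y = c *s x" using homogeneous_coords_unique assms by blast
  then show "crs x y = 0" by simp
next
  have x: "x \<noteq> 0" and y: "y \<noteq> 0" using assms by (auto simp: homogeneous_coords_def)
  assume "crs x y = 0"
  then obtain c where c: "y = c *s x" using crs_eq_0_iff[OF x] by blast
  then have "c \<noteq> 0" using y by auto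
  then have "proj_rel x y" unfolding proj_rel_def using x y c by blast
  then have "abs_proj2 x = abs_proj2 y" by (rule Quotient3_rel_abs[OF Quotient3_proj2])
  then show "p = q" using assms by (simp add: homogeneous_coords_def)
qed

lemma inj_iff_gen: "coords p X \<Longrightarrow> inj p \<longleftrightarrow> gen UNIV X"
  unfolding inj_def gen_def coords_def using homogeneous_coords_eq_iff by blast

lemma gen_coords:
  assumes "gen UNIV X" shows "coords (\<lambda>i. abs_proj2 (X i)) X"
  unfolding coords_def homogeneous_coords_def
proof (intro allI conjI refl)
  fix i :: 8
  have "i \<noteq> i + 1" by simp
  then have "crs (X i) (X (i + 1)) \<noteq> 0" using assms unfolding gen_def by blast
  then show "X i \<noteq> 0" by auto
qed

lemma line_iff_coll:
  assumes p: "coords p X"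
  shows "(\<exists>L. plane_line L \<and> p ` T \<subseteq> L) \<longleftrightarrow> coll X T"
proof
  assume "\<exists>L. plane_line L \<and> p ` T \<subseteq> L"
  then obtain f where f: "f \<noteq> 0" "homogeneous 1 f" "p ` T \<subseteq> plane_zeros f"
    unfolding plane_line_def by blast
  obtain n where n: "f = linear_form n" using homogeneous_1[OF f(2)] .
  have "n \<noteq> 0" using f(1) n by (auto simp: linear_form_def)
  moreover have "dot3 n (X i) = 0" if "i \<in> T" for i
    using f(3) p that unfolding plane_zeros_def coords_def n peval_linear_form by blast
  ultimately show "coll X T" unfolding coll_def by blast
next
  assume "coll X T"
  then obtain n where n: "n \<noteq> 0" "\<And>i. i \<in> T \<Longrightarrow> dot3 n (X i) = 0" unfolding coll_def by blast
  have "linear_form n \<noteq> 0"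
  proof
    assume *: "linear_form n = 0"
    have "dot3 n x = 0" for x unfolding peval_linear_form[symmetric] * by simp
    from this[of "axis 1 1"] this[of "axis 2 1"] this[of "axis 3 1"] n(1) show False
      by (simp add: dot3_def axis_def vec3_eq_iff)
  qed
  moreover have "p i \<in> plane_zeros (linear_form n)" if "i \<in> T" for i
    unfolding plane_zeros_def peval_linear_form
  proof clarify
    fix x assume "homogeneous_coords (p i) x"
    then obtain c where "x = c *s X i" using homogeneous_coords_unique p unfolding coords_def by blast
    then show "dot3 n x = 0" using n(2)[OF that] by simp
  qed
  ultimately show "\<exists>L. plane_line L \<and> p ` T \<subseteq> L"
    unfolding plane_line_def using homogeneous_linear_form by blast
qed

lemma nonunit_if_vanishing:
  assumes "peval x f = 0" shows "\<not> f dvd 1"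
proof
  assume "f dvd 1"
  then obtain u where u: "1 = f * u" by (rule dvdE)
  have "peval x 1 = 1" using peval_single[of x 0 1] by simp
  moreover have "peval x 1 = peval x f * peval x u" by (metis peval_mult u)
  ultimately show False using assms by simp
qed

lemma linear_form_nonunit: "\<not> linear_form n dvd 1"
  by (rule nonunit_if_vanishing[of "\<lambda>j. (0 :: complex^3) $ j"], unfold peval_linear_form) simp

text \<open>Three distinct collinear points would make the line split off. The equality of values
  then becomes a factorization of polynomials by \<open>quadratic_form_eqI\<close>, with two linear
  forms as nonunit factors.\<close>

lemma irreducible_conic_nocoll:
  assumes f: "irreducible (quadratic_form a b)" and gen: "gen S X"
    and on: "\<And>i. i \<in> S \<Longrightarrow> qform a b (X i) = 0"
  shows "nocoll X S"
  unfolding nocoll_def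
proof (intro allI impI notI)
  fix T assume T: "T \<subseteq> S" "card T = 3" "coll X T"
  obtain i j k where ijk: "T = {i, j, k}" "i \<noteq> j" "i \<noteq> k" "j \<noteq> k" using card3E[OF T(2)] .
  have "crs (X i) (X j) \<noteq> 0" "crs (X i) (X k) \<noteq> 0" "crs (X k) (X j) \<noteq> 0"
    using gen ijk T(1) unfolding gen_def by auto
  moreover have "det3 (X i) (X j) (X k) = 0" using T(3) ijk coll_iff_det3 by metis
  moreover have "i \<in> S" "j \<in> S" "k \<in> S" using T(1) ijk(1) by auto
  ultimately obtain m where m: "\<And>w. qform a b w = dot3 (crs (X i) (X j)) w * dot3 m w"
    using quadric_contains_line[of a b "X i" "X j" "X k"] on by blast
  have "homogeneous 2 (linear_form (crs (X i) (X j)) * linear_form m)"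
    using homogeneous_mult[OF homogeneous_linear_form homogeneous_linear_form] by (simp only: one_add_one)
  then have "quadratic_form a b = linear_form (crs (X i) (X j)) * linear_form m"
    by (intro quadratic_form_eqI homogeneous_quadratic_form)
      (simp_all add: peval_quadratic_form peval_mult peval_linear_form m)
  then show False using f linear_form_nonunit unfolding irreducible_def by blast
qed

text \<open>A proper factorization would consist of two linear forms by
  \<open>quadratic_form_factors\<close>. Each of the two lines contains at most two of the points,
  too few for five.\<close>

lemma nocoll_irreducible:
  assumes ab: "a \<noteq> 0 \<or> b \<noteq> 0" and S: "5 \<le> card S" "nocoll X S" and on: "\<And>i. i \<in> S \<Longrightarrow> qform a b (X i) = 0"
  shows "irreducible (quadratic_form a b)"
proof (rule irreducibleI)
  show nz: "quadratic_form a b \<noteq> 0"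
  proof
    assume *: "quadratic_form a b = 0"
    have "qform a b x = 0" for x unfolding peval_quadratic_form[symmetric] * by simp
    then show False using qform_eq_zeroD ab by blast
  qed
  show "\<not> quadratic_form a b dvd 1"
    by (rule nonunit_if_vanishing[of "\<lambda>j. (0 :: complex^3) $ j"], unfold peval_quadratic_form) simp
  fix g h assume gh: "quadratic_form a b = g * h"
  show "g dvd 1 \<or> h dvd 1"
  proof (rule ccontr)
    assume nu: "\<not> ?thesis"
    have "homogeneous 1 g" "homogeneous 1 h"
      using quadratic_form_factors[OF homogeneous_quadratic_form nz gh] nu by blast+
    then obtain l m where lm: "g = linear_form l" "h = linear_form m" using homogeneous_1 by metis
    have "l \<noteq> 0" "m \<noteq> 0" using nz gh unfolding lm by (auto simp: linear_form_def)
    have q: "qform a b x = dot3 l x * dot3 m x" for x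
      unfolding peval_quadratic_form[symmetric] gh lm peval_mult peval_linear_form ..
    have small: "card B < 3" if "coll X B" "B \<subseteq> S" for B
    proof (rule ccontr)
      assume "\<not> card B < 3"
      then have "3 \<le> card B" by simp
      then obtain C where C: "C \<subseteq> B" "card C = 3" by (rule obtain_subset_with_card_n)
      then show False using that S(2) coll_mono[of X B C] unfolding nocoll_def by blast
    qed
    let ?A = "{i\<in>S. dot3 l (X i) = 0}" and ?B = "{i\<in>S. dot3 m (X i) = 0}"
    have "S \<subseteq> ?A \<union> ?B" using on q by auto
    then have "card S \<le> card (?A \<union> ?B)" by (intro card_mono) auto
    also have "\<dots> \<le> card ?A + card ?B" by (rule card_Un_le)
    finally have "5 \<le> card ?A + card ?B" using S(1) by simp
    moreover have "card ?A < 3" "card ?B < 3"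
      using \<open>l \<noteq> 0\<close> \<open>m \<noteq> 0\<close> by (intro small; auto simp: coll_def)+
    ultimately show False by simp
  qed
qed

text \<open>A reducible quadric, being a pair of lines, cannot contain six points without a
  collinear triple; an irreducible one contains no collinear triple at all.\<close>

lemma conic_iff_onconic:
  assumes p: "coords p X" and gen: "gen UNIV X" and S: "card S = 6"
  shows "(\<exists>C. plane_conic C \<and> p ` S \<subseteq> C) \<longleftrightarrow> nocoll X S \<and> onconic X S"
proof
  assume "\<exists>C. plane_conic C \<and> p ` S \<subseteq> C"
  then obtain f where f: "irreducible f" "homogeneous 2 f" "p ` S \<subseteq> plane_zeros f"
    unfolding plane_conic_def by blast
  obtain a b where ab: "f = quadratic_form a b" using homogeneous_2[OF f(2)] .
  have on: "qform a b (X i) = 0" if "i \<in> S" for i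
    using f(3) p that unfolding plane_zeros_def coords_def ab peval_quadratic_form by blast
  have "f \<noteq> 0" using f(1) by auto
  then have "a \<noteq> 0 \<or> b \<noteq> 0" unfolding ab by (auto simp: quadratic_form_def)
  then have "onconic X S" unfolding onconic_def using on by blast
  moreover have "nocoll X S"
    using irreducible_conic_nocoll[OF f(1)[unfolded ab] gen_mono[OF gen] on] by simp
  ultimately show "nocoll X S \<and> onconic X S" by blast
next
  assume *: "nocoll X S \<and> onconic X S"
  then obtain a b where ab: "a \<noteq> 0 \<or> b \<noteq> 0" "\<And>i. i \<in> S \<Longrightarrow> qform a b (X i) = 0"
    unfolding onconic_def by blast
  have irr: "irreducible (quadratic_form a b)"
    by (rule nocoll_irreducible[OF ab(1) _ _ ab(2)]) (use * S in auto)
  have "p i \<in> plane_zeros (quadratic_form a b)" if "i \<in> S" for i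
    unfolding plane_zeros_def peval_quadratic_form
  proof clarify
    fix x assume "homogeneous_coords (p i) x"
    then obtain c where "x = c *s X i" using homogeneous_coords_unique p unfolding coords_def by blast
    then show "qform a b x = 0" using ab(2)[OF that] by (simp add: qform_scale)
  qed
  then show "\<exists>C. plane_conic C \<and> p ` S \<subseteq> C"
    unfolding plane_conic_def using irr homogeneous_quadratic_form by blast
qed

lemma realization_space_coords:
  assumes "coords p X"
  shows "p \<in> realization_space Q \<longleftrightarrow> gen UNIV X \<and> {T. card T = 3 \<and> coll X T} = fst Q \<and>
    {S. card S = 6 \<and> nocoll X S \<and> onconic X S} = snd Q"
proof (cases "gen UNIV X")
  case True
  have "{T. card T = 6 \<and> (\<exists>C. plane_conic C \<and> p ` T \<subseteq> C)} = {S. card S = 6 \<and> nocoll X S \<and> onconic X S}"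
    using conic_iff_onconic[OF assms True] by auto
  then show ?thesis
    unfolding realization_space_def mem_Collect_eq by (simp add: inj_iff_gen[OF assms] line_iff_coll[OF assms])
next
  case False
  then show ?thesis unfolding realization_space_def mem_Collect_eq by (simp add: inj_iff_gen[OF assms])
qed

text \<open>Any realization can serve as reference tuple. The restriction to sextuples without
  collinear triple in \<open>stratum\<close> matches the restriction to irreducible conics.\<close>

lemma realization_space_stratum:
  assumes "coords q Y" "q \<in> realization_space Q" "coords p X"
  shows "p \<in> realization_space Q \<longleftrightarrow> X \<in> stratum UNIV Y"
proof -
  have Y: "gen UNIV Y" "\<And>T. card T = 3 \<and> coll Y T \<longleftrightarrow> T \<in> fst Q"
    "\<And>S. card S = 6 \<and> nocoll Y S \<and> onconic Y S \<longleftrightarrow> S \<in> snd Q"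
    using assms(2) unfolding realization_space_coords[OF assms(1)] by blast+
  show ?thesis
  proof
    assume "p \<in> realization_space Q"
    then have X: "gen UNIV X" "\<And>T. card T = 3 \<and> coll X T \<longleftrightarrow> T \<in> fst Q"
      "\<And>S. card S = 6 \<and> nocoll X S \<and> onconic X S \<longleftrightarrow> S \<in> snd Q"
      unfolding realization_space_coords[OF assms(3)] by blast+
    have c: "coll X T \<longleftrightarrow> coll Y T" if "card T = 3" for T using X(2) Y(2) that by blast
    then have "nocoll X S \<longleftrightarrow> nocoll Y S" for S unfolding nocoll_def by blast
    then have "onconic X S \<longleftrightarrow> onconic Y S" if "card S = 6" "nocoll Y S" for S
      using X(3)[of S] Y(3)[of S] that by blast
    then show "X \<in> stratum UNIV Y" using X(1) c by (simp add: stratum_def)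
  next
    assume X: "X \<in> stratum UNIV Y"
    have "{T. card T = 3 \<and> coll X T} = fst Q" using X Y(2) by (auto simp: stratum_def)
    moreover have "{S. card S = 6 \<and> nocoll X S \<and> onconic X S} = snd Q"
      using stratum_nocoll[OF X] stratum_onconic[OF X] Y(3) by auto
    ultimately show "p \<in> realization_space Q"
      using stratum_gen[OF X] unfolding realization_space_coords[OF assms(3)] by blast
  qed
qed

text \<open>If neither of two covering closed sets is everything, each has a defining polynomial
  that is nonzero at some point. The product of these two polynomials vanishes on all coordinates in
  \<open>W\<close>, which contradicts \<open>irr\<close>.\<close>

lemma irreducible_space_if_irr:
  assumes W: "irr W" "\<And>X. X \<in> W \<Longrightarrow> gen UNIV X" and Z: "\<And>p X. coords p X \<Longrightarrow> p \<in> Z \<longleftrightarrow> X \<in> W"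
  shows "irreducible_space (subtopology zariski Z)"
  unfolding irreducible_space_def
proof (intro conjI allI impI)
  have pt: "\<exists>p\<in>Z. coords p X" if "X \<in> W" for X
    using gen_coords[OF W(2)[OF that]] Z that by blast
  obtain X where "X \<in> W" using W(1) by (auto simp: irr_def)
  then show "topspace (subtopology zariski Z) \<noteq> {}" using pt by auto
  fix C D assume CD: "closedin (subtopology zariski Z) C \<and> closedin (subtopology zariski Z) D \<and>
    C \<union> D = topspace (subtopology zariski Z)"
  then obtain C' D' where "zariski_closed C'" "C = C' \<inter> Z" "zariski_closed D'" "D = D' \<inter> Z"
    unfolding closedin_subtopology closedin_zariski by blast
  then obtain F G where FG: "C = tuple_zeros F \<inter> Z" "D = tuple_zeros G \<inter> Z"
    unfolding zariski_closed_def by blast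
  have un: "C \<union> D = Z" using CD by simp
  show "C = topspace (subtopology zariski Z) \<or> D = topspace (subtopology zariski Z)"
  proof (rule ccontr)
    assume "\<not> ?thesis"
    then have "C \<noteq> Z" "D \<noteq> Z" by simp_all
    then obtain p q where "p \<in> Z" "p \<notin> tuple_zeros F" "q \<in> Z" "q \<notin> tuple_zeros G" using FG by blast
    then obtain f g X Y where f: "f \<in> F" "coords p X" "peval (\<lambda>(i, j). X i $ j) f \<noteq> 0"
      and g: "g \<in> G" "coords q Y" "peval (\<lambda>(i, j). Y i $ j) g \<noteq> 0"
      unfolding tuple_zeros_def coords_def by blast
    have "X \<in> W" "Y \<in> W" using Z f(2) g(2) \<open>p \<in> Z\<close> \<open>q \<in> Z\<close> by blast+
    have "peval (\<lambda>(i, j). v i $ j) f * peval (\<lambda>(i, j). v i $ j) g = 0" if v: "v \<in> W" for v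
    proof -
      obtain r where r: "r \<in> Z" "coords r v" using pt[OF v] by blast
      then have "r \<in> tuple_zeros F \<or> r \<in> tuple_zeros G" using un FG by blast
      then have "peval (\<lambda>(i, j). v i $ j) f = 0 \<or> peval (\<lambda>(i, j). v i $ j) g = 0"
        using f(1) g(1) r(2) unfolding tuple_zeros_def coords_def by blast
      then show ?thesis by auto
    qed
    from irrD[OF W(1) regfun_peval regfun_peval this] show False
      using f(3) g(3) \<open>X \<in> W\<close> \<open>Y \<in> W\<close> by blast
  qed
qed

text \<open>An irreducible subset is covered by its intersections with C and D, so it lies in one of
  them; hence C and D are the maximal ones.\<close>

lemma irreducible_components_two:
  assumes un: "topspace X = C \<union> D" and C: "closedin X C" "irreducible_space (subtopology X C)"
    and D: "closedin X D" "irreducible_space (subtopology X D)" and n: "\<not> C \<subseteq> D" "\<not> D \<subseteq> C"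
  shows "irreducible_components X = {C, D}"
proof -
  have sub: "E \<subseteq> C \<or> E \<subseteq> D" if E: "E \<subseteq> topspace X" "irreducible_space (subtopology X E)" for E
  proof -
    have "closedin (subtopology X E) (C \<inter> E)" "closedin (subtopology X E) (D \<inter> E)"
      using C(1) D(1) by (auto simp: closedin_subtopology)
    moreover have "(C \<inter> E) \<union> (D \<inter> E) = topspace (subtopology X E)" using E(1) un by auto
    ultimately have "C \<inter> E = topspace (subtopology X E) \<or> D \<inter> E = topspace (subtopology X E)"
      using E(2) unfolding irreducible_space_def by blast
    then show ?thesis using E(1) by auto
  qed
  have max: "C \<in> irreducible_components X" if "topspace X = C \<union> D" "irreducible_space (subtopology X C)" "\<not> C \<subseteq> D"
    "\<And>E. E \<subseteq> topspace X \<Longrightarrow> irreducible_space (subtopology X E) \<Longrightarrow> E \<subseteq> C \<or> E \<subseteq> D" for C D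
    using that unfolding irreducible_components_def by blast
  have "E = C \<or> E = D" if "E \<in> irreducible_components X" for E
  proof -
    have E: "E \<subseteq> topspace X" "irreducible_space (subtopology X E)"
      "\<And>F. E \<subseteq> F \<Longrightarrow> F \<subseteq> topspace X \<Longrightarrow> irreducible_space (subtopology X F) \<Longrightarrow> F = E"
      using that unfolding irreducible_components_def by blast+
    have "C \<subseteq> topspace X" "D \<subseteq> topspace X" using un by auto
    then show ?thesis using sub[OF E(1,2)] E(3) C(2) D(2) by metis
  qed
  moreover have "C \<in> irreducible_components X" by (rule max[OF un C(2) n(1) sub])
  moreover have "D \<in> irreducible_components X"
    by (rule max[of D C]) (use un D(2) n(2) sub in auto)
  ultimately show ?thesis by blast
qed

lemma irreducible_realization_space:
  assumes "coords q Y" "q \<in> realization_space Q" "irr (stratum UNIV Y)"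
  shows "irreducible_space (subtopology zariski (realization_space Q))"
  by (rule irreducible_space_if_irr[OF assms(3) stratum_gen realization_space_stratum[OF assms(1,2)]])

subsection \<open>The ratio equation as a multihomogeneous polynomial\<close>

definition entry :: "8 \<Rightarrow> 3 \<Rightarrow> (8 \<times> 3) cpoly" where
  "entry i j = Poly_Mapping.single (Poly_Mapping.single (i, j) 1) 1"

definition det_poly :: "8 \<Rightarrow> 8 \<Rightarrow> 8 \<Rightarrow> (8 \<times> 3) cpoly" where
  "det_poly i j k = entry i 1 * (entry j 2 * entry k 3 - entry j 3 * entry k 2)
     + entry i 2 * (entry j 3 * entry k 1 - entry j 1 * entry k 3)
     + entry i 3 * (entry j 1 * entry k 2 - entry j 2 * entry k 1)"

lemma peval_entry: "peval (\<lambda>(i, j). X i $ j) (entry i j) = X i $ j"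
proof -
  have "(\<Prod>v\<in>UNIV. (case v of (i, j) \<Rightarrow> X i $ j) ^ (1 when (i, j) = v)) =
      (\<Prod>v\<in>UNIV. if v = (i, j) then X i $ j else 1)"
    by (rule prod.cong) (auto simp: when_def)
  then show ?thesis by (simp add: entry_def peval_single lookup_single prod.delta)
qed

lemma peval_det_poly: "peval (\<lambda>(i, j). X i $ j) (det_poly i j k) = det3 (X i) (X j) (X k)"
  by (simp add: det_poly_def peval_add peval_diff peval_mult peval_entry det3_expand)

lemma multihomogeneous_entry: "multihomogeneous (\<lambda>l. of_bool (l = i)) (entry i j)"
proof -
  have "(\<Sum>j'\<in>UNIV. 1 when (i, j) = (l, j')) = (of_bool (l = i) :: nat)" for l
    by (cases "l = i") (simp_all add: when_def)
  then show ?thesis by (simp add: multihomogeneous_def entry_def lookup_single)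
qed

lemma multihomogeneous_add: "multihomogeneous d f \<Longrightarrow> multihomogeneous d g \<Longrightarrow> multihomogeneous d (f + g)"
  unfolding multihomogeneous_def using Poly_Mapping.keys_add[of f g] by blast

lemma multihomogeneous_diff: "multihomogeneous d f \<Longrightarrow> multihomogeneous d g \<Longrightarrow> multihomogeneous d (f - g)"
  unfolding multihomogeneous_def using keys_diff[of f g] by blast

lemma multihomogeneous_mult':
  "multihomogeneous d f \<Longrightarrow> multihomogeneous e g \<Longrightarrow> (\<And>i. c i = d i + e i) \<Longrightarrow> multihomogeneous c (f * g)"
  using multihomogeneous_mult[of d f e g] by presburger

lemma multihomogeneous_det_poly:
  "multihomogeneous (\<lambda>l. of_bool (l = i) + (of_bool (l = j) + of_bool (l = k))) (det_poly i j k)"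
  unfolding det_poly_def
  by (intro multihomogeneous_add multihomogeneous_diff multihomogeneous_mult'[OF multihomogeneous_entry]
      multihomogeneous_entry) (auto simp: multihomogeneous_entry)

context moebius_kantor_labels
begin

definition ratio_poly :: "complex \<Rightarrow> (8 \<times> 3) cpoly" where
  "ratio_poly \<gamma> = det_poly a c d * det_poly k b d +
     Poly_Mapping.single 0 (- \<gamma>) * (det_poly c b d * det_poly a k d)"

lemma peval_ratio_poly: "peval (\<lambda>(i, j). X i $ j) (ratio_poly \<gamma>) = ratio_eq \<gamma> X"
  by (simp add: ratio_poly_def ratio_eq_def peval_add peval_mult peval_det_poly peval_single)

lemma multihomogeneous_ratio_poly: "\<exists>D. multihomogeneous D (ratio_poly \<gamma>)"
proof -
  let ?\<delta> = "\<lambda>i l. of_bool (l = i) :: nat"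
  have 0: "multihomogeneous (\<lambda>_. 0) (Poly_Mapping.single 0 c :: (8 \<times> 3) cpoly)" for c
    by (simp add: multihomogeneous_def)
  \<comment> \<open>Both summands have degree 1 in a, b, c, k and degree 2 in d.\<close>
  have "multihomogeneous (\<lambda>l. ?\<delta> a l + (?\<delta> c l + ?\<delta> d l) + (?\<delta> k l + (?\<delta> b l + ?\<delta> d l))) (ratio_poly \<gamma>)"
    unfolding ratio_poly_def
    by (intro multihomogeneous_add multihomogeneous_mult'[OF multihomogeneous_det_poly multihomogeneous_det_poly]
        multihomogeneous_mult'[OF 0 multihomogeneous_mult'[OF multihomogeneous_det_poly multihomogeneous_det_poly refl]])
      auto
  then show ?thesis by blast
qed

lemma realization_space_config:
  assumes "coords p X" shows "p \<in> realization_space (lines, {}) \<longleftrightarrow> config X lines {}"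
proof -
  have L: "(\<exists>L\<in>lines. T \<subseteq> L) \<longleftrightarrow> T \<in> lines" if "card T = 3" for T
    using that lines_card card_subset_eq by (metis finite subset_refl)
  have "{T. card T = 3 \<and> coll X T} = lines \<longleftrightarrow> (\<forall>T. card T = 3 \<longrightarrow> (coll X T \<longleftrightarrow> (\<exists>L\<in>lines. T \<subseteq> L)))"
    using L lines_card by auto
  then show ?thesis unfolding realization_space_coords[OF assms] config_def by auto
qed

text \<open>A tuple satisfies the ratio equation for only one of the two roots, so the two closed
  pieces are disjoint and, being nonempty, not contained in each other.\<close>

theorem two_components:
  "\<exists>C1 C2. C1 \<noteq> C2 \<and>
     irreducible_components (subtopology zariski (realization_space (lines, {}))) = {C1, C2} \<and>
     realization_space (lines, {}) = C1 \<union> C2"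
proof -
  let ?S = "realization_space (lines, {})"
  \<comment> \<open>A primitive sixth root of unity; the other root of the equation is 1 -
    \<omega>.\<close>
  define \<omega> :: complex where "\<omega> = (1 + csqrt (-3)) / 2"
  have s: "(csqrt (-3))^2 = -3" by (rule power2_csqrt)
  have \<omega>: "\<omega> * \<omega> = \<omega> - 1" using s by (simp add: \<omega>_def power2_eq_square field_simps)
  then have \<omega>': "(1 - \<omega>) * (1 - \<omega>) = (1 - \<omega>) - 1" by algebra
  have ne: "\<omega> \<noteq> 1 - \<omega>"
  proof
    assume "\<omega> = 1 - \<omega>"
    then have h: "\<omega> = 1 / 2" by (simp add: field_simps)
    show False using \<omega> unfolding h by simp
  qed
  define C where "C = (\<lambda>\<gamma>. ?S \<inter> tuple_zeros {ratio_poly \<gamma>})"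
  have mem: "p \<in> C \<gamma> \<longleftrightarrow> config X lines {} \<and> ratio_eq \<gamma> X = 0" if p: "coords p X" for p X \<gamma>
  proof -
    have "p \<in> tuple_zeros {ratio_poly \<gamma>} \<longleftrightarrow> ratio_eq \<gamma> X = 0"
    proof
      assume "p \<in> tuple_zeros {ratio_poly \<gamma>}"
      then show "ratio_eq \<gamma> X = 0" using p unfolding tuple_zeros_def coords_def peval_ratio_poly[symmetric] by blast
    next
      assume *: "ratio_eq \<gamma> X = 0"
      obtain D where D: "multihomogeneous D (ratio_poly \<gamma>)" using multihomogeneous_ratio_poly by blast
      show "p \<in> tuple_zeros {ratio_poly \<gamma>}"
        unfolding tuple_zeros_def
      proof clarify
        fix y assume "\<forall>i. homogeneous_coords (p i) (y i)"
        then show "peval (\<lambda>(i, j). y i $ j) (ratio_poly \<gamma>) = 0"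
          using vanishing_independent_of_coords[OF D, of p X y] p * by (simp add: coords_def peval_ratio_poly)
      qed
    qed
    then show ?thesis unfolding C_def using realization_space_config[OF p] by blast
  qed
  have irred: "irreducible_space (subtopology zariski (C \<gamma>))" "C \<gamma> \<noteq> {}" if \<gamma>: "\<gamma> * \<gamma> = \<gamma> - 1" for \<gamma>
  proof -
    obtain Y where Y: "config Y lines {}" "ratio_eq \<gamma> Y = 0" using config_realized[OF \<gamma>] by blast
    have gY: "gen UNIV Y" using Y(1) by (simp add: config_def)
    have q: "coords (\<lambda>i. abs_proj2 (Y i)) Y" by (rule gen_coords[OF gY])
    show "C \<gamma> \<noteq> {}" using mem[OF q] Y by blast
    let ?W = "{X \<in> stratum UNIV Y. ratio_eq \<gamma> X = 0}"
    have "Y \<in> ?W" using stratum_refl[OF gY] Y(2) by simp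
    then have W: "irr ?W" using irr_ratio_eq[OF Y(1) \<gamma>] by blast
    have "config X lines {} \<longleftrightarrow> X \<in> stratum UNIV Y" if "coords p X" for p X
      using realization_space_stratum[OF q _ that] realization_space_config[OF q] realization_space_config[OF that] Y(1)
      by blast
    then have "p \<in> C \<gamma> \<longleftrightarrow> X \<in> ?W" if "coords p X" for p X using mem[OF that] that by blast
    then show "irreducible_space (subtopology zariski (C \<gamma>))"
      using irreducible_space_if_irr[OF W] stratum_gen by blast
  qed
  have cover: "?S \<subseteq> C \<omega> \<union> C (1 - \<omega>)"
  proof
    fix p assume p: "p \<in> ?S"
    obtain X where X: "coords p X" using coords_exist by blast
    then have cX: "config X lines {}" using realization_space_config p by blast
    obtain \<gamma> where \<gamma>: "\<gamma> * \<gamma> = \<gamma> - 1" "ratio_eq \<gamma> X = 0" using ratio_eq_cases[OF cX] .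
    have "(\<gamma> - \<omega>) * (\<gamma> - (1 - \<omega>)) = 0" using \<gamma>(1) \<omega> by algebra
    then have "\<gamma> = \<omega> \<or> \<gamma> = 1 - \<omega>" by auto
    then show "p \<in> C \<omega> \<union> C (1 - \<omega>)" using mem[OF X] cX \<gamma>(2) by blast
  qed
  have disj: "C \<omega> \<inter> C (1 - \<omega>) = {}"
  proof -
    have False if p: "p \<in> C \<omega>" "p \<in> C (1 - \<omega>)" for p
    proof -
      obtain X where X: "coords p X" using coords_exist by blast
      then show False using p ratio_eq_unique[of X \<omega> "1 - \<omega>"] ne unfolding mem[OF X] by blast
    qed
    then show ?thesis by blast
  qed
  have clos: "closedin (subtopology zariski ?S) (C \<gamma>)" for \<gamma>
  proof -
    have "zariski_closed (tuple_zeros {ratio_poly \<gamma>})"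
      unfolding zariski_closed_def using multihomogeneous_ratio_poly by blast
    then show ?thesis unfolding C_def closedin_subtopology closedin_zariski by blast
  qed
  have sub: "subtopology (subtopology zariski ?S) (C \<gamma>) = subtopology zariski (C \<gamma>)" for \<gamma>
    unfolding subtopology_subtopology C_def by (simp add: Int_assoc[symmetric])
  have S: "?S = C \<omega> \<union> C (1 - \<omega>)" using cover unfolding C_def by blast
  have "irreducible_components (subtopology zariski ?S) = {C \<omega>, C (1 - \<omega>)}"
  proof (rule irreducible_components_two)
    show "topspace (subtopology zariski ?S) = C \<omega> \<union> C (1 - \<omega>)" using S by simp
    show "closedin (subtopology zariski ?S) (C \<omega>)" "closedin (subtopology zariski ?S) (C (1 - \<omega>))"
      by (rule clos)+
    show "irreducible_space (subtopology (subtopology zariski ?S) (C \<omega>))"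
      "irreducible_space (subtopology (subtopology zariski ?S) (C (1 - \<omega>)))"
      unfolding sub by (rule irred \<omega> \<omega>')+
    show "\<not> C \<omega> \<subseteq> C (1 - \<omega>)" "\<not> C (1 - \<omega>) \<subseteq> C \<omega>"
      using disj irred(2)[OF \<omega>] irred(2)[OF \<omega>'] by blast+
  qed
  moreover have "C \<omega> \<noteq> C (1 - \<omega>)" using disj irred(2)[OF \<omega>] by blast
  ultimately show ?thesis using S by blast
qed

end

section \<open>From labelled configurations to the orbit\<close>

lemma UNIV_8: "(UNIV :: 8 set) = {1, 2, 3, 4, 5, 6, 7, 8}"
proof -
  have "card {1, 2, 3, 4, 5, 6, 7, 8 :: 8} = CARD(8)" by simp
  then show ?thesis by (metis card_subset_eq finite subset_UNIV)
qed

theorem theorem4p1: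
  fixes Q :: "8 set set \<times> 8 set set"
  shows "(quatroid Q \<and> Q \<notin> S8_orbit Q41 \<longrightarrow>
            irreducible_space (subtopology zariski (realization_space Q))) \<and>
         (Q \<in> S8_orbit Q41 \<longrightarrow>
            (\<exists>C1 C2. C1 \<noteq> C2 \<and>
               irreducible_components (subtopology zariski (realization_space Q)) = {C1, C2} \<and>
               realization_space Q = C1 \<union> C2))"
proof (intro conjI impI)
  assume Q: "quatroid Q \<and> Q \<notin> S8_orbit Q41"
  then obtain q where q: "q \<in> realization_space Q" by (auto simp: quatroid_def)
  obtain Y where Y: "coords q Y" using coords_exist by blast
  interpret general_tuple Y
    using q unfolding realization_space_coords[OF Y] by unfold_locales blast
  show "irreducible_space (subtopology zariski (realization_space Q))"
  proof (rule irr_or_moebius_kantor)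
    assume "irr (stratum UNIV Y)"
    then show ?thesis by (rule irreducible_realization_space[OF Y q])
  next
    fix a b c d e f k h
    assume dist: "distinct [a, b, c, d, e, f, k, h]" and un: "UNIV = {a, b, c, d, e, f, k, h}"
      and con: "config Y {{a,b,c},{a,d,e},{a,f,k},{b,d,f},{b,e,h},{c,e,k},{c,f,h},{d,k,h}} {}"
    interpret moebius_kantor_labels a b c d e f k h by unfold_locales (rule dist un)+
    have "q \<in> realization_space (lines, {})" using con realization_space_config[OF Y] by (simp add: lines_def)
    then have "fst Q = lines" "snd Q = {}" using q unfolding realization_space_coords[OF Y] by auto
    then have Q': "Q = (lines, {})" by (metis prod.collapse)
    \<comment> \<open>The default value h is the image of the remaining label 8.\<close>
    define \<pi> :: "8 \<Rightarrow> 8" where "\<pi> = (\<lambda>_. h)(1 := a, 2 := b, 3 := c, 4 := d, 5 := e, 6 := f, 7 := k)"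
    have \<pi>: "\<pi> 1 = a" "\<pi> 2 = b" "\<pi> 3 = c" "\<pi> 4 = d" "\<pi> 5 = e" "\<pi> 6 = f" "\<pi> 7 = k" "\<pi> 8 = h"
      by (simp_all add: \<pi>_def)
    have "range \<pi> = {a, b, c, d, e, f, k, h}" unfolding UNIV_8 by (simp only: image_insert image_empty \<pi>)
    then have "surj \<pi>" using un by simp
    then have "bij \<pi>" using finite_UNIV_surj_inj[of \<pi>] by (simp add: bij_def)
    \<comment> \<open>The triples in \<open>lines\<close> are listed in the order of
      \<open>Q41\<close>, so replacing 1, ..., 8 by a, b, c, d, e, f, k, h matches them one by
      one.\<close>
    moreover have "(`) \<pi> ` fst Q41 = lines" "(`) \<pi> ` snd Q41 = {}"
      unfolding Q41_def lines_def fst_conv snd_conv by (simp_all only: image_insert image_empty \<pi>)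
    ultimately have "Q \<in> S8_orbit Q41" unfolding S8_orbit_def Q' by blast
    then show ?thesis using Q by blast
  qed
next
  assume "Q \<in> S8_orbit Q41"
  then obtain \<pi> where \<pi>: "bij \<pi>" "Q = ((`) \<pi> ` fst Q41, (`) \<pi> ` snd Q41)" unfolding S8_orbit_def by blast
  have inj: "\<pi> i = \<pi> j \<longleftrightarrow> i = j" for i j using \<pi>(1) by (auto simp: bij_def inj_def)
  interpret moebius_kantor_labels "\<pi> 1" "\<pi> 2" "\<pi> 3" "\<pi> 4" "\<pi> 5" "\<pi> 6" "\<pi> 7" "\<pi> 8"
  proof
    show "distinct [\<pi> 1, \<pi> 2, \<pi> 3, \<pi> 4, \<pi> 5, \<pi> 6, \<pi> 7, \<pi> 8]" by (simp add: inj)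
    have "UNIV = \<pi> ` UNIV" using \<pi>(1) by (simp add: bij_def)
    also have "\<dots> = {\<pi> 1, \<pi> 2, \<pi> 3, \<pi> 4, \<pi> 5, \<pi> 6, \<pi> 7, \<pi> 8}"
      unfolding UNIV_8 by (simp only: image_insert image_empty)
    finally show "UNIV = {\<pi> 1, \<pi> 2, \<pi> 3, \<pi> 4, \<pi> 5, \<pi> 6, \<pi> 7, \<pi> 8}" .
  qed
  have "Q = (lines, {})"
    unfolding \<pi>(2) Q41_def lines_def fst_conv snd_conv by (simp only: image_insert image_empty)
  then show "\<exists>C1 C2. C1 \<noteq> C2 \<and>
      irreducible_components (subtopology zariski (realization_space Q)) = {C1, C2} \<and>
      realization_space Q = C1 \<union> C2" using two_components by simp
qed

end
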